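(* Let $F:\mathbb{R}^n\to\mathbb{R}$ be an a.s. smooth centred isotropic Gaussian random field, normalized so that $\mathbb{E}[F(x)^2]=1$, whose spectral measure $\rho$ satisfies: $(\rho1)$ $\rho$ has no atoms; $(\rho2)$ $\int_{\mathbb{R}^n}|\lambda|^p\,d\rho(\lambda)<\infty$ for some $p>4$; $(\rho3)$ the support of $\rho$ does not lie in a linear hyperplane. Then for every $t>0$ the random variable $$\frac{\mathcal{N}(F,t;R)}{\mathrm{Vol}(B(R))}$$ converges in mean, as $R\to\infty$, to a deterministic constant. If, in addition, $(\rho4)$: the Nazarov–Sodin constant $c(\rho)$ of $F$ is positive, then $\lim_{R\to\infty}\mathcal{N}(F;R)/\mathrm{Vol}(B(R))=c(\rho)>0$ does not vanish, so that the normalized limit (in mean) $$\Psi_\rho(t):=\lim_{R\to\infty}\frac{\mathcal{N}(F,t;R)}{c(\rho)\cdot\mathrm{Vol}(B(R))}$$ is well defined.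
   Context: Isotropic means the covariance $\mathbb{E}[F(x)F(y)]$ depends only on $|x-y|$. The spectral measure $\rho$ is the probability measure on $\mathbb{R}^n$ whose Fourier transform is the covariance function of $F$. $B(R)$ is the ball of radius $R$ in $\mathbb{R}^n$ centred at the origin. A nodal domain of $F$ is a connected component of $\mathbb{R}^n\setminus F^{-1}(0)$. $\mathcal{N}(F,t;R)$ is the number of nodal domains $\omega$ of $F$ lying entirely in $B(R)$ with $n$-dimensional volume $\mathrm{Vol}(\omega)\le t$, and $\mathcal{N}(F;R)=\mathcal{N}(F,\infty;R)$ is the number of all nodal domains lying entirely in $B(R)$. Under $(\rho1)$–$(\rho3)$, Nazarov and Sodin proved that there is a constant $c(\rho)\ge0$ (the Nazarov–Sodin constant) such that $\mathcal{N}(F;R)/\mathrm{Vol}(B(R))\to c(\rho)$ both in mean and a.s. as $R\to\infty$. Measurability of $\mathcal{N}(F,t;R)$ may be taken for granted. *)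

theory Defs
  imports "HOL-Probability.Probability"
begin

section \<open>Smooth centred Gaussian fields\<close>

primrec C_k :: "nat \<Rightarrow> (real ^ 'n \<Rightarrow> real) \<Rightarrow> bool" where
  "C_k 0 f \<longleftrightarrow> continuous_on UNIV f"
| "C_k (Suc k) f \<longleftrightarrow>
     (\<exists>f'. (\<forall>x. (f has_derivative f' x) (at x)) \<and> (\<forall>v. C_k k (\<lambda>x. f' x v)))"

definition smooth :: "(real ^ 'n \<Rightarrow> real) \<Rightarrow> bool" where
  "smooth f \<longleftrightarrow> (\<forall>k. C_k k f)"

text \<open>The zero random variable is a degenerate Gaussian.\<close>

definition centred_gaussian :: "'w measure \<Rightarrow> ('w \<Rightarrow> real) \<Rightarrow> bool" where
  "centred_gaussian M X \<longleftrightarrow> X \<in> borel_measurable M \<and>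
     ((AE w in M. X w = 0) \<or> (\<exists>\<sigma>>0. distributed M lborel X (normal_density 0 \<sigma>)))"

text \<open>Finite-dimensional distributions are centred Gaussian vectors if and only if all finite
  linear combinations are centred Gaussian variables.\<close>

definition centred_gaussian_field :: "'w measure \<Rightarrow> (real ^ 'n \<Rightarrow> 'w \<Rightarrow> real) \<Rightarrow> bool" where
  "centred_gaussian_field M F \<longleftrightarrow>
     (\<forall>S a. finite S \<longrightarrow> centred_gaussian M (\<lambda>w. \<Sum>x\<in>S. a x * F x w))"

definition covariance :: "'w measure \<Rightarrow> (real ^ 'n \<Rightarrow> 'w \<Rightarrow> real) \<Rightarrow> real ^ 'n \<Rightarrow> real ^ 'n \<Rightarrow> real" where
  "covariance M F x y = (\<integral>w. F x w * F y w \<partial>M)"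

definition isotropic :: "'w measure \<Rightarrow> (real ^ 'n \<Rightarrow> 'w \<Rightarrow> real) \<Rightarrow> bool" where
  "isotropic M F \<longleftrightarrow> (\<exists>k. \<forall>x y. covariance M F x y = k (dist x y))"

text \<open>The Fourier transform is normalised as in \<^const>\<open>char\<close>. A factor \<open>2\<pi>\<close> in the exponent
  would only rescale \<open>\<rho>\<close>.\<close>

definition spectral_measure ::
  "'w measure \<Rightarrow> (real ^ 'n \<Rightarrow> 'w \<Rightarrow> real) \<Rightarrow> (real ^ 'n) measure \<Rightarrow> bool" where
  "spectral_measure M F \<rho> \<longleftrightarrow> prob_space \<rho> \<and> sets \<rho> = sets borel \<and>
     (\<forall>x y. complex_of_real (covariance M F x y) = (CLINT \<xi>|\<rho>. iexp ((x - y) \<bullet> \<xi>)))"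

definition measure_support :: "'a::topological_space measure \<Rightarrow> 'a set" where
  "measure_support \<mu> = {x. \<forall>U. open U \<and> x \<in> U \<longrightarrow> emeasure \<mu> U > 0}"


section \<open>Counting nodal domains\<close>

definition nodal_domains :: "(real ^ 'n \<Rightarrow> real) \<Rightarrow> (real ^ 'n) set set" where
  "nodal_domains f = components (UNIV - f -` {0})"

text \<open>The count is extended-valued, so that infinitely many domains count as \<open>\<infinity>\<close> (with
  \<^const>\<open>card\<close> they would count as \<open>0\<close>). Taking \<open>t = \<infinity>\<close> counts all domains. Nodal domains of
  continuous functions are open, so it makes no difference whether the ball is open or closed.\<close>

definition nodal_count :: "(real ^ 'n \<Rightarrow> real) \<Rightarrow> ennreal \<Rightarrow> real \<Rightarrow> ennreal" where
  "nodal_count f t R = emeasure (count_space UNIV)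
     {\<omega> \<in> nodal_domains f. \<omega> \<subseteq> ball 0 R \<and> emeasure lborel \<omega> \<le> t}"


section \<open>Limits\<close>

text \<open>Convergence in mean to a constant as \<open>R \<rightarrow> \<infinity>\<close> of extended-valued variables; if a variable is
  infinite with positive probability, its distance to the limit is \<open>\<infinity>\<close>. Measurability
  refers to the completion because a field that is only almost surely smooth determines the counts
  only outside a null set; the integral over \<open>M\<close> agrees with the integral over the completion
  (\<open>nn_integral_completion\<close>).\<close>

definition converges_in_mean :: "'w measure \<Rightarrow> (real \<Rightarrow> 'w \<Rightarrow> ennreal) \<Rightarrow> real \<Rightarrow> bool" where
  "converges_in_mean M X c \<longleftrightarrow>
     (\<forall>R>0. X R \<in> borel_measurable (completion M)) \<and>
     ((\<lambda>R. \<integral>\<^sup>+ w. e2ennreal \<bar>enn2ereal (X R w) - ereal c\<bar> \<partial>M) \<longlongrightarrow> 0) at_top"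

definition converges_almost_surely :: "'w measure \<Rightarrow> (real \<Rightarrow> 'w \<Rightarrow> ennreal) \<Rightarrow> real \<Rightarrow> bool" where
  "converges_almost_surely M X c \<longleftrightarrow>
     (AE w in M. ((\<lambda>R. enn2ereal (X R w)) \<longlongrightarrow> ereal c) at_top)"

definition nazarov_sodin_constant :: "'w measure \<Rightarrow> (real ^ 'n \<Rightarrow> 'w \<Rightarrow> real) \<Rightarrow> real" where
  "nazarov_sodin_constant M F = (THE c.
     converges_in_mean M
       (\<lambda>R w. nodal_count (\<lambda>x. F x w) \<infinity> R / emeasure lborel (ball (0 :: real ^ 'n) R)) c \<and>
     converges_almost_surely M
       (\<lambda>R w. nodal_count (\<lambda>x. F x w) \<infinity> R / emeasure lborel (ball (0 :: real ^ 'n) R)) c)"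

end

theory Submission
  imports Defs
begin

text \<open>The law of the field on the space of twice differentiable paths is stationary, and trigonometric
  functions of finitely many values are dense enough to deduce from Wiener's lemma on \<open>\<rho>\<close> that it is
  ergodic. The count in \<open>ball 0 R\<close> is the integral over \<open>x\<close> of \<open>1 / vol\<close> of the nodal domain of \<open>x\<close>, so it lies
  between integrals over balls of stationary processes: from below one keeps only the domains contained
  in \<open>ball x r\<close>, from above all bounded ones. As \<open>r \<longrightarrow> \<infinity>\<close> the two bounds meet, provided that the expected
  density is finite. Finiteness is a Kac-Rice bound: a bounded domain contains a critical point, near
  which \<open>\<bar>\<nabla>f\<bar> < \<epsilon>\<close> on a set whose size is controlled by the second derivatives.\<close>

section \<open>A functional monotone class theorem for trigonometric functions\<close>

text \<open>Cosines are the test functions because a centred Gaussian law is encoded by E cos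
  (\<theta> + Y) = cos \<theta> exp (- Var Y / 2). The covariance of two translated cosines is then
  explicit and of the order of \<kappa>, and averages of \<bar>\<kappa>\<bar> tend to 0 because
  \<rho> has no atoms. The Nazarov-Sodin constant is the common value of a limit in mean and an
  almost sure limit, so both are proved. The upper density is integrable but possibly unbounded,
  which is why a maximal inequality enters. The Kac-Rice bound avoids joint densities of gradient
  and Hessian: the event of a small gradient is dominated by a Gaussian weight, and this weight is
  an average of cosines of directional derivatives. By parity these derivatives are independent of
  each second derivative. Isotropy makes the covariance of the gradient a multiple of the identity,
  (\<rho>3) makes the multiple positive, and (\<rho>2) gives the fourth spectral moment that bounds
  the Hessian. The factor \<epsilon>^n from the weight cancels against the volume of a ball of
  radius \<epsilon>.\<close>

definition cylinder_generator :: "'w set \<Rightarrow> ('i \<Rightarrow> 'w \<Rightarrow> real) \<Rightarrow> 'w set set" where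
  "cylinder_generator \<Omega> X = {{w\<in>\<Omega>. \<forall>i\<in>J. X i w \<le> c i} | J c. finite J}"

lemma cylinder_generatorI:
  "finite J \<Longrightarrow> {w\<in>\<Omega>. \<forall>i\<in>J. X i w \<le> c i} \<in> cylinder_generator \<Omega> X"
  unfolding cylinder_generator_def by (rule CollectI, rule exI[of _ J], rule exI[of _ c]) simp

text \<open>\<open>H\<close> stays abstract because the argument is used for three properties:
  invariance under shifts, mean ergodicity, and factorisation of expectations. None of them is
  closed under products. The phase \<theta> lets cosines stand for sines as well.\<close>

locale trig_class =
  fixes N :: "'w measure" and X :: "'i \<Rightarrow> 'w \<Rightarrow> real" and H :: "('w \<Rightarrow> real) \<Rightarrow> bool"
  assumes sets_N: "sets N = sigma_sets (space N) (cylinder_generator (space N) X)"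
    and H_trig: "\<And>\<theta> S a. finite S \<Longrightarrow> H (\<lambda>w. cos (\<theta> + (\<Sum>i\<in>S. a i * X i w)))"
    and H_scale: "\<And>u a. H u \<Longrightarrow> H (\<lambda>w. a * u w)"
    and H_add: "\<And>u v. H u \<Longrightarrow> H v \<Longrightarrow> H (\<lambda>w. u w + v w)"
    and H_lim: "\<And>u v K. (\<And>k::nat. H (u k)) \<Longrightarrow> (\<And>k. u k \<in> borel_measurable N) \<Longrightarrow>
        (\<And>k w. w \<in> space N \<Longrightarrow> \<bar>u k w\<bar> \<le> K) \<Longrightarrow>
        (\<And>w. w \<in> space N \<Longrightarrow> (\<lambda>k. u k w) \<longlonglongrightarrow> v w) \<Longrightarrow> H v"
begin

lemma generator_closed: "cylinder_generator (space N) X \<subseteq> Pow (space N)"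
  by (auto simp: cylinder_generator_def)

text \<open>Two boxes meet in the box over the union of their coordinates with the smaller bounds.
  Boxes over several coordinates are in the generator for this reason: Dynkin's lemma needs a
  pi-system.\<close>

lemma generator_Int_stable: "Int_stable (cylinder_generator (space N) X)"
proof (rule Int_stableI)
  fix A B assume "A \<in> cylinder_generator (space N) X" "B \<in> cylinder_generator (space N) X"
  then obtain J c J' c' where A: "A = {w\<in>space N. \<forall>i\<in>J. X i w \<le> c i}" "finite J"
    and B: "B = {w\<in>space N. \<forall>i\<in>J'. X i w \<le> c' i}" "finite J'"
    by (auto simp: cylinder_generator_def)
  let ?c = "\<lambda>i. if i \<in> J then if i \<in> J' then min (c i) (c' i) else c i else c' i"
  have "A \<inter> B = {w\<in>space N. \<forall>i\<in>J \<union> J'. X i w \<le> ?c i}"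
    unfolding A B by (auto split: if_splits)
  then show "A \<inter> B \<in> cylinder_generator (space N) X"
    using A B by (simp add: cylinder_generatorI)
qed

lemma X_measurable [measurable]: "X i \<in> borel_measurable N"
proof (rule borel_measurable_iff_le[THEN iffD2], rule allI)
  fix c :: real
  have "{w\<in>space N. X i w \<le> c} = {w\<in>space N. \<forall>j\<in>{i}. X j w \<le> (\<lambda>_. c) j}" by simp
  also have "\<dots> \<in> cylinder_generator (space N) X"
    by (rule cylinder_generatorI) simp
  finally show "{w\<in>space N. X i w \<le> c} \<in> sets N"
    unfolding sets_N by blast
qed

text \<open>The substitute for closure under products: if every cosine times \<open>u\<close> lies
  in \<open>H\<close>, then \<open>u\<close> can be multiplied by further functions of single
  coordinates without leaving the class.\<close>

definition trig_multiplier :: "('w \<Rightarrow> real) \<Rightarrow> bool" where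
  "trig_multiplier u \<longleftrightarrow> u \<in> borel_measurable N \<and> (\<exists>K. \<forall>w\<in>space N. \<bar>u w\<bar> \<le> K) \<and>
     (\<forall>\<theta> S a. finite S \<longrightarrow> H (\<lambda>w. u w * cos (\<theta> + (\<Sum>i\<in>S. a i * X i w))))"

lemma trig_multiplierI:
  assumes "u \<in> borel_measurable N" "\<And>w. w \<in> space N \<Longrightarrow> \<bar>u w\<bar> \<le> K"
    and "\<And>\<theta> S a. finite S \<Longrightarrow> H (\<lambda>w. u w * cos (\<theta> + (\<Sum>i\<in>S. a i * X i w)))"
  shows "trig_multiplier u"
  unfolding trig_multiplier_def by (intro conjI exI[of _ K] ballI allI impI assms)

lemma trig_multiplierD:
  assumes "trig_multiplier u"
  shows "u \<in> borel_measurable N" "\<exists>K. \<forall>w\<in>space N. \<bar>u w\<bar> \<le> K"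
    and "finite S \<Longrightarrow> H (\<lambda>w. u w * cos (\<theta> + (\<Sum>i\<in>S. a i * X i w)))"
proof -
  note * = assms[unfolded trig_multiplier_def]
  show "u \<in> borel_measurable N" by (rule conjunct1[OF *])
  show "\<exists>K. \<forall>w\<in>space N. \<bar>u w\<bar> \<le> K" by (rule conjunct1[OF conjunct2[OF *]])
  show "finite S \<Longrightarrow> H (\<lambda>w. u w * cos (\<theta> + (\<Sum>i\<in>S. a i * X i w)))"
    by (rule conjunct2[OF conjunct2[OF *], rule_format])
qed

lemma trig_multiplier_one: "trig_multiplier (\<lambda>w. 1)"
proof (rule trig_multiplierI[where K = 1])
  show "H (\<lambda>w. 1 * cos (\<theta> + (\<Sum>i\<in>S. a i * X i w)))" if "finite S" for \<theta> S a
    unfolding mult_1 by (rule H_trig[OF that])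
qed simp_all

lemma trig_multiplier_H:
  assumes "trig_multiplier u" shows "H u"
  using trig_multiplierD(3)[OF assms, of "{}" 0] by simp

lemma trig_multiplier_scale:
  assumes u: "trig_multiplier u" shows "trig_multiplier (\<lambda>w. a * u w)"
proof -
  obtain K where K: "\<forall>w\<in>space N. \<bar>u w\<bar> \<le> K"
    using trig_multiplierD(2)[OF u] ..
  show ?thesis
  proof (rule trig_multiplierI[where K = "\<bar>a\<bar> * K"])
    show "(\<lambda>w. a * u w) \<in> borel_measurable N"
      by (intro borel_measurable_times borel_measurable_const trig_multiplierD[OF u])
    show "\<bar>a * u w\<bar> \<le> \<bar>a\<bar> * K" if "w \<in> space N" for w
      unfolding abs_mult using K that by (intro mult_left_mono) auto
    show "H (\<lambda>w. a * u w * cos (\<theta> + (\<Sum>i\<in>S. b i * X i w)))" if "finite S" for \<theta> S b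
      unfolding mult.assoc by (rule H_scale[OF trig_multiplierD(3)[OF u that]])
  qed
qed

lemma trig_multiplier_add:
  assumes u: "trig_multiplier u" and v: "trig_multiplier v"
  shows "trig_multiplier (\<lambda>w. u w + v w)"
proof -
  obtain K where K: "\<forall>w\<in>space N. \<bar>u w\<bar> \<le> K"
    using trig_multiplierD(2)[OF u] ..
  obtain L where L: "\<forall>w\<in>space N. \<bar>v w\<bar> \<le> L"
    using trig_multiplierD(2)[OF v] ..
  show ?thesis
  proof (rule trig_multiplierI[where K = "K + L"])
    show "(\<lambda>w. u w + v w) \<in> borel_measurable N"
      by (intro borel_measurable_add trig_multiplierD[OF u] trig_multiplierD[OF v])
    show "\<bar>u w + v w\<bar> \<le> K + L" if "w \<in> space N" for w
      using K L that abs_triangle_ineq[of "u w" "v w"] by fastforce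
    show "H (\<lambda>w. (u w + v w) * cos (\<theta> + (\<Sum>i\<in>S. b i * X i w)))" if "finite S" for \<theta> S b
      unfolding distrib_right
      by (rule H_add[OF trig_multiplierD(3)[OF u that] trig_multiplierD(3)[OF v that]])
  qed
qed

text \<open>The addition formulas give sin B cos A = (sin (A + B) - sin (A - B)) / 2, and both sines
  are cosines with a phase moved by \<pi> / 2.\<close>

lemma trig_multiplier_sin:
  assumes u: "trig_multiplier u" shows "trig_multiplier (\<lambda>w. u w * sin (b * X i w))"
proof -
  obtain K where K: "\<And>w. w \<in> space N \<Longrightarrow> \<bar>u w\<bar> \<le> K"
    using trig_multiplierD(2)[OF u] by blast
  have [measurable]: "u \<in> borel_measurable N" by (rule trig_multiplierD[OF u])
  have bd: "\<bar>u w * sin (b * X i w)\<bar> \<le> K" if "w \<in> space N" for w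
    using K[OF that] mult_mono[OF K[OF that] abs_sin_le_one[of "b * X i w"]]
    by (simp add: abs_mult)
  have trig: "H (\<lambda>w. u w * sin (b * X i w) * cos (\<theta> + (\<Sum>j\<in>S. a j * X j w)))"
    if S: "finite S" for \<theta> S a
  proof -
    \<comment> \<open>The index \<open>i\<close> may already belong to \<open>S\<close>, so the new
      coefficient \<open>s * b\<close> is added to the old one instead of replacing it.\<close>
    let ?a = "\<lambda>s j. (if j \<in> S then a j else 0) + (if j = i then s * b else 0)"
    have lin: "(\<Sum>j\<in>insert i S. ?a s j * X j w) = s * (b * X i w) + (\<Sum>j\<in>S. a j * X j w)" for w s
    proof -
      have "(\<Sum>j\<in>insert i S. ?a s j * X j w) =
          (\<Sum>j\<in>insert i S. (if j \<in> S then a j * X j w else 0)) +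
          (\<Sum>j\<in>insert i S. (if j = i then s * b * X i w else 0))"
        unfolding sum.distrib[symmetric] by (rule sum.cong) (auto simp: algebra_simps)
      also have "(\<Sum>j\<in>insert i S. (if j \<in> S then a j * X j w else 0)) = (\<Sum>j\<in>S. a j * X j w)"
        using S by (intro sum.mono_neutral_cong_right) auto
      finally show ?thesis using S by simp
    qed
    have mult: "H (\<lambda>w. u w * cos (\<phi> + (\<Sum>j\<in>insert i S. ?a s j * X j w)))" for \<phi> s
      by (rule trig_multiplierD(3)[OF u]) (use S in simp)
    have "H (\<lambda>w. (1/2) * (u w * cos (\<theta> - pi/2 + (\<Sum>j\<in>insert i S. ?a 1 j * X j w))) +
        (1/2) * (u w * cos (\<theta> + pi/2 + (\<Sum>j\<in>insert i S. ?a (-1) j * X j w))))"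
      by (intro H_add H_scale mult)
    moreover have "(1/2) * (u w * cos (\<theta> - pi/2 + (\<Sum>j\<in>insert i S. ?a 1 j * X j w))) +
        (1/2) * (u w * cos (\<theta> + pi/2 + (\<Sum>j\<in>insert i S. ?a (-1) j * X j w))) =
        u w * sin (b * X i w) * cos (\<theta> + (\<Sum>j\<in>S. a j * X j w))" for w
    proof -
      define A where "A = \<theta> + (\<Sum>j\<in>S. a j * X j w)"
      define B where "B = b * X i w"
      have 1: "\<theta> - pi/2 + (\<Sum>j\<in>insert i S. ?a 1 j * X j w) = (A + B) - pi/2"
        and 2: "\<theta> + pi/2 + (\<Sum>j\<in>insert i S. ?a (-1) j * X j w) = (A - B) + pi/2"
        unfolding lin A_def B_def by simp_all
      have 3: "cos ((A + B) - pi/2) = sin (A + B)" "cos ((A - B) + pi/2) = - sin (A - B)"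
        by (simp_all add: cos_diff[of _ "pi/2"] cos_add[of _ "pi/2"])
      show ?thesis
        unfolding 1 2 A_def[symmetric] B_def[symmetric] 3
        by (simp add: sin_add sin_diff algebra_simps)
    qed
    ultimately show ?thesis by simp
  qed
  show ?thesis
    by (rule trig_multiplierI[where K = K]) (use bd trig in measurable)
qed

text \<open>The induction generalises \<open>u\<close>: for a product, the multiplier obtained from
  the first factor is the one to which the second is applied.\<close>

lemma trig_multiplier_poly:
  assumes "real_polynomial_function q" "trig_multiplier u"
  shows "trig_multiplier (\<lambda>w. u w * q (sin (b * X i w)))"
  using assms
proof (induction arbitrary: u rule: real_polynomial_function.induct)
  case (linear f)
  interpret bounded_linear f by fact
  have "f x = f 1 * x" for x
    using scale[of x 1] by simp
  then have "(\<lambda>w. u w * f (sin (b * X i w))) = (\<lambda>w. f 1 * (u w * sin (b * X i w)))"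
    by (metis mult.left_commute)
  then show ?case
    using trig_multiplier_scale[OF trig_multiplier_sin[OF linear.prems]] by simp
next
  case (const c)
  then show ?case using trig_multiplier_scale[of u c] by (simp add: mult.commute)
next
  case (add f g)
  then show ?case using trig_multiplier_add[OF add.IH] by (simp add: distrib_left)
next
  case (mult f g)
  then show ?case using mult.IH(2)[OF mult.IH(1)] by (simp add: mult.assoc)
qed

lemma trig_multiplier_lim:
  assumes u: "\<And>k::nat. trig_multiplier (u k)"
    and K: "\<And>k w. w \<in> space N \<Longrightarrow> \<bar>u k w\<bar> \<le> K"
    and lim': "\<And>w. w \<in> space N \<Longrightarrow> (\<lambda>k. u k w) \<longlonglongrightarrow> v w"
  shows "trig_multiplier v"
proof (rule trig_multiplierI[where K = K])
  have [measurable]: "u k \<in> borel_measurable N" for k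
    by (rule trig_multiplierD[OF u])
  show "v \<in> borel_measurable N"
    by (rule borel_measurable_LIMSEQ_real[OF lim']) auto
  show "\<bar>v w\<bar> \<le> K" if "w \<in> space N" for w
    by (rule LIMSEQ_le_const2[OF tendsto_rabs[OF lim'[OF that]]]) (use K[OF that] in auto)
  fix \<theta> and S :: "'i set" and a assume S: "finite S"
  show "H (\<lambda>w. v w * cos (\<theta> + (\<Sum>i\<in>S. a i * X i w)))"
  proof (rule H_lim[where K = K and u = "\<lambda>k w. u k w * cos (\<theta> + (\<Sum>i\<in>S. a i * X i w))"])
    show "H (\<lambda>w. u k w * cos (\<theta> + (\<Sum>i\<in>S. a i * X i w)))" for k
      by (rule trig_multiplierD(3)[OF u S])
    show "(\<lambda>w. u k w * cos (\<theta> + (\<Sum>i\<in>S. a i * X i w))) \<in> borel_measurable N" for k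
      by measurable
    show "\<bar>u k w * cos (\<theta> + (\<Sum>i\<in>S. a i * X i w))\<bar> \<le> K" if "w \<in> space N" for k w
      using mult_mono[OF K[OF that, of k] abs_cos_le_one[of "\<theta> + (\<Sum>i\<in>S. a i * X i w)"]]
        K[OF that, of k] by (simp add: abs_mult)
  qed (intro tendsto_intros lim')
qed

text \<open>Since \<open>k sin (t / k) \<longrightarrow> t\<close>, it is enough to approximate \<open>\<psi> (k s)\<close> by polynomials for
  \<open>\<bar>s\<bar> \<le> 1\<close>.\<close>

lemma trig_multiplier_continuous:
  assumes u: "trig_multiplier u" and \<psi>: "continuous_on UNIV \<psi>" and B: "\<And>t. \<bar>\<psi> t\<bar> \<le> B"
  shows "trig_multiplier (\<lambda>w. u w * \<psi> (X i w))"
proof -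
  have "\<exists>q. real_polynomial_function q \<and> (\<forall>s\<in>{-1..1::real}. \<bar>\<psi> (real (Suc k) * s) - q s\<bar> < 1 / Suc k)" for k
  proof -
    have "continuous_on {-1..1} (\<lambda>s. \<psi> (real (Suc k) * s))"
      by (rule continuous_on_compose2[OF \<psi>]) (auto intro!: continuous_intros)
    from Stone_Weierstrass_real_polynomial_function[OF _ this, of "1 / Suc k"]
    show ?thesis by (metis compact_Icc of_nat_0_less_iff zero_less_Suc zero_less_divide_1_iff)
  qed
  then obtain q where q: "\<And>k. real_polynomial_function (q k)"
    and q2: "\<And>k s. s \<in> {-1..1} \<Longrightarrow> \<bar>\<psi> (real (Suc k) * s) - q k s\<bar> < 1 / Suc k"
    by metis
  obtain K where K: "\<And>w. w \<in> space N \<Longrightarrow> \<bar>u w\<bar> \<le> K"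
    using trig_multiplierD(2)[OF u] by blast
  show ?thesis
  proof (rule trig_multiplier_lim[where K = "K * (B + 1)"])
    show "trig_multiplier (\<lambda>w. u w * q k (sin (1 / Suc k * X i w)))" for k
      by (rule trig_multiplier_poly[OF q u])
    show "\<bar>u w * q k (sin (1 / Suc k * X i w))\<bar> \<le> K * (B + 1)" if "w \<in> space N" for k w
    proof -
      let ?s = "sin (1 / Suc k * X i w)"
      have "\<bar>\<psi> (Suc k * ?s) - q k ?s\<bar> < 1 / Suc k" by (rule q2) simp
      moreover have "1 / real (Suc k) \<le> 1" by simp
      ultimately have "\<bar>q k ?s\<bar> \<le> B + 1" using B[of "Suc k * ?s"] by linarith
      then show ?thesis unfolding abs_mult
        by (intro mult_mono K that) (use K[OF that] in auto)
    qed
    fix w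
    define x where "x = X i w"
    have L: "(\<lambda>k. real (Suc k) * sin (1 / Suc k * x)) \<longlonglongrightarrow> x"
    proof -
      have "((\<lambda>h. (sin (x * (0 + h)) - sin (x * 0)) / h) \<longlongrightarrow> x * cos (x * 0)) (at 0)"
      proof -
        have "((\<lambda>h. sin (x * h)) has_field_derivative x * cos (x * 0)) (at 0)"
          by (auto intro!: derivative_eq_intros)
        then show ?thesis unfolding DERIV_def .
      qed
      then have "((\<lambda>h. sin (x * h) / h) \<longlongrightarrow> x) (at 0)" by simp
      moreover have "filterlim (\<lambda>k. 1 / real (Suc k)) (at 0) sequentially"
        by (rule filterlim_atI) (use LIMSEQ_inverse_real_of_nat in \<open>auto simp: inverse_eq_divide\<close>)
      ultimately have "(\<lambda>k. sin (x * (1 / real (Suc k))) / (1 / real (Suc k))) \<longlonglongrightarrow> x"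
        by (rule filterlim_compose)
      then show ?thesis by (simp add: mult.commute)
    qed
    have "(\<lambda>k. \<psi> (real (Suc k) * sin (1 / Suc k * x))) \<longlonglongrightarrow> \<psi> x"
      by (rule continuous_on_tendsto_compose[OF \<psi> L]) auto
    moreover have "(\<lambda>k. q k (sin (1 / Suc k * x)) - \<psi> (real (Suc k) * sin (1 / Suc k * x))) \<longlonglongrightarrow> 0"
    proof (rule Lim_null_comparison)
      show "\<forall>\<^sub>F k in sequentially. norm (q k (sin (1 / Suc k * x)) - \<psi> (real (Suc k) * sin (1 / Suc k * x))) \<le> 1 / real (Suc k)"
        using q2[of "sin (1 / Suc _ * x)", THEN less_imp_le] by (auto simp: abs_minus_commute)
      show "(\<lambda>k. 1 / real (Suc k)) \<longlonglongrightarrow> 0"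
        using LIMSEQ_inverse_real_of_nat by (simp add: inverse_eq_divide)
    qed
    ultimately have "(\<lambda>k. q k (sin (1 / Suc k * x))) \<longlonglongrightarrow> \<psi> x"
      using tendsto_add by fastforce
    then show "(\<lambda>k. u w * q k (sin (1 / Suc k * X i w))) \<longlonglongrightarrow> u w * \<psi> (X i w)"
      unfolding x_def by (intro tendsto_intros)
  qed
qed

text \<open>The indicator of a half-line is a limit of continuous ramps, so the indicator of a box
  is a bounded limit of products of ramps, one factor for each coordinate. The factors are attached
  one at a time by \<open>trig_multiplier_continuous\<close>.\<close>

lemma H_generator:
  assumes "A \<in> cylinder_generator (space N) X" shows "H (indicator A)"
proof -
  obtain J c where J: "finite J" and A: "A = {w\<in>space N. \<forall>i\<in>J. X i w \<le> c i}"
    using assms unfolding cylinder_generator_def by blast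
  \<comment> \<open>The ramp is 1 for t \<le> 0, is 0 for t \<ge> 1 / k, and tends to the indicator
    of t \<le> 0, matching the weak inequality in the generator.\<close>
  define \<psi> where "\<psi> = (\<lambda>(k::nat) t::real. max 0 (min 1 (1 - k * t)))"
  have \<psi>01: "0 \<le> \<psi> k t" "\<psi> k t \<le> 1" for k t unfolding \<psi>_def by auto
  have \<psi>lim: "(\<lambda>k. \<psi> k t) \<longlonglongrightarrow> (if t \<le> 0 then 1 else 0)" for t
  proof (cases "t \<le> 0")
    case True
    then have "\<psi> k t = 1" for k
      using mult_nonneg_nonpos[of "real k" t] unfolding \<psi>_def by simp
    then show ?thesis using True by simp
  next
    case False
    obtain k0 :: nat where "1 / t < k0" using reals_Archimedean2 by blast
    then have "\<psi> k t = 0" if "k \<ge> k0" for k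
    proof -
      have "1 / t \<le> k" using \<open>1 / t < k0\<close> that by linarith
      then have "1 \<le> k * t" using False by (simp add: field_simps)
      then show ?thesis unfolding \<psi>_def by simp
    qed
    then have "\<forall>\<^sub>F k in sequentially. \<psi> k t = 0"
      unfolding eventually_sequentially by blast
    then show ?thesis using False by (simp add: tendsto_eventually)
  qed
  have mult: "trig_multiplier (\<lambda>w. \<Prod>i\<in>J. \<psi> k (X i w - c i))" for k
    using J
  proof (induction J)
    case empty
    then show ?case using trig_multiplier_one by simp
  next
    case (insert j J)
    have "trig_multiplier (\<lambda>w. (\<Prod>i\<in>J. \<psi> k (X i w - c i)) * (\<lambda>t. \<psi> k (t - c j)) (X j w))"
      by (rule trig_multiplier_continuous[where B = 1, OF insert.IH])
         (use \<psi>01 in \<open>auto simp: \<psi>_def intro!: continuous_intros\<close>)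
    then show ?case using insert by (simp add: mult.commute)
  qed
  show ?thesis
  proof (rule H_lim[where K = 1])
    show "H (\<lambda>w. \<Prod>i\<in>J. \<psi> k (X i w - c i))" for k by (rule trig_multiplier_H[OF mult])
    show "(\<lambda>w. \<Prod>i\<in>J. \<psi> k (X i w - c i)) \<in> borel_measurable N" for k
      by (rule trig_multiplierD[OF mult])
    show "\<bar>\<Prod>i\<in>J. \<psi> k (X i w - c i)\<bar> \<le> 1" for k w
      using \<psi>01 by (simp add: prod_nonneg prod_le_1)
    fix w assume w: "w \<in> space N"
    have "(\<lambda>k. \<Prod>i\<in>J. \<psi> k (X i w - c i)) \<longlonglongrightarrow> (\<Prod>i\<in>J. if X i w - c i \<le> 0 then 1 else 0)"
      by (intro tendsto_prod \<psi>lim)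
    also have "(\<Prod>i\<in>J. if X i w - c i \<le> 0 then 1 else 0) = (indicator A w :: real)"
      using J w by (auto simp: A indicator_def intro: prod.neutral)
    finally show "(\<lambda>k. \<Prod>i\<in>J. \<psi> k (X i w - c i)) \<longlonglongrightarrow> indicator A w" .
  qed
qed

lemma H_const: "H (\<lambda>w. c)"
  using H_scale[OF H_trig[of "{}" 0], of c] by simp

lemma H_indicator:
  assumes "A \<in> sets N" shows "H (indicator A)"
proof -
  have "A \<in> sigma_sets (space N) (cylinder_generator (space N) X)" using assms sets_N by simp
  from generator_Int_stable generator_closed this show ?thesis
  proof (induction rule: sigma_sets_induct_disjoint)
    case (basic A)
    then show ?case by (rule H_generator)
  next
    case empty
    then show ?case using H_const[of 0] by (simp add: indicator_def[abs_def])
  next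
    case (compl A)
    have "A \<subseteq> space N" using compl(1) generator_closed sigma_sets_into_sp by blast
    let ?u = "\<lambda>w. 1 + (-1) * indicator A w :: real"
    have "H ?u" by (intro H_add H_scale H_const compl)
    moreover have "A \<in> sets N" using compl sets_N by simp
    \<comment> \<open>The function 1 - \<open>indicator A\<close> agrees with the indicator of the
      complement only on \<open>space N\<close>. A constant sequence in \<open>H_lim\<close>
      replaces one by the other.\<close>
    ultimately show ?case
    proof (intro H_lim[where u = "\<lambda>_. ?u" and v = "indicator (space N - A)" and K = 1])
      show "(\<lambda>_::nat. ?u w) \<longlonglongrightarrow> indicator (space N - A) w" if "w \<in> space N" for w
      proof -
        have "?u w = indicator (space N - A) w" using that by (simp add: indicator_def)
        then show ?thesis by simp
      qed
      show "\<bar>?u w\<bar> \<le> 1" for w by (simp add: indicator_def)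
    qed auto
  next
    case (union A)
    have A: "A i \<in> sets N" for i using union sets_N by auto
    have fin: "H (\<lambda>w. \<Sum>i<k. indicator (A i) w)" for k :: nat
      proof (induction k)
        case 0
        show ?case using H_const[of 0] by simp
      next
        case (Suc k)
        show ?case unfolding sum.lessThan_Suc by (intro H_add Suc union)
      qed
    have eq: "(\<Sum>i<k. indicator (A i) w :: real) = indicator (\<Union>i<k. A i) w" for k w
      using union(1) by (subst indicator_UN_disjoint) (auto simp: disjoint_family_on_def)
    show ?case
    proof (rule H_lim[where K = 1])
      show "H (\<lambda>w. \<Sum>i<k. indicator (A i) w)" for k :: nat by (rule fin)
      show "(\<lambda>w. \<Sum>i<k. indicator (A i) w :: real) \<in> borel_measurable N" for k :: nat
        using A by measurable
      show "\<bar>\<Sum>i<k. indicator (A i) w\<bar> \<le> (1::real)" for k w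
        unfolding eq by (simp add: indicator_def)
      show "(\<lambda>k. \<Sum>i<k. indicator (A i) w) \<longlonglongrightarrow> (indicator (\<Union>i. A i) w :: real)" for w
        unfolding eq by (rule LIMSEQ_indicator_UN)
    qed
  qed
qed

theorem H_bounded_measurable:
  assumes u: "u \<in> borel_measurable N" and K: "\<And>w. w \<in> space N \<Longrightarrow> \<bar>u w\<bar> \<le> K"
  shows "H u"
proof -
  \<comment> \<open>The induction over measurable functions wants nonnegative values everywhere,
    hence the shift by \<open>K\<close> and the value 0 outside the space. The shift is undone at
    the end.\<close>
  let ?v = "\<lambda>w. if w \<in> space N then K + u w else 0"
  have "?v w \<ge> 0" for w using K[of w] by auto
  moreover have "?v \<in> borel_measurable N" using u by measurable
  ultimately have "?v \<in> borel_measurable N" "\<And>w. ?v w \<ge> 0" by blast+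
  \<comment> \<open>Boundedness becomes a premise inside the induction, because the parts of a
    bounded function built by the induction are again bounded and \<open>H_lim\<close> requires a
    uniform bound.\<close>
  then have "(\<exists>B. \<forall>w\<in>space N. \<bar>?v w\<bar> \<le> B) \<longrightarrow> H ?v"
  proof (induction rule: borel_measurable_induct_real)
    case (set A)
    then show ?case using H_indicator by blast
  next
    case (mult u c)
    show ?case
    proof (cases "c = 0")
      case True
      then show ?thesis using H_const[of 0] by simp
    next
      case False
      show ?thesis
      proof
        assume "\<exists>B. \<forall>w\<in>space N. \<bar>c * u w\<bar> \<le> B"
        then obtain B where "\<forall>w\<in>space N. \<bar>c * u w\<bar> \<le> B" by blast
        then have "\<forall>w\<in>space N. \<bar>u w\<bar> \<le> B / c"
          using mult(1) False by (auto simp: field_simps abs_mult)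
        then show "H (\<lambda>w. c * u w)" using mult(4) H_scale by blast
      qed
    qed
  next
    case (add u v)
    show ?case
    proof
      assume "\<exists>B. \<forall>w\<in>space N. \<bar>v w + u w\<bar> \<le> B"
      then obtain B where B: "\<And>w. w \<in> space N \<Longrightarrow> \<bar>v w + u w\<bar> \<le> B" by blast
      have "\<bar>u w\<bar> \<le> B" "\<bar>v w\<bar> \<le> B" if "w \<in> space N" for w
        using B[OF that] add.hyps(2)[of w] add.hyps(4)[of w] by linarith+
      then show "H (\<lambda>w. v w + u w)" using add.IH by (intro H_add) blast+
    qed
  next
    case (seq U)
    show ?case
    proof
      assume "\<exists>B. \<forall>w\<in>space N. \<bar>?v w\<bar> \<le> B"
      then obtain B where B: "\<And>w. w \<in> space N \<Longrightarrow> \<bar>?v w\<bar> \<le> B" by blast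
      have bd: "\<bar>U k w\<bar> \<le> B" if w: "w \<in> space N" for k w
      proof -
        have "U k w \<le> ?v w"
          by (rule incseq_le[OF _ seq.hyps(4)[OF w]])
             (use seq.hyps(3) in \<open>auto simp: incseq_def le_fun_def\<close>)
        then show ?thesis using B[OF w] seq.hyps(2)[of k w] by linarith
      qed
      show "H ?v"
        by (rule H_lim[where u = U and K = B]) (use seq.IH seq.hyps bd in blast)+
    qed
  qed
  moreover have "\<bar>?v w\<bar> \<le> 2 * K" if "w \<in> space N" for w using K[OF that] that by auto
  ultimately have "H ?v" by blast
  then have "H (\<lambda>w. ?v w + (-K))" by (intro H_add H_const)
  then show ?thesis
    by (rule H_lim[where u = "\<lambda>_ w. ?v w + (-K)" and K = K]) (use u K in auto)
qed

end

section \<open>Averages over balls\<close>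

lemma ennreal_divide_mult_cancel:
  assumes "v > 0" shows "x / ennreal v * ennreal v = x"
proof -
  have "x / ennreal v * ennreal v = x * ennreal v / ennreal v"
    by (metis ennreal_times_divide mult.commute)
  also have "\<dots> = x"
    by (rule ennreal_mult_divide_eq) (use assms in auto)
  finally show ?thesis .
qed

definition ball_avg :: "real \<Rightarrow> 'a::euclidean_space measure" where
  "ball_avg R = uniform_measure lborel (ball 0 R)"

lemma sets_ball_avg [measurable_cong, simp]: "sets (ball_avg R) = sets borel"
  by (simp add: ball_avg_def)

text \<open>Holds for negative radii too, where both sides are 0. Differences of radii such as
  \<open>R - r\<close> can therefore be used without a case distinction.\<close>

lemma emeasure_ball_eq: "emeasure lborel (ball c R :: 'a::euclidean_space set) = ennreal (measure lborel (ball (0::'a) R))"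
proof (cases "R \<ge> 0")
  case True
  then show ?thesis by (simp add: emeasure_ball measure_def)
next
  case False
  then show ?thesis by (simp add: ball_empty)
qed

lemma measure_ball_eq: "measure lborel (ball (c::'a::euclidean_space) R) = measure lborel (ball (0::'a) R)"
  using emeasure_ball_eq[of c R] by (simp add: measure_def)

lemma measure_ball_scale:
  assumes "R \<ge> 0" "a \<ge> 0"
  shows "measure lborel (ball (0::'a::euclidean_space) (a * R)) = a ^ DIM('a) * measure lborel (ball (0::'a) R)"
  using assms by (simp add: content_ball power_mult_distrib)

lemma measure_ball_pos: "R > 0 \<Longrightarrow> measure lborel (ball (0::'a::euclidean_space) R) > 0"
  by simp

text \<open>The ratio is (1 - r / R)^d for large R. Every boundary effect below disappears through
  this limit; a negative \<open>r\<close> is allowed and is used to enlarge a ball.\<close>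

lemma measure_ball_ratio_tendsto:
  fixes r :: real
  shows "((\<lambda>R. measure lborel (ball (0::'a::euclidean_space) (R - r)) / measure lborel (ball (0::'a) R)) \<longlongrightarrow> 1) at_top"
proof -
  have "((\<lambda>R::real. 1 - r / R) \<longlongrightarrow> 1 - 0) at_top"
    by (intro tendsto_intros tendsto_divide_0[OF tendsto_const] filterlim_at_top_imp_at_infinity filterlim_ident)
  then have "((\<lambda>R::real. (1 - r / R) ^ DIM('a)) \<longlongrightarrow> 1) at_top"
    using tendsto_power[of "\<lambda>R. 1 - r / R" 1 at_top "DIM('a)"] by simp
  moreover have "\<forall>\<^sub>F R in at_top. (1 - r / R) ^ DIM('a) = measure lborel (ball (0::'a) (R - r)) / measure lborel (ball (0::'a) R)"
    using eventually_gt_at_top[of "max 1 r"]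
  proof eventually_elim
    case (elim R)
    then have "R - r = (1 - r / R) * R" "1 - r / R \<ge> 0" by (auto simp: field_simps)
    then have "measure lborel (ball (0::'a) (R - r)) = (1 - r / R) ^ DIM('a) * measure lborel (ball (0::'a) R)"
      using measure_ball_scale[of R "1 - r / R", where 'a = 'a] elim by simp
    moreover have "measure lborel (ball (0::'a) R) > 0" using elim by simp
    ultimately show ?case by simp
  qed
  ultimately show ?thesis by (rule Lim_transform_eventually)
qed

lemma prob_space_ball_avg: "R > 0 \<Longrightarrow> prob_space (ball_avg R :: 'a::euclidean_space measure)"
  unfolding ball_avg_def
  by (rule prob_space_uniform_measure) (simp_all add: emeasure_ball_eq)

lemma AE_ball_avg: "R > 0 \<Longrightarrow> AE x in (ball_avg R :: 'a::euclidean_space measure). x \<in> ball 0 R"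
  unfolding ball_avg_def by (rule AE_uniform_measureI) auto

lemma nn_integral_ball_avg:
  fixes f :: "'a::euclidean_space \<Rightarrow> ennreal"
  assumes [measurable]: "f \<in> borel_measurable borel"
  shows "(\<integral>\<^sup>+x. f x \<partial>ball_avg R) = (\<integral>\<^sup>+x. f x * indicator (ball 0 R) x \<partial>lborel) / measure lborel (ball (0::'a) R)"
  unfolding ball_avg_def
  by (subst nn_integral_uniform_measure) (simp_all add: emeasure_ball_eq)

lemma integral_ball_avg:
  fixes f :: "'a::euclidean_space \<Rightarrow> real"
  assumes [measurable]: "f \<in> borel_measurable borel" and "R > 0"
  shows "(\<integral>x. f x \<partial>ball_avg R) = (\<integral>x. indicator (ball 0 R) x * f x \<partial>lborel) / measure lborel (ball (0::'a) R)"
proof -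
  let ?V = "measure lborel (ball (0::'a) R)"
  have V: "?V > 0" using \<open>R > 0\<close> by simp
  have "ball_avg R = density lborel (\<lambda>x::'a. ennreal (indicator (ball 0 R) x / ?V))"
    unfolding ball_avg_def uniform_measure_def using V
    by (intro density_cong) (auto simp: emeasure_ball_eq indicator_def divide_ennreal ennreal_1[symmetric] simp del: ennreal_1 intro!: AE_I2)
  moreover have "(\<lambda>x::'a. indicator (ball 0 R) x / ?V) \<in> borel_measurable lborel"
    by (intro borel_measurable_divide borel_measurable_indicator) auto
  ultimately have "(\<integral>x. f x \<partial>ball_avg R) = (\<integral>x. (indicator (ball 0 R) x / ?V) *\<^sub>R f x \<partial>lborel)"
    by (simp add: integral_density)
  also have "\<dots> = (\<integral>x. indicator (ball 0 R) x * f x \<partial>lborel) / ?V"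
    by (subst integral_divide_zero[symmetric]) simp
  finally show ?thesis .
qed

lemma nn_integral_ball_avg_shift:
  fixes f :: "'a::euclidean_space \<Rightarrow> ennreal"
  assumes [measurable]: "f \<in> borel_measurable borel"
  shows "(\<integral>\<^sup>+x. f (x + y) \<partial>ball_avg R) = (\<integral>\<^sup>+x. f x * indicator (ball y R) x \<partial>lborel) / measure lborel (ball (0::'a) R)"
proof -
  have "(\<integral>\<^sup>+x. f x * indicator (ball y R) x \<partial>lborel) = (\<integral>\<^sup>+x. f x * indicator (ball y R) x \<partial>distr lborel borel ((+) y))"
    by (simp add: lborel_distr_plus)
  also have "\<dots> = (\<integral>\<^sup>+x. f (x + y) * indicator (ball 0 R) x \<partial>lborel)"
    by (subst nn_integral_distr) (auto intro!: nn_integral_cong simp: indicator_def dist_norm add.commute)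
  finally show ?thesis by (subst nn_integral_ball_avg) auto
qed

text \<open>Both balls \<open>ball 0 R\<close> and \<open>ball h R\<close> contain \<open>ball 0 (R - r)\<close>.\<close>

lemma ball_avg_shift_bound:
  fixes \<psi> :: "'a::euclidean_space \<Rightarrow> real"
  assumes [measurable]: "\<psi> \<in> borel_measurable borel" and K: "\<And>x. \<bar>\<psi> x\<bar> \<le> K"
    and h: "norm h \<le> r" and R: "r < R"
  shows "\<bar>(\<integral>x. \<psi> (x + h) \<partial>ball_avg R) - (\<integral>x. \<psi> x \<partial>ball_avg R)\<bar>
    \<le> 2 * K * (1 - measure lborel (ball (0::'a) (R - r)) / measure lborel (ball (0::'a) R))"
proof -
  have R0: "R > 0" using h R norm_ge_zero[of h] by linarith
  have K0: "K \<ge> 0" using K[of 0] by linarith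
  let ?V = "measure lborel (ball (0::'a) R)" and ?V' = "measure lborel (ball (0::'a) (R - r))"
  have V: "?V > 0" using R0 by simp
  have fin: "integrable lborel (\<lambda>x. indicator (ball c s) x :: real)" for c :: 'a and s
    by (rule integrable_real_indicator) (auto simp: emeasure_ball_eq)
  have int: "integrable lborel (\<lambda>x. indicator (ball c s) x * \<psi> x)" for c s
  proof (rule Bochner_Integration.integrable_bound[OF integrable_mult_left[OF fin[of c s], of K]])
    show "(\<lambda>x. indicator (ball c s) x * \<psi> x) \<in> borel_measurable lborel"
      by (intro borel_measurable_times borel_measurable_indicator) auto
    show "AE x in lborel. norm (indicator (ball c s) x * \<psi> x) \<le> norm (indicator (ball c s) x * K)"
      using K K0 by (intro AE_I2) (simp add: indicator_def)
  qed
  have "(\<integral>x. indicator (ball h R) x * \<psi> x \<partial>lborel) = (\<integral>x. indicator (ball h R) x * \<psi> x \<partial>distr lborel borel ((+) h))"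
    by (simp add: lborel_distr_plus)
  also have "\<dots> = (\<integral>x. indicator (ball 0 R) x * \<psi> (x + h) \<partial>lborel)"
    by (subst integral_distr) (auto intro!: Bochner_Integration.integral_cong simp: indicator_def dist_norm add.commute)
  finally have "(\<integral>x. \<psi> (x + h) \<partial>ball_avg R) - (\<integral>x. \<psi> x \<partial>ball_avg R) =
      ((\<integral>x. indicator (ball h R) x * \<psi> x \<partial>lborel) - (\<integral>x. indicator (ball 0 R) x * \<psi> x \<partial>lborel)) / ?V"
    using R0 by (simp add: integral_ball_avg diff_divide_distrib)
  also have "\<dots> = (\<integral>x. indicator (ball h R) x * \<psi> x - indicator (ball 0 R) x * \<psi> x \<partial>lborel) / ?V"
    by (simp add: int)
  finally have eq: "\<bar>(\<integral>x. \<psi> (x + h) \<partial>ball_avg R) - (\<integral>x. \<psi> x \<partial>ball_avg R)\<bar> =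
      \<bar>\<integral>x. indicator (ball h R) x * \<psi> x - indicator (ball 0 R) x * \<psi> x \<partial>lborel\<bar> / ?V"
    using V by simp
  have "\<bar>\<integral>x. indicator (ball h R) x * \<psi> x - indicator (ball 0 R) x * \<psi> x \<partial>lborel\<bar> \<le>
      (\<integral>x. \<bar>indicator (ball h R) x * \<psi> x - indicator (ball 0 R) x * \<psi> x\<bar> \<partial>lborel)"
    by (rule integral_abs_bound)
  \<comment> \<open>The integrand vanishes off the symmetric difference of the two balls. On that
    set the bracket is 1, and elsewhere it is nonnegative since the smaller ball lies in
    both.\<close>
  also have "\<dots> \<le> (\<integral>x. K * (indicator (ball h R) x + indicator (ball 0 R) x - 2 * indicator (ball 0 (R - r)) x) \<partial>lborel)"
  proof (rule integral_mono)
    show "integrable lborel (\<lambda>x. \<bar>indicator (ball h R) x * \<psi> x - indicator (ball 0 R) x * \<psi> x\<bar>)"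
      by (intro integrable_abs Bochner_Integration.integrable_diff int)
    show "integrable lborel (\<lambda>x. K * (indicator (ball h R) x + indicator (ball 0 R) x - 2 * indicator (ball 0 (R - r)) x))"
      by (intro integrable_mult_right Bochner_Integration.integrable_diff Bochner_Integration.integrable_add fin)
    fix x :: 'a
    have "x \<in> ball 0 R \<and> x \<in> ball h R" if "x \<in> ball 0 (R - r)"
    proof -
      have "0 \<le> r" using h norm_ge_zero[of h] by linarith
      then show ?thesis using that h R norm_triangle_ineq4[of h x] by (auto simp: dist_norm)
    qed
    then show "\<bar>indicator (ball h R) x * \<psi> x - indicator (ball 0 R) x * \<psi> x\<bar> \<le>
        K * (indicator (ball h R) x + indicator (ball 0 R) x - 2 * indicator (ball 0 (R - r)) x)"
      using K[of x] K0 by (cases "x \<in> ball 0 R"; cases "x \<in> ball h R"; cases "x \<in> ball 0 (R - r)")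
        (simp_all only: indicator_simps, auto)
  qed
  also have "\<dots> = K * (measure lborel (ball h R) + ?V - 2 * ?V')"
    using fin by simp
  also have "\<dots> = 2 * K * (?V - ?V')"
    by (simp add: measure_ball_eq[of h] algebra_simps)
  finally show ?thesis
    unfolding eq using V by (simp add: field_simps)
qed

text \<open>The Hardy-Littlewood inequality by Vitali covering. A point \<open>y\<close> of the
  exceptional set carries a ball with much mass of \<open>u\<close>; disjoint such balls, blown up
  five times, cover the set, which gives the constant 5^d. Radii up to \<open>N\<close> around
  centres in \<open>ball 0 L\<close> stay in \<open>ball 0 (L + N)\<close>.\<close>

lemma ball_maximal_bound:
  fixes u :: "'a::euclidean_space \<Rightarrow> ennreal" and N :: nat
  assumes [measurable]: "u \<in> borel_measurable borel"
  shows "ennreal t * emeasure lborel {y \<in> ball 0 L. \<exists>m\<in>{1..N}. ennreal t < (\<integral>\<^sup>+x. u (x + y) \<partial>ball_avg (real m))}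
    \<le> 5 ^ DIM('a) * (\<integral>\<^sup>+x. u x * indicator (ball 0 (L + N)) x \<partial>lborel)"
proof -
  define S where "S = {y \<in> ball (0::'a) L. \<exists>m\<in>{1..N}. ennreal t < (\<integral>\<^sup>+x. u (x + y) \<partial>ball_avg (real m))}"
  define \<nu> where "\<nu> = density lborel u"
  have \<nu>: "emeasure \<nu> A = (\<integral>\<^sup>+x. u x * indicator A x \<partial>lborel)" if "A \<in> sets borel" for A
    unfolding \<nu>_def using that by (simp add: emeasure_density)
  define m where "m y = (SOME m. m \<in> {1..N} \<and> ennreal t < (\<integral>\<^sup>+x. u (x + y) \<partial>ball_avg (real m)))" for y
  have m: "m y \<in> {1..N} \<and> ennreal t < (\<integral>\<^sup>+x. u (x + y) \<partial>ball_avg (real (m y)))" if "y \<in> S" for y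
  proof -
    have "\<exists>m. m \<in> {1..N} \<and> ennreal t < (\<integral>\<^sup>+x. u (x + y) \<partial>ball_avg (real m))"
      using that unfolding S_def by blast
    then show ?thesis unfolding m_def by (rule someI_ex)
  qed
  have mass: "ennreal t * emeasure lborel (ball y (5 * real (m y))) \<le> 5 ^ DIM('a) * emeasure \<nu> (ball y (m y))" if "y \<in> S" for y
  proof -
    have m1: "real (m y) > 0" using m[OF that] by auto
    let ?V = "measure lborel (ball (0::'a) (m y))"
    have V: "?V > 0" using m1 by simp
    have "ennreal t < emeasure \<nu> (ball y (m y)) / ?V"
      using m[OF that] by (simp add: nn_integral_ball_avg_shift \<nu>)
    then have "ennreal t * ?V \<le> emeasure \<nu> (ball y (m y)) / ?V * ?V"
      by (rule mult_right_mono[OF less_imp_le]) simp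
    also have "\<dots> = emeasure \<nu> (ball y (m y))"
      by (rule ennreal_divide_mult_cancel[OF V])
    finally have "5 ^ DIM('a) * (ennreal t * ?V) \<le> 5 ^ DIM('a) * emeasure \<nu> (ball y (m y))"
      by (rule mult_left_mono) simp
    moreover have "emeasure lborel (ball y (5 * real (m y))) = 5 ^ DIM('a) * ennreal ?V"
      using m1 measure_ball_scale[of "real (m y)" 5, where 'a = 'a]
      by (simp add: emeasure_ball_eq ennreal_mult ennreal_power[symmetric])
    ultimately show ?thesis by (simp add: ac_simps)
  qed
  have r: "0 < real (m y) \<and> real (m y) \<le> real N" if "y \<in> S" for y
    using m[OF that] by auto
  have sub: "S \<subseteq> (\<Union>y\<in>S. ball y (real (m y)))"
  proof
    fix y assume "y \<in> S"
    then show "y \<in> (\<Union>y\<in>S. ball y (real (m y)))" using r[of y] by (intro UN_I[of y]) auto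
  qed
  \<comment> \<open>Vitali needs bounded radii; this is where the restriction m \<le>
    \<open>N\<close> enters.\<close>
  obtain C where C: "countable C" "C \<subseteq> S"
    and disj: "pairwise (\<lambda>i j. disjnt (ball i (real (m i))) (ball j (real (m j)))) C"
    and cov: "S \<subseteq> (\<Union>i\<in>C. ball i (5 * real (m i)))"
    by (rule Vitali_covering_lemma_balls[OF sub r]) (blast intro: that)+
  let ?B = "\<nu> (ball 0 (L + N))"
  \<comment> \<open>Finite subfamilies suffice: disjointness adds up their masses, and the countable
    cover is the increasing union of its finite parts.\<close>
  have fin: "ennreal t * emeasure lborel (\<Union>y\<in>D. ball y (5 * real (m y))) \<le> 5 ^ DIM('a) * ?B"
    if D: "finite D" "D \<subseteq> C" for D
  proof -
    have "emeasure lborel (\<Union>y\<in>D. ball y (5 * real (m y))) \<le> (\<Sum>y\<in>D. emeasure lborel (ball y (5 * real (m y))))"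
      by (rule emeasure_subadditive_finite) (use D in auto)
    then have "ennreal t * emeasure lborel (\<Union>y\<in>D. ball y (5 * real (m y))) \<le>
        (\<Sum>y\<in>D. ennreal t * emeasure lborel (ball y (5 * real (m y))))"
      unfolding sum_distrib_left[symmetric] by (rule mult_left_mono) simp
    also have "\<dots> \<le> (\<Sum>y\<in>D. 5 ^ DIM('a) * emeasure \<nu> (ball y (m y)))"
      by (rule sum_mono, rule mass) (use D C in auto)
    also have "\<dots> = 5 ^ DIM('a) * (\<Sum>y\<in>D. emeasure \<nu> (ball y (m y)))"
      by (simp add: sum_distrib_left)
    also have "(\<Sum>y\<in>D. emeasure \<nu> (ball y (m y))) = emeasure \<nu> (\<Union>y\<in>D. ball y (m y))"
    proof (rule sum_emeasure)
      show "disjoint_family_on (\<lambda>y. ball y (real (m y))) D"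
        using disj D(2) unfolding disjoint_family_on_def pairwise_def disjnt_def by blast
      show "(\<lambda>y. ball y (real (m y))) ` D \<subseteq> sets \<nu>" by (auto simp: \<nu>_def)
    qed (fact D(1))
    also have "\<dots> \<le> ?B"
    proof (rule emeasure_mono)
      show "(\<Union>y\<in>D. ball y (m y)) \<subseteq> ball 0 (L + N)"
      proof
        fix x assume "x \<in> (\<Union>y\<in>D. ball y (m y))"
        then obtain y where y: "y \<in> D" "dist y x < m y" by auto
        then have "y \<in> S" using D C by auto
        then have "norm y < L" "real (m y) \<le> N" using r unfolding S_def by auto
        then show "x \<in> ball 0 (L + N)"
          using y norm_triangle_ineq4[of y "y - x"] by (simp add: dist_norm)
      qed
    qed (simp add: \<nu>_def)
    finally show ?thesis by (simp add: mult_left_mono)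
  qed
  have "ennreal t * emeasure lborel S \<le> 5 ^ DIM('a) * ?B"
  proof (cases "C = {}")
    case True
    then show ?thesis using cov by simp
  next
    case False
    let ?U = "\<lambda>k. \<Union>y\<in>from_nat_into C ` {..<k}. ball y (5 * real (m y))"
    have "(\<Union>k. ?U k) = (\<Union>i\<in>C. ball i (5 * real (m i)))"
    proof -
      have *: "C = (\<Union>k. from_nat_into C ` {..<k})"
        using range_from_nat_into[OF False C(1)] by (auto simp: image_iff)
      have "(\<Union>k. ?U k) = (\<Union>i\<in>(\<Union>k. from_nat_into C ` {..<k}). ball i (5 * real (m i)))" by blast
      then show ?thesis unfolding *[symmetric] .
    qed
    have "emeasure lborel S \<le> emeasure lborel (\<Union>k. ?U k)"
    proof (rule emeasure_mono)
      show "S \<subseteq> (\<Union>k. ?U k)" using cov \<open>(\<Union>k. ?U k) = _\<close> by simp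
      have "open (\<Union>k. ?U k)" by blast
      then show "(\<Union>k. ?U k) \<in> sets lborel" by simp
    qed
    also have "\<dots> = (SUP k. emeasure lborel (?U k))"
    proof (rule SUP_emeasure_incseq[symmetric])
      show "incseq ?U" unfolding incseq_def by (intro allI impI UN_mono image_mono) auto
    qed auto
    finally have "ennreal t * emeasure lborel S \<le> (SUP k. ennreal t * emeasure lborel (?U k))"
      by (subst SUP_mult_left_ennreal[symmetric]) (rule mult_left_mono, simp_all)
    also have "\<dots> \<le> 5 ^ DIM('a) * ?B"
      by (rule SUP_least, rule fin) (use from_nat_into[OF False] in auto)
    finally show ?thesis .
  qed
  then show ?thesis unfolding S_def by (simp add: \<nu>)
qed

section \<open>The ergodic theorem of Wiener\<close>

text \<open>The exceptional points lie in every member of a sequence of measurable sets with measure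
  at most 1 / (k + 1), hence in their intersection, a null set. This form fits maximal inequalities,
  which produce a small bad set for every \<delta>.\<close>

lemma (in prob_space) AE_from_small_sets:
  assumes "\<And>\<delta>::real. \<delta> > 0 \<Longrightarrow> \<exists>E\<in>sets M. emeasure M E \<le> ennreal \<delta> \<and> (\<forall>w\<in>space M - E. P w)"
  shows "AE w in M. P w"
proof -
  have "\<exists>E. E \<in> sets M \<and> emeasure M E \<le> ennreal (1 / Suc k) \<and> (\<forall>w\<in>space M - E. P w)" for k
    using assms[of "1 / Suc k"] by auto
  then obtain E where E: "\<And>k. E k \<in> sets M" "\<And>k. emeasure M (E k) \<le> ennreal (1 / Suc k)"
    "\<And>k w. w \<in> space M - E k \<Longrightarrow> P w"
    by metis
  have "emeasure M (\<Inter>k. E k) \<le> ennreal \<delta>" if \<delta>: "\<delta> > 0" for \<delta>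
  proof -
    obtain k where "inverse (real (Suc k)) < \<delta>" using reals_Archimedean[OF \<delta>] by blast
    have "emeasure M (\<Inter>k. E k) \<le> emeasure M (E k)" by (rule emeasure_mono) (use E in auto)
    also have "\<dots> \<le> ennreal (1 / Suc k)" by (rule E)
    also have "\<dots> \<le> ennreal \<delta>" using \<open>inverse (real (Suc k)) < \<delta>\<close>
      by (intro ennreal_leI) (simp add: inverse_eq_divide)
    finally show ?thesis .
  qed
  then have "emeasure M (\<Inter>k. E k) = 0"
    by (metis ennreal_0 ennreal_le_epsilon add.left_neutral le_zero_eq top_greatest)
  then have "(\<Inter>k. E k) \<in> null_sets M" using E by auto
  then show ?thesis by (rule AE_I') (use E in auto)
qed

text \<open>A measure-preserving action of the translation group. Joint measurability in
  \<open>T_pair\<close> is what Fubini between a ball and the probability space requires.\<close>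

locale ball_flow = prob_space \<mu> for \<mu> :: "'b measure" +
  fixes T :: "'a::euclidean_space \<Rightarrow> 'b \<Rightarrow> 'b"
  assumes T_pair: "(\<lambda>p. T (fst p) (snd p)) \<in> borel \<Otimes>\<^sub>M \<mu> \<rightarrow>\<^sub>M \<mu>"
    and T_add: "\<And>x y w. w \<in> space \<mu> \<Longrightarrow> T x (T y w) = T (x + y) w"
    and T_distr: "\<And>x. distr \<mu> \<mu> (T x) = \<mu>"
begin

lemma T_measurable [measurable (raw)]:
  assumes "f \<in> N \<rightarrow>\<^sub>M borel" "g \<in> N \<rightarrow>\<^sub>M \<mu>"
  shows "(\<lambda>x. T (f x) (g x)) \<in> N \<rightarrow>\<^sub>M \<mu>"
  using measurable_compose[OF measurable_Pair[OF assms] T_pair] by simp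

lemma T_space: "w \<in> space \<mu> \<Longrightarrow> T x w \<in> space \<mu>"
  using measurable_space[of "T x" \<mu> \<mu> w] by measurable

definition flow_avg :: "real \<Rightarrow> ('b \<Rightarrow> real) \<Rightarrow> 'b \<Rightarrow> real" where
  "flow_avg R g w = (\<integral>x. g (T x w) \<partial>ball_avg R)"

definition bounded_meas :: "real \<Rightarrow> ('b \<Rightarrow> real) \<Rightarrow> bool" where
  "bounded_meas K g \<longleftrightarrow> g \<in> borel_measurable \<mu> \<and> (\<forall>w\<in>space \<mu>. \<bar>g w\<bar> \<le> K)"

lemma bounded_measD [dest]:
  assumes "bounded_meas K g"
  shows "g \<in> borel_measurable \<mu>" "\<And>w. w \<in> space \<mu> \<Longrightarrow> \<bar>g w\<bar> \<le> K"
  using assms unfolding bounded_meas_def by auto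

lemma bounded_meas_integrable: "bounded_meas K g \<Longrightarrow> integrable \<mu> g"
  by (rule integrable_const_bound[where B = K]) (auto simp: bounded_meas_def)

lemma flow_integrable:
  assumes g: "bounded_meas K g" and R: "R > 0" and w: "w \<in> space \<mu>"
  shows "integrable (ball_avg R) (\<lambda>x. g (T x w))"
proof -
  interpret B: prob_space "ball_avg R :: 'a measure" by (rule prob_space_ball_avg[OF R])
  have [measurable]: "g \<in> borel_measurable \<mu>" using g by blast
  show ?thesis
    by (rule B.integrable_const_bound[where B = K]) (use g w T_space in \<open>auto simp: bounded_meas_def\<close>)
qed

lemma flow_avg_bounded_meas:
  assumes g: "bounded_meas K g" and R: "R > 0"
  shows "bounded_meas K (flow_avg R g)"
proof -
  interpret B: prob_space "ball_avg R :: 'a measure" by (rule prob_space_ball_avg[OF R])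
  have [measurable]: "g \<in> borel_measurable \<mu>" using g by blast
  have "flow_avg R g \<in> borel_measurable \<mu>" unfolding flow_avg_def by measurable
  moreover have "\<bar>flow_avg R g w\<bar> \<le> K" if w: "w \<in> space \<mu>" for w
  proof -
    have "\<bar>flow_avg R g w\<bar> \<le> (\<integral>x. \<bar>g (T x w)\<bar> \<partial>ball_avg R)"
      unfolding flow_avg_def by (rule integral_abs_bound)
    also have "\<dots> \<le> (\<integral>x. K \<partial>(ball_avg R :: 'a measure))"
      by (rule integral_mono) (use flow_integrable[OF g R w] g w T_space in \<open>auto simp: bounded_meas_def\<close>)
    finally show ?thesis using B.prob_space by simp
  qed
  ultimately show ?thesis unfolding bounded_meas_def by blast
qed

section \<open>Integrals under the flow and under its ball averages\<close>

lemma integral_T: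
  assumes "g \<in> borel_measurable \<mu>"
  shows "(\<integral>w. g (T x w) \<partial>\<mu>) = (\<integral>w. g w \<partial>\<mu> :: real)"
proof -
  have "(\<integral>w. g w \<partial>distr \<mu> \<mu> (T x)) = (\<integral>w. g (T x w) \<partial>\<mu>)"
    by (rule integral_distr) (use assms in measurable)
  then show ?thesis by (simp add: T_distr)
qed

lemma nn_integral_T:
  assumes "g \<in> borel_measurable \<mu>"
  shows "(\<integral>\<^sup>+w. g (T x w) \<partial>\<mu>) = (\<integral>\<^sup>+w. g w \<partial>\<mu>)"
proof -
  have "(\<integral>\<^sup>+w. g w \<partial>distr \<mu> \<mu> (T x)) = (\<integral>\<^sup>+w. g (T x w) \<partial>\<mu>)"
    by (rule nn_integral_distr) (use assms in measurable)
  then show ?thesis by (simp add: T_distr)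
qed

lemma nn_integral_flow:
  assumes [measurable]: "h \<in> borel_measurable \<mu>" and R: "R > 0"
  shows "(\<integral>\<^sup>+w. (\<integral>\<^sup>+x. h (T x w) \<partial>ball_avg R) \<partial>\<mu>) = (\<integral>\<^sup>+w. h w \<partial>\<mu>)"
proof -
  interpret B: prob_space "ball_avg R :: 'a measure" by (rule prob_space_ball_avg[OF R])
  interpret P: pair_sigma_finite \<mu> "ball_avg R :: 'a measure" ..
  have "(\<integral>\<^sup>+w. (\<integral>\<^sup>+x. h (T x w) \<partial>ball_avg R) \<partial>\<mu>) = (\<integral>\<^sup>+x. (\<integral>\<^sup>+w. h (T x w) \<partial>\<mu>) \<partial>ball_avg R)"
    by (rule P.Fubini'[symmetric]) measurable
  also have "\<dots> = (\<integral>\<^sup>+w. h w \<partial>\<mu>)"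
    by (simp add: nn_integral_T B.emeasure_space_1[simplified])
  finally show ?thesis .
qed

lemma integral_flow_avg:
  assumes g: "bounded_meas K g" and R: "R > 0"
  shows "(\<integral>w. flow_avg R g w \<partial>\<mu>) = (\<integral>w. g w \<partial>\<mu>)"
proof -
  interpret B: prob_space "ball_avg R :: 'a measure" by (rule prob_space_ball_avg[OF R])
  interpret P: pair_prob_space \<mu> "ball_avg R :: 'a measure" ..
  have [measurable]: "g \<in> borel_measurable \<mu>" using g by blast
  have "(\<integral>w. flow_avg R g w \<partial>\<mu>) = (\<integral>x. (\<integral>w. g (T x w) \<partial>\<mu>) \<partial>ball_avg R)"
    unfolding flow_avg_def
  proof (rule P.Fubini_integral[symmetric])
    show "integrable (\<mu> \<Otimes>\<^sub>M ball_avg R) (\<lambda>(w, x). g (T x w))"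
      by (rule P.P.integrable_const_bound[where B = K])
         (use g T_space in \<open>auto simp: bounded_meas_def space_pair_measure\<close>)
  qed
  then show ?thesis by (simp add: integral_T B.prob_space[simplified])
qed

text \<open>Averaging contracts the L1 norm, uniformly in \<open>R\<close>. This makes mean
  ergodicity stable under L1 approximation.\<close>

lemma flow_avg_L1_le:
  assumes g: "bounded_meas K g" and R: "R > 0"
  shows "(\<integral>w. \<bar>flow_avg R g w\<bar> \<partial>\<mu>) \<le> (\<integral>w. \<bar>g w\<bar> \<partial>\<mu>)"
proof -
  have abs: "bounded_meas K (\<lambda>w. \<bar>g w\<bar>)" using g unfolding bounded_meas_def by auto
  have "(\<integral>w. \<bar>flow_avg R g w\<bar> \<partial>\<mu>) \<le> (\<integral>w. flow_avg R (\<lambda>w. \<bar>g w\<bar>) w \<partial>\<mu>)"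
  proof (rule integral_mono)
    show "integrable \<mu> (\<lambda>w. \<bar>flow_avg R g w\<bar>)"
      using bounded_meas_integrable[OF flow_avg_bounded_meas[OF g R]] by simp
    show "integrable \<mu> (flow_avg R (\<lambda>w. \<bar>g w\<bar>))"
      by (rule bounded_meas_integrable[OF flow_avg_bounded_meas[OF abs R]])
    show "\<bar>flow_avg R g w\<bar> \<le> flow_avg R (\<lambda>w. \<bar>g w\<bar>) w" for w
      unfolding flow_avg_def by (rule integral_abs_bound)
  qed
  also have "\<dots> = (\<integral>w. \<bar>g w\<bar> \<partial>\<mu>)" by (rule integral_flow_avg[OF abs R])
  finally show ?thesis .
qed

lemma flow_avg_diff:
  assumes "bounded_meas K g" "bounded_meas L h" "R > 0" "w \<in> space \<mu>"
  shows "flow_avg R (\<lambda>w. g w - h w) w = flow_avg R g w - flow_avg R h w"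
  unfolding flow_avg_def using assms by (simp add: flow_integrable)

text \<open>Convergence in L1 of the averages to the space mean. Ergodicity of the flow takes the
  form that every bounded measurable function has this property; boundedness is built in so that all
  integrals exist.\<close>

definition mean_ergodic :: "('b \<Rightarrow> real) \<Rightarrow> bool" where
  "mean_ergodic g \<longleftrightarrow> (\<exists>K. bounded_meas K g) \<and>
     ((\<lambda>R. \<integral>w. \<bar>flow_avg R g w - (\<integral>w. g w \<partial>\<mu>)\<bar> \<partial>\<mu>) \<longlongrightarrow> 0) at_top"

text \<open>The error for \<open>v\<close> splits into the average of \<open>v - u\<close>, the
  error for \<open>u\<close>, and the difference of the means. The outer two are at most \<epsilon>
  / 4 each by L1 contraction, the middle one is below \<epsilon> / 2 for large R.\<close>

lemma mean_ergodic_approx: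
  assumes v: "bounded_meas K v"
    and approx: "\<And>\<epsilon>. \<epsilon> > 0 \<Longrightarrow> \<exists>u. mean_ergodic u \<and> (\<integral>w. \<bar>v w - u w\<bar> \<partial>\<mu>) \<le> \<epsilon>"
  shows "mean_ergodic v"
proof -
  have "\<forall>\<^sub>F R in at_top. dist (\<integral>w. \<bar>flow_avg R v w - (\<integral>w. v w \<partial>\<mu>)\<bar> \<partial>\<mu>) 0 < \<epsilon>" if "\<epsilon> > 0" for \<epsilon>
  proof -
    have "\<epsilon> / 4 > 0" using that by simp
    from approx[OF this] obtain u where u: "mean_ergodic u"
      and uv: "(\<integral>w. \<bar>v w - u w\<bar> \<partial>\<mu>) \<le> \<epsilon> / 4" by blast
    obtain L where L: "bounded_meas L u" using u unfolding mean_ergodic_def by blast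
    have "\<forall>\<^sub>F R in at_top. dist (\<integral>w. \<bar>flow_avg R u w - (\<integral>w. u w \<partial>\<mu>)\<bar> \<partial>\<mu>) 0 < \<epsilon> / 2"
      using u that unfolding mean_ergodic_def by (intro tendstoD) auto
    then show ?thesis using eventually_gt_at_top[of 0]
    proof eventually_elim
      case (elim R)
      have d: "bounded_meas (K + L) (\<lambda>w. v w - u w)"
        using v L unfolding bounded_meas_def by (auto intro!: order_trans[OF abs_triangle_ineq4] add_mono)
      have int: "integrable \<mu> u" "integrable \<mu> v" "integrable \<mu> (flow_avg R u)" "integrable \<mu> (flow_avg R v)"
          "integrable \<mu> (flow_avg R (\<lambda>w. v w - u w))"
        using bounded_meas_integrable flow_avg_bounded_meas elim v L d by blast+
      have "(\<integral>w. \<bar>flow_avg R v w - (\<integral>w. v w \<partial>\<mu>)\<bar> \<partial>\<mu>) \<le>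
          (\<integral>w. \<bar>flow_avg R (\<lambda>w. v w - u w) w\<bar> + \<bar>flow_avg R u w - (\<integral>w. u w \<partial>\<mu>)\<bar> + \<bar>(\<integral>w. u w \<partial>\<mu>) - (\<integral>w. v w \<partial>\<mu>)\<bar> \<partial>\<mu>)"
        using int by (intro integral_mono) (auto simp: flow_avg_diff[OF v L \<open>0 < R\<close>])
      also have "\<dots> = (\<integral>w. \<bar>flow_avg R (\<lambda>w. v w - u w) w\<bar> \<partial>\<mu>) + (\<integral>w. \<bar>flow_avg R u w - (\<integral>w. u w \<partial>\<mu>)\<bar> \<partial>\<mu>)
          + \<bar>(\<integral>w. u w \<partial>\<mu>) - (\<integral>w. v w \<partial>\<mu>)\<bar>"
        using int by (simp add: prob_space)
      also have "\<bar>(\<integral>w. u w \<partial>\<mu>) - (\<integral>w. v w \<partial>\<mu>)\<bar> \<le> (\<integral>w. \<bar>v w - u w\<bar> \<partial>\<mu>)"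
        using int integral_abs_bound[of \<mu> "\<lambda>w. v w - u w"] by (simp add: abs_minus_commute)
      also have "(\<integral>w. \<bar>flow_avg R (\<lambda>w. v w - u w) w\<bar> \<partial>\<mu>) \<le> (\<integral>w. \<bar>v w - u w\<bar> \<partial>\<mu>)"
        by (rule flow_avg_L1_le[OF d]) (use elim in simp)
      finally have "(\<integral>w. \<bar>flow_avg R v w - (\<integral>w. v w \<partial>\<mu>)\<bar> \<partial>\<mu>) < \<epsilon>"
        using elim uv by (auto simp: dist_real_def)
      then show ?case by (simp add: dist_real_def)
    qed
  qed
  then show ?thesis unfolding mean_ergodic_def using v by (auto intro: tendstoI)
qed

lemma mean_ergodic_lim:
  assumes u: "\<And>k::nat. mean_ergodic (u k)"
    and K: "\<And>k w. w \<in> space \<mu> \<Longrightarrow> \<bar>u k w\<bar> \<le> K"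
    and lim: "\<And>w. w \<in> space \<mu> \<Longrightarrow> (\<lambda>k. u k w) \<longlonglongrightarrow> v w"
  shows "mean_ergodic v"
proof -
  have [measurable]: "u k \<in> borel_measurable \<mu>" for k using u unfolding mean_ergodic_def by blast
  have [measurable]: "v \<in> borel_measurable \<mu>" by (rule borel_measurable_LIMSEQ_real[OF lim]) auto
  have Kv: "\<bar>v w\<bar> \<le> K" if "w \<in> space \<mu>" for w
    by (rule LIMSEQ_le_const2[OF tendsto_rabs[OF lim[OF that]]]) (use K[OF that] in auto)
  show ?thesis
  proof (rule mean_ergodic_approx)
    show "bounded_meas K v" unfolding bounded_meas_def using Kv by auto
    fix \<epsilon> :: real assume "\<epsilon> > 0"
    have "(\<lambda>k. \<integral>w. \<bar>v w - u k w\<bar> \<partial>\<mu>) \<longlonglongrightarrow> (\<integral>w. \<bar>v w - v w\<bar> \<partial>\<mu>)"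
    proof (rule integral_dominated_convergence[where w = "\<lambda>_. K + K"])
      show "AE w in \<mu>. (\<lambda>k. \<bar>v w - u k w\<bar>) \<longlonglongrightarrow> \<bar>v w - v w\<bar>"
        by (intro AE_I2 tendsto_intros lim)
      show "AE w in \<mu>. norm \<bar>v w - u k w\<bar> \<le> K + K" for k
      proof (rule AE_I2)
        fix w assume "w \<in> space \<mu>"
        then show "norm \<bar>v w - u k w\<bar> \<le> K + K" using K[of w k] Kv[of w] by simp
      qed
    qed auto
    then have "\<forall>\<^sub>F k in sequentially. (\<integral>w. \<bar>v w - u k w\<bar> \<partial>\<mu>) < \<epsilon>"
      using \<open>\<epsilon> > 0\<close> by (intro order_tendstoD) auto
    then obtain k where "(\<integral>w. \<bar>v w - u k w\<bar> \<partial>\<mu>) < \<epsilon>"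
      unfolding eventually_sequentially by blast
    then show "\<exists>u. mean_ergodic u \<and> (\<integral>w. \<bar>v w - u w\<bar> \<partial>\<mu>) \<le> \<epsilon>"
      using u[of k] by (intro exI[of _ "u k"]) simp
  qed
qed

lemma mean_ergodic_add:
  assumes u: "mean_ergodic u" and v: "mean_ergodic v"
  shows "mean_ergodic (\<lambda>w. u w + v w)"
proof -
  obtain K L where K: "bounded_meas K u" and L: "bounded_meas L v"
    using u v unfolding mean_ergodic_def by blast
  have b: "bounded_meas (K + L) (\<lambda>w. u w + v w)"
    using K L unfolding bounded_meas_def by (auto intro!: order_trans[OF abs_triangle_ineq] add_mono)
  have "((\<lambda>R. (\<integral>w. \<bar>flow_avg R u w - (\<integral>w. u w \<partial>\<mu>)\<bar> \<partial>\<mu>) + (\<integral>w. \<bar>flow_avg R v w - (\<integral>w. v w \<partial>\<mu>)\<bar> \<partial>\<mu>)) \<longlongrightarrow> 0 + 0) at_top"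
    using u v unfolding mean_ergodic_def by (intro tendsto_add) auto
  then have lim: "((\<lambda>R. (\<integral>w. \<bar>flow_avg R u w - (\<integral>w. u w \<partial>\<mu>)\<bar> \<partial>\<mu>) + (\<integral>w. \<bar>flow_avg R v w - (\<integral>w. v w \<partial>\<mu>)\<bar> \<partial>\<mu>)) \<longlongrightarrow> 0) at_top"
    by simp
  have "((\<lambda>R. \<integral>w. \<bar>flow_avg R (\<lambda>w. u w + v w) w - (\<integral>w. u w + v w \<partial>\<mu>)\<bar> \<partial>\<mu>) \<longlongrightarrow> 0) at_top"
  proof (rule Lim_null_comparison[OF _ lim])
    show "\<forall>\<^sub>F R in at_top. norm (\<integral>w. \<bar>flow_avg R (\<lambda>w. u w + v w) w - (\<integral>w. u w + v w \<partial>\<mu>)\<bar> \<partial>\<mu>)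
       \<le> (\<integral>w. \<bar>flow_avg R u w - (\<integral>w. u w \<partial>\<mu>)\<bar> \<partial>\<mu>) + (\<integral>w. \<bar>flow_avg R v w - (\<integral>w. v w \<partial>\<mu>)\<bar> \<partial>\<mu>)"
      using eventually_gt_at_top[of 0]
    proof eventually_elim
      case (elim R)
      have int: "integrable \<mu> u" "integrable \<mu> v" "integrable \<mu> (flow_avg R u)" "integrable \<mu> (flow_avg R v)"
          "integrable \<mu> (flow_avg R (\<lambda>w. u w + v w))"
        using bounded_meas_integrable flow_avg_bounded_meas elim K L b by blast+
      have "(\<integral>w. \<bar>flow_avg R (\<lambda>w. u w + v w) w - (\<integral>w. u w + v w \<partial>\<mu>)\<bar> \<partial>\<mu>) \<le>
        (\<integral>w. \<bar>flow_avg R u w - (\<integral>w. u w \<partial>\<mu>)\<bar> + \<bar>flow_avg R v w - (\<integral>w. v w \<partial>\<mu>)\<bar> \<partial>\<mu>)"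
      proof (rule integral_mono)
        fix w assume w: "w \<in> space \<mu>"
        have "flow_avg R (\<lambda>w. u w + v w) w = flow_avg R u w + flow_avg R v w"
          unfolding flow_avg_def using flow_integrable[OF K elim w] flow_integrable[OF L elim w] by simp
        then show "\<bar>flow_avg R (\<lambda>w. u w + v w) w - (\<integral>w. u w + v w \<partial>\<mu>)\<bar> \<le>
            \<bar>flow_avg R u w - (\<integral>w. u w \<partial>\<mu>)\<bar> + \<bar>flow_avg R v w - (\<integral>w. v w \<partial>\<mu>)\<bar>"
          using int by simp
      qed (use int in auto)
      then show ?case using int by simp
    qed
  qed
  then show ?thesis unfolding mean_ergodic_def using b by blast
qed

lemma mean_ergodic_scale:
  assumes u: "mean_ergodic u" shows "mean_ergodic (\<lambda>w. a * u w)"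
proof -
  obtain K where K: "bounded_meas K u" using u unfolding mean_ergodic_def by blast
  have "bounded_meas (\<bar>a\<bar> * K) (\<lambda>w. a * u w)"
    using K unfolding bounded_meas_def by (auto simp: abs_mult intro!: mult_left_mono)
  moreover have "((\<lambda>R. \<bar>a\<bar> * (\<integral>w. \<bar>flow_avg R u w - (\<integral>w. u w \<partial>\<mu>)\<bar> \<partial>\<mu>)) \<longlongrightarrow> 0) at_top"
    using u unfolding mean_ergodic_def by (intro tendsto_mult_right_zero) auto
  moreover have "(\<integral>w. \<bar>flow_avg R (\<lambda>w. a * u w) w - (\<integral>w. a * u w \<partial>\<mu>)\<bar> \<partial>\<mu>) =
      \<bar>a\<bar> * (\<integral>w. \<bar>flow_avg R u w - (\<integral>w. u w \<partial>\<mu>)\<bar> \<partial>\<mu>)" for R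
    unfolding flow_avg_def integral_mult_right_zero right_diff_distrib[symmetric] abs_mult ..
  ultimately show ?thesis unfolding mean_ergodic_def by auto
qed

text \<open>Transference: the inequality on Euclidean space is applied to the orbit functions x
  \<mapsto> h (T x w) and integrated over \<open>w\<close>. Invariance turns both sides into
  multiples of ball volumes, whose ratio tends to 1 as the window grows.\<close>

lemma maximal_bound:
  assumes [measurable]: "h \<in> borel_measurable \<mu>" and t: "t > 0"
  shows "ennreal t * emeasure \<mu> {w\<in>space \<mu>. \<exists>m::nat\<ge>1. ennreal t < (\<integral>\<^sup>+x. h (T x w) \<partial>ball_avg m)}
     \<le> 5 ^ DIM('a) * (\<integral>\<^sup>+w. h w \<partial>\<mu>)"
proof -
  define E where "E N = {w\<in>space \<mu>. \<exists>m\<in>{1..N}. ennreal t < (\<integral>\<^sup>+x. h (T x w) \<partial>ball_avg (real m))}" for N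
  have ball_meas [measurable]: "(\<lambda>w. \<integral>\<^sup>+x. h (T x w) \<partial>ball_avg (real m)) \<in> borel_measurable \<mu>" if "m \<ge> 1" for m
  proof -
    interpret B: prob_space "ball_avg (real m) :: 'a measure" by (rule prob_space_ball_avg) (use that in simp)
    show ?thesis by measurable
  qed
  have E_sets [measurable]: "E N \<in> sets \<mu>" for N
  proof -
    have "E N = (\<Union>m\<in>{1..N}. {w\<in>space \<mu>. ennreal t < (\<integral>\<^sup>+x. h (T x w) \<partial>ball_avg (real m))})"
      unfolding E_def by auto
    also have "\<dots> \<in> sets \<mu>"
      by (intro sets.finite_UN borel_measurable_less borel_measurable_const ball_meas) auto
    finally show ?thesis .
  qed
  let ?I = "\<integral>\<^sup>+w. h w \<partial>\<mu>"
  have main: "ennreal t * emeasure \<mu> (E N) \<le> 5 ^ DIM('a) * ?I" for N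
  proof -
    \<comment> \<open>Integrating the indicator of \<open>E N\<close> at \<open>T y w\<close> over y
      in \<open>ball 0 L\<close>: for fixed \<open>w\<close> the admissible \<open>y\<close> form
      the exceptional set of \<open>ball_maximal_bound\<close>.\<close>
    have bound: "ennreal t * emeasure \<mu> (E N) * ennreal (measure lborel (ball (0::'a) L)) \<le>
        5 ^ DIM('a) * ?I * ennreal (measure lborel (ball (0::'a) (L + N)))" for L
    proof -
      interpret P: pair_sigma_finite \<mu> "lborel :: 'a measure" ..
      have [measurable]: "(\<lambda>p. indicator (ball (0::'a) s) (snd p) :: ennreal) \<in> borel_measurable (\<mu> \<Otimes>\<^sub>M lborel)" for s
        by (rule measurable_compose[OF measurable_snd borel_measurable_indicator]) simp
      have [measurable]: "(\<lambda>p. indicator (E N) (T (snd p) (fst p)) :: ennreal) \<in> borel_measurable (\<mu> \<Otimes>\<^sub>M lborel)"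
        by (rule measurable_compose[OF T_measurable borel_measurable_indicator[OF E_sets]]) measurable
      have E_T: "T y w \<in> E N \<longleftrightarrow> (\<exists>m\<in>{1..N}. ennreal t < (\<integral>\<^sup>+x. h (T (x + y) w) \<partial>ball_avg (real m)))"
        if "w \<in> space \<mu>" for w y
        unfolding E_def using that by (simp add: T_space T_add)
      have "ennreal t * emeasure \<mu> (E N) * emeasure lborel (ball (0::'a) L) =
          (\<integral>\<^sup>+y. indicator (ball (0::'a) L) y * (ennreal t * (\<integral>\<^sup>+w. indicator (E N) w \<partial>\<mu>)) \<partial>lborel)"
        by (subst nn_integral_multc) (auto simp: mult.commute intro!: borel_measurable_indicator)
      also have "\<dots> = (\<integral>\<^sup>+y. indicator (ball (0::'a) L) y * (ennreal t * (\<integral>\<^sup>+w. indicator (E N) (T y w) \<partial>\<mu>)) \<partial>lborel)"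
        by (subst nn_integral_T) auto
      also have "\<dots> = (\<integral>\<^sup>+y. (\<integral>\<^sup>+w. ennreal t * (indicator (ball (0::'a) L) y * indicator (E N) (T y w)) \<partial>\<mu>) \<partial>lborel)"
      proof (rule nn_integral_cong)
        fix y :: 'a
        have [measurable]: "(\<lambda>w. indicator (E N) (T y w) :: ennreal) \<in> borel_measurable \<mu>" by measurable
        show "indicator (ball (0::'a) L) y * (ennreal t * (\<integral>\<^sup>+w. indicator (E N) (T y w) \<partial>\<mu>)) =
            (\<integral>\<^sup>+w. ennreal t * (indicator (ball (0::'a) L) y * indicator (E N) (T y w)) \<partial>\<mu>)"
          by (simp add: nn_integral_cmult ac_simps)
      qed
      also have "\<dots> = (\<integral>\<^sup>+w. (\<integral>\<^sup>+y. ennreal t * (indicator (ball (0::'a) L) y * indicator (E N) (T y w)) \<partial>lborel) \<partial>\<mu>)"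
        by (rule P.Fubini') (simp add: case_prod_beta', measurable)
      also have "\<dots> \<le> (\<integral>\<^sup>+w. 5 ^ DIM('a) * (\<integral>\<^sup>+x. h (T x w) * indicator (ball (0::'a) (L + N)) x \<partial>lborel) \<partial>\<mu>)"
      proof (rule nn_integral_mono)
        fix w assume w: "w \<in> space \<mu>"
        then have [measurable]: "(\<lambda>x. h (T x w)) \<in> borel_measurable borel" by measurable
        let ?S = "{y \<in> ball 0 L. \<exists>m\<in>{1..N}. ennreal t < (\<integral>\<^sup>+x. h (T (x + y) w) \<partial>ball_avg (real m))}"
        have eq: "?S = ball 0 L \<inter> {y \<in> space borel. T y w \<in> E N}" using E_T[OF w] by auto
        have "{y \<in> space borel. T y w \<in> E N} \<in> sets borel" using w by measurable
        then have S: "?S \<in> sets lborel" unfolding eq by auto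
        have "(\<integral>\<^sup>+y. ennreal t * (indicator (ball (0::'a) L) y * indicator (E N) (T y w)) \<partial>lborel) =
            (\<integral>\<^sup>+y. ennreal t * indicator ?S y \<partial>lborel)"
          by (intro nn_integral_cong) (auto simp: indicator_def E_T[OF w])
        also have "\<dots> = ennreal t * emeasure lborel ?S" by (rule nn_integral_cmult_indicator[OF S])
        also have "\<dots> \<le> 5 ^ DIM('a) * (\<integral>\<^sup>+x. h (T x w) * indicator (ball (0::'a) (L + N)) x \<partial>lborel)"
          by (rule ball_maximal_bound) simp
        finally show "(\<integral>\<^sup>+y. ennreal t * (indicator (ball (0::'a) L) y * indicator (E N) (T y w)) \<partial>lborel) \<le>
          5 ^ DIM('a) * (\<integral>\<^sup>+x. h (T x w) * indicator (ball (0::'a) (L + N)) x \<partial>lborel)" .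
      qed
      also have "\<dots> = 5 ^ DIM('a) * (\<integral>\<^sup>+w. (\<integral>\<^sup>+x. h (T x w) * indicator (ball (0::'a) (L + N)) x \<partial>lborel) \<partial>\<mu>)"
        by (rule nn_integral_cmult) measurable
      also have "(\<integral>\<^sup>+w. (\<integral>\<^sup>+x. h (T x w) * indicator (ball (0::'a) (L + N)) x \<partial>lborel) \<partial>\<mu>) =
          (\<integral>\<^sup>+x. (\<integral>\<^sup>+w. h (T x w) * indicator (ball (0::'a) (L + N)) x \<partial>\<mu>) \<partial>lborel)"
        by (rule P.Fubini'[symmetric]) measurable
      also have "\<dots> = (\<integral>\<^sup>+x. ?I * indicator (ball (0::'a) (L + N)) x \<partial>lborel)"
        by (intro nn_integral_cong) (subst nn_integral_multc, auto simp: nn_integral_T)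
      also have "\<dots> = ?I * emeasure lborel (ball (0::'a) (L + N))"
        by (rule nn_integral_cmult_indicator) simp
      finally show ?thesis by (simp add: emeasure_ball_eq[of 0] mult.assoc)
    qed
    show ?thesis
    proof (cases "?I = \<top>")
      case True
      then show ?thesis by (simp add: ennreal_mult_top)
    next
      case False
      define a where "a = t * measure \<mu> (E N)"
      define b where "b = 5 ^ DIM('a) * enn2real ?I"
      have a: "ennreal t * emeasure \<mu> (E N) = ennreal a"
        unfolding a_def using t by (simp add: emeasure_eq_measure ennreal_mult)
      have b: "5 ^ DIM('a) * ?I = ennreal b"
        unfolding b_def using False by (simp add: ennreal_mult ennreal_enn2real less_top ennreal_power[symmetric])
      have b0: "b \<ge> 0" unfolding b_def by simp
      \<comment> \<open>The window is chosen as L = R - N, so that the enlarged ball has radius R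
        and the quotient of volumes tends to 1.\<close>
      have "a * (measure lborel (ball (0::'a) (R - N)) / measure lborel (ball (0::'a) R)) \<le> b" if "R > 0" for R :: real
      proof -
        have "ennreal a * ennreal (measure lborel (ball (0::'a) (R - N))) \<le> ennreal b * ennreal (measure lborel (ball (0::'a) R))"
          using bound[of "R - N"] unfolding a b by simp
        then have "a * measure lborel (ball (0::'a) (R - N)) \<le> b * measure lborel (ball (0::'a) R)"
          using b0 by (simp add: ennreal_mult''[symmetric] ennreal_le_iff)
        then show ?thesis using measure_ball_pos[OF that, where 'a = 'a] by (simp add: field_simps)
      qed
      then have "a * 1 \<le> b"
        by (intro tendsto_upperbound[OF tendsto_mult[OF tendsto_const measure_ball_ratio_tendsto[of N, where 'a = 'a]]])
           (auto intro: eventually_mono[OF eventually_gt_at_top[of 0]])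
      then show ?thesis unfolding a b by (intro ennreal_leI) simp
    qed
  qed
  have "{w\<in>space \<mu>. \<exists>m::nat\<ge>1. ennreal t < (\<integral>\<^sup>+x. h (T x w) \<partial>ball_avg m)} = (\<Union>N. E N)"
    unfolding E_def by (auto 0 3)
  also have "emeasure \<mu> \<dots> = (SUP N. emeasure \<mu> (E N))"
    by (rule SUP_emeasure_incseq[symmetric]) (auto simp: incseq_def E_def Bex_def)
  finally show ?thesis
    by (simp add: SUP_mult_left_ennreal SUP_le_iff main)
qed

end

section \<open>Pointwise convergence of averages along integer radii\<close>

context ball_flow
begin

lemma maximal_set_sets:
  assumes [measurable]: "h \<in> borel_measurable \<mu>"
  shows "{w\<in>space \<mu>. \<exists>m::nat\<ge>1. ennreal t < (\<integral>\<^sup>+x. h (T x w) \<partial>ball_avg m)} \<in> sets \<mu>"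
proof -
  have "{w\<in>space \<mu>. \<exists>m::nat\<ge>1. ennreal t < (\<integral>\<^sup>+x. h (T x w) \<partial>ball_avg m)} =
      (\<Union>m\<in>{1..}. {w\<in>space \<mu>. ennreal t < (\<integral>\<^sup>+x. h (T x w) \<partial>ball_avg (real m))})" by auto
  also have "\<dots> \<in> sets \<mu>"
  proof (rule sets.countable_UN')
    show "(\<lambda>m. {w\<in>space \<mu>. ennreal t < (\<integral>\<^sup>+x. h (T x w) \<partial>ball_avg (real m))}) ` {1..} \<subseteq> sets \<mu>"
    proof safe
      fix m :: nat assume "1 \<le> m"
      then interpret B: prob_space "ball_avg (real m) :: 'a measure" by (intro prob_space_ball_avg) simp
      show "{w\<in>space \<mu>. ennreal t < (\<integral>\<^sup>+x. h (T x w) \<partial>ball_avg (real m))} \<in> sets \<mu>" by measurable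
    qed
  qed auto
  finally show ?thesis .
qed

text \<open>The integral of \<open>h\<close> is measured in the unit that cancels the factor 5^d, so
  that the bad set at level \<open>t\<close> has measure at most \<open>b\<close>.\<close>

lemma maximal_bound_real:
  assumes [measurable]: "h \<in> borel_measurable \<mu>" and t: "t > 0" and b: "0 \<le> b"
    and h: "(\<integral>\<^sup>+w. h w \<partial>\<mu>) \<le> ennreal (t * b / 5 ^ DIM('a))"
  shows "emeasure \<mu> {w\<in>space \<mu>. \<exists>m::nat\<ge>1. ennreal t < (\<integral>\<^sup>+x. h (T x w) \<partial>ball_avg m)} \<le> ennreal b"
proof -
  let ?E = "{w\<in>space \<mu>. \<exists>m::nat\<ge>1. ennreal t < (\<integral>\<^sup>+x. h (T x w) \<partial>ball_avg m)}"
  have "ennreal (t * measure \<mu> ?E) = ennreal t * emeasure \<mu> ?E"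
    using t by (simp add: emeasure_eq_measure ennreal_mult)
  also have "\<dots> \<le> 5 ^ DIM('a) * (\<integral>\<^sup>+w. h w \<partial>\<mu>)"
    by (rule maximal_bound) (use t in auto)
  also have "\<dots> \<le> 5 ^ DIM('a) * ennreal (t * b / 5 ^ DIM('a))"
    by (rule mult_left_mono[OF h]) simp
  also have "\<dots> = ennreal (5 ^ DIM('a)) * ennreal (t * b / 5 ^ DIM('a))"
    by (simp add: ennreal_power[symmetric])
  also have "\<dots> = ennreal (t * b)"
    using t b by (subst ennreal_mult[symmetric]) auto
  finally have "t * measure \<mu> ?E \<le> t * b" using t b by (simp add: ennreal_le_iff)
  then show ?thesis using t b by (simp add: emeasure_eq_measure ennreal_le_iff)
qed

text \<open>By Fubini the iterated average is a mean, over \<open>y\<close> in the small ball, of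
  averages over \<open>ball 0 R\<close> translated by \<open>y\<close>. Each translation costs only
  the boundary term of \<open>ball_avg_shift_bound\<close>.\<close>

lemma flow_avg_iterate:
  assumes g: "bounded_meas K g" and r: "0 < r" "r < R" and w: "w \<in> space \<mu>"
  shows "\<bar>flow_avg R g w - flow_avg R (flow_avg r g) w\<bar>
    \<le> 2 * K * (1 - measure lborel (ball (0::'a) (R - r)) / measure lborel (ball (0::'a) R))"
    (is "_ \<le> ?B")
proof -
  have R: "R > 0" using r by simp
  interpret B: prob_space "ball_avg R :: 'a measure" by (rule prob_space_ball_avg[OF R])
  interpret C: prob_space "ball_avg r :: 'a measure" by (rule prob_space_ball_avg[OF r(1)])
  interpret P: pair_prob_space "ball_avg R :: 'a measure" "ball_avg r :: 'a measure" ..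
  have [measurable]: "g \<in> borel_measurable \<mu>" using g by blast
  have gT: "\<bar>g (T x w)\<bar> \<le> K" for x using g w T_space by blast
  have [measurable]: "(\<lambda>x. g (T x w)) \<in> borel_measurable borel" using w by measurable
  have int: "integrable (ball_avg R \<Otimes>\<^sub>M ball_avg r) (\<lambda>(x, y). g (T (x + y) w))"
    by (rule P.P.integrable_const_bound[where B = K]) (use gT w in auto)
  have "flow_avg R (flow_avg r g) w = (\<integral>x. (\<integral>y. g (T (x + y) w) \<partial>ball_avg r) \<partial>ball_avg R)"
    unfolding flow_avg_def using w by (simp add: T_add add.commute)
  also have "\<dots> = (\<integral>y. (\<integral>x. g (T (x + y) w) \<partial>ball_avg R) \<partial>ball_avg r)"
    by (rule P.Fubini_integral[symmetric, OF int])
  finally have it: "flow_avg R (flow_avg r g) w = (\<integral>y. (\<integral>x. g (T (x + y) w) \<partial>ball_avg R) \<partial>ball_avg r)" .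
  let ?D = "\<lambda>y. (\<integral>x. g (T x w) \<partial>ball_avg R) - (\<integral>x. g (T (x + y) w) \<partial>ball_avg R)"
  have intD': "integrable (ball_avg r) (\<lambda>y. \<integral>x. g (T (x + y) w) \<partial>ball_avg R)"
    using P.integrable_snd[OF int] .
  then have intD: "integrable (ball_avg r) ?D" by simp
  have "flow_avg R g w - flow_avg R (flow_avg r g) w = (\<integral>y. ?D y \<partial>ball_avg r)"
    unfolding it flow_avg_def[of R g] using intD' C.prob_space by simp
  also have "\<bar>\<dots>\<bar> \<le> (\<integral>y. \<bar>?D y\<bar> \<partial>ball_avg r)" by (rule integral_abs_bound)
  also have "\<dots> \<le> ?B"
  proof (rule C.integral_le_const)
    show "AE y in ball_avg r. \<bar>?D y\<bar> \<le> ?B"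
      using AE_ball_avg[OF r(1), where 'a = 'a]
    proof eventually_elim
      case (elim y)
      have "\<bar>(\<integral>x. g (T (x + y) w) \<partial>ball_avg R) - (\<integral>x. g (T x w) \<partial>ball_avg R)\<bar> \<le> ?B"
        by (rule ball_avg_shift_bound[of "\<lambda>x. g (T x w)"]) (use gT elim r in auto)
      then show ?case by (simp add: abs_minus_commute)
    qed
  qed (use intD in simp)
  finally show ?thesis .
qed

text \<open>The part \<open>g - flow_avg r g\<close> has uniformly small averages, and the remaining part
  \<open>flow_avg r g - \<integral>g\<close> is small in mean, so that the maximal inequality applies to it.\<close>

theorem pointwise_ergodic:
  assumes g: "mean_ergodic g"
  shows "AE w in \<mu>. (\<lambda>m::nat. flow_avg m g w) \<longlonglongrightarrow> (\<integral>w. g w \<partial>\<mu>)"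
proof -
  obtain K where K: "bounded_meas K g" using g unfolding mean_ergodic_def by blast
  define c where "c = (\<integral>w. g w \<partial>\<mu>)"
  have near: "AE w in \<mu>. \<forall>\<^sub>F m in sequentially. \<bar>flow_avg (real m) g w - c\<bar> \<le> 2 * t" if t: "t > 0" for t
  proof (rule AE_from_small_sets)
    fix \<delta> :: real assume \<delta>: "\<delta> > 0"
    \<comment> \<open>The threshold is what the maximal inequality at level \<open>t\<close>
      converts into a bad set of measure at most \<delta>.\<close>
    have "\<forall>\<^sub>F r in at_top. (\<integral>w. \<bar>flow_avg r g w - c\<bar> \<partial>\<mu>) < t * \<delta> / 5 ^ DIM('a)"
      using g t \<delta> unfolding mean_ergodic_def c_def by (intro order_tendstoD(2)) auto
    then have "\<forall>\<^sub>F r in at_top. r > 0 \<and> (\<integral>w. \<bar>flow_avg r g w - c\<bar> \<partial>\<mu>) < t * \<delta> / 5 ^ DIM('a)"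
      using eventually_gt_at_top[of 0] by eventually_elim simp
    then obtain r where r: "r > 0" "(\<integral>w. \<bar>flow_avg r g w - c\<bar> \<partial>\<mu>) < t * \<delta> / 5 ^ DIM('a)"
      unfolding eventually_at_top_linorder by blast
    define q where "q w = flow_avg r g w - c" for w
    have Kr: "bounded_meas K (flow_avg r g)" by (rule flow_avg_bounded_meas[OF K r(1)])
    have q: "bounded_meas (K + \<bar>c\<bar>) q"
      using Kr unfolding bounded_meas_def q_def by (auto intro!: order_trans[OF abs_triangle_ineq4] add_mono)
    have [measurable]: "q \<in> borel_measurable \<mu>" using q by blast
    define E where "E = {w\<in>space \<mu>. \<exists>m::nat\<ge>1. ennreal t < (\<integral>\<^sup>+x. (\<lambda>w. ennreal \<bar>q w\<bar>) (T x w) \<partial>ball_avg m)}"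
    have "(\<integral>\<^sup>+w. ennreal \<bar>q w\<bar> \<partial>\<mu>) = ennreal (\<integral>w. \<bar>q w\<bar> \<partial>\<mu>)"
      by (rule nn_integral_eq_integral) (use bounded_meas_integrable[OF q] in auto)
    also have "\<dots> \<le> ennreal (t * \<delta> / 5 ^ DIM('a))"
      using r(2) unfolding q_def by (intro ennreal_leI) simp
    finally have "emeasure \<mu> E \<le> ennreal \<delta>"
      unfolding E_def by (intro maximal_bound_real) (use t \<delta> in auto)
    moreover have "E \<in> sets \<mu>" unfolding E_def by (rule maximal_set_sets) measurable
    moreover have "\<forall>\<^sub>F m in sequentially. \<bar>flow_avg (real m) g w - c\<bar> \<le> 2 * t" if w: "w \<in> space \<mu> - E" for w
    proof -
      have "((\<lambda>R. 2 * K * (1 - measure lborel (ball (0::'a) (R - r)) / measure lborel (ball (0::'a) R))) \<longlongrightarrow> 2 * K * (1 - 1)) at_top"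
        by (intro tendsto_intros measure_ball_ratio_tendsto)
      then have "\<forall>\<^sub>F R in at_top. 2 * K * (1 - measure lborel (ball (0::'a) (R - r)) / measure lborel (ball (0::'a) R)) < t"
        using t by (intro order_tendstoD(2)) auto
      then have "\<forall>\<^sub>F m in sequentially. 2 * K * (1 - measure lborel (ball (0::'a) (real m - r)) / measure lborel (ball (0::'a) (real m))) < t"
        by (rule eventually_compose_filterlim[OF _ filterlim_real_sequentially])
      moreover have "\<forall>\<^sub>F m in sequentially. r < real m"
        by (rule eventually_compose_filterlim[OF eventually_gt_at_top filterlim_real_sequentially])
      \<comment> \<open>One \<open>t\<close> comes from replacing \<open>g\<close> by
        \<open>flow_avg r g\<close>, the other from the maximal inequality for \<open>q\<close>,
        giving 2 t in total.\<close>
      ultimately show ?thesis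
      proof eventually_elim
        case (elim m)
        have m: "real m > 0" "m \<ge> 1" using elim(2) r(1) by linarith+
        have "(\<integral>\<^sup>+x. ennreal \<bar>q (T x w)\<bar> \<partial>(ball_avg (real m) :: 'a measure)) \<le> ennreal t"
          using w m unfolding E_def by auto
        moreover have absq: "bounded_meas (K + \<bar>c\<bar>) (\<lambda>w. \<bar>q w\<bar>)" using q unfolding bounded_meas_def by auto
        then have "(\<integral>\<^sup>+x. ennreal \<bar>q (T x w)\<bar> \<partial>(ball_avg (real m) :: 'a measure)) = ennreal (\<integral>x. \<bar>q (T x w)\<bar> \<partial>(ball_avg (real m) :: 'a measure))"
          by (intro nn_integral_eq_integral flow_integrable) (use w m in auto)
        ultimately have "(\<integral>x. \<bar>q (T x w)\<bar> \<partial>(ball_avg (real m) :: 'a measure)) \<le> t"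
          using t by (simp add: ennreal_le_iff)
        moreover have "\<bar>flow_avg m q w\<bar> \<le> (\<integral>x. \<bar>q (T x w)\<bar> \<partial>(ball_avg (real m) :: 'a measure))"
          unfolding flow_avg_def by (rule integral_abs_bound)
        moreover have "flow_avg m q w = flow_avg m (flow_avg r g) w - c"
        proof -
          interpret B: prob_space "ball_avg (real m) :: 'a measure" by (rule prob_space_ball_avg[OF m(1)])
          show ?thesis
            unfolding flow_avg_def[of m] q_def
            using flow_integrable[OF Kr m(1), of w] w B.prob_space by simp
        qed
        moreover have "\<bar>flow_avg m g w - flow_avg m (flow_avg r g) w\<bar> \<le> t"
          using flow_avg_iterate[OF K r(1) elim(2), of w] w elim(1) by simp
        ultimately show ?case by linarith
      qed
    qed
    ultimately show "\<exists>E\<in>sets \<mu>. emeasure \<mu> E \<le> ennreal \<delta> \<and>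
        (\<forall>w\<in>space \<mu> - E. \<forall>\<^sub>F m in sequentially. \<bar>flow_avg (real m) g w - c\<bar> \<le> 2 * t)"
      by blast
  qed
  have "AE w in \<mu>. \<forall>k. \<forall>\<^sub>F m in sequentially. \<bar>flow_avg (real m) g w - c\<bar> \<le> 2 * (1 / Suc k)"
    unfolding AE_all_countable by (intro allI near) simp
  then show ?thesis
  proof eventually_elim
    case (elim w)
    show ?case
    proof (rule tendstoI)
      fix e :: real assume "e > 0"
      then obtain k where k: "inverse (real (Suc k)) < e / 2" using reals_Archimedean[of "e / 2"] by auto
      from elim have "\<forall>\<^sub>F m in sequentially. \<bar>flow_avg (real m) g w - c\<bar> \<le> 2 * (1 / Suc k)" ..
      then show "\<forall>\<^sub>F m in sequentially. dist (flow_avg (real m) g w) (\<integral>w. g w \<partial>\<mu>) < e"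
        by eventually_elim (use k in \<open>simp add: dist_real_def c_def inverse_eq_divide\<close>)
    qed
  qed
qed

text \<open>An integrable \<phi> is a bounded truncation \<open>g k\<close>, to which
  \<open>pointwise_ergodic\<close> applies, plus a tail \<open>h k\<close> of small integral. By the
  maximal inequality the averages of the tail stay below \<open>t\<close> outside a small set, and
  each of the two errors is at most \<open>t\<close> = \<epsilon> / 2.\<close>

theorem pointwise_ergodic_upper:
  assumes erg: "\<And>K g. bounded_meas K g \<Longrightarrow> mean_ergodic g"
    and [measurable]: "\<phi> \<in> borel_measurable \<mu>" and fin: "(\<integral>\<^sup>+w. \<phi> w \<partial>\<mu>) < \<infinity>" and \<epsilon>: "\<epsilon> > 0"
  shows "AE w in \<mu>. \<forall>\<^sub>F m in sequentially.
    (\<integral>\<^sup>+x. \<phi> (T x w) \<partial>ball_avg (real m)) \<le> (\<integral>\<^sup>+w. \<phi> w \<partial>\<mu>) + ennreal \<epsilon>"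
proof -
  define t where "t = \<epsilon> / 2"
  have t: "t > 0" unfolding t_def using \<epsilon> by simp
  define g where "g k w = enn2real (min (\<phi> w) (of_nat k))" for k :: nat and w
  define h where "h k w = \<phi> w - min (\<phi> w) (of_nat k)" for k :: nat and w
  have gm [measurable]: "g k \<in> borel_measurable \<mu>" for k unfolding g_def by measurable
  have hm [measurable]: "h k \<in> borel_measurable \<mu>" for k unfolding h_def by measurable
  have g_enn: "ennreal (g k w) = min (\<phi> w) (of_nat k)" for k w
    unfolding g_def by (rule ennreal_enn2real) (simp add: min_less_iff_disj of_nat_less_top)
  have split: "\<phi> w = ennreal (g k w) + h k w" for k w
    unfolding g_enn h_def by (simp add: add_diff_inverse_ennreal)
  have g0: "0 \<le> g k w" for k w unfolding g_def by simp
  have gb: "bounded_meas (real k) (g k)" for k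
  proof -
    have "g k w \<le> real k" for w
      unfolding g_def by (rule enn2real_leI) (auto simp: ennreal_of_nat_eq_real_of_nat min.coboundedI2)
    then show ?thesis unfolding bounded_meas_def using gm g0 by auto
  qed
  define E where "E k = {w\<in>space \<mu>. \<exists>m::nat\<ge>1. ennreal t < (\<integral>\<^sup>+x. h k (T x w) \<partial>ball_avg m)}" for k
  \<comment> \<open>The truncation level may depend on \<open>w\<close>: almost every point escapes
    the bad set of some tail, and the countably many truncations converge simultaneously.\<close>
  have "AE w in \<mu>. \<exists>k. w \<notin> E k"
  proof (rule AE_from_small_sets)
    fix \<delta> :: real assume \<delta>: "\<delta> > 0"
    define \<eta> where "\<eta> = ennreal (t * \<delta> / 5 ^ DIM('a))"
    have \<eta>: "\<eta> > 0" unfolding \<eta>_def using t \<delta> by simp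
    have "(\<lambda>k. \<integral>\<^sup>+w. ennreal (g k w) \<partial>\<mu>) \<longlonglongrightarrow> (\<integral>\<^sup>+w. \<phi> w \<partial>\<mu>)"
    proof -
      have inc: "incseq (\<lambda>k w. min (\<phi> w) (of_nat k :: ennreal))"
        by (intro incseq_SucI le_funI min.mono order_refl of_nat_mono) simp
      have "(SUP k. min (\<phi> w) (of_nat k)) = \<phi> w" if lt: "\<phi> w < \<infinity>" for w
      proof -
        obtain k where "\<phi> w \<le> of_nat k"
          using ennreal_Ex_less_of_nat[OF lt[unfolded infinity_ennreal_def]] less_imp_le by blast
        then show ?thesis by (intro antisym SUP_least SUP_upper2[of k]) auto
      qed
      moreover have "AE w in \<mu>. \<phi> w < \<infinity>"
        using nn_integral_PInf_AE[of \<phi> \<mu>] fin by (auto simp: less_top)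
      ultimately have "(\<integral>\<^sup>+w. \<phi> w \<partial>\<mu>) = (\<integral>\<^sup>+w. (SUP k. min (\<phi> w) (of_nat k)) \<partial>\<mu>)"
        by (intro nn_integral_cong_AE) auto
      also have "\<dots> = (SUP k. \<integral>\<^sup>+w. min (\<phi> w) (of_nat k) \<partial>\<mu>)"
        by (rule nn_integral_monotone_convergence_SUP[OF inc]) measurable
      finally show ?thesis unfolding g_enn
        using LIMSEQ_SUP[of "\<lambda>k. \<integral>\<^sup>+w. min (\<phi> w) (of_nat k) \<partial>\<mu>"]
        by (metis (no_types, lifting) inc incseq_def le_funD nn_integral_mono)
    qed
    moreover have lt: "(\<integral>\<^sup>+w. \<phi> w \<partial>\<mu>) < (\<integral>\<^sup>+w. \<phi> w \<partial>\<mu>) + \<eta>"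
      using fin \<eta> by (metis add.right_neutral ennreal_add_left_cancel_less infinity_ennreal_def less_top)
    ultimately have "(\<lambda>k. (\<integral>\<^sup>+w. ennreal (g k w) \<partial>\<mu>) + \<eta>) \<longlonglongrightarrow> (\<integral>\<^sup>+w. \<phi> w \<partial>\<mu>) + \<eta>"
      by (intro tendsto_intros)
    then have "\<forall>\<^sub>F k in sequentially. (\<integral>\<^sup>+w. \<phi> w \<partial>\<mu>) < (\<integral>\<^sup>+w. ennreal (g k w) \<partial>\<mu>) + \<eta>"
      using lt by (rule order_tendstoD(1))
    then obtain k where k: "(\<integral>\<^sup>+w. \<phi> w \<partial>\<mu>) < (\<integral>\<^sup>+w. ennreal (g k w) \<partial>\<mu>) + \<eta>"
      unfolding eventually_sequentially by blast
    have "(\<integral>\<^sup>+w. \<phi> w \<partial>\<mu>) = (\<integral>\<^sup>+w. ennreal (g k w) + h k w \<partial>\<mu>)" using split[of _ k] by simp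
    also have "\<dots> = (\<integral>\<^sup>+w. ennreal (g k w) \<partial>\<mu>) + (\<integral>\<^sup>+w. h k w \<partial>\<mu>)"
      by (rule nn_integral_add) measurable
    finally have "(\<integral>\<^sup>+w. ennreal (g k w) \<partial>\<mu>) + (\<integral>\<^sup>+w. h k w \<partial>\<mu>) < (\<integral>\<^sup>+w. ennreal (g k w) \<partial>\<mu>) + \<eta>"
      using k by simp
    then have "(\<integral>\<^sup>+w. h k w \<partial>\<mu>) \<le> \<eta>"
      by (meson add_left_mono leI less_imp_le not_le)
    then have "emeasure \<mu> (E k) \<le> ennreal \<delta>"
      unfolding E_def \<eta>_def by (intro maximal_bound_real) (use t \<delta> in auto)
    moreover have "E k \<in> sets \<mu>" unfolding E_def by (rule maximal_set_sets) measurable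
    ultimately show "\<exists>E'\<in>sets \<mu>. emeasure \<mu> E' \<le> ennreal \<delta> \<and> (\<forall>w\<in>space \<mu> - E'. \<exists>k. w \<notin> E k)"
      by blast
  qed
  moreover have "AE w in \<mu>. \<forall>k. (\<lambda>m::nat. flow_avg m (g k) w) \<longlonglongrightarrow> (\<integral>w. g k w \<partial>\<mu>)"
    unfolding AE_all_countable by (intro allI pointwise_ergodic erg[OF gb])
  ultimately show ?thesis using AE_space
  proof eventually_elim
    case (elim w)
    then obtain k where k: "w \<notin> E k" by blast
    have "\<forall>\<^sub>F m in sequentially. flow_avg (real m) (g k) w < (\<integral>w. g k w \<partial>\<mu>) + t"
      using elim t by (intro order_tendstoD(2)[of _ "\<integral>w. g k w \<partial>\<mu>"]) auto
    moreover have "\<forall>\<^sub>F m::nat in sequentially. m \<ge> 1" by (rule eventually_ge_at_top)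
    ultimately show ?case
    proof eventually_elim
      case (elim m)
      have w: "w \<in> space \<mu>" by fact
      have m: "real m > 0" using elim by simp
      have [measurable]: "(\<lambda>x. g k (T x w)) \<in> borel_measurable borel" "(\<lambda>x. h k (T x w)) \<in> borel_measurable borel"
        using w by measurable
      have "(\<integral>\<^sup>+x. \<phi> (T x w) \<partial>(ball_avg (real m) :: 'a measure)) = (\<integral>\<^sup>+x. ennreal (g k (T x w)) + h k (T x w) \<partial>(ball_avg (real m) :: 'a measure))"
        using split[of _ k] by simp
      also have "\<dots> = (\<integral>\<^sup>+x. ennreal (g k (T x w)) \<partial>(ball_avg (real m) :: 'a measure)) + (\<integral>\<^sup>+x. h k (T x w) \<partial>(ball_avg (real m) :: 'a measure))"
        by (rule nn_integral_add) measurable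
      also have "(\<integral>\<^sup>+x. ennreal (g k (T x w)) \<partial>(ball_avg (real m) :: 'a measure)) = ennreal (flow_avg m (g k) w)"
        unfolding flow_avg_def by (rule nn_integral_eq_integral[OF flow_integrable[OF gb m w]]) (simp add: g0)
      also have "(\<integral>\<^sup>+x. h k (T x w) \<partial>(ball_avg (real m) :: 'a measure)) \<le> ennreal t"
        using k w elim unfolding E_def by auto
      also have "ennreal (flow_avg m (g k) w) \<le> ennreal ((\<integral>w. g k w \<partial>\<mu>) + t)"
        using elim by (intro ennreal_leI) simp
      also have "\<dots> = ennreal (\<integral>w. g k w \<partial>\<mu>) + ennreal t"
        using t g0 by (intro ennreal_plus integral_nonneg) auto
      also have "ennreal (\<integral>w. g k w \<partial>\<mu>) = (\<integral>\<^sup>+w. ennreal (g k w) \<partial>\<mu>)"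
        by (rule nn_integral_eq_integral[symmetric]) (use bounded_meas_integrable[OF gb] g0 in auto)
      also have "\<dots> \<le> (\<integral>\<^sup>+w. \<phi> w \<partial>\<mu>)"
        by (rule nn_integral_mono) (simp add: g_enn)
      finally have "(\<integral>\<^sup>+x. \<phi> (T x w) \<partial>(ball_avg (real m) :: 'a measure)) \<le> (\<integral>\<^sup>+w. \<phi> w \<partial>\<mu>) + ennreal t + ennreal t"
        by (simp add: add_mono)
      also have "\<dots> = (\<integral>\<^sup>+w. \<phi> w \<partial>\<mu>) + ennreal \<epsilon>"
        using t unfolding t_def by (simp add: add.assoc ennreal_plus[symmetric] del: ennreal_plus)
      finally show ?case .
    qed
  qed
qed

end

section \<open>The space of twice differentiable paths\<close>

lemma C_k_continuous: "C_k k f \<Longrightarrow> continuous_on UNIV f"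
proof (cases k)
  case (Suc j)
  assume "C_k k f"
  then obtain f' where "\<And>x. (f has_derivative f' x) (at x)" using Suc by auto
  then show ?thesis by (intro continuous_at_imp_continuous_on ballI has_derivative_continuous)
qed simp

lemma C_k_shift: "C_k k f \<Longrightarrow> C_k k (\<lambda>y. f (x + y))"
proof (induction k arbitrary: f)
  case 0
  then show ?case by (auto intro!: continuous_on_compose2[of UNIV f] continuous_intros)
next
  case (Suc k)
  then obtain f' where f': "\<And>x. (f has_derivative f' x) (at x)" and k: "\<And>v. C_k k (\<lambda>x. f' x v)"
    by auto
  have "((\<lambda>y. f (x + y)) has_derivative f' (x + y)) (at y)" for y
  proof -
    have "((\<lambda>y. x + y) has_derivative (\<lambda>z. z)) (at y)" by (auto intro!: derivative_eq_intros)
    from has_derivative_compose[OF this f'] show ?thesis by simp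
  qed
  then show ?case using Suc.IH[OF k] by (auto intro!: exI[of _ "\<lambda>y. f' (x + y)"])
qed

text \<open>Approximate the point x by simple functions of x. With finitely many points in place of
  x, joint measurability is clear, and continuity in x passes to the limit.\<close>

lemma caratheodory_measurable:
  fixes X :: "'a::euclidean_space \<Rightarrow> 'w \<Rightarrow> real"
  assumes X: "\<And>x. X x \<in> borel_measurable N"
    and cont: "\<And>w. w \<in> space N \<Longrightarrow> continuous_on UNIV (\<lambda>x. X x w)"
  shows "(\<lambda>p. X (fst p) (snd p)) \<in> borel_measurable (borel \<Otimes>\<^sub>M N)"
proof -
  obtain s :: "nat \<Rightarrow> 'a \<Rightarrow> 'a" where s: "\<And>i. simple_function borel (s i)"
    and lim: "\<And>x. (\<lambda>i. s i x) \<longlonglongrightarrow> x"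
    using borel_measurable_implies_sequence_metric[of "\<lambda>x::'a. x" borel 0] by auto
  show ?thesis
  proof (rule borel_measurable_LIMSEQ_real)
    show "(\<lambda>i. X (s i (fst p)) (snd p)) \<longlonglongrightarrow> X (fst p) (snd p)" if "p \<in> space (borel \<Otimes>\<^sub>M N)" for p
      by (rule continuous_on_tendsto_compose[OF cont lim]) (use that in \<open>auto simp: space_pair_measure\<close>)
    fix i
    have fin: "finite (range (s i))" using s[of i] by (simp add: simple_function_def)
    show "(\<lambda>p. X (s i (fst p)) (snd p)) \<in> borel_measurable (borel \<Otimes>\<^sub>M N)"
    proof (rule measurable_compose_countable'[where I = "range (s i)" and g = "\<lambda>p. s i (fst p)" and f = "\<lambda>x p. X x (snd p)"])
      show "(\<lambda>p. X x (snd p)) \<in> borel_measurable (borel \<Otimes>\<^sub>M N)" for x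
        by (rule measurable_compose[OF measurable_snd X])
      have "s i \<in> borel \<rightarrow>\<^sub>M count_space (range (s i))"
        using s[of i] fin by (simp add: measurable_count_space_eq2 simple_function_def)
      then show "(\<lambda>p. s i (fst p)) \<in> borel \<Otimes>\<^sub>M N \<rightarrow>\<^sub>M count_space (range (s i))"
        by (rule measurable_compose[OF measurable_fst])
    qed (use fin in \<open>auto intro: countable_finite\<close>)
  qed
qed

text \<open>Two derivatives are what the estimate at critical points uses, so the paths are of class
  C2. Evaluations generate the sigma-algebra; volumes and inclusions of nodal domains must be shown
  measurable for it by countable descriptions.\<close>

definition path_space :: "(real ^ 'n \<Rightarrow> real) measure" where
  "path_space = sigma {f. C_k 2 f} (cylinder_generator {f. C_k 2 f} (\<lambda>x f. f x))"

lemma space_path_space [simp]: "space path_space = {f. C_k 2 f}"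
  unfolding path_space_def by (rule space_measure_of) (auto simp: cylinder_generator_def)

lemma sets_path_space:
  "sets (path_space :: (real ^ 'n \<Rightarrow> real) measure) =
    sigma_sets (space path_space) (cylinder_generator (space path_space) (\<lambda>x f. f x))"
  unfolding space_path_space unfolding path_space_def
  by (rule sets_measure_of) (auto simp: cylinder_generator_def)

lemma measurable_path_spaceI:
  fixes X :: "real ^ 'n \<Rightarrow> 'w \<Rightarrow> real"
  assumes X: "\<And>x. X x \<in> borel_measurable N" and path: "\<And>w. w \<in> space N \<Longrightarrow> C_k 2 (\<lambda>x. X x w)"
  shows "(\<lambda>w x. X x w) \<in> N \<rightarrow>\<^sub>M path_space"
  unfolding path_space_def
proof (rule measurable_measure_of)
  fix A assume "A \<in> cylinder_generator {f. C_k 2 f} (\<lambda>x f::real ^ 'n \<Rightarrow> real. f x)"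
  then obtain J c where J: "finite J" and A: "A = {f\<in>{f. C_k 2 f}. \<forall>x\<in>J. f x \<le> c x}"
    unfolding cylinder_generator_def by blast
  have "(\<lambda>w x. X x w) -` A \<inter> space N = {w\<in>space N. \<forall>x\<in>J. X x w \<le> c x}"
    using path unfolding A by auto
  also have "\<dots> \<in> sets N"
    by (intro sets.sets_Collect_finite_All J borel_measurable_le X borel_measurable_const)
  finally show "(\<lambda>w x. X x w) -` A \<inter> space N \<in> sets N" .
qed (use path in \<open>auto simp: cylinder_generator_def\<close>)

lemma eval_measurable: "(\<lambda>f. f x) \<in> borel_measurable path_space"
proof (rule borel_measurable_iff_le[THEN iffD2], rule allI)
  fix c :: real
  have "{f\<in>space path_space. f x \<le> c} = {f\<in>space path_space. \<forall>y\<in>{x}. f y \<le> (\<lambda>_. c) y}" by simp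
  also have "\<dots> \<in> cylinder_generator (space path_space) (\<lambda>x f. f x)"
    by (rule cylinder_generatorI) simp
  finally show "{f\<in>space path_space. f x \<le> c} \<in> sets path_space"
    unfolding sets_path_space by blast
qed

lemma eval_pair_measurable:
  "(\<lambda>p. snd p (fst p)) \<in> borel_measurable (borel \<Otimes>\<^sub>M path_space)"
  by (rule caratheodory_measurable[of "\<lambda>x f. f x"])
     (use eval_measurable in \<open>auto intro: C_k_continuous\<close>)

definition path_shift :: "real ^ 'n \<Rightarrow> (real ^ 'n \<Rightarrow> real) \<Rightarrow> real ^ 'n \<Rightarrow> real" where
  "path_shift x f = (\<lambda>y. f (x + y))"

lemma path_shift_pair_measurable:
  "(\<lambda>p. path_shift (fst p) (snd p)) \<in> borel \<Otimes>\<^sub>M path_space \<rightarrow>\<^sub>M path_space"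
  unfolding path_shift_def
proof (rule measurable_path_spaceI)
  fix y :: "real ^ 'a"
  have "(\<lambda>p. (fst p + y, snd p)) \<in> borel \<Otimes>\<^sub>M path_space \<rightarrow>\<^sub>M borel \<Otimes>\<^sub>M path_space"
    by measurable
  from measurable_compose[OF this eval_pair_measurable]
  show "(\<lambda>p. snd p (fst p + y)) \<in> borel_measurable (borel \<Otimes>\<^sub>M path_space)" by simp
qed (auto simp: space_pair_measure intro: C_k_shift)


section \<open>Linear combinations of evaluations\<close>

text \<open>A list of weighted points represents a linear functional of the path. Lists may repeat
  points, so that addition is concatenation and translation is a map, without merging
  coefficients.\<close>

definition lin :: "(real \<times> 'a) list \<Rightarrow> ('a \<Rightarrow> real) \<Rightarrow> real" where
  "lin L f = (\<Sum>(a, x)\<leftarrow>L. a * f x)"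

text \<open>The covariance of two linear combinations when the field has covariance \<kappa> (x -
  y).\<close>

definition qform :: "('a::group_add \<Rightarrow> real) \<Rightarrow> (real \<times> 'a) list \<Rightarrow> (real \<times> 'a) list \<Rightarrow> real" where
  "qform \<kappa> L L' = lin L (\<lambda>x. lin L' (\<lambda>y. \<kappa> (x - y)))"

definition lshift :: "'a::ab_group_add \<Rightarrow> (real \<times> 'a) list \<Rightarrow> (real \<times> 'a) list" where
  "lshift h L = map (\<lambda>(a, x). (a, h + x)) L"

definition lscale :: "real \<Rightarrow> (real \<times> 'a) list \<Rightarrow> (real \<times> 'a) list" where
  "lscale c L = map (\<lambda>(a, x). (c * a, x)) L"

lemma lin_Nil [simp]: "lin [] f = 0" by (simp add: lin_def)
lemma lin_Cons [simp]: "lin ((a, x) # L) f = a * f x + lin L f" by (simp add: lin_def)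
lemma lin_append [simp]: "lin (L @ L') f = lin L f + lin L' f" by (simp add: lin_def)

lemma lin_add: "lin L (\<lambda>x. f x + g x) = lin L f + lin L g"
  by (induction L) (auto simp: algebra_simps)

lemma lin_mult: "lin L (\<lambda>x. c * f x) = c * lin L f"
  by (induction L) (auto simp: algebra_simps)

lemma lin_lshift: "lin (lshift h L) f = lin L (\<lambda>x. f (h + x))"
  by (induction L) (auto simp: lshift_def)

lemma lin_lscale: "lin (lscale c L) f = c * lin L f"
  by (induction L) (auto simp: lscale_def algebra_simps)

lemma lin_swap: "lin L (\<lambda>x. lin L' (\<lambda>y. k x y)) = lin L' (\<lambda>y. lin L (\<lambda>x. k x y))"
proof (induction L)
  case Nil
  show ?case using lin_mult[of L' 0 "\<lambda>_. 0"] by simp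
qed (auto simp: lin_add lin_mult)

lemma qform_append: "qform \<kappa> (L @ L') M = qform \<kappa> L M + qform \<kappa> L' M"
    "qform \<kappa> M (L @ L') = qform \<kappa> M L + qform \<kappa> M L'"
  by (simp_all add: qform_def lin_add)

lemma qform_lscale: "qform \<kappa> (lscale c L) M = c * qform \<kappa> L M" "qform \<kappa> M (lscale c L) = c * qform \<kappa> M L"
  by (simp_all add: qform_def lin_lscale lin_mult)

lemma qform_lshift: "qform \<kappa> (lshift h L) (lshift h M) = qform \<kappa> L M"
  by (simp add: qform_def lin_lshift)

lemma qform_commute:
  assumes "\<And>x. \<kappa> (- x) = \<kappa> x" shows "qform \<kappa> L M = qform \<kappa> M L"
proof -
  have "\<kappa> (x - y) = \<kappa> (y - x)" for x y using assms[of "y - x"] by simp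
  then show ?thesis unfolding qform_def by (subst lin_swap) simp
qed

lemma lin_of_sum:
  assumes "finite S" shows "\<exists>L. \<forall>f. lin L f = (\<Sum>x\<in>S. a x * f x)"
  using assms
proof (induction S)
  case empty
  show ?case by (intro exI[of _ "[]"]) simp
next
  case (insert x S)
  then obtain L where "\<And>f. lin L f = (\<Sum>x\<in>S. a x * f x)" by blast
  then show ?case using insert by (intro exI[of _ "(a x, x) # L"]) simp
qed

lemma lin_as_sum: "\<exists>S a. finite S \<and> (\<forall>f. lin L f = (\<Sum>x\<in>S. a x * f x))"
proof (induction L)
  case Nil
  show ?case by (intro exI[of _ "{}"]) simp
next
  case (Cons p L)
  obtain b y where p: "p = (b, y)" by (cases p)
  obtain S a where S: "finite S" and L: "\<And>f. lin L f = (\<Sum>x\<in>S. a x * f x)" using Cons by blast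
  \<comment> \<open>A point occurring repeatedly in the list receives the sum of its
    weights.\<close>
  let ?a = "\<lambda>x. (if x \<in> S then a x else 0) + (if x = y then b else 0)"
  have "lin (p # L) f = (\<Sum>x\<in>insert y S. ?a x * f x)" for f
  proof -
    have "(\<Sum>x\<in>insert y S. ?a x * f x) =
        (\<Sum>x\<in>insert y S. (if x \<in> S then a x * f x else 0)) + (\<Sum>x\<in>insert y S. (if x = y then b * f y else 0))"
      unfolding sum.distrib[symmetric] by (rule sum.cong) (auto simp: algebra_simps)
    also have "(\<Sum>x\<in>insert y S. (if x \<in> S then a x * f x else 0)) = (\<Sum>x\<in>S. a x * f x)"
      using S by (intro sum.mono_neutral_cong_right) auto
    finally show ?thesis using S by (simp add: L p)
  qed
  moreover have "finite (insert y S)" using S by simp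
  ultimately show ?case by (intro exI[of _ "insert y S"] exI[of _ ?a] conjI allI)
qed

lemma lin_measurable [measurable]: "lin L \<in> borel_measurable path_space"
proof (induction L)
  case (Cons p L)
  obtain b y where p: "p = (b, y)" by (cases p)
  show ?case unfolding p
    using borel_measurable_add[OF borel_measurable_times[OF borel_measurable_const eval_measurable[of y]] Cons]
    by (simp add: lin_def)
qed (simp add: lin_def)


section \<open>Stationary Gaussian measures on paths\<close>

text \<open>A centred stationary Gaussian law given through the real part of its characteristic
  functional. Taking \<theta> = - \<pi> / 2 recovers the vanishing sine part, and evenness of
  \<kappa> makes the covariance symmetric.\<close>

locale gaussian_path = prob_space \<mu> for \<mu> :: "(real ^ 'n \<Rightarrow> real) measure" +
  fixes \<kappa> :: "real ^ 'n \<Rightarrow> real"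
  assumes sets_\<mu>: "sets \<mu> = sets path_space"
    and even_\<kappa>: "\<And>x. \<kappa> (- x) = \<kappa> x"
    and cos_lin: "\<And>\<theta> L. (\<integral>f. cos (\<theta> + lin L f) \<partial>\<mu>) = cos \<theta> * exp (- qform \<kappa> L L / 2)"
begin

lemma space_\<mu>: "space \<mu> = {f. C_k 2 f}"
  using sets_eq_imp_space_eq[OF sets_\<mu>] by simp

lemma lin_meas [measurable]: "lin L \<in> borel_measurable \<mu>"
  using lin_measurable measurable_cong_sets[OF sets_\<mu> refl] by blast

text \<open>Positive semidefiniteness is read off from the law: an expectation of a cosine is at
  most 1, hence exp (- Q / 2) \<le> 1.\<close>

lemma qform_nonneg: "0 \<le> qform \<kappa> L L"
proof -
  have "\<bar>\<integral>f. cos (0 + lin L f) \<partial>\<mu>\<bar> \<le> (\<integral>f. \<bar>cos (0 + lin L f)\<bar> \<partial>\<mu>)" by (rule integral_abs_bound)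
  also have "\<dots> \<le> 1"
    by (rule integral_le_const) (auto intro!: integrable_const_bound[where B = 1])
  finally have "exp (- qform \<kappa> L L / 2) \<le> 1" unfolding cos_lin by simp
  then show ?thesis by simp
qed

lemma trig_class_\<mu>:
  assumes "\<And>\<theta> L. H (\<lambda>f. cos (\<theta> + lin L f))"
    and "\<And>u a. H u \<Longrightarrow> H (\<lambda>w. a * u w)"
    and "\<And>u v. H u \<Longrightarrow> H v \<Longrightarrow> H (\<lambda>w. u w + v w)"
    and "\<And>u v K. (\<And>k::nat. H (u k)) \<Longrightarrow> (\<And>k. u k \<in> borel_measurable \<mu>) \<Longrightarrow>
        (\<And>k w. w \<in> space \<mu> \<Longrightarrow> \<bar>u k w\<bar> \<le> K) \<Longrightarrow>
        (\<And>w. w \<in> space \<mu> \<Longrightarrow> (\<lambda>k. u k w) \<longlonglongrightarrow> v w) \<Longrightarrow> H v"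
  shows "trig_class \<mu> (\<lambda>x f. f x) H"
proof
  show "sets \<mu> = sigma_sets (space \<mu>) (cylinder_generator (space \<mu>) (\<lambda>x f. f x))"
    using sets_path_space sets_\<mu> sets_eq_imp_space_eq[OF sets_\<mu>] by simp
  fix \<theta> and S :: "(real ^ 'n) set" and a assume "finite S"
  then obtain L where "\<And>f. lin L f = (\<Sum>x\<in>S. a x * f x)" using lin_of_sum by blast
  then show "H (\<lambda>w. cos (\<theta> + (\<Sum>i\<in>S. a i * w i)))" using assms(1)[of \<theta> L] by simp
qed fact+

lemma path_shift_meas:
  "(\<lambda>p. path_shift (fst p) (snd p)) \<in> borel \<Otimes>\<^sub>M \<mu> \<rightarrow>\<^sub>M \<mu>"
  unfolding measurable_cong_sets[OF sets_pair_measure_cong[OF refl sets_\<mu>] sets_\<mu>]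
  by (rule path_shift_pair_measurable)

lemma path_shift_meas1 [measurable]: "path_shift h \<in> \<mu> \<rightarrow>\<^sub>M \<mu>"
  using measurable_compose[OF measurable_Pair1' path_shift_meas, of h] by simp

text \<open>Cosines are invariant in mean because \<open>qform\<close> depends on differences of
  points alone; the monotone class theorem extends this to all bounded measurable functions.\<close>

lemma integral_path_shift:
  fixes u :: "_ \<Rightarrow> real"
  assumes "u \<in> borel_measurable \<mu>" "\<And>f. f \<in> space \<mu> \<Longrightarrow> \<bar>u f\<bar> \<le> K"
  shows "(\<integral>f. u (path_shift h f) \<partial>\<mu>) = (\<integral>f. u f \<partial>\<mu>)"
proof -
  define H where "H u \<longleftrightarrow> u \<in> borel_measurable \<mu> \<and> (\<exists>K. \<forall>f\<in>space \<mu>. \<bar>u f\<bar> \<le> K) \<and>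
    (\<integral>f. u (path_shift h f) \<partial>\<mu>) = (\<integral>f. u f \<partial>\<mu>)" for u :: "_ \<Rightarrow> real"
  have int: "integrable \<mu> u" "integrable \<mu> (\<lambda>f. u (path_shift h f))"
    if u: "H u" for u
  proof -
    obtain K where K: "\<And>f. f \<in> space \<mu> \<Longrightarrow> \<bar>u f\<bar> \<le> K" using u unfolding H_def by blast
    have [measurable]: "u \<in> borel_measurable \<mu>" using u unfolding H_def by blast
    show "integrable \<mu> u" by (rule integrable_const_bound[where B = K]) (use K in auto)
    show "integrable \<mu> (\<lambda>f. u (path_shift h f))"
      by (rule integrable_const_bound[where B = K])
         (use K measurable_space[OF path_shift_meas1] in auto)
  qed
  interpret trig_class \<mu> "\<lambda>x f. f x" H
  proof (rule trig_class_\<mu>)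
    show "H (\<lambda>f. cos (\<theta> + lin L f))" for \<theta> L
    proof -
      have "lin L (path_shift h f) = lin (lshift h L) f" for f
        by (simp add: lin_lshift path_shift_def)
      then show ?thesis unfolding H_def
        by (auto simp: cos_lin qform_lshift intro!: exI[of _ 1])
    qed
    show "H (\<lambda>w. a * u w)" if u: "H u" for u a
    proof -
      obtain K where "\<forall>f\<in>space \<mu>. \<bar>u f\<bar> \<le> K" using u unfolding H_def by blast
      then have "\<forall>f\<in>space \<mu>. \<bar>a * u f\<bar> \<le> \<bar>a\<bar> * K" by (auto simp: abs_mult intro!: mult_left_mono)
      then show ?thesis using u unfolding H_def by auto
    qed
    show "H (\<lambda>w. u w + v w)" if u: "H u" and v: "H v" for u v
    proof -
      obtain K where K: "\<forall>f\<in>space \<mu>. \<bar>u f\<bar> \<le> K" using u unfolding H_def by blast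
      obtain L where L: "\<forall>f\<in>space \<mu>. \<bar>v f\<bar> \<le> L" using v unfolding H_def by blast
      have "\<forall>f\<in>space \<mu>. \<bar>u f + v f\<bar> \<le> K + L"
        using K L by (auto intro!: order_trans[OF abs_triangle_ineq] add_mono)
      then show ?thesis using u v int[OF u] int[OF v] unfolding H_def by auto
    qed
    fix u v K
    assume u: "\<And>k::nat. H (u k)" and [measurable]: "\<And>k. u k \<in> borel_measurable \<mu>"
      and K: "\<And>k w. w \<in> space \<mu> \<Longrightarrow> \<bar>u k w\<bar> \<le> K"
      and lim: "\<And>w. w \<in> space \<mu> \<Longrightarrow> (\<lambda>k. u k w) \<longlonglongrightarrow> v w"
    have [measurable]: "v \<in> borel_measurable \<mu>" by (rule borel_measurable_LIMSEQ_real[OF lim]) auto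
    have Kv: "\<bar>v w\<bar> \<le> K" if "w \<in> space \<mu>" for w
      by (rule LIMSEQ_le_const2[OF tendsto_rabs[OF lim[OF that]]]) (use K[OF that] in auto)
    have 1: "(\<lambda>k. \<integral>f. u k f \<partial>\<mu>) \<longlonglongrightarrow> (\<integral>f. v f \<partial>\<mu>)"
      by (rule integral_dominated_convergence[where w = "\<lambda>_. K"]) (use lim K in auto)
    have 2: "(\<lambda>k. \<integral>f. u k (path_shift h f) \<partial>\<mu>) \<longlonglongrightarrow> (\<integral>f. v (path_shift h f) \<partial>\<mu>)"
      by (rule integral_dominated_convergence[where w = "\<lambda>_. K"])
         (use lim K measurable_space[OF path_shift_meas1] in auto)
    have 3: "(\<integral>f. u k (path_shift h f) \<partial>\<mu>) = (\<integral>f. u k f \<partial>\<mu>)" for k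
      using u unfolding H_def by blast
    have "(\<integral>f. v (path_shift h f) \<partial>\<mu>) = (\<integral>f. v f \<partial>\<mu>)"
      by (rule LIMSEQ_unique[OF 2[unfolded 3] 1])
    then show "H v" unfolding H_def by (intro conjI exI[of _ K] ballI Kv) simp_all
  qed
  have "H u" by (rule H_bounded_measurable[OF assms])
  then show ?thesis unfolding H_def by blast
qed

lemma distr_path_shift: "distr \<mu> \<mu> (path_shift h) = \<mu>"
proof (rule measure_eqI)
  fix A assume "A \<in> sets (distr \<mu> \<mu> (path_shift h))"
  then have A: "A \<in> sets \<mu>" by simp
  have "measure \<mu> A = (\<integral>f. indicator A f \<partial>\<mu>)" using A by simp
  also have "\<dots> = (\<integral>f. indicator A (path_shift h f) \<partial>\<mu>)"
    by (rule integral_path_shift[symmetric, where K = 1]) (use A in \<open>auto simp: indicator_def\<close>)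
  also have "\<dots> = (\<integral>f. indicator A f \<partial>distr \<mu> \<mu> (path_shift h))"
    using A by (intro integral_distr[symmetric]) auto
  also have "\<dots> = measure (distr \<mu> \<mu> (path_shift h)) A" using A by simp
  finally show "emeasure (distr \<mu> \<mu> (path_shift h)) A = emeasure \<mu> A"
    using prob_space_distr[OF path_shift_meas1, of h]
    by (simp add: emeasure_eq_measure finite_measure.emeasure_eq_measure prob_space_def)
qed simp

sublocale ball_flow \<mu> path_shift
proof
  show "(\<lambda>p. path_shift (fst p) (snd p)) \<in> borel \<Otimes>\<^sub>M \<mu> \<rightarrow>\<^sub>M \<mu>" by (rule path_shift_meas)
  show "path_shift x (path_shift y w) = path_shift (x + y) w" for x y w
    by (simp add: path_shift_def ac_simps)
  show "distr \<mu> \<mu> (path_shift x) = \<mu>" for x by (rule distr_path_shift)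
qed

end

section \<open>Ergodicity of Gaussian fields without spectral atoms\<close>

text \<open>A translation by \<open>h\<close> with \<open>h \<bullet> \<zeta> = \<pi>\<close> changes the sign of the integrand.\<close>

lemma ball_avg_cos_tendsto:
  fixes \<zeta> :: "'a::euclidean_space"
  assumes "\<zeta> \<noteq> 0"
  shows "((\<lambda>R. \<integral>x. cos (x \<bullet> \<zeta>) \<partial>ball_avg R) \<longlongrightarrow> 0) at_top"
proof -
  define h where "h = (pi / (\<zeta> \<bullet> \<zeta>)) *\<^sub>R \<zeta>"
  have h: "h \<bullet> \<zeta> = pi" using assms by (simp add: h_def)
  define r where "r = norm h"
  have "((\<lambda>R. 1 * (1 - measure lborel (ball (0::'a) (R - r)) / measure lborel (ball (0::'a) R))) \<longlongrightarrow> 1 * (1 - 1)) at_top"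
    by (intro tendsto_intros measure_ball_ratio_tendsto)
  then have lim: "((\<lambda>R. 1 - measure lborel (ball (0::'a) (R - r)) / measure lborel (ball (0::'a) R)) \<longlongrightarrow> 0) at_top"
    by simp
  show ?thesis
  proof (rule Lim_null_comparison[OF _ lim])
    show "\<forall>\<^sub>F R in at_top. norm (\<integral>x. cos (x \<bullet> \<zeta>) \<partial>(ball_avg R :: 'a measure)) \<le>
        1 - measure lborel (ball (0::'a) (R - r)) / measure lborel (ball (0::'a) R)"
      using eventually_gt_at_top[of r]
    proof eventually_elim
      case (elim R)
      have "\<bar>(\<integral>x. cos ((x + h) \<bullet> \<zeta>) \<partial>(ball_avg R :: 'a measure)) - (\<integral>x. cos (x \<bullet> \<zeta>) \<partial>ball_avg R)\<bar> \<le>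
          2 * 1 * (1 - measure lborel (ball (0::'a) (R - r)) / measure lborel (ball (0::'a) R))"
        by (rule ball_avg_shift_bound) (use elim in \<open>auto simp: r_def\<close>)
      moreover have "cos ((x + h) \<bullet> \<zeta>) = - cos (x \<bullet> \<zeta>)" for x
        using h by (simp add: inner_add_left)
      ultimately show ?case by simp
    qed
  qed
qed

text \<open>The two Fourier assumptions say that \<kappa> is the transform of \<rho> and that this
  transform is real.\<close>

locale spectral_path = gaussian_path \<mu> \<kappa> + spec: prob_space \<rho>
  for \<mu> :: "(real ^ 'n \<Rightarrow> real) measure" and \<kappa> and \<rho> :: "(real ^ 'n) measure" +
  assumes sets_\<rho>: "sets \<rho> = sets borel"
    and \<kappa>_cos: "\<And>x. \<kappa> x = (\<integral>\<xi>. cos (x \<bullet> \<xi>) \<partial>\<rho>)"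
    and \<kappa>_sin: "\<And>x. (\<integral>\<xi>. sin (x \<bullet> \<xi>) \<partial>\<rho>) = 0"
    and no_atoms: "\<And>\<xi>. measure \<rho> {\<xi>} = 0"
begin

lemmas sets_\<rho>' [measurable_cong] = sets_\<rho>

lemma \<kappa>_bound: "\<bar>\<kappa> x\<bar> \<le> 1"
proof -
  have "\<bar>\<kappa> x\<bar> \<le> (\<integral>\<xi>. \<bar>cos (x \<bullet> \<xi>)\<bar> \<partial>\<rho>)" unfolding \<kappa>_cos by (rule integral_abs_bound)
  also have "\<dots> \<le> 1"
    by (rule spec.integral_le_const) (auto intro!: spec.integrable_const_bound[where B = 1])
  finally show ?thesis .
qed

lemma \<kappa>_measurable [measurable]: "\<kappa> \<in> borel_measurable borel"
  unfolding \<kappa>_cos[abs_def] by measurable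

text \<open>The square of the transform of \<rho> is the transform of the law of the difference of
  two independent frequencies.\<close>

lemma \<kappa>_square: "(\<kappa> x)\<^sup>2 = (\<integral>p. cos (x \<bullet> (fst p - snd p)) \<partial>(\<rho> \<Otimes>\<^sub>M \<rho>))"
proof -
  interpret P: pair_prob_space \<rho> \<rho> ..
  have int: "integrable \<rho> (\<lambda>\<xi>. cos (x \<bullet> \<xi>))" "integrable \<rho> (\<lambda>\<xi>. sin (x \<bullet> \<xi>))"
    by (auto intro!: spec.integrable_const_bound[where B = 1])
  have "(\<integral>p. cos (x \<bullet> (fst p - snd p)) \<partial>(\<rho> \<Otimes>\<^sub>M \<rho>)) = (\<integral>\<xi>. (\<integral>\<eta>. cos (x \<bullet> (\<xi> - \<eta>)) \<partial>\<rho>) \<partial>\<rho>)"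
    by (subst P.integral_fst'[symmetric]) (auto intro!: P.P.integrable_const_bound[where B = 1])
  also have "\<dots> = (\<integral>\<xi>. cos (x \<bullet> \<xi>) * \<kappa> x \<partial>\<rho>)"
    using int \<kappa>_sin[of x] by (simp add: inner_diff_right cos_diff \<kappa>_cos)
  also have "\<dots> = (\<kappa> x)\<^sup>2" by (simp add: \<kappa>_cos[symmetric] power2_eq_square)
  finally show ?thesis ..
qed

text \<open>Wiener's lemma. By Fubini the average of \<kappa> squared is an integral over pairs of
  frequencies of averaged cosines of their difference; these tend to 0 off the diagonal, and the
  diagonal is null.\<close>

lemma ball_avg_\<kappa>_square: "((\<lambda>R. \<integral>x. (\<kappa> x)\<^sup>2 \<partial>ball_avg R) \<longlongrightarrow> 0) at_top"
proof -
  interpret P: pair_prob_space \<rho> \<rho> ..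
  let ?D = "\<lambda>R \<zeta>. \<integral>x. cos (x \<bullet> \<zeta>) \<partial>(ball_avg R :: (real ^ 'n) measure)"
  \<comment> \<open>Dominated convergence asks for measurability at every \<open>R\<close>, while
    \<open>ball_avg\<close> is known to be a probability measure only for positive radii;
    \<open>max R 1\<close> agrees with \<open>R\<close> eventually.\<close>
  have "((\<lambda>R. \<integral>p. ?D (max R 1) (fst p - snd p) \<partial>(\<rho> \<Otimes>\<^sub>M \<rho>)) \<longlongrightarrow> (\<integral>p. 0 \<partial>(\<rho> \<Otimes>\<^sub>M \<rho>))) at_top"
  proof (rule integral_dominated_convergence_at_top[where w = "\<lambda>_. 1"])
    have D_meas: "?D (max R 1) \<in> borel_measurable borel" for R
    proof -
      interpret B: prob_space "ball_avg (max R 1) :: (real ^ 'n) measure" by (rule prob_space_ball_avg) simp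
      show ?thesis by measurable
    qed
    show "(\<lambda>p. ?D (max R 1) (fst p - snd p)) \<in> borel_measurable (\<rho> \<Otimes>\<^sub>M \<rho>)" for R
      by (rule measurable_compose[OF _ D_meas]) measurable
    have "\<bar>?D (max R 1) \<zeta>\<bar> \<le> 1" for R \<zeta>
    proof -
      interpret B: prob_space "ball_avg (max R 1) :: (real ^ 'n) measure" by (rule prob_space_ball_avg) simp
      have "\<bar>?D (max R 1) \<zeta>\<bar> \<le> (\<integral>x. \<bar>cos (x \<bullet> \<zeta>)\<bar> \<partial>(ball_avg (max R 1) :: (real ^ 'n) measure))"
        by (rule integral_abs_bound)
      also have "\<dots> \<le> 1"
        by (rule B.integral_le_const) (auto intro!: B.integrable_const_bound[where B = 1])
      finally show ?thesis .
    qed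
    then show "\<forall>\<^sub>F R in at_top. AE p in \<rho> \<Otimes>\<^sub>M \<rho>. norm (?D (max R 1) (fst p - snd p)) \<le> 1"
      by simp
    \<comment> \<open>Fubini: the section of the diagonal at \<xi> is the single point \<xi>, which
      has no mass.\<close>
    have "AE p in \<rho> \<Otimes>\<^sub>M \<rho>. fst p \<noteq> snd p"
    proof (rule P.AE_pair_measure)
      show "{p \<in> space (\<rho> \<Otimes>\<^sub>M \<rho>). fst p \<noteq> snd p} \<in> sets (\<rho> \<Otimes>\<^sub>M \<rho>)" by measurable
      have "AE \<eta> in \<rho>. \<xi> \<noteq> \<eta>" for \<xi>
      proof -
        have "{\<xi>} \<in> null_sets \<rho>"
          using no_atoms[of \<xi>] by (intro null_setsI) (simp_all add: spec.emeasure_eq_measure sets_\<rho>)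
        then show ?thesis by (rule AE_I') auto
      qed
      then show "AE \<xi> in \<rho>. AE \<eta> in \<rho>. fst (\<xi>, \<eta>) \<noteq> snd (\<xi>, \<eta>)" by simp
    qed
    then show "AE p in \<rho> \<Otimes>\<^sub>M \<rho>. ((\<lambda>R. ?D (max R 1) (fst p - snd p)) \<longlongrightarrow> 0) at_top"
    proof eventually_elim
      case (elim p)
      then have "((\<lambda>R. ?D R (fst p - snd p)) \<longlongrightarrow> 0) at_top" by (intro ball_avg_cos_tendsto) simp
      moreover have "\<forall>\<^sub>F R in at_top. ?D R (fst p - snd p) = ?D (max R 1) (fst p - snd p)"
        using eventually_ge_at_top[of 1] by eventually_elim (simp add: max_def)
      ultimately show ?case by (rule Lim_transform_eventually)
    qed
  qed auto
  then have lim: "((\<lambda>R. \<integral>p. ?D (max R 1) (fst p - snd p) \<partial>(\<rho> \<Otimes>\<^sub>M \<rho>)) \<longlongrightarrow> 0) at_top" by simp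
  moreover have "\<forall>\<^sub>F R in at_top. (\<integral>p. ?D (max R 1) (fst p - snd p) \<partial>(\<rho> \<Otimes>\<^sub>M \<rho>)) = (\<integral>x. (\<kappa> x)\<^sup>2 \<partial>ball_avg R)"
    using eventually_ge_at_top[of 1]
  proof eventually_elim
    case (elim R)
    interpret B: prob_space "ball_avg R :: (real ^ 'n) measure" by (rule prob_space_ball_avg) (use elim in simp)
    interpret Q: pair_prob_space "\<rho> \<Otimes>\<^sub>M \<rho>" "ball_avg R :: (real ^ 'n) measure" ..
    have "(\<integral>p. ?D R (fst p - snd p) \<partial>(\<rho> \<Otimes>\<^sub>M \<rho>)) = (\<integral>x. (\<integral>p. cos (x \<bullet> (fst p - snd p)) \<partial>(\<rho> \<Otimes>\<^sub>M \<rho>)) \<partial>ball_avg R)"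
      by (rule Q.Fubini_integral[symmetric]) (auto intro!: Q.P.integrable_const_bound[where B = 1] simp: case_prod_beta')
    then show ?case using elim by (simp add: \<kappa>_square max_def)
  qed
  ultimately show ?thesis by (rule Lim_transform_eventually)
qed

text \<open>From second to first powers by \<bar>k\<bar> \<le> \<epsilon> / 2 + k^2 / (2
  \<epsilon>). Once the mean of k^2 is below \<epsilon>^2, both summands contribute at most
  \<epsilon> / 2.\<close>

lemma ball_avg_abs_\<kappa>: "((\<lambda>R. \<integral>x. \<bar>\<kappa> x\<bar> \<partial>ball_avg R) \<longlongrightarrow> 0) at_top"
proof (rule tendstoI)
  fix \<epsilon> :: real assume \<epsilon>: "\<epsilon> > 0"
  have "\<forall>\<^sub>F R in at_top. (\<integral>x. (\<kappa> x)\<^sup>2 \<partial>ball_avg R) < \<epsilon>\<^sup>2"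
    using ball_avg_\<kappa>_square \<epsilon> by (intro order_tendstoD(2)) auto
  then show "\<forall>\<^sub>F R in at_top. dist (\<integral>x. \<bar>\<kappa> x\<bar> \<partial>ball_avg R) 0 < \<epsilon>"
    using eventually_gt_at_top[of 0]
  proof eventually_elim
    case (elim R)
    interpret B: prob_space "ball_avg R :: (real ^ 'n) measure" by (rule prob_space_ball_avg) (use elim in simp)
    have k1: "(\<kappa> x)\<^sup>2 \<le> 1" for x using \<kappa>_bound[of x] by (simp add: abs_square_le_1)
    have int: "integrable (ball_avg R) (\<lambda>x. (\<kappa> x)\<^sup>2)" "integrable (ball_avg R) (\<lambda>x. \<bar>\<kappa> x\<bar>)"
      using \<kappa>_bound k1 by (auto intro!: B.integrable_const_bound[where B = 1])
    have "(\<integral>x. \<bar>\<kappa> x\<bar> \<partial>ball_avg R) \<le> (\<integral>x. \<epsilon> / 2 + (\<kappa> x)\<^sup>2 / (2 * \<epsilon>) \<partial>ball_avg R)"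
    proof (rule integral_mono)
      fix x
      have "0 \<le> (\<bar>\<kappa> x\<bar> - \<epsilon>)\<^sup>2" by simp
      then have "2 * \<epsilon> * \<bar>\<kappa> x\<bar> \<le> \<epsilon> * \<epsilon> + (\<kappa> x)\<^sup>2" by (simp add: power2_diff power2_eq_square algebra_simps)
      then show "\<bar>\<kappa> x\<bar> \<le> \<epsilon> / 2 + (\<kappa> x)\<^sup>2 / (2 * \<epsilon>)" using \<epsilon> by (simp add: field_simps)
    qed (use int in auto)
    also have "\<dots> = \<epsilon> / 2 + (\<integral>x. (\<kappa> x)\<^sup>2 \<partial>ball_avg R) / (2 * \<epsilon>)"
      using int B.prob_space by simp
    also have "\<dots> < \<epsilon> / 2 + \<epsilon>\<^sup>2 / (2 * \<epsilon>)"
      using elim \<epsilon> by (intro add_strict_left_mono divide_strict_right_mono) auto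
    also have "\<dots> = \<epsilon>" using \<epsilon> by (simp add: power2_eq_square)
    finally show ?case by (simp add: abs_of_nonneg)
  qed
qed

text \<open>The translated ball lies in \<open>ball 0 S\<close>; enlarging the domain of integration
  costs the ratio of the volumes.\<close>

lemma ball_avg_\<kappa>_shift_le:
  assumes "norm h + R \<le> S" and R: "R > 0"
  shows "(\<integral>x. \<bar>\<kappa> (x + h)\<bar> \<partial>ball_avg R) \<le>
    measure lborel (ball (0 :: real ^ 'n) S) / measure lborel (ball (0 :: real ^ 'n) R) * (\<integral>x. \<bar>\<kappa> x\<bar> \<partial>ball_avg S)"
proof -
  let ?V = "\<lambda>R. measure lborel (ball (0 :: real ^ 'n) R)"
  have S: "S > 0" using assms norm_ge_zero[of h] by linarith
  interpret B: prob_space "ball_avg R :: (real ^ 'n) measure" by (rule prob_space_ball_avg[OF R])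
  interpret C: prob_space "ball_avg S :: (real ^ 'n) measure" by (rule prob_space_ball_avg[OF S])
  have V: "?V R > 0" "?V S > 0" using R S by simp_all
  have sub: "ball h R \<subseteq> ball 0 S"
  proof
    fix x assume "x \<in> ball h R"
    then have "dist h x < R" by simp
    then show "x \<in> ball 0 S" using assms(1) norm_triangle_ineq4[of h "h - x"] by (simp add: dist_norm)
  qed
  have int: "integrable (ball_avg S) (\<lambda>x. \<bar>\<kappa> x\<bar>)" "integrable (ball_avg R) (\<lambda>x. \<bar>\<kappa> (x + h)\<bar>)"
    using \<kappa>_bound by (auto intro!: B.integrable_const_bound[where B = 1] C.integrable_const_bound[where B = 1])
  have "ennreal (\<integral>x. \<bar>\<kappa> (x + h)\<bar> \<partial>ball_avg R) = (\<integral>\<^sup>+x. ennreal \<bar>\<kappa> (x + h)\<bar> \<partial>ball_avg R)"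
    by (rule nn_integral_eq_integral[symmetric, OF int(2)]) simp
  also have "\<dots> = (\<integral>\<^sup>+x. ennreal \<bar>\<kappa> x\<bar> * indicator (ball h R) x \<partial>lborel) / ?V R"
    by (rule nn_integral_ball_avg_shift[of "\<lambda>x. ennreal \<bar>\<kappa> x\<bar>"]) measurable
  also have "\<dots> \<le> (\<integral>\<^sup>+x. ennreal \<bar>\<kappa> x\<bar> * indicator (ball 0 S) x \<partial>lborel) / ?V R"
    by (intro divide_right_mono_ennreal nn_integral_mono mult_left_mono) (use sub in \<open>auto simp: indicator_def\<close>)
  also have "(\<integral>\<^sup>+x. ennreal \<bar>\<kappa> x\<bar> * indicator (ball 0 S) x \<partial>lborel) =
      (\<integral>\<^sup>+x. ennreal \<bar>\<kappa> x\<bar> * indicator (ball 0 S) x \<partial>lborel) / ?V S * ?V S"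
    by (rule ennreal_divide_mult_cancel[symmetric, OF V(2)])
  also have "(\<integral>\<^sup>+x. ennreal \<bar>\<kappa> x\<bar> * indicator (ball 0 S) x \<partial>lborel) / ?V S = (\<integral>\<^sup>+x. ennreal \<bar>\<kappa> x\<bar> \<partial>ball_avg S)"
    by (rule nn_integral_ball_avg[symmetric]) measurable
  also have "\<dots> = ennreal (\<integral>x. \<bar>\<kappa> x\<bar> \<partial>ball_avg S)"
    by (rule nn_integral_eq_integral[OF int(1)]) simp
  also have "\<dots> * ?V S / ?V R = ennreal (?V S / ?V R * (\<integral>x. \<bar>\<kappa> x\<bar> \<partial>ball_avg S))"
    using V by (simp add: ennreal_mult'[symmetric] divide_ennreal mult.commute)
  finally show ?thesis using V by (subst (asm) ennreal_le_iff) auto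
qed

text \<open>For fixed \<open>y\<close> in the ball, the points x - y + z stay in the ball of radius
  \<open>norm z + 2 * R\<close>. Once R exceeds \<open>norm z\<close> this radius is below 3 R,
  which gives the factor 3^n.\<close>

lemma pair_avg_\<kappa>:
  "((\<lambda>R. \<integral>p. \<bar>\<kappa> (fst p - snd p + z)\<bar> \<partial>(ball_avg R \<Otimes>\<^sub>M ball_avg R)) \<longlongrightarrow> 0) at_top"
proof -
  let ?V = "\<lambda>R. measure lborel (ball (0 :: real ^ 'n) R)"
  have "filterlim (\<lambda>R. norm z + 2 * R) at_top at_top"
    by (intro filterlim_tendsto_add_at_top[OF tendsto_const] filterlim_tendsto_pos_mult_at_top[OF tendsto_const] filterlim_ident) simp
  then have "((\<lambda>R. \<integral>x. \<bar>\<kappa> x\<bar> \<partial>ball_avg (norm z + 2 * R)) \<longlongrightarrow> 0) at_top"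
    by (rule filterlim_compose[OF ball_avg_abs_\<kappa>])
  then have lim: "((\<lambda>R. 3 ^ CARD('n) * (\<integral>x. \<bar>\<kappa> x\<bar> \<partial>ball_avg (norm z + 2 * R))) \<longlongrightarrow> 0) at_top"
    by (rule tendsto_mult_right_zero)
  show ?thesis
  proof (rule Lim_null_comparison[OF _ lim])
    show "\<forall>\<^sub>F R in at_top. norm (\<integral>p. \<bar>\<kappa> (fst p - snd p + z)\<bar> \<partial>(ball_avg R \<Otimes>\<^sub>M ball_avg R)) \<le>
        3 ^ CARD('n) * (\<integral>x. \<bar>\<kappa> x\<bar> \<partial>ball_avg (norm z + 2 * R))"
      using eventually_gt_at_top[of "norm z"]
    proof eventually_elim
      case (elim R)
      have R: "R > 0" using elim norm_ge_zero[of z] by linarith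
      let ?B = "ball_avg R :: (real ^ 'n) measure"
      let ?S = "norm z + 2 * R"
      interpret B: prob_space ?B by (rule prob_space_ball_avg[OF R])
      interpret P: pair_prob_space ?B ?B ..
      have int: "integrable (?B \<Otimes>\<^sub>M ?B) (\<lambda>(x, y). \<bar>\<kappa> (x - y + z)\<bar>)"
        using \<kappa>_bound by (auto intro!: P.P.integrable_const_bound[where B = 1] simp: case_prod_beta')
      have "(\<integral>p. \<bar>\<kappa> (fst p - snd p + z)\<bar> \<partial>(?B \<Otimes>\<^sub>M ?B)) = (\<integral>y. (\<integral>x. \<bar>\<kappa> (x - y + z)\<bar> \<partial>?B) \<partial>?B)"
        using P.integral_snd[OF int] by (simp add: case_prod_beta')
      also have "\<dots> \<le> 3 ^ CARD('n) * (\<integral>x. \<bar>\<kappa> x\<bar> \<partial>ball_avg ?S)"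
      proof (rule B.integral_le_const)
        show "integrable ?B (\<lambda>y. \<integral>x. \<bar>\<kappa> (x - y + z)\<bar> \<partial>?B)"
          using P.integrable_snd[OF int] by simp
        have V: "?V R > 0" using R by simp
        have "?V ?S \<le> ?V (3 * R)"
          using elim by (intro measure_mono_fmeasurable) (auto simp: fmeasurable_def emeasure_ball_eq)
        also have "\<dots> = 3 ^ CARD('n) * ?V R" using R by (subst measure_ball_scale) auto
        finally have ratio: "?V ?S / ?V R \<le> 3 ^ CARD('n)" using V by (simp add: field_simps)
        show "AE y in ?B. (\<integral>x. \<bar>\<kappa> (x - y + z)\<bar> \<partial>?B) \<le> 3 ^ CARD('n) * (\<integral>x. \<bar>\<kappa> x\<bar> \<partial>ball_avg ?S)"
          using AE_ball_avg[OF R, where 'a = "real ^ 'n"]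
        proof eventually_elim
          case (elim y)
          have "(\<integral>x. \<bar>\<kappa> (x - y + z)\<bar> \<partial>?B) = (\<integral>x. \<bar>\<kappa> (x + (z - y))\<bar> \<partial>?B)"
            by (simp add: algebra_simps)
          also have "\<dots> \<le> ?V ?S / ?V R * (\<integral>x. \<bar>\<kappa> x\<bar> \<partial>ball_avg ?S)"
            by (rule ball_avg_\<kappa>_shift_le[OF _ R])
               (use elim norm_triangle_ineq4[of z y] in simp)
          also have "\<dots> \<le> 3 ^ CARD('n) * (\<integral>x. \<bar>\<kappa> x\<bar> \<partial>ball_avg ?S)"
            by (rule mult_right_mono[OF ratio]) (simp add: Bochner_Integration.integral_nonneg)
          finally show ?case .
        qed
      qed
      finally show ?case by (simp add: abs_of_nonneg)
    qed
  qed
qed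

end

section \<open>Correlations and second moments of averaged cosines\<close>

definition labs :: "(real \<times> 'a) list \<Rightarrow> (real \<times> 'a) list" where
  "labs L = map (\<lambda>(a, x). (\<bar>a\<bar>, x)) L"

lemma abs_lin_le: "\<bar>lin L f\<bar> \<le> lin (labs L) (\<lambda>x. \<bar>f x\<bar>)"
proof (induction L)
  case (Cons p L)
  obtain a x where p: "p = (a, x)" by (cases p)
  have "\<bar>a * f x + lin L f\<bar> \<le> \<bar>a\<bar> * \<bar>f x\<bar> + \<bar>lin L f\<bar>" by (metis abs_mult abs_triangle_ineq)
  then show ?case using Cons by (simp add: p labs_def)
qed (simp add: labs_def)

lemma lin_labs_mono: "(\<And>x. f x \<le> g x) \<Longrightarrow> lin (labs L) f \<le> lin (labs L) g"
  by (induction L) (auto simp: labs_def intro!: add_mono mult_left_mono)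

lemma integrable_lin:
  "(\<And>x. integrable M (f x)) \<Longrightarrow> integrable M (\<lambda>w. lin L (\<lambda>x. f x w))"
  by (induction L) auto

lemma integral_lin:
  "(\<And>x. integrable M (f x)) \<Longrightarrow> (\<integral>w. lin L (\<lambda>x. f x w) \<partial>M) = lin L (\<lambda>x. \<integral>w. f x w \<partial>M)"
  by (induction L) (auto simp: integrable_lin)

lemma tendsto_lin_zero: "(\<And>x. ((\<lambda>R. f x R) \<longlongrightarrow> 0) F) \<Longrightarrow> ((\<lambda>R. lin L (\<lambda>x. f x R)) \<longlongrightarrow> 0) F"
  by (induction L) (auto intro!: tendsto_add_zero tendsto_mult_right_zero)

lemma abs_exp_minus_one_le: "\<bar>exp x - 1\<bar> \<le> \<bar>x\<bar> * exp \<bar>x\<bar>" for x :: real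
proof (cases "x \<ge> 0")
  case True
  have "1 - x \<le> exp (- x)" using exp_ge_add_one_self[of "- x"] by simp
  then have "(1 - x) * exp x \<le> exp (- x) * exp x" by (rule mult_right_mono) simp
  then have "exp x - 1 \<le> x * exp x" by (simp add: exp_minus algebra_simps)
  then show ?thesis using True by simp
next
  case False
  have "- x * 1 \<le> - x * exp (- x)" using False by (intro mult_left_mono) auto
  moreover have "1 + x \<le> exp x" by (rule exp_ge_add_one_self)
  moreover have "exp x \<le> 1" using False by simp
  ultimately have "1 - exp x \<le> - x * exp (- x)" "\<bar>exp x - 1\<bar> = 1 - exp x" by linarith+
  then show ?thesis using False by simp
qed

context gaussian_path
begin

text \<open>The product of the two cosines is half the sum of cosines of the sum and the difference
  of the combinations, with variances 2 V + 2 c and 2 V - 2 c. The covariance becomes exp (- V) (cos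
  (2 \<theta>) (exp (- c) - 1) + (exp c - 1)) / 2, which is of order c.\<close>

lemma cos_shift_covariance:
  fixes L \<theta>
  defines "u \<equiv> \<lambda>f. cos (\<theta> + lin L f)"
  defines "m \<equiv> \<integral>f. u f \<partial>\<mu>" and "c \<equiv> \<lambda>x y. qform \<kappa> (lshift x L) (lshift y L)"
  shows "\<bar>\<integral>f. (u (path_shift x f) - m) * (u (path_shift y f) - m) \<partial>\<mu>\<bar> \<le> \<bar>c x y\<bar> * exp \<bar>c x y\<bar>"
proof -
  let ?x = "lshift x L" and ?y = "lshift y L"
  define V where "V = qform \<kappa> L L"
  have Vxy: "qform \<kappa> ?x ?x = V" "qform \<kappa> ?y ?y = V" by (simp_all add: qform_lshift V_def)
  have cyx: "qform \<kappa> ?y ?x = c x y" unfolding c_def by (rule qform_commute) (rule even_\<kappa>)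
  have cxy: "qform \<kappa> ?x ?y = c x y" unfolding c_def ..
  have Q1: "qform \<kappa> (?x @ ?y) (?x @ ?y) = 2 * V + 2 * c x y"
    by (simp add: qform_append Vxy cyx cxy)
  have Q2: "qform \<kappa> (?x @ lscale (-1) ?y) (?x @ lscale (-1) ?y) = 2 * V - 2 * c x y"
    by (simp add: qform_append qform_lscale Vxy cyx cxy)
  have u: "u (path_shift h f) = cos (\<theta> + lin (lshift h L) f)" for h f
    unfolding u_def path_shift_def lin_lshift ..
  have m: "m = cos \<theta> * exp (- V / 2)" unfolding m_def u_def cos_lin V_def ..
  have int_cos: "integrable \<mu> (\<lambda>f. cos (\<phi> + lin K f))" for \<phi> K
    by (rule integrable_const_bound[where B = 1]) auto
  have uu: "u (path_shift x f) * u (path_shift y f) =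
      (cos (2 * \<theta> + lin (?x @ ?y) f) + cos (0 + lin (?x @ lscale (-1) ?y) f)) / 2" for f
    unfolding u by (subst cos_times_cos) (simp add: lin_lscale algebra_simps)
  have "(\<integral>f. (u (path_shift x f) - m) * (u (path_shift y f) - m) \<partial>\<mu>) =
      (\<integral>f. u (path_shift x f) * u (path_shift y f) - m * u (path_shift x f) - m * u (path_shift y f) + m * m \<partial>\<mu>)"
    by (simp add: algebra_simps)
  also have "\<dots> = (\<integral>f. u (path_shift x f) * u (path_shift y f) \<partial>\<mu>) - m * m - m * m + m * m"
  proof -
    have 3: "(\<integral>f. u (path_shift h f) \<partial>\<mu>) = m" for h
      unfolding u cos_lin m by (simp add: qform_lshift V_def)
    have 1: "integrable \<mu> (\<lambda>f. u (path_shift x f) * u (path_shift y f))"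
      unfolding uu using int_cos by (intro integrable_divide Bochner_Integration.integrable_add)
    have 2: "integrable \<mu> (\<lambda>f. u (path_shift h f))" for h unfolding u by (rule int_cos)
    show ?thesis using 1 2 3 prob_space by simp
  qed
  also have "(\<integral>f. u (path_shift x f) * u (path_shift y f) \<partial>\<mu>) = (cos (2 * \<theta>) * exp (- V - c x y) + exp (- V + c x y)) / 2"
  proof -
    have "- (2 * V + 2 * c x y) / 2 = - V - c x y" "- (2 * V - 2 * c x y) / 2 = - V + c x y"
      by (simp_all add: field_simps)
    then show ?thesis
      unfolding uu using int_cos[of "2 * \<theta>" "?x @ ?y"] int_cos[of 0 "?x @ lscale (-1) ?y"]
      by (simp only: integral_divide_zero Bochner_Integration.integral_add cos_lin Q1 Q2) simp
  qed
  \<comment> \<open>Here cos^2 \<theta> = (1 + cos (2 \<theta>)) / 2 splits \<open>m * m\<close>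
    into the two parts that are subtracted from the exponentials.\<close>
  also have "(cos (2 * \<theta>) * exp (- V - c x y) + exp (- V + c x y)) / 2 - m * m - m * m + m * m =
      exp (- V) * (cos (2 * \<theta>) * (exp (- c x y) - 1) + (exp (c x y) - 1)) / 2"
  proof -
    have "m * m = (cos \<theta>)\<^sup>2 * exp (- V)"
      unfolding m by (simp add: power2_eq_square exp_add[symmetric] ac_simps flip: exp_double)
    also have "(cos \<theta>)\<^sup>2 = (1 + cos (2 * \<theta>)) / 2" by (simp add: cos_double_cos)
    finally have mm: "m * m = (1 + cos (2 * \<theta>)) / 2 * exp (- V)" .
    have e: "exp (- V - c x y) = exp (- V) * exp (- c x y)" "exp (- V + c x y) = exp (- V) * exp (c x y)"
      by (simp_all add: exp_add[symmetric])
    show ?thesis unfolding mm e by (simp add: field_simps)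
  qed
  also have "\<bar>\<dots>\<bar> \<le> \<bar>c x y\<bar> * exp \<bar>c x y\<bar>"
  proof -
    have "\<bar>cos (2 * \<theta>) * (exp (- c x y) - 1) + (exp (c x y) - 1)\<bar> \<le>
        \<bar>cos (2 * \<theta>)\<bar> * \<bar>exp (- c x y) - 1\<bar> + \<bar>exp (c x y) - 1\<bar>"
      by (metis abs_mult abs_triangle_ineq)
    also have "\<dots> \<le> 1 * \<bar>exp (- c x y) - 1\<bar> + \<bar>exp (c x y) - 1\<bar>"
      by (intro add_right_mono mult_right_mono) auto
    also have "\<dots> \<le> 2 * (\<bar>c x y\<bar> * exp \<bar>c x y\<bar>)"
      using abs_exp_minus_one_le[of "c x y"] abs_exp_minus_one_le[of "- c x y"] by simp
    finally have b: "\<bar>cos (2 * \<theta>) * (exp (- c x y) - 1) + (exp (c x y) - 1)\<bar> / 2 \<le> \<bar>c x y\<bar> * exp \<bar>c x y\<bar>" by simp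
    have "exp (- V) \<le> 1" using qform_nonneg[of L] unfolding V_def by simp
    then have "exp (- V) * (\<bar>cos (2 * \<theta>) * (exp (- c x y) - 1) + (exp (c x y) - 1)\<bar> / 2) \<le> 1 * (\<bar>c x y\<bar> * exp \<bar>c x y\<bar>)"
      by (rule mult_mono[OF _ b]) auto
    then show ?thesis by (simp add: abs_mult)
  qed
  finally show ?thesis .
qed

end

context spectral_path
begin

text \<open>The second moment of the centred average is the double ball average of covariances.
  Those are bounded by finitely many translates of \<bar>\<kappa>\<bar>, so
  \<open>pair_avg_\<kappa>\<close> sends it to 0.\<close>

lemma mean_ergodic_cos: "mean_ergodic (\<lambda>f. cos (\<theta> + lin L f))"
proof -
  define u where "u = (\<lambda>f::real ^ 'n \<Rightarrow> real. cos (\<theta> + lin L f))"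
  define m where "m = (\<integral>f. u f \<partial>\<mu>)"
  define c where "c x y = qform \<kappa> (lshift x L) (lshift y L)" for x y
  \<comment> \<open>The square of the sum of the absolute weights bounds every covariance
    \<open>c x y\<close>, so the exponential factor of \<open>cos_shift_covariance\<close> is at
    most \<open>exp A\<close>.\<close>
  define A where "A = lin (labs L) (\<lambda>x. lin (labs L) (\<lambda>y. 1))"
  define W where "W x y = lin (labs L) (\<lambda>s. lin (labs L) (\<lambda>t. \<bar>\<kappa> (x - y + (s - t))\<bar>))" for x y
  have cW: "\<bar>c x y\<bar> \<le> W x y" for x y
  proof -
    have "c x y = lin L (\<lambda>s. lin L (\<lambda>t. \<kappa> (x - y + (s - t))))"
      unfolding c_def qform_def lin_lshift by (simp add: algebra_simps)
    also have "\<bar>\<dots>\<bar> \<le> W x y"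
      unfolding W_def by (intro order_trans[OF abs_lin_le] lin_labs_mono abs_lin_le)
    finally show ?thesis .
  qed
  have WA: "W x y \<le> A" for x y
    unfolding W_def A_def by (intro lin_labs_mono \<kappa>_bound)
  have um: "bounded_meas 1 u" unfolding bounded_meas_def u_def by auto
  have [measurable]: "u \<in> borel_measurable \<mu>" using um by blast
  have m1: "\<bar>m\<bar> \<le> 1"
  proof -
    have "\<bar>m\<bar> \<le> (\<integral>f. \<bar>u f\<bar> \<partial>\<mu>)" unfolding m_def by (rule integral_abs_bound)
    also have "\<dots> \<le> 1" by (rule integral_le_const) (use bounded_meas_integrable[OF um] in \<open>auto simp: u_def\<close>)
    finally show ?thesis .
  qed
  define Z where "Z x f = u (path_shift x f) - m" for x f
  have Z2: "\<bar>Z x f\<bar> \<le> 2" for x f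
    unfolding Z_def u_def using m1 abs_cos_le_one[of "\<theta> + lin L (path_shift x f)"] by linarith
  have ZZ: "\<bar>Z x f * Z y f\<bar> \<le> 4" for x y f
    using mult_mono[OF Z2[of x f] Z2[of y f]] by (simp add: abs_mult)
  have Z_meas [measurable]: "(\<lambda>p. Z (g p) (h p)) \<in> borel_measurable N"
    if [measurable]: "g \<in> N \<rightarrow>\<^sub>M borel" "h \<in> N \<rightarrow>\<^sub>M \<mu>" for g h and N :: "'z measure"
    unfolding Z_def by measurable
  let ?G = "\<lambda>z R. \<integral>p. \<bar>\<kappa> (fst p - snd p + z)\<bar> \<partial>(ball_avg R \<Otimes>\<^sub>M ball_avg R)"
  let ?H = "\<lambda>R. lin (labs L) (\<lambda>s. lin (labs L) (\<lambda>t. ?G (s - t) R))"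
  have H: "(?H \<longlongrightarrow> 0) at_top"
    by (intro tendsto_lin_zero pair_avg_\<kappa>)
  have second_moment: "(\<integral>f. (flow_avg R u f - m)\<^sup>2 \<partial>\<mu>) \<le> exp A * ?H R" if R: "R > 0" for R
  proof -
    let ?B = "ball_avg R :: (real ^ 'n) measure"
    interpret B: prob_space ?B by (rule prob_space_ball_avg[OF R])
    interpret P: pair_prob_space ?B ?B ..
    interpret Q: pair_prob_space \<mu> "?B \<Otimes>\<^sub>M ?B" ..
    have sq: "(flow_avg R u f - m)\<^sup>2 = (\<integral>p. Z (fst p) f * Z (snd p) f \<partial>(?B \<Otimes>\<^sub>M ?B))" if f: "f \<in> space \<mu>" for f
    proof -
      have intZ: "integrable ?B (\<lambda>x. Z x f)"
        by (rule B.integrable_const_bound[where B = 2]) (use Z2 f in auto)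
      have "flow_avg R u f - m = (\<integral>x. Z x f \<partial>?B)"
        unfolding flow_avg_def Z_def using flow_integrable[OF um R f] B.prob_space by simp
      then have "(flow_avg R u f - m)\<^sup>2 = (\<integral>x. Z x f \<partial>?B) * (\<integral>y. Z y f \<partial>?B)"
        by (simp add: power2_eq_square)
      also have "\<dots> = (\<integral>x. (\<integral>y. Z x f * Z y f \<partial>?B) \<partial>?B)" by simp
      also have "\<dots> = (\<integral>p. Z (fst p) f * Z (snd p) f \<partial>(?B \<Otimes>\<^sub>M ?B))"
        by (subst P.integral_fst'[symmetric])
           (use ZZ f in \<open>auto intro!: P.P.integrable_const_bound[where B = 4]\<close>)
      finally show ?thesis .
    qed
    have intW: "integrable (?B \<Otimes>\<^sub>M ?B) (\<lambda>p. \<bar>\<kappa> (fst p - snd p + z)\<bar>)" for z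
      using \<kappa>_bound by (auto intro!: P.P.integrable_const_bound[where B = 1])
    have "(\<integral>f. (flow_avg R u f - m)\<^sup>2 \<partial>\<mu>) = (\<integral>f. (\<integral>p. Z (fst p) f * Z (snd p) f \<partial>(?B \<Otimes>\<^sub>M ?B)) \<partial>\<mu>)"
      by (rule Bochner_Integration.integral_cong[OF refl sq])
    also have "\<dots> = (\<integral>p. (\<integral>f. Z (fst p) f * Z (snd p) f \<partial>\<mu>) \<partial>(?B \<Otimes>\<^sub>M ?B))"
      by (rule Q.Fubini_integral[symmetric])
         (use ZZ in \<open>auto intro!: Q.P.integrable_const_bound[where B = 4] simp: case_prod_beta'\<close>)
    also have "\<dots> \<le> (\<integral>p. exp A * W (fst p) (snd p) \<partial>(?B \<Otimes>\<^sub>M ?B))"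
    proof (rule integral_mono)
      have "integrable (?B \<Otimes>\<^sub>M ?B) (\<lambda>p. W (fst p) (snd p))"
        unfolding W_def by (intro integrable_lin intW)
      then show "integrable (?B \<Otimes>\<^sub>M ?B) (\<lambda>p. exp A * W (fst p) (snd p))" by simp
      have "\<bar>\<integral>f. Z (fst p) f * Z (snd p) f \<partial>\<mu>\<bar> \<le> exp A * W (fst p) (snd p)" for p
      proof -
        have "\<bar>\<integral>f. Z (fst p) f * Z (snd p) f \<partial>\<mu>\<bar> \<le> \<bar>c (fst p) (snd p)\<bar> * exp \<bar>c (fst p) (snd p)\<bar>"
          unfolding Z_def u_def m_def c_def by (rule cos_shift_covariance)
        also have "\<dots> \<le> W (fst p) (snd p) * exp A"
          using cW[of "fst p" "snd p"] WA[of "fst p" "snd p"] by (intro mult_mono) auto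
        finally show ?thesis by (simp add: mult.commute)
      qed
      then show "(\<integral>f. Z (fst p) f * Z (snd p) f \<partial>\<mu>) \<le> exp A * W (fst p) (snd p)" for p
        by (rule abs_le_D1)
      show "integrable (?B \<Otimes>\<^sub>M ?B) (\<lambda>p. \<integral>f. Z (fst p) f * Z (snd p) f \<partial>\<mu>)"
        by (rule Q.integrable_snd[where f = "\<lambda>f p. Z (fst p) f * Z (snd p) f"])
           (use ZZ in \<open>auto intro!: Q.P.integrable_const_bound[where B = 4] simp: case_prod_beta'\<close>)
    qed
    also have "\<dots> = exp A * ?H R"
      unfolding W_def by (simp add: integral_lin integrable_lin intW)
    finally show ?thesis .
  qed
  have "((\<lambda>R. \<integral>f. \<bar>flow_avg R u f - m\<bar> \<partial>\<mu>) \<longlongrightarrow> 0) at_top"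
  proof (rule tendstoI)
    fix \<epsilon> :: real assume \<epsilon>: "\<epsilon> > 0"
    have "((\<lambda>R. exp A * ?H R) \<longlongrightarrow> 0) at_top" by (rule tendsto_mult_right_zero[OF H])
    then have "\<forall>\<^sub>F R in at_top. exp A * ?H R < \<epsilon>\<^sup>2"
      using \<epsilon> by (intro order_tendstoD(2)) auto
    then show "\<forall>\<^sub>F R in at_top. dist (\<integral>f. \<bar>flow_avg R u f - m\<bar> \<partial>\<mu>) 0 < \<epsilon>"
      using eventually_gt_at_top[of 0]
    proof eventually_elim
      case (elim R)
      define Y where "Y f = flow_avg R u f - m" for f
      have fm: "bounded_meas 1 (flow_avg R u)" by (rule flow_avg_bounded_meas[OF um elim(2)])
      have [measurable]: "Y \<in> borel_measurable \<mu>" unfolding Y_def using fm by (auto dest: bounded_measD(1))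
      have Y2: "\<bar>Y f\<bar> \<le> 2" if "f \<in> space \<mu>" for f
        unfolding Y_def using bounded_measD(2)[OF fm that] m1 by linarith
      have "(Y f)\<^sup>2 \<le> 4" if "f \<in> space \<mu>" for f
        using power_mono[OF Y2[OF that], of 2] by simp
      then have "integrable \<mu> (\<lambda>f. (Y f)\<^sup>2)"
        by (intro integrable_const_bound[where B = 4]) auto
      moreover have "integrable \<mu> (\<lambda>f. \<bar>Y f\<bar>)"
        using Y2 by (intro integrable_const_bound[where B = 2]) auto
      ultimately have int: "integrable \<mu> (\<lambda>f. (Y f)\<^sup>2)" "integrable \<mu> (\<lambda>f. \<bar>Y f\<bar>)" by blast+
      \<comment> \<open>The weights \<epsilon> / 2 and 1 / (2 \<epsilon>) turn a second moment below
        \<epsilon>^2 into a first moment below \<epsilon>.\<close>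
      have "(\<integral>f. \<bar>Y f\<bar> \<partial>\<mu>) \<le> (\<integral>f. \<epsilon> / 2 + (Y f)\<^sup>2 / (2 * \<epsilon>) \<partial>\<mu>)"
      proof (rule integral_mono)
        fix f
        have "0 \<le> (\<bar>Y f\<bar> - \<epsilon>)\<^sup>2" by simp
        then have "2 * \<epsilon> * \<bar>Y f\<bar> \<le> \<epsilon> * \<epsilon> + (Y f)\<^sup>2" by (simp add: power2_diff power2_eq_square algebra_simps)
        then show "\<bar>Y f\<bar> \<le> \<epsilon> / 2 + (Y f)\<^sup>2 / (2 * \<epsilon>)" using \<epsilon> by (simp add: field_simps)
      qed (use int in auto)
      also have "\<dots> = \<epsilon> / 2 + (\<integral>f. (Y f)\<^sup>2 \<partial>\<mu>) / (2 * \<epsilon>)"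
        using int prob_space by simp
      also have "(\<integral>f. (Y f)\<^sup>2 \<partial>\<mu>) < \<epsilon>\<^sup>2"
        using second_moment[OF elim(2)] elim(1) unfolding Y_def by linarith
      then have "\<epsilon> / 2 + (\<integral>f. (Y f)\<^sup>2 \<partial>\<mu>) / (2 * \<epsilon>) < \<epsilon> / 2 + \<epsilon>\<^sup>2 / (2 * \<epsilon>)"
        using \<epsilon> by (intro add_strict_left_mono divide_strict_right_mono) auto
      also have "\<dots> = \<epsilon>" using \<epsilon> by (simp add: power2_eq_square)
      finally show ?case unfolding Y_def by (simp add: abs_of_nonneg)
    qed
  qed
  then show ?thesis
    unfolding mean_ergodic_def m_def using um unfolding u_def by blast
qed

theorem ergodic: "bounded_meas K g \<Longrightarrow> mean_ergodic g"
proof -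
  assume g: "bounded_meas K g"
  interpret trig_class \<mu> "\<lambda>x f. f x" mean_ergodic
    by (rule trig_class_\<mu>) (blast intro: mean_ergodic_cos mean_ergodic_scale mean_ergodic_add mean_ergodic_lim)+
  show ?thesis by (rule H_bounded_measurable[where K = K]) (use g in auto)
qed

end

section \<open>Measurability of nodal domains\<close>

lemma pred_Bex_countable:
  assumes "countable X" "\<And>i. i \<in> X \<Longrightarrow> Measurable.pred M (P i)"
  shows "Measurable.pred M (\<lambda>x. \<exists>i\<in>X. P i x)"
proof -
  have "{x\<in>space M. \<exists>i\<in>X. P i x} = (\<Union>i\<in>X. {x\<in>space M. P i x})" by auto
  also have "\<dots> \<in> sets M"
    by (rule sets.countable_UN'[OF assms(1)]) (use assms(2) in \<open>auto simp: pred_def\<close>)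
  finally show ?thesis by (simp add: pred_def)
qed

lemma pred_Ball_countable:
  assumes "countable X" "\<And>i. i \<in> X \<Longrightarrow> Measurable.pred M (P i)"
  shows "Measurable.pred M (\<lambda>x. \<forall>i\<in>X. P i x)"
proof -
  have "Measurable.pred M (\<lambda>x. \<not> (\<exists>i\<in>X. \<not> P i x))"
    by (intro pred_intros_logic(2) pred_Bex_countable assms)
  then show ?thesis by simp
qed

text \<open>One countable dense set is fixed once and for all, so that conditions on open sets
  become countable quantifiers.\<close>

definition dense_points :: "'a::euclidean_space set" where
  "dense_points = (SOME D. countable D \<and> (\<forall>X. open X \<longrightarrow> X \<noteq> {} \<longrightarrow> (\<exists>d\<in>D. d \<in> X)))"

lemma dense_points: "countable (dense_points :: 'a::euclidean_space set)"
    "open X \<Longrightarrow> X \<noteq> {} \<Longrightarrow> \<exists>d\<in>dense_points. d \<in> (X :: 'a set)"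
proof -
  have "\<exists>D::'a set. countable D \<and> (\<forall>X. open X \<longrightarrow> X \<noteq> {} \<longrightarrow> (\<exists>d\<in>D. d \<in> X))"
    by (rule countable_dense_exists)
  from someI_ex[OF this]
  show "countable (dense_points :: 'a set)"
    and "open X \<Longrightarrow> X \<noteq> {} \<Longrightarrow> \<exists>d\<in>dense_points. d \<in> (X :: 'a set)"
    unfolding dense_points_def by blast+
qed

lemma closure_dense_points: "open X \<Longrightarrow> X \<subseteq> closure (X \<inter> dense_points)"
proof
  fix x assume X: "open X" "x \<in> X"
  show "x \<in> closure (X \<inter> dense_points)"
    unfolding closure_iff_nhds_not_empty
  proof safe
    fix A V assume "X \<inter> dense_points \<inter> A = {}" "x \<in> V" "open V" "V \<subseteq> A"
    moreover have "open (X \<inter> V)" "X \<inter> V \<noteq> {}" using X \<open>open V\<close> \<open>x \<in> V\<close> by auto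
    then obtain d where "d \<in> dense_points" "d \<in> X \<inter> V" using dense_points(2) by blast
    ultimately show False by blast
  qed
qed

section \<open>Connectivity through countably many balls of constant sign\<close>

definition grid_ball :: "'a::euclidean_space \<times> nat \<Rightarrow> 'a set" where
  "grid_ball b = ball (fst b) (1 / Suc (snd b))"

abbreviation grid :: "('a::euclidean_space \<times> nat) set" where
  "grid \<equiv> dense_points \<times> UNIV"

lemma countable_grid: "countable grid"
  by (intro countable_SIGMA dense_points) simp

lemma open_grid_ball [simp]: "open (grid_ball b)"
  by (simp add: grid_ball_def)

lemma connected_grid_ball [simp]: "connected (grid_ball b)"
  by (simp add: grid_ball_def)

lemma grid_ball_inside:
  assumes "open X" "x \<in> X"
  shows "\<exists>b\<in>grid. x \<in> grid_ball b \<and> grid_ball b \<subseteq> X"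
proof -
  obtain e where e: "e > 0" "ball x e \<subseteq> X" using assms open_contains_ball by blast
  then obtain k where k: "inverse (real (Suc k)) < e / 2" using reals_Archimedean[of "e / 2"] by auto
  obtain d where d: "d \<in> dense_points" "d \<in> ball x (1 / Suc k)"
    using dense_points(2)[of "ball x (1 / Suc k)"] by auto
  have "grid_ball (d, k) \<subseteq> ball x e"
  proof
    fix y assume "y \<in> grid_ball (d, k)"
    then have "dist d y < 1 / Suc k" "dist x d < 1 / Suc k" using d by (auto simp: grid_ball_def)
    then have "dist x y < 1 / Suc k + 1 / Suc k" using dist_triangle[of x y d] by linarith
    then show "y \<in> ball x e" using k by (simp add: inverse_eq_divide)
  qed
  then show ?thesis using d e by (intro bexI[of _ "(d, k)"]) (auto simp: grid_ball_def dist_commute)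
qed

text \<open>The uniform bound makes it possible to test the sign of a continuous function on a ball at
  countably many points.\<close>

definition sign_ball :: "('a::euclidean_space \<Rightarrow> real) \<Rightarrow> 'a \<times> nat \<Rightarrow> bool" where
  "sign_ball f b \<longleftrightarrow> (\<exists>j::nat. (\<forall>z\<in>dense_points. z \<in> grid_ball b \<longrightarrow> 1 / Suc j \<le> f z) \<or>
     (\<forall>z\<in>dense_points. z \<in> grid_ball b \<longrightarrow> f z \<le> - (1 / Suc j)))"

lemma sign_ball_nonzero:
  assumes f: "continuous_on UNIV f" and b: "sign_ball f b" and y: "y \<in> grid_ball b"
  shows "f y \<noteq> 0"
proof -
  have y': "y \<in> closure (grid_ball b \<inter> dense_points)"
    using closure_dense_points[of "grid_ball b"] y by auto
  obtain j :: nat where "(\<forall>z\<in>dense_points. z \<in> grid_ball b \<longrightarrow> 1 / Suc j \<le> f z) \<or>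
     (\<forall>z\<in>dense_points. z \<in> grid_ball b \<longrightarrow> f z \<le> - (1 / Suc j))"
    using b unfolding sign_ball_def by blast
  then show ?thesis
  proof
    assume "\<forall>z\<in>dense_points. z \<in> grid_ball b \<longrightarrow> 1 / Suc j \<le> f z"
    then have "grid_ball b \<inter> dense_points \<subseteq> {z. 1 / Suc j \<le> f z}" by auto
    then have "closure (grid_ball b \<inter> dense_points) \<subseteq> {z. 1 / Suc j \<le> f z}"
      by (rule closure_minimal) (intro closed_Collect_le continuous_on_const f)
    then have "1 / real (Suc j) \<le> f y" using y' by auto
    moreover have "1 / real (Suc j) > 0" by simp
    ultimately show ?thesis by linarith
  next
    assume "\<forall>z\<in>dense_points. z \<in> grid_ball b \<longrightarrow> f z \<le> - (1 / Suc j)"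
    then have "grid_ball b \<inter> dense_points \<subseteq> {z. f z \<le> - (1 / Suc j)}" by auto
    then have "closure (grid_ball b \<inter> dense_points) \<subseteq> {z. f z \<le> - (1 / Suc j)}"
      by (rule closure_minimal) (intro closed_Collect_le continuous_on_const f)
    then have "f y \<le> - (1 / real (Suc j))" using y' by auto
    moreover have "1 / real (Suc j) > 0" by simp
    ultimately show ?thesis by linarith
  qed
qed

lemma sign_ball_exists:
  assumes f: "continuous_on UNIV f" and y: "f y \<noteq> 0"
  shows "\<exists>b\<in>grid. sign_ball f b \<and> y \<in> grid_ball b"
proof -
  obtain j :: nat where j: "inverse (real (Suc j)) < \<bar>f y\<bar>" using reals_Archimedean[of "\<bar>f y\<bar>"] y by auto
  then have j': "1 / real (Suc j) < \<bar>f y\<bar>" by (simp add: inverse_eq_divide)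
  show ?thesis
  proof (cases "f y > 0")
    case True
    have "open {z. 1 / real (Suc j) < f z}" by (intro open_Collect_less continuous_on_const f)
    from grid_ball_inside[OF this, of y] obtain b where "b \<in> grid" "y \<in> grid_ball b" "grid_ball b \<subseteq> {z. 1 / real (Suc j) < f z}"
      using j' True by auto
    then show ?thesis by (intro bexI[of _ b]) (auto simp: sign_ball_def intro!: exI[of _ j] less_imp_le)
  next
    case False
    have "open {z. f z < - (1 / real (Suc j))}" by (intro open_Collect_less continuous_on_const f)
    from grid_ball_inside[OF this, of y] obtain b where "b \<in> grid" "y \<in> grid_ball b" "grid_ball b \<subseteq> {z. f z < - (1 / real (Suc j))}"
      using j' False by auto
    then show ?thesis by (intro bexI[of _ b]) (auto simp: sign_ball_def intro!: exI[of _ j] less_imp_le)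
  qed
qed

text \<open>Path-free connectedness: finitely many successively overlapping grid balls on each of
  which \<open>f\<close> keeps away from 0. Reachability quantifies over countable sets, which the
  definition of a component does not.\<close>

primrec chain :: "('a::euclidean_space \<Rightarrow> real) \<Rightarrow> 'a \<times> nat \<Rightarrow> nat \<Rightarrow> 'a \<times> nat \<Rightarrow> bool" where
  "chain f b 0 b' \<longleftrightarrow> sign_ball f b \<and> b' = b"
| "chain f b (Suc m) b' \<longleftrightarrow> (\<exists>c\<in>grid. chain f b m c \<and> sign_ball f b' \<and> grid_ball c \<inter> grid_ball b' \<noteq> {})"

text \<open>The domain is indexed by one of its points; it is empty when that point is a zero of
  \<open>f\<close>.\<close>

definition nodal_domain :: "('a::euclidean_space \<Rightarrow> real) \<Rightarrow> 'a \<Rightarrow> 'a set" where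
  "nodal_domain f x = connected_component_set {y. f y \<noteq> 0} x"

lemma chain_subset:
  assumes f: "continuous_on UNIV f" and x: "x \<in> grid_ball b"
  shows "chain f b m b' \<Longrightarrow> grid_ball b' \<subseteq> nodal_domain f x"
proof (induction m arbitrary: b')
  case 0
  then have b: "sign_ball f b" "b' = b" by auto
  have "grid_ball b \<subseteq> {y. f y \<noteq> 0}" using sign_ball_nonzero[OF f b(1)] by blast
  then show ?case using x unfolding nodal_domain_def b(2)
    by (intro connected_component_maximal) auto
next
  case (Suc m)
  then obtain c where c: "chain f b m c" "sign_ball f b'" "grid_ball c \<inter> grid_ball b' \<noteq> {}" by auto
  then obtain z where z: "z \<in> grid_ball c" "z \<in> grid_ball b'" by auto
  then have "z \<in> nodal_domain f x" using Suc.IH[OF c(1)] by auto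
  then have "nodal_domain f z = nodal_domain f x" unfolding nodal_domain_def by (rule connected_component_eq)
  moreover have "grid_ball b' \<subseteq> nodal_domain f z"
    unfolding nodal_domain_def
    by (rule connected_component_maximal) (use sign_ball_nonzero[OF f c(2)] z in auto)
  ultimately show ?case by simp
qed

text \<open>The balls reachable from \<open>b\<close> and the remaining balls of constant sign have
  disjoint open unions covering the domain; connectedness leaves room for the first only.\<close>

lemma mem_nodal_domain_iff_chain:
  assumes f: "continuous_on UNIV f"
  shows "y \<in> nodal_domain f x \<longleftrightarrow>
    (\<exists>b\<in>grid. \<exists>b'\<in>grid. \<exists>m. x \<in> grid_ball b \<and> y \<in> grid_ball b' \<and> chain f b m b')"
proof
  assume y: "y \<in> nodal_domain f x"
  then have "x \<in> {y. f y \<noteq> 0}" unfolding nodal_domain_def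
    by (metis connected_component_eq_empty empty_iff)
  then obtain b where b: "b \<in> grid" "sign_ball f b" "x \<in> grid_ball b"
    using sign_ball_exists[OF f] by blast
  define W where "W = \<Union>{grid_ball b' | b'. b' \<in> grid \<and> (\<exists>m. chain f b m b')}"
  define V where "V = \<Union>{grid_ball b' | b'. b' \<in> grid \<and> sign_ball f b' \<and> \<not> (\<exists>m. chain f b m b')}"
  have disj: "W \<inter> V = {}"
  proof (rule equals0I)
    fix z assume "z \<in> W \<inter> V"
    then obtain c c' m where "c \<in> grid" "chain f b m c" "z \<in> grid_ball c"
      "sign_ball f c'" "\<not> (\<exists>m. chain f b m c')" "z \<in> grid_ball c'" unfolding W_def V_def by blast
    then have "chain f b (Suc m) c'" by auto
    \<comment> \<open>An overlap of the two unions would prolong the chain by one ball,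
      contradicting that its last ball is unreachable.\<close>
    then show False using \<open>\<not> (\<exists>m. chain f b m c')\<close> by blast
  qed
  have cov: "nodal_domain f x \<subseteq> W \<union> V"
  proof
    fix z assume "z \<in> nodal_domain f x"
    then have "f z \<noteq> 0" unfolding nodal_domain_def using connected_component_subset by blast
    then obtain c where "c \<in> grid" "sign_ball f c" "z \<in> grid_ball c" using sign_ball_exists[OF f] by blast
    then show "z \<in> W \<union> V" unfolding W_def V_def by (cases "\<exists>m. chain f b m c") blast+
  qed
  have conn: "connected (nodal_domain f x)" unfolding nodal_domain_def by simp
  have op: "open W" "open V" unfolding W_def V_def by (auto intro!: open_Union)
  have alt: "W \<inter> nodal_domain f x = {} \<or> V \<inter> nodal_domain f x = {}"
    by (rule connectedD[OF conn op _ cov]) (use disj in blast)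
  have "chain f b 0 b" using b by simp
  then have "x \<in> W" unfolding W_def using b by blast
  moreover have "x \<in> nodal_domain f x" unfolding nodal_domain_def
    using \<open>x \<in> {y. f y \<noteq> 0}\<close> by simp
  ultimately have "y \<in> W" using alt cov y by blast
  then obtain b' m where "b' \<in> grid" "chain f b m b'" "y \<in> grid_ball b'" unfolding W_def by blast
  then show "\<exists>b\<in>grid. \<exists>b'\<in>grid. \<exists>m. x \<in> grid_ball b \<and> y \<in> grid_ball b' \<and> chain f b m b'"
    using b(1,3) by (intro bexI[of _ b] bexI[of _ b'] exI[of _ m] conjI)
next
  assume "\<exists>b\<in>grid. \<exists>b'\<in>grid. \<exists>m. x \<in> grid_ball b \<and> y \<in> grid_ball b' \<and> chain f b m b'"
  then show "y \<in> nodal_domain f x" using chain_subset[OF f] by blast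
qed

lemma sign_ball_measurable: "Measurable.pred path_space (\<lambda>f. sign_ball f b)"
proof -
  note eval_measurable [measurable]
  have "Measurable.pred path_space (\<lambda>f. \<forall>z\<in>dense_points. z \<in> grid_ball b \<longrightarrow> 1 / Suc j \<le> f z)" for j
    by (intro pred_Ball_countable dense_points) measurable
  moreover have "Measurable.pred path_space (\<lambda>f. \<forall>z\<in>dense_points. z \<in> grid_ball b \<longrightarrow> f z \<le> - (1 / Suc j))" for j
    by (intro pred_Ball_countable dense_points) measurable
  ultimately show ?thesis unfolding sign_ball_def by measurable
qed

lemma chain_measurable: "Measurable.pred path_space (\<lambda>f. chain f b m b')"
proof (induction m arbitrary: b')
  case 0
  note sign_ball_measurable [measurable]
  show ?case unfolding chain.simps by measurable
next
  case (Suc m)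
  note sign_ball_measurable [measurable] Suc [measurable]
  show ?case unfolding chain.simps
    by (intro pred_Bex_countable countable_grid) measurable
qed

lemma nodal_domain_pred:
  "Measurable.pred (((borel :: (real ^ 'n) measure) \<Otimes>\<^sub>M path_space) \<Otimes>\<^sub>M borel) (\<lambda>q. snd q \<in> nodal_domain (snd (fst q)) (fst (fst q)))"
proof -
  have "Measurable.pred (((borel :: (real ^ 'n) measure) \<Otimes>\<^sub>M path_space) \<Otimes>\<^sub>M borel)
    (\<lambda>q. \<exists>b\<in>grid. \<exists>b'\<in>grid. \<exists>m. fst (fst q) \<in> grid_ball b \<and> snd q \<in> grid_ball b' \<and> chain (snd (fst q)) b m b')"
  proof (intro pred_Bex_countable pred_intros_countable(2) pred_intros_logic(3) countable_grid)
    fix b b' :: "(real ^ 'n) \<times> nat" and m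
    have [measurable]: "grid_ball c \<in> sets borel" for c :: "(real ^ 'n) \<times> nat" by simp
    show "Measurable.pred ((borel \<Otimes>\<^sub>M path_space) \<Otimes>\<^sub>M borel) (\<lambda>q. fst (fst q) \<in> grid_ball b)" by measurable
    show "Measurable.pred ((borel \<Otimes>\<^sub>M path_space) \<Otimes>\<^sub>M borel) (\<lambda>q. snd q \<in> grid_ball b')" by measurable
    show "Measurable.pred ((borel \<Otimes>\<^sub>M path_space) \<Otimes>\<^sub>M borel) (\<lambda>q. chain (snd (fst q)) b m b')"
      by (rule measurable_compose[OF _ chain_measurable]) measurable
  qed
  moreover have "(\<exists>b\<in>grid. \<exists>b'\<in>grid. \<exists>m. fst (fst q) \<in> grid_ball b \<and> snd q \<in> grid_ball b' \<and> chain (snd (fst q)) b m b') \<longleftrightarrow>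
      snd q \<in> nodal_domain (snd (fst q)) (fst (fst q))"
    if "q \<in> space ((borel \<Otimes>\<^sub>M path_space) \<Otimes>\<^sub>M borel)" for q :: "((real ^ 'n) \<times> (real ^ 'n \<Rightarrow> real)) \<times> (real ^ 'n)"
  proof -
    have "C_k 2 (snd (fst q))" using that by (auto simp: space_pair_measure)
    from mem_nodal_domain_iff_chain[OF C_k_continuous[OF this]] show ?thesis by blast
  qed
  ultimately show ?thesis by (rule measurable_cong[THEN iffD1, rotated])
qed

lemma nodal_volume_measurable:
  "(\<lambda>p. emeasure lborel (nodal_domain (snd p) (fst p))) \<in> borel_measurable (borel \<Otimes>\<^sub>M path_space)"
proof -
  let ?Q = "{q \<in> space ((borel \<Otimes>\<^sub>M path_space) \<Otimes>\<^sub>M lborel). snd q \<in> nodal_domain (snd (fst q)) (fst (fst q))}"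
  have "?Q \<in> sets ((borel \<Otimes>\<^sub>M path_space) \<Otimes>\<^sub>M lborel)"
    using predE[OF nodal_domain_pred] by (simp add: space_pair_measure cong: sets_pair_measure_cong)
  from lborel.measurable_emeasure_Pair[OF this]
  show ?thesis
    by (rule measurable_cong[THEN iffD1, rotated])
       (auto simp: space_pair_measure intro!: arg_cong[where f = "emeasure lborel"])
qed

lemma open_nodal_domain:
  assumes "continuous_on UNIV f" shows "open (nodal_domain f x)"
proof -
  have "open {y. f y \<noteq> 0}" by (intro open_Collect_neq assms continuous_on_const)
  then show ?thesis unfolding nodal_domain_def by (rule open_connected_component)
qed

text \<open>An open domain that contains a point of norm at least R also contains an open set of
  points of norm above R, hence a point of the dense set.\<close>

lemma nodal_domain_subset_ball_iff:
  assumes f: "continuous_on UNIV f" and R: "R > 0"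
  shows "nodal_domain f x \<subseteq> ball 0 R \<longleftrightarrow> (\<forall>z\<in>dense_points. R \<le> norm z \<longrightarrow> z \<notin> nodal_domain f x)"
proof
  assume *: "\<forall>z\<in>dense_points. R \<le> norm z \<longrightarrow> z \<notin> nodal_domain f x"
  show "nodal_domain f x \<subseteq> ball 0 R"
  proof (rule ccontr)
    assume "\<not> nodal_domain f x \<subseteq> ball 0 R"
    then obtain y where y: "y \<in> nodal_domain f x" "R \<le> norm y" by (force simp: not_less)
    obtain e where e: "e > 0" "ball y e \<subseteq> nodal_domain f x"
      using open_nodal_domain[OF f, of x] y open_contains_ball by blast
    \<comment> \<open>The point is pushed outwards by e / 2, inside the ball contained in the domain
      but strictly beyond radius R.\<close>
    define t where "t = e / (2 * norm y)"
    have ny: "norm y > 0" using y R by linarith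
    have t: "t > 0" unfolding t_def using e ny by simp
    let ?y = "(1 + t) *\<^sub>R y"
    have "dist y ?y = t * norm y" using t by (simp add: dist_norm algebra_simps)
    then have "?y \<in> ball y e" using e ny by (simp add: t_def)
    moreover have "R < norm ?y"
    proof -
      have "norm ?y = (1 + t) * norm y" using t by simp
      then have "norm ?y = norm y + t * norm y" by (simp add: distrib_right)
      moreover have "t * norm y > 0" using t ny by simp
      ultimately show ?thesis using y by linarith
    qed
    ultimately have "ball y e \<inter> {z. R < norm z} \<noteq> {}" by blast
    moreover have "open (ball y e \<inter> {z. R < norm z})"
      by (intro open_Int open_ball open_Collect_less continuous_intros)
    ultimately obtain d where "d \<in> dense_points" "d \<in> ball y e" "R < norm d"
      using dense_points(2) by blast
    then show False using * e by auto
  qed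
qed auto

lemma nodal_domain_subset_pred:
  assumes "R > 0"
  shows "Measurable.pred ((borel :: (real ^ 'n) measure) \<Otimes>\<^sub>M path_space) (\<lambda>p. nodal_domain (snd p) (fst p) \<subseteq> ball 0 R)"
proof -
  have "Measurable.pred ((borel :: (real ^ 'n) measure) \<Otimes>\<^sub>M path_space) (\<lambda>p. \<forall>z\<in>dense_points. R \<le> norm z \<longrightarrow> z \<notin> nodal_domain (snd p) (fst p))"
  proof (intro pred_Ball_countable pred_intros_imp' pred_intros_logic(2) dense_points)
    fix z :: "real ^ 'n"
    have "(\<lambda>p. (p, z)) \<in> borel \<Otimes>\<^sub>M path_space \<rightarrow>\<^sub>M (borel \<Otimes>\<^sub>M path_space) \<Otimes>\<^sub>M borel" by measurable
    from measurable_compose[OF this nodal_domain_pred]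
    show "Measurable.pred (borel \<Otimes>\<^sub>M path_space) (\<lambda>p. z \<in> nodal_domain (snd p) (fst p))" by simp
  qed
  moreover have "(\<forall>z\<in>dense_points. R \<le> norm z \<longrightarrow> z \<notin> nodal_domain (snd p) (fst p)) \<longleftrightarrow>
      nodal_domain (snd p) (fst p) \<subseteq> ball 0 R" if "p \<in> space (borel \<Otimes>\<^sub>M path_space)" for p :: "(real ^ 'n) \<times> (real ^ 'n \<Rightarrow> real)"
  proof -
    have "C_k 2 (snd p)" using that by (auto simp: space_pair_measure)
    from nodal_domain_subset_ball_iff[OF C_k_continuous[OF this] assms] show ?thesis by blast
  qed
  ultimately show ?thesis by (rule measurable_cong[THEN iffD1, rotated])
qed


section \<open>The density of nodal domains\<close>

text \<open>The test for \<open>f x \<noteq> 0\<close> is essential: at a zero the domain is empty,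
  it would pass the other two tests, and 1 / 0 is infinite.\<close>

definition nodal_density :: "ennreal \<Rightarrow> real \<Rightarrow> (real ^ 'n \<Rightarrow> real) \<Rightarrow> real ^ 'n \<Rightarrow> ennreal" where
  "nodal_density t R f x = (if f x \<noteq> 0 \<and> nodal_domain f x \<subseteq> ball 0 R \<and> emeasure lborel (nodal_domain f x) \<le> t
     then 1 / emeasure lborel (nodal_domain f x) else 0)"

lemma nodal_density_measurable:
  assumes "R > 0"
  shows "(\<lambda>p. nodal_density t R (snd p) (fst p)) \<in> borel_measurable (borel \<Otimes>\<^sub>M path_space)"
proof -
  note nodal_volume_measurable [measurable] eval_pair_measurable [measurable]
    nodal_domain_subset_pred[OF assms, measurable]
  show ?thesis unfolding nodal_density_def by measurable
qed

lemma nodal_density_path_measurable: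
  assumes f: "C_k 2 f" and "R > 0"
  shows "nodal_density t R f \<in> borel_measurable borel"
proof -
  have "(\<lambda>x. (x, f)) \<in> borel \<rightarrow>\<^sub>M borel \<Otimes>\<^sub>M path_space" by (rule measurable_Pair2') (simp add: f)
  from measurable_compose[OF this nodal_density_measurable[OF \<open>R > 0\<close>]] show ?thesis by simp
qed

lemma nodal_domains_iff: "\<omega> \<in> nodal_domains f \<longleftrightarrow> (\<exists>x. f x \<noteq> 0 \<and> \<omega> = nodal_domain f x)"
proof -
  have "UNIV - f -` {0} = {y. f y \<noteq> 0}" by auto
  then show ?thesis unfolding nodal_domains_def nodal_domain_def by (auto simp: components_iff)
qed

lemma nodal_domain_self: "f x \<noteq> 0 \<Longrightarrow> x \<in> nodal_domain f x"
  unfolding nodal_domain_def by simp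

lemma nodal_domain_nonzero: "x \<in> nodal_domain f y \<Longrightarrow> f x \<noteq> 0"
  unfolding nodal_domain_def using connected_component_subset by blast

lemma nodal_domain_eq: "y \<in> nodal_domain f x \<Longrightarrow> nodal_domain f y = nodal_domain f x"
  unfolding nodal_domain_def by (rule connected_component_eq)

lemma nodal_domain_volume:
  fixes f :: "'a::euclidean_space \<Rightarrow> real"
  assumes f: "continuous_on UNIV f" and x: "f x \<noteq> 0"
  shows "emeasure lborel (nodal_domain f x) > 0"
    and "bounded (nodal_domain f x) \<Longrightarrow> emeasure lborel (nodal_domain f x) < \<infinity>"
proof -
  obtain e where e: "e > 0" "ball x e \<subseteq> nodal_domain f x"
    using open_nodal_domain[OF f, of x] nodal_domain_self[where f = f and x = x, OF x]
      open_contains_ball by blast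
  have "0 < emeasure lborel (ball x e)" using e by (simp add: emeasure_ball_eq)
  also have "\<dots> \<le> emeasure lborel (nodal_domain f x)"
    using e open_nodal_domain[OF f, of x] by (intro emeasure_mono) auto
  finally show "emeasure lborel (nodal_domain f x) > 0" .
  show "bounded (nodal_domain f x) \<Longrightarrow> emeasure lborel (nodal_domain f x) < \<infinity>"
    by (rule emeasure_bounded_finite)
qed

text \<open>Every counted domain contributes the integral of the constant \<open>1 / vol\<close> over itself.\<close>

lemma nodal_count_eq_integral:
  fixes f :: "real ^ 'n \<Rightarrow> real"
  assumes f: "C_k 2 f" and R: "R > 0"
  shows "nodal_count f t R = (\<integral>\<^sup>+x. nodal_density t R f x \<partial>lborel)"
proof -
  have cont: "continuous_on UNIV f" using f by (rule C_k_continuous)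
  define S where "S = {\<omega> \<in> nodal_domains f. \<omega> \<subseteq> ball 0 R \<and> emeasure lborel \<omega> \<le> t}"
  have S_open: "open \<omega>" if "\<omega> \<in> S" for \<omega>
    using that open_nodal_domain[OF cont] unfolding S_def nodal_domains_iff by auto
  have disj: "\<omega> \<inter> \<omega>' = {}" if w: "\<omega> \<in> S" "\<omega>' \<in> S" "\<omega> \<noteq> \<omega>'" for \<omega> \<omega>'
  proof (rule ccontr)
    assume "\<omega> \<inter> \<omega>' \<noteq> {}"
    then obtain z where z: "z \<in> \<omega>" "z \<in> \<omega>'" by blast
    obtain x x' where "\<omega> = nodal_domain f x" "\<omega>' = nodal_domain f x'"
      using w(1,2) unfolding S_def nodal_domains_iff by auto
    then show False using z nodal_domain_eq[of z f x] nodal_domain_eq[of z f x'] w(3) by simp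
  qed
  \<comment> \<open>The domains are disjoint and open, so there are countably many and the measure
    \<nu> adds up over them.\<close>
  have "countable S"
    by (rule countable_disjoint_open_subsets) (use S_open disj in \<open>auto simp: pairwise_def disjnt_def\<close>)
  have [measurable]: "nodal_density t R f \<in> borel_measurable borel"
    by (rule nodal_density_path_measurable[OF f R])
  define \<nu> where "\<nu> = density lborel (nodal_density t R f)"
  have \<nu>: "emeasure \<nu> A = (\<integral>\<^sup>+x. nodal_density t R f x * indicator A x \<partial>lborel)" if "A \<in> sets borel" for A
    unfolding \<nu>_def using that by (simp add: emeasure_density)
  have \<nu>S: "emeasure \<nu> \<omega> = 1" if \<omega>: "\<omega> \<in> S" for \<omega>
  proof -
    obtain x where x: "f x \<noteq> 0" "\<omega> = nodal_domain f x" using \<omega> unfolding S_def nodal_domains_iff by auto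
    have b: "bounded \<omega>" using \<omega> unfolding S_def by (auto intro: bounded_subset[OF bounded_ball])
    note vol = nodal_domain_volume[OF cont x(1), folded x(2)]
    have "nodal_density t R f y * indicator \<omega> y = 1 / emeasure lborel \<omega> * indicator \<omega> y" for y
    proof (cases "y \<in> \<omega>")
      case True
      then have "nodal_domain f y = \<omega>" "f y \<noteq> 0" using x nodal_domain_eq nodal_domain_nonzero by blast+
      then show ?thesis using \<omega> unfolding S_def nodal_density_def by auto
    qed simp
    then have "emeasure \<nu> \<omega> = (\<integral>\<^sup>+y. 1 / emeasure lborel \<omega> * indicator \<omega> y \<partial>lborel)"
      using S_open[OF \<omega>] by (simp add: \<nu>)
    also have "\<dots> = 1 / emeasure lborel \<omega> * emeasure lborel \<omega>"
      using S_open[OF \<omega>] by (intro nn_integral_cmult_indicator) simp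
    also have "\<dots> = 1"
      using vol b by (simp add: ennreal_divide_times)
    finally show ?thesis .
  qed
  have "(\<integral>\<^sup>+x. nodal_density t R f x \<partial>lborel) = (\<integral>\<^sup>+x. nodal_density t R f x * indicator (\<Union>\<omega>\<in>S. \<omega>) x \<partial>lborel)"
  proof (rule nn_integral_cong)
    fix x
    have "nodal_density t R f x = 0" if "x \<notin> (\<Union>\<omega>\<in>S. \<omega>)"
    proof (rule ccontr)
      assume "nodal_density t R f x \<noteq> 0"
      then have "f x \<noteq> 0" "nodal_domain f x \<in> S"
        unfolding nodal_density_def S_def nodal_domains_iff by (auto split: if_splits)
      then show False using that nodal_domain_self by blast
    qed
    then show "nodal_density t R f x = nodal_density t R f x * indicator (\<Union>\<omega>\<in>S. \<omega>) x"
      by (auto simp: indicator_def)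
  qed
  also have "\<dots> = emeasure \<nu> (\<Union>\<omega>\<in>S. \<omega>)"
    by (rule \<nu>[symmetric]) (use S_open in \<open>auto intro!: borel_open open_Union\<close>)
  also have "\<dots> = (\<integral>\<^sup>+\<omega>. emeasure \<nu> \<omega> \<partial>count_space S)"
    by (rule emeasure_UN_countable)
       (use \<open>countable S\<close> S_open disj in \<open>auto simp: \<nu>_def disjoint_family_on_def\<close>)
  also have "\<dots> = (\<integral>\<^sup>+\<omega>. 1 \<partial>count_space S)"
    by (rule nn_integral_cong) (simp add: \<nu>S)
  also have "\<dots> = emeasure (count_space S) S" by simp
  also have "\<dots> = emeasure (count_space UNIV) S"
    by (cases "finite S") (simp_all add: emeasure_count_space_finite emeasure_count_space_infinite)
  also have "\<dots> = nodal_count f t R" unfolding nodal_count_def S_def ..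
  finally show ?thesis ..
qed

section \<open>Translation of nodal domains and the local bounds on their density\<close>

lemma nodal_domain_path_shift: "nodal_domain (path_shift x f) y = (\<lambda>z. z - x) ` nodal_domain f (x + y)"
proof -
  have sub: "(\<lambda>z. z - a) ` nodal_domain g (a + y) \<subseteq> nodal_domain (path_shift a g) y" for a g y
  proof (cases "g (a + y) = 0")
    case True
    then have "nodal_domain g (a + y) = {}" unfolding nodal_domain_def
      by (subst connected_component_eq_empty) simp
    then show ?thesis by simp
  next
    case False
    show ?thesis unfolding nodal_domain_def[of "path_shift a g"]
    proof (rule connected_component_maximal)
      show "y \<in> (\<lambda>z. z - a) ` nodal_domain g (a + y)"
        using nodal_domain_self[of g "a + y"] False by (intro image_eqI[of _ _ "a + y"]) auto
      show "connected ((\<lambda>z. z - a) ` nodal_domain g (a + y))"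
        unfolding nodal_domain_def by (intro connected_continuous_image continuous_intros) simp
      show "(\<lambda>z. z - a) ` nodal_domain g (a + y) \<subseteq> {y. path_shift a g y \<noteq> 0}"
        by (auto simp: path_shift_def dest: nodal_domain_nonzero)
    qed
  qed
  \<comment> \<open>The reverse inclusion is the same one for the shifted path, translated back by
    \<open>- x\<close>.\<close>
  have "(\<lambda>z. z - (- x)) ` nodal_domain (path_shift x f) (- x + (x + y)) \<subseteq> nodal_domain (path_shift (- x) (path_shift x f)) (x + y)"
    by (rule sub)
  then have "(\<lambda>z. z + x) ` nodal_domain (path_shift x f) y \<subseteq> nodal_domain f (x + y)"
    by (simp add: path_shift_def)
  then have "nodal_domain (path_shift x f) y \<subseteq> (\<lambda>z. z - x) ` nodal_domain f (x + y)"
    by (force simp: image_iff)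
  then show ?thesis using sub[of x f y] by blast
qed

lemma nodal_density_path_shift:
  fixes f :: "real ^ 'n \<Rightarrow> real"
  assumes f: "C_k 2 f"
  shows "nodal_density t r (path_shift x f) 0 =
    (if f x \<noteq> 0 \<and> nodal_domain f x \<subseteq> ball x r \<and> emeasure lborel (nodal_domain f x) \<le> t
     then 1 / emeasure lborel (nodal_domain f x) else 0)"
proof -
  have op: "open (nodal_domain f x)" using f by (intro open_nodal_domain C_k_continuous)
  have vol: "emeasure lborel ((\<lambda>z. z - x) ` nodal_domain f x) = emeasure lborel (nodal_domain f x)"
  proof -
    have "(\<lambda>z. z - x) ` nodal_domain f x = (+) x -` nodal_domain f x" by (force simp: image_iff)
    then have "emeasure lborel ((\<lambda>z. z - x) ` nodal_domain f x) = emeasure (distr lborel borel ((+) x)) (nodal_domain f x)"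
      using op by (subst emeasure_distr) auto
    then show ?thesis by (simp add: lborel_distr_plus)
  qed
  have "(\<lambda>z. z - x) ` nodal_domain f x \<subseteq> ball 0 r \<longleftrightarrow> nodal_domain f x \<subseteq> ball x r"
    by (auto simp: dist_norm norm_minus_commute)
  then show ?thesis
    unfolding nodal_density_def nodal_domain_path_shift add_0_right vol by (simp add: path_shift_def)
qed

text \<open>A domain within distance r of x lies in \<open>ball 0 R\<close> as soon as
  \<open>norm x \<le> R - r\<close>; this discards domains that are too large and points too close
  to the boundary.\<close>

lemma nodal_density_lower:
  assumes f: "C_k 2 f" and x: "norm x \<le> R - r"
  shows "nodal_density t r (path_shift x f) 0 \<le> nodal_density t R f x"
proof -
  have "ball x r \<subseteq> ball 0 R"
  proof
    fix y assume "y \<in> ball x r"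
    then show "y \<in> ball 0 R" using x norm_triangle_ineq4[of x "x - y"] by (simp add: dist_norm)
  qed
  then show ?thesis unfolding nodal_density_path_shift[OF f] nodal_density_def[of t R] by auto
qed

lemma nodal_density_upper:
  assumes f: "C_k 2 f"
  shows "nodal_density t R f x \<le> (SUP r. nodal_density t (real (Suc r)) (path_shift x f) 0) * indicator (ball 0 R) x"
proof (cases "nodal_density t R f x = 0")
  case False
  then have *: "f x \<noteq> 0" "nodal_domain f x \<subseteq> ball 0 R" "emeasure lborel (nodal_domain f x) \<le> t"
    unfolding nodal_density_def by (auto split: if_splits)
  then have x: "x \<in> ball 0 R" using nodal_domain_self by blast
  \<comment> \<open>Two points of \<open>ball 0 R\<close> are less than 2 R apart, so this radius
    around \<open>x\<close> contains every counted domain.\<close>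
  obtain r :: nat where r: "2 * R < real r" using reals_Archimedean2 by blast
  have "ball 0 R \<subseteq> ball x (real (Suc r))"
  proof
    fix y :: "real ^ 'a" assume "y \<in> ball 0 R"
    then show "y \<in> ball x (real (Suc r))" using x r norm_triangle_ineq4[of x y] by (simp add: dist_norm)
  qed
  then have "nodal_domain f x \<subseteq> ball x (real (Suc r))" using * by blast
  then have "nodal_density t R f x = nodal_density t (real (Suc r)) (path_shift x f) 0"
    unfolding nodal_density_path_shift[OF f] nodal_density_def[of t R] using * by auto
  also have "\<dots> \<le> (SUP r. nodal_density t (real (Suc r)) (path_shift x f) 0)" by (rule SUP_upper) simp
  finally show ?thesis using x by simp
qed simp

lemma nodal_density_mono: "r \<le> R \<Longrightarrow> nodal_density t r f x \<le> nodal_density t R f x"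
proof -
  assume "r \<le> R"
  then have "ball 0 r \<subseteq> (ball 0 R :: (real ^ 'a) set)" by auto
  then show ?thesis unfolding nodal_density_def by auto
qed

lemma nodal_count_mono: "r \<le> R \<Longrightarrow> nodal_count f t r \<le> nodal_count f t R"
proof -
  assume "r \<le> R"
  then have "ball 0 r \<subseteq> (ball 0 R :: (real ^ 'a) set)" by auto
  then show ?thesis unfolding nodal_count_def by (intro emeasure_mono) auto
qed

section \<open>Limits of counts enclosed by ergodic averages\<close>

text \<open>From integer to real radii. Monotonicity traps \<open>n R\<close> between its values at
  the floor m of R and at m + 1; comparing with the balls of radii R - 1 and R + 1 loses a volume
  ratio tending to 1.\<close>

lemma mono_ball_ratio_tendsto:
  fixes n :: "real \<Rightarrow> real" and c :: real
  defines "V \<equiv> \<lambda>R. measure lborel (ball (0::'a::euclidean_space) R)"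
  assumes mono: "\<And>r R. r \<le> R \<Longrightarrow> n r \<le> n R" and nonneg: "\<And>R. 0 \<le> n R"
    and lim: "(\<lambda>m::nat. n (real m) / V (real m)) \<longlonglongrightarrow> c"
  shows "((\<lambda>R. n R / V R) \<longlongrightarrow> c) at_top"
proof -
  define x where "x m = n (real m) / V (real m)" for m :: nat
  have Vmono: "V r \<le> V R" if "r \<le> R" for r R
    unfolding V_def using that by (intro measure_mono_fmeasurable) (auto simp: fmeasurable_def emeasure_ball_eq)
  have floor: "filterlim (\<lambda>R::real. nat \<lfloor>R\<rfloor>) sequentially at_top"
    by (intro filterlim_compose[OF filterlim_nat_sequentially filterlim_floor_sequentially])
  have floor1: "filterlim (\<lambda>R::real. nat \<lfloor>R\<rfloor> + 1) sequentially at_top"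
    by (rule filterlim_compose[OF filterlim_add_const_nat_at_top floor])
  have l: "((\<lambda>R. x (nat \<lfloor>R\<rfloor>) * (V (R - 1) / V R)) \<longlongrightarrow> c * 1) at_top"
    unfolding V_def x_def[unfolded V_def]
    by (intro tendsto_mult measure_ball_ratio_tendsto filterlim_compose[OF lim[unfolded V_def] floor])
  have u: "((\<lambda>R. x (nat \<lfloor>R\<rfloor> + 1) * (V (R - (-1)) / V R)) \<longlongrightarrow> c * 1) at_top"
    unfolding V_def x_def[unfolded V_def]
    by (intro tendsto_mult measure_ball_ratio_tendsto filterlim_compose[OF lim[unfolded V_def] floor1])
  show ?thesis
  proof (rule tendsto_sandwich[OF _ _ l[unfolded mult_1_right] u[unfolded mult_1_right]])
    show "\<forall>\<^sub>F R in at_top. x (nat \<lfloor>R\<rfloor>) * (V (R - 1) / V R) \<le> n R / V R"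
      using eventually_ge_at_top[of 1]
    proof eventually_elim
      case (elim R)
      let ?m = "real (nat \<lfloor>R\<rfloor>)"
      have m: "?m \<le> R" "R - 1 \<le> ?m" "0 < ?m" using elim by linarith+
      have V: "V ?m > 0" "V R > 0" unfolding V_def using m elim by simp_all
      have "x (nat \<lfloor>R\<rfloor>) * V (R - 1) \<le> n ?m / V ?m * V ?m"
        unfolding x_def using V nonneg[of ?m] by (intro mult_left_mono Vmono m) auto
      also have "\<dots> \<le> n R" using V mono[OF m(1)] by simp
      finally show ?case using V by (simp add: field_simps)
    qed
    show "\<forall>\<^sub>F R in at_top. n R / V R \<le> x (nat \<lfloor>R\<rfloor> + 1) * (V (R - (-1)) / V R)"
      using eventually_ge_at_top[of 1]
    proof eventually_elim
      case (elim R)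
      let ?m = "real (nat \<lfloor>R\<rfloor> + 1)"
      have m: "R \<le> ?m" "?m \<le> R - (-1)" "0 < ?m" using elim by linarith+
      have V: "V ?m > 0" "V R > 0" unfolding V_def using m elim by simp_all
      have "n R \<le> n ?m" by (rule mono[OF m(1)])
      also have "\<dots> = n ?m / V ?m * V ?m" using V by simp
      also have "\<dots> \<le> x (nat \<lfloor>R\<rfloor> + 1) * V (R - (-1))"
        unfolding x_def using V nonneg[of ?m] by (intro mult_left_mono Vmono m) auto
      finally show ?case using V by (simp add: field_simps)
    qed
  qed
qed

lemma tendsto_0_le_ennreal:
  fixes f :: "'a \<Rightarrow> ennreal"
  assumes "\<And>\<epsilon>::real. \<epsilon> > 0 \<Longrightarrow> \<forall>\<^sub>F x in F. f x \<le> ennreal \<epsilon>"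
  shows "(f \<longlongrightarrow> 0) F"
proof (rule order_tendstoI)
  fix a :: ennreal assume "0 < a"
  then obtain b where b: "0 < b" "b < a" using dense by blast
  have "b < \<top>" by (rule less_le_trans[OF b(2) top_greatest])
  then have "b = ennreal (enn2real b)" "enn2real b > 0" using b by (simp_all add: enn2real_positive_iff)
  then have "\<forall>\<^sub>F x in F. f x \<le> b" using assms[of "enn2real b"] by simp
  then show "\<forall>\<^sub>F x in F. f x < a" by eventually_elim (use b in simp)
qed simp

text \<open>With a pointwise lower bound \<open>L\<close> of \<open>X\<close>, the distance to
  \<open>c\<close> splits into an excess over \<open>L\<close>, which is controlled in expectation
  alone, and a real error of \<open>L\<close>. The value \<infinity> of \<open>X\<close> is
  harmless.\<close>

lemma abs_dist_ennreal_le: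
  assumes L: "0 \<le> L" "ennreal L \<le> X"
  shows "e2ennreal \<bar>enn2ereal X - ereal c\<bar> \<le> (X - ennreal L) + ennreal \<bar>L - c\<bar>"
proof (cases X)
  case (real r)
  have "\<bar>enn2ereal X - ereal c\<bar> = ereal \<bar>r - c\<bar>" using real by (simp add: enn2ereal_ennreal)
  then have "e2ennreal \<bar>enn2ereal X - ereal c\<bar> = ennreal \<bar>r - c\<bar>" by simp
  also have "L \<le> r" using real L by (simp add: ennreal_le_iff)
  then have "ennreal \<bar>r - c\<bar> \<le> ennreal ((r - L) + \<bar>L - c\<bar>)" by (intro ennreal_leI) arith
  also have "\<dots> = ennreal (r - L) + ennreal \<bar>L - c\<bar>"
    using real L by (intro ennreal_plus) (auto simp: ennreal_le_iff)
  also have "ennreal (r - L) = X - ennreal L" using real L by (simp add: ennreal_minus)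
  finally show ?thesis .
next
  case top
  then show ?thesis by simp
qed

abbreviation ball_vol :: "'a::euclidean_space itself \<Rightarrow> real \<Rightarrow> real" where
  "ball_vol X R \<equiv> measure lborel (ball (0::'a) R)"

text \<open>Here \<open>N\<close> is the count and \<open>\<phi> r\<close> the density of domains
  within radius \<open>Suc r\<close> of the origin. The abstraction keeps the ergodic argument apart
  from nodal domains.\<close>

locale flow_sandwich = ball_flow \<mu> T for \<mu> :: "'b measure" and T :: "'a::euclidean_space \<Rightarrow> 'b \<Rightarrow> 'b" +
  fixes N :: "real \<Rightarrow> 'b \<Rightarrow> ennreal" and \<phi> :: "nat \<Rightarrow> 'b \<Rightarrow> ennreal"
  assumes N_meas: "\<And>R. R > 0 \<Longrightarrow> N R \<in> borel_measurable \<mu>"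
    and \<phi>_meas [measurable]: "\<And>r. \<phi> r \<in> borel_measurable \<mu>"
    and \<phi>_mono: "\<And>r w. \<phi> r w \<le> \<phi> (Suc r) w"
    and N_mono: "\<And>r R w. r \<le> R \<Longrightarrow> N r w \<le> N R w"
    and N_lower: "\<And>r R w. w \<in> space \<mu> \<Longrightarrow> real (Suc r) < R \<Longrightarrow>
        (\<integral>\<^sup>+x. \<phi> r (T x w) * indicator (ball 0 (R - real (Suc r))) x \<partial>lborel) \<le> N R w"
    and N_upper: "\<And>R w. w \<in> space \<mu> \<Longrightarrow> 0 < R \<Longrightarrow>
        N R w \<le> (\<integral>\<^sup>+x. (SUP r. \<phi> r (T x w)) * indicator (ball 0 R) x \<partial>lborel)"
begin

definition \<Phi> :: "'b \<Rightarrow> ennreal" where "\<Phi> w = (SUP r. \<phi> r w)"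

lemma \<Phi>_meas [measurable]: "\<Phi> \<in> borel_measurable \<mu>"
  unfolding \<Phi>_def by measurable

lemma T_path_meas: "h \<in> borel_measurable \<mu> \<Longrightarrow> w \<in> space \<mu> \<Longrightarrow> (\<lambda>x. h (T x w)) \<in> borel_measurable borel"
  by (rule measurable_compose[OF T_measurable]) simp_all

lemma N_upper_avg:
  assumes w: "w \<in> space \<mu>" and R: "R > 0"
  shows "N R w / ball_vol TYPE('a) R \<le> (\<integral>\<^sup>+x. \<Phi> (T x w) \<partial>ball_avg R)"
  using N_upper[OF w R] T_path_meas[OF \<Phi>_meas w]
  by (subst nn_integral_ball_avg) (auto simp: \<Phi>_def intro!: divide_right_mono_ennreal)

lemma N_lower_avg:
  assumes w: "w \<in> space \<mu>" and R: "real (Suc r) < R"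
  shows "ennreal (ball_vol TYPE('a) (R - real (Suc r))) * (\<integral>\<^sup>+x. \<phi> r (T x w) \<partial>ball_avg (R - real (Suc r))) \<le> N R w"
proof -
  have "ball_vol TYPE('a) (R - real (Suc r)) > 0" using R by simp
  then show ?thesis
    using N_lower[OF w R] T_path_meas[OF \<phi>_meas w, of r]
    by (subst nn_integral_ball_avg) (auto simp: mult.commute[of "ennreal _"] ennreal_divide_mult_cancel)
qed

lemma integral_\<Phi>_SUP: "(\<integral>\<^sup>+w. \<Phi> w \<partial>\<mu>) = (SUP r. \<integral>\<^sup>+w. \<phi> r w \<partial>\<mu>)"
  unfolding \<Phi>_def
  by (rule nn_integral_monotone_convergence_SUP) (auto intro!: incseq_SucI le_funI \<phi>_mono)

text \<open>Taking expectations in the lower bound, the mean of \<open>\<phi> r\<close> times the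
  volume of \<open>ball 0 (R - s)\<close> is at most K times the volume of \<open>ball 0 R\<close>.
  Divide, let R tend to infinity, then take the supremum over r.\<close>

lemma integral_\<Phi>_le:
  assumes K: "0 \<le> K" and N: "\<And>R. R > 0 \<Longrightarrow> (\<integral>\<^sup>+w. N R w \<partial>\<mu>) \<le> ennreal (K * ball_vol TYPE('a) R)"
  shows "(\<integral>\<^sup>+w. \<Phi> w \<partial>\<mu>) \<le> ennreal K"
  unfolding integral_\<Phi>_SUP
proof (rule SUP_least)
  fix r
  let ?s = "real (Suc r)"
  let ?I = "\<integral>\<^sup>+w. \<phi> r w \<partial>\<mu>"
  have le: "ennreal (ball_vol TYPE('a) (R - ?s)) * ?I \<le> ennreal (K * ball_vol TYPE('a) R)" if R: "R > ?s" for R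
  proof -
    interpret B: prob_space "ball_avg (R - ?s) :: 'a measure" by (rule prob_space_ball_avg) (use R in simp)
    have "ennreal (ball_vol TYPE('a) (R - ?s)) * ?I = ennreal (ball_vol TYPE('a) (R - ?s)) * (\<integral>\<^sup>+w. (\<integral>\<^sup>+x. \<phi> r (T x w) \<partial>ball_avg (R - ?s)) \<partial>\<mu>)"
      using R by (subst nn_integral_flow) auto
    also have "\<dots> = (\<integral>\<^sup>+w. ennreal (ball_vol TYPE('a) (R - ?s)) * (\<integral>\<^sup>+x. \<phi> r (T x w) \<partial>ball_avg (R - ?s)) \<partial>\<mu>)"
      by (rule nn_integral_cmult[symmetric]) measurable
    also have "\<dots> \<le> (\<integral>\<^sup>+w. N R w \<partial>\<mu>)"
      by (rule nn_integral_mono) (rule N_lower_avg[OF _ R])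
    also have "\<dots> \<le> ennreal (K * ball_vol TYPE('a) R)" using R by (intro N) simp
    finally show ?thesis .
  qed
  \<comment> \<open>Finiteness comes first, from the single radius s + 1, so that the inequality can
    be divided in the reals.\<close>
  have fin: "?I < \<top>"
  proof (rule ccontr)
    assume "\<not> ?I < \<top>"
    then have "?I = \<top>" using top.not_eq_extremum by blast
    moreover have "ball_vol TYPE('a) (?s + 1 - ?s) > 0" by simp
    ultimately show False using le[of "?s + 1"] by (auto simp: ennreal_mult_top top_unique)
  qed
  define a where "a = enn2real ?I"
  have a: "?I = ennreal a" "a \<ge> 0" unfolding a_def using fin by simp_all
  have "a * (ball_vol TYPE('a) (R - ?s) / ball_vol TYPE('a) R) \<le> K" if R: "R > ?s" for R
  proof -
    have "ennreal (ball_vol TYPE('a) (R - ?s) * a) \<le> ennreal (K * ball_vol TYPE('a) R)"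
      using le[OF R] a by (simp add: ennreal_mult'')
    then have "ball_vol TYPE('a) (R - ?s) * a \<le> K * ball_vol TYPE('a) R" using K by (subst (asm) ennreal_le_iff) auto
    moreover have "ball_vol TYPE('a) R > 0" using R by simp
    ultimately show ?thesis by (simp add: field_simps)
  qed
  then have "a * 1 \<le> K"
    by (intro tendsto_upperbound[OF tendsto_mult[OF tendsto_const measure_ball_ratio_tendsto[of ?s, where 'a = 'a]]])
       (auto intro: eventually_mono[OF eventually_gt_at_top[of ?s]])
  then show "?I \<le> ennreal K" unfolding a(1) by (intro ennreal_leI) simp
qed

text \<open>One index bounds both the size of the domains and the height of the density, so the
  truncations are bounded and increase to \<Phi> wherever \<Phi> is finite.\<close>

definition trunc :: "nat \<Rightarrow> 'b \<Rightarrow> real" where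
  "trunc k w = enn2real (min (\<phi> k w) (of_nat k))"

lemma ennreal_trunc: "ennreal (trunc k w) = min (\<phi> k w) (of_nat k)"
  unfolding trunc_def by (rule ennreal_enn2real) (simp add: min_less_iff_disj of_nat_less_top)

lemma trunc_nonneg: "0 \<le> trunc k w" unfolding trunc_def by simp

lemma bounded_meas_trunc: "bounded_meas (real k) (trunc k)"
proof -
  have "trunc k w \<le> real k" for w
    unfolding trunc_def by (rule enn2real_leI) (auto simp: ennreal_of_nat_eq_real_of_nat min.coboundedI2)
  moreover have "trunc k \<in> borel_measurable \<mu>" unfolding trunc_def by measurable
  ultimately show ?thesis unfolding bounded_meas_def using trunc_nonneg by auto
qed

lemma trunc_tendsto:
  assumes fin: "(\<integral>\<^sup>+w. \<Phi> w \<partial>\<mu>) < \<infinity>"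
  shows "(\<lambda>k. \<integral>w. trunc k w \<partial>\<mu>) \<longlonglongrightarrow> enn2real (\<integral>\<^sup>+w. \<Phi> w \<partial>\<mu>)"
proof -
  let ?g = "\<lambda>k w. min (\<phi> k w) (of_nat k)"
  have inc: "incseq ?g"
    by (intro incseq_SucI le_funI min.mono \<phi>_mono of_nat_mono) simp
  have sup: "(SUP k. ?g k w) = \<Phi> w" if lt: "\<Phi> w < \<infinity>" for w
  proof (rule antisym)
    show "(SUP k. ?g k w) \<le> \<Phi> w" unfolding \<Phi>_def by (intro SUP_mono) (auto intro: min.cobounded1)
    obtain j :: nat where j: "\<Phi> w \<le> of_nat j"
      using ennreal_Ex_less_of_nat[OF lt[unfolded infinity_ennreal_def]] less_imp_le by blast
    show "\<Phi> w \<le> (SUP k. ?g k w)" unfolding \<Phi>_def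
    proof (rule SUP_least)
      fix r
      \<comment> \<open>The index \<open>max r j\<close> is beyond r, and its height exceeds the
        finite value \<Phi> w, so that truncation has no effect there.\<close>
      have "\<phi> r w \<le> \<phi> (max r j) w"
        using lift_Suc_mono_le[of "\<lambda>r. \<phi> r w" r "max r j"] \<phi>_mono by simp
      moreover have "\<phi> (max r j) w \<le> of_nat (max r j)"
      proof -
        have "\<phi> (max r j) w \<le> \<Phi> w" unfolding \<Phi>_def by (rule SUP_upper) simp
        also have "\<dots> \<le> of_nat j" by (rule j)
        also have "\<dots> \<le> of_nat (max r j)" by (rule of_nat_mono) simp
        finally show ?thesis .
      qed
      ultimately have "\<phi> r w \<le> ?g (max r j) w" by simp
      also have "\<dots> \<le> (SUP k. ?g k w)" by (rule SUP_upper) simp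
      finally show "\<phi> r w \<le> (SUP k. ?g k w)" .
    qed
  qed
  have "AE w in \<mu>. \<Phi> w < \<infinity>"
    using nn_integral_PInf_AE[of \<Phi> \<mu>] fin by (auto simp: less_top)
  then have "(\<integral>\<^sup>+w. \<Phi> w \<partial>\<mu>) = (\<integral>\<^sup>+w. (SUP k. ?g k w) \<partial>\<mu>)"
    by (intro nn_integral_cong_AE) (auto simp: sup)
  also have "\<dots> = (SUP k. \<integral>\<^sup>+w. ?g k w \<partial>\<mu>)"
    by (rule nn_integral_monotone_convergence_SUP[OF inc]) measurable
  finally have eq: "(\<integral>\<^sup>+w. \<Phi> w \<partial>\<mu>) = (SUP k. \<integral>\<^sup>+w. ?g k w \<partial>\<mu>)" .
  have "(\<lambda>k. \<integral>\<^sup>+w. ?g k w \<partial>\<mu>) \<longlonglongrightarrow> (\<integral>\<^sup>+w. \<Phi> w \<partial>\<mu>)"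
    unfolding eq
  proof (rule LIMSEQ_SUP)
    show "incseq (\<lambda>k. \<integral>\<^sup>+w. ?g k w \<partial>\<mu>)"
      using inc by (intro monoI nn_integral_mono) (auto simp: incseq_def le_fun_def)
  qed
  moreover have "(\<integral>\<^sup>+w. ?g k w \<partial>\<mu>) = ennreal (\<integral>w. trunc k w \<partial>\<mu>)" for k
    unfolding ennreal_trunc[symmetric]
    by (rule nn_integral_eq_integral[OF bounded_meas_integrable[OF bounded_meas_trunc]]) (simp add: trunc_nonneg)
  ultimately have "(\<lambda>k. ennreal (\<integral>w. trunc k w \<partial>\<mu>)) \<longlonglongrightarrow> ennreal (enn2real (\<integral>\<^sup>+w. \<Phi> w \<partial>\<mu>))"
    using fin by (simp add: less_top)
  then show ?thesis
    by (subst (asm) tendsto_ennreal_iff)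
       (auto intro!: always_eventually Bochner_Integration.integral_nonneg trunc_nonneg)
qed

lemma N_lower_trunc:
  assumes w: "w \<in> space \<mu>" and R: "real (Suc k) < R"
  shows "ennreal (ball_vol TYPE('a) (R - real (Suc k)) / ball_vol TYPE('a) R * flow_avg (R - real (Suc k)) (trunc k) w) \<le> N R w / ball_vol TYPE('a) R"
proof -
  let ?s = "real (Suc k)"
  have V: "ball_vol TYPE('a) R > 0" "ball_vol TYPE('a) (R - ?s) > 0" using R by simp_all
  have Rs: "R - ?s > 0" using R by simp
  have nn: "0 \<le> flow_avg (R - ?s) (trunc k) w"
    unfolding flow_avg_def by (intro Bochner_Integration.integral_nonneg trunc_nonneg)
  have "ennreal (flow_avg (R - ?s) (trunc k) w) = (\<integral>\<^sup>+x. ennreal (trunc k (T x w)) \<partial>ball_avg (R - ?s))"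
    unfolding flow_avg_def
    by (rule nn_integral_eq_integral[symmetric, OF flow_integrable[OF bounded_meas_trunc Rs w]])
       (simp add: trunc_nonneg)
  also have "\<dots> \<le> (\<integral>\<^sup>+x. \<phi> k (T x w) \<partial>ball_avg (R - ?s))"
    by (rule nn_integral_mono) (simp add: ennreal_trunc)
  finally have "ennreal (ball_vol TYPE('a) (R - ?s)) * ennreal (flow_avg (R - ?s) (trunc k) w) \<le> N R w"
    using order_trans[OF mult_left_mono N_lower_avg[OF w R]] by simp
  then have "ennreal (ball_vol TYPE('a) (R - ?s)) * ennreal (flow_avg (R - ?s) (trunc k) w) / ennreal (ball_vol TYPE('a) R) \<le> N R w / ball_vol TYPE('a) R"
    by (rule divide_right_mono_ennreal)
  also have "ennreal (ball_vol TYPE('a) (R - ?s)) * ennreal (flow_avg (R - ?s) (trunc k) w) / ennreal (ball_vol TYPE('a) R) =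
      ennreal (ball_vol TYPE('a) (R - ?s) / ball_vol TYPE('a) R * flow_avg (R - ?s) (trunc k) w)"
    using V nn by (simp add: ennreal_mult[symmetric] divide_ennreal)
  finally show ?thesis .
qed

context
  assumes fin: "(\<integral>\<^sup>+w. \<Phi> w \<partial>\<mu>) < \<infinity>"
    and erg: "\<And>K g. bounded_meas K g \<Longrightarrow> mean_ergodic g"
begin

definition limit :: real where "limit = enn2real (\<integral>\<^sup>+w. \<Phi> w \<partial>\<mu>)"

lemma ennreal_limit: "ennreal limit = (\<integral>\<^sup>+w. \<Phi> w \<partial>\<mu>)"
  unfolding limit_def using fin by (simp add: less_top)

lemma limit_nonneg: "0 \<le> limit" unfolding limit_def by simp

text \<open>The quotient X lies above a multiple \<open>L\<close> of a bounded ergodic average, and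
  its expectation is at most \<open>limit\<close>. Hence both the mean of X - L and the mean
  distance of \<open>L\<close> from \<open>limit\<close> are small; no pointwise upper estimate of X
  enters.\<close>

theorem mean_limit:
  "((\<lambda>R. \<integral>\<^sup>+w. e2ennreal \<bar>enn2ereal (N R w / ball_vol TYPE('a) R) - ereal limit\<bar> \<partial>\<mu>) \<longlongrightarrow> 0) at_top"
proof (rule tendsto_0_le_ennreal)
  fix \<epsilon> :: real assume \<epsilon>: "\<epsilon> > 0"
  \<comment> \<open>The total error tends to 2 (limit - m), which is below \<epsilon> / 2 with this
    choice.\<close>
  have "\<forall>\<^sub>F k in sequentially. (\<integral>w. trunc k w \<partial>\<mu>) > limit - \<epsilon> / 4"
    using trunc_tendsto[OF fin] \<epsilon> unfolding limit_def by (intro order_tendstoD(1)) auto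
  then obtain k where k: "(\<integral>w. trunc k w \<partial>\<mu>) > limit - \<epsilon> / 4" unfolding eventually_sequentially by blast
  define m where "m = (\<integral>w. trunc k w \<partial>\<mu>)"
  have m0: "0 \<le> m" unfolding m_def by (intro Bochner_Integration.integral_nonneg trunc_nonneg)
  let ?s = "real (Suc k)"
  define ratio where "ratio R = ball_vol TYPE('a) (R - ?s) / ball_vol TYPE('a) R" for R
  define M where "M R = (\<integral>w. \<bar>flow_avg R (trunc k) w - m\<bar> \<partial>\<mu>)" for R
  have ratio: "(ratio \<longlongrightarrow> 1) at_top" unfolding ratio_def by (rule measure_ball_ratio_tendsto)
  have "filterlim (\<lambda>R::real. R - ?s) at_top at_top"
    using filterlim_tendsto_add_at_top[OF tendsto_const[of "- ?s"] filterlim_ident]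
    by (simp add: algebra_simps)
  moreover have "(M \<longlongrightarrow> 0) at_top"
    using erg[OF bounded_meas_trunc, of k] unfolding mean_ergodic_def M_def m_def by blast
  ultimately have M: "((\<lambda>R. M (R - ?s)) \<longlongrightarrow> 0) at_top" by (rule filterlim_compose[rotated])
  have "((\<lambda>R. ratio R * M (R - ?s) + (\<bar>ratio R * m - limit\<bar> + \<bar>limit - ratio R * m\<bar>)) \<longlongrightarrow>
      1 * 0 + (\<bar>1 * m - limit\<bar> + \<bar>limit - 1 * m\<bar>)) at_top"
    by (intro tendsto_intros ratio M)
  moreover have "m \<le> limit"
  proof -
    have "ennreal m = (\<integral>\<^sup>+w. ennreal (trunc k w) \<partial>\<mu>)" unfolding m_def
      by (rule nn_integral_eq_integral[symmetric, OF bounded_meas_integrable[OF bounded_meas_trunc]]) (simp add: trunc_nonneg)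
    also have "\<dots> \<le> (\<integral>\<^sup>+w. \<Phi> w \<partial>\<mu>)"
      by (rule nn_integral_mono) (auto simp: ennreal_trunc \<Phi>_def intro!: min.coboundedI1 SUP_upper)
    finally show ?thesis unfolding ennreal_limit[symmetric] using limit_nonneg by (simp add: ennreal_le_iff)
  qed
  then have "1 * 0 + (\<bar>1 * m - limit\<bar> + \<bar>limit - 1 * m\<bar>) < \<epsilon>" using k \<epsilon> unfolding m_def by simp
  ultimately have "\<forall>\<^sub>F R in at_top. ratio R * M (R - ?s) + (\<bar>ratio R * m - limit\<bar> + \<bar>limit - ratio R * m\<bar>) < \<epsilon>"
    by (rule order_tendstoD(2))
  then show "\<forall>\<^sub>F R in at_top. (\<integral>\<^sup>+w. e2ennreal \<bar>enn2ereal (N R w / ball_vol TYPE('a) R) - ereal limit\<bar> \<partial>\<mu>) \<le> ennreal \<epsilon>"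
    using eventually_gt_at_top[of ?s]
  proof eventually_elim
    case (elim R)
    have R: "R > 0" "R - ?s > 0" using elim by simp_all
    have V: "ball_vol TYPE('a) R > 0" "ball_vol TYPE('a) (R - ?s) > 0" using R by simp_all
    have r0: "ratio R \<ge> 0" unfolding ratio_def by simp
    define L where "L w = ratio R * flow_avg (R - ?s) (trunc k) w" for w
    have fb: "bounded_meas (real k) (flow_avg (R - ?s) (trunc k))"
      by (rule flow_avg_bounded_meas[OF bounded_meas_trunc R(2)])
    have fi: "integrable \<mu> (flow_avg (R - ?s) (trunc k))" by (rule bounded_meas_integrable[OF fb])
    have [measurable]: "L \<in> borel_measurable \<mu>" unfolding L_def using fi by measurable
    have Li: "integrable \<mu> L" unfolding L_def using fi by simp
    have L0: "L w \<ge> 0" for w unfolding L_def flow_avg_def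
      by (intro mult_nonneg_nonneg r0 Bochner_Integration.integral_nonneg trunc_nonneg)
    have LX: "ennreal (L w) \<le> N R w / ball_vol TYPE('a) R" if "w \<in> space \<mu>" for w
      unfolding L_def ratio_def by (rule N_lower_trunc[OF that elim(2)])
    have [measurable]: "N R \<in> borel_measurable \<mu>" by (rule N_meas[OF R(1)])
    have EL: "(\<integral>w. L w \<partial>\<mu>) = ratio R * m"
      unfolding L_def m_def using integral_flow_avg[OF bounded_meas_trunc R(2)] by simp
    have ELn: "(\<integral>\<^sup>+w. ennreal (L w) \<partial>\<mu>) = ennreal (ratio R * m)"
      unfolding EL[symmetric] by (rule nn_integral_eq_integral[OF Li]) (simp add: L0)
    have "(\<integral>\<^sup>+w. N R w / ball_vol TYPE('a) R \<partial>\<mu>) \<le> (\<integral>\<^sup>+w. (\<integral>\<^sup>+x. \<Phi> (T x w) \<partial>ball_avg R) \<partial>\<mu>)"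
      by (intro nn_integral_mono N_upper_avg R)
    also have "\<dots> = ennreal limit" unfolding ennreal_limit by (rule nn_integral_flow[OF \<Phi>_meas R(1)])
    finally have EX: "(\<integral>\<^sup>+w. N R w / ball_vol TYPE('a) R \<partial>\<mu>) \<le> ennreal limit" .
    have "(\<integral>\<^sup>+w. N R w / ball_vol TYPE('a) R - ennreal (L w) \<partial>\<mu>) = (\<integral>\<^sup>+w. N R w / ball_vol TYPE('a) R \<partial>\<mu>) - (\<integral>\<^sup>+w. ennreal (L w) \<partial>\<mu>)"
      by (rule nn_integral_diff) (use LX ELn in auto)
    also have "\<dots> \<le> ennreal limit - ennreal (ratio R * m)"
      unfolding ELn using EX by (intro ennreal_minus_mono) auto
    also have "\<dots> = ennreal (limit - ratio R * m)" using r0 m0 by (intro ennreal_minus) simp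
    also have "\<dots> \<le> ennreal \<bar>limit - ratio R * m\<bar>" by (intro ennreal_leI) simp
    finally have E1: "(\<integral>\<^sup>+w. N R w / ball_vol TYPE('a) R - ennreal (L w) \<partial>\<mu>) \<le> ennreal \<bar>limit - ratio R * m\<bar>" .
    have "(\<integral>\<^sup>+w. ennreal \<bar>L w - limit\<bar> \<partial>\<mu>) = ennreal (\<integral>w. \<bar>L w - limit\<bar> \<partial>\<mu>)"
      by (rule nn_integral_eq_integral) (use Li in auto)
    also have "(\<integral>w. \<bar>L w - limit\<bar> \<partial>\<mu>) \<le> (\<integral>w. ratio R * \<bar>flow_avg (R - ?s) (trunc k) w - m\<bar> + \<bar>ratio R * m - limit\<bar> \<partial>\<mu>)"
    proof (rule integral_mono)
      fix w
      have "L w - limit = ratio R * (flow_avg (R - ?s) (trunc k) w - m) + (ratio R * m - limit)"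
        unfolding L_def by (simp add: algebra_simps)
      then show "\<bar>L w - limit\<bar> \<le> ratio R * \<bar>flow_avg (R - ?s) (trunc k) w - m\<bar> + \<bar>ratio R * m - limit\<bar>"
        using r0 by (metis abs_mult abs_of_nonneg abs_triangle_ineq)
    qed (use Li fi in auto)
    also have "\<dots> = ratio R * M (R - ?s) + \<bar>ratio R * m - limit\<bar>"
      unfolding M_def using fi prob_space by simp
    finally have E2: "(\<integral>\<^sup>+w. ennreal \<bar>L w - limit\<bar> \<partial>\<mu>) \<le> ennreal (ratio R * M (R - ?s) + \<bar>ratio R * m - limit\<bar>)"
      by (simp add: ennreal_leI)
    have M0: "M (R - ?s) \<ge> 0" unfolding M_def by simp
    have "(\<integral>\<^sup>+w. e2ennreal \<bar>enn2ereal (N R w / ball_vol TYPE('a) R) - ereal limit\<bar> \<partial>\<mu>) \<le>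
        (\<integral>\<^sup>+w. (N R w / ball_vol TYPE('a) R - ennreal (L w)) + ennreal \<bar>L w - limit\<bar> \<partial>\<mu>)"
      by (rule nn_integral_mono) (rule abs_dist_ennreal_le[OF L0 LX])
    also have "\<dots> = (\<integral>\<^sup>+w. N R w / ball_vol TYPE('a) R - ennreal (L w) \<partial>\<mu>) + (\<integral>\<^sup>+w. ennreal \<bar>L w - limit\<bar> \<partial>\<mu>)"
      by (rule nn_integral_add) measurable
    also have "\<dots> \<le> ennreal \<bar>limit - ratio R * m\<bar> + ennreal (ratio R * M (R - ?s) + \<bar>ratio R * m - limit\<bar>)"
      by (rule add_mono[OF E1 E2])
    also have "\<dots> = ennreal (\<bar>limit - ratio R * m\<bar> + (ratio R * M (R - ?s) + \<bar>ratio R * m - limit\<bar>))"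
      using r0 M0 by (intro ennreal_plus[symmetric]) auto
    also have "\<dots> \<le> ennreal \<epsilon>" using elim(1) by (intro ennreal_leI) simp
    finally show ?case .
  qed
qed

text \<open>Along integers, the lower bound follows from \<open>pointwise_ergodic\<close> for the
  truncations and the upper bound from \<open>pointwise_ergodic_upper\<close> for \<Phi>.
  Monotonicity of the counts then fills in the real radii.\<close>

theorem almost_sure_limit:
  "AE w in \<mu>. ((\<lambda>R. enn2ereal (N R w / ball_vol TYPE('a) R)) \<longlongrightarrow> ereal limit) at_top"
proof -
  have "AE w in \<mu>. \<forall>j. \<forall>\<^sub>F m in sequentially.
      (\<integral>\<^sup>+x. \<Phi> (T x w) \<partial>ball_avg (real m)) \<le> (\<integral>\<^sup>+w. \<Phi> w \<partial>\<mu>) + ennreal (1 / Suc j)"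
    unfolding AE_all_countable
  proof
    show "AE w in \<mu>. \<forall>\<^sub>F m in sequentially.
      (\<integral>\<^sup>+x. \<Phi> (T x w) \<partial>ball_avg (real m)) \<le> (\<integral>\<^sup>+w. \<Phi> w \<partial>\<mu>) + ennreal (1 / Suc j)" for j
      by (rule pointwise_ergodic_upper[OF erg \<Phi>_meas fin]) simp_all
  qed
  moreover have "AE w in \<mu>. \<forall>k. (\<lambda>m::nat. flow_avg m (trunc k) w) \<longlonglongrightarrow> (\<integral>w. trunc k w \<partial>\<mu>)"
    unfolding AE_all_countable by (intro allI pointwise_ergodic erg[OF bounded_meas_trunc])
  ultimately show ?thesis using AE_space
  proof eventually_elim
    case (elim w)
    have w: "w \<in> space \<mu>" by fact
    have pos: "\<forall>\<^sub>F m::nat in sequentially. m \<ge> 1" by (rule eventually_ge_at_top)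
    have up: "\<forall>\<^sub>F m in sequentially. N (real m) w / ball_vol TYPE('a) (real m) \<le> ennreal (limit + 1 / Suc j)" for j
      using elim(1)[rule_format, of j] pos
    proof eventually_elim
      case (elim m)
      have "N (real m) w / ball_vol TYPE('a) (real m) \<le> (\<integral>\<^sup>+x. \<Phi> (T x w) \<partial>ball_avg (real m))"
        by (rule N_upper_avg[OF w]) (use elim in simp)
      also have "\<dots> \<le> ennreal limit + ennreal (1 / Suc j)" using elim(1) by (simp add: ennreal_limit)
      also have "\<dots> = ennreal (limit + 1 / Suc j)" using limit_nonneg by (intro ennreal_plus[symmetric]) auto
      finally show ?case .
    qed
    \<comment> \<open>Every count is dominated by one at a large integer radius, where the upper
      bound is finite.\<close>
    have Nfin: "N R w < \<top>" for R
    proof -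
      have "\<forall>\<^sub>F m in sequentially. real m \<ge> R"
        by (rule eventually_compose_filterlim[OF eventually_ge_at_top filterlim_real_sequentially])
      then have "\<forall>\<^sub>F m in sequentially. R \<le> real m \<and> m \<ge> 1 \<and> N (real m) w / ball_vol TYPE('a) (real m) \<le> ennreal (limit + 1 / Suc 0)"
        using pos up[of 0] by eventually_elim simp
      then obtain m where m: "R \<le> real m" "m \<ge> 1" "N (real m) w / ball_vol TYPE('a) (real m) \<le> ennreal (limit + 1 / Suc 0)"
        unfolding eventually_sequentially by blast
      have "ball_vol TYPE('a) (real m) > 0" using m by simp
      then have "N (real m) w = N (real m) w / ball_vol TYPE('a) (real m) * ball_vol TYPE('a) (real m)" by (rule ennreal_divide_mult_cancel[symmetric])
      also have "\<dots> \<le> ennreal (limit + 1 / Suc 0) * ball_vol TYPE('a) (real m)" by (rule mult_right_mono[OF m(3)]) simp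
      also have "\<dots> < \<top>" by (simp add: ennreal_mult_less_top)
      finally show ?thesis using N_mono[OF m(1), of w] by (rule le_less_trans[rotated])
    qed
    define n where "n R = enn2real (N R w)" for R
    have n: "N R w = ennreal (n R)" for R unfolding n_def using Nfin by simp
    have n0: "0 \<le> n R" for R unfolding n_def by simp
    have nV: "N R w / ball_vol TYPE('a) R = ennreal (n R / ball_vol TYPE('a) R)" if "R > 0" for R
      using n n0 that by (simp add: divide_ennreal)
    have "(\<lambda>m::nat. n (real m) / ball_vol TYPE('a) (real m)) \<longlonglongrightarrow> limit"
    proof (rule tendstoI)
      fix \<epsilon> :: real assume \<epsilon>: "\<epsilon> > 0"
      obtain j where j: "inverse (real (Suc j)) < \<epsilon>" using reals_Archimedean[OF \<epsilon>] by blast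
      have "\<forall>\<^sub>F k in sequentially. (\<integral>w. trunc k w \<partial>\<mu>) > limit - \<epsilon>"
        using trunc_tendsto[OF fin] \<epsilon> unfolding limit_def by (intro order_tendstoD(1)) auto
      then obtain k where k: "(\<integral>w. trunc k w \<partial>\<mu>) > limit - \<epsilon>" unfolding eventually_sequentially by blast
      \<comment> \<open>The lower bound at radius m uses the average over radius m - (k + 1), again
        an integer for large m.\<close>
      have sub: "(\<lambda>m::nat. flow_avg (real m - real (Suc k)) (trunc k) w) \<longlonglongrightarrow> (\<integral>w. trunc k w \<partial>\<mu>)"
      proof (rule LIMSEQ_offset[of _ "Suc k"])
        show "(\<lambda>m. flow_avg (real (m + Suc k) - real (Suc k)) (trunc k) w) \<longlonglongrightarrow> (\<integral>w. trunc k w \<partial>\<mu>)"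
          using elim(2) by simp
      qed
      have "(\<lambda>m::nat. ball_vol TYPE('a) (real m - real (Suc k)) / ball_vol TYPE('a) (real m)) \<longlonglongrightarrow> 1"
        by (rule filterlim_compose[OF measure_ball_ratio_tendsto filterlim_real_sequentially])
      from tendsto_mult[OF this sub]
      have "\<forall>\<^sub>F m in sequentially. limit - \<epsilon> < ball_vol TYPE('a) (real m - real (Suc k)) / ball_vol TYPE('a) (real m) * flow_avg (real m - real (Suc k)) (trunc k) w"
        using k by (intro order_tendstoD(1)) auto
      moreover have "\<forall>\<^sub>F m in sequentially. real (Suc k) < real m"
        by (rule eventually_compose_filterlim[OF eventually_gt_at_top filterlim_real_sequentially])
      ultimately show "\<forall>\<^sub>F m::nat in sequentially. dist (n (real m) / ball_vol TYPE('a) (real m)) limit < \<epsilon>"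
        using up[of j]
      proof eventually_elim
        case (elim m)
        have m: "real m > 0" using elim by simp
        have nV0: "0 \<le> n (real m) / ball_vol TYPE('a) (real m)" using n0 by simp
        have "n (real m) / ball_vol TYPE('a) (real m) \<le> limit + 1 / Suc j"
          using elim(3) limit_nonneg unfolding nV[OF m] by (subst (asm) ennreal_le_iff) auto
        moreover have "ball_vol TYPE('a) (real m - real (Suc k)) / ball_vol TYPE('a) (real m) * flow_avg (real m - real (Suc k)) (trunc k) w \<le> n (real m) / ball_vol TYPE('a) (real m)"
          using N_lower_trunc[OF w elim(2)] nV0 unfolding nV[OF m] by (subst (asm) ennreal_le_iff) auto
        ultimately show ?case using elim(1) j by (simp add: dist_real_def abs_less_iff inverse_eq_divide)
      qed
    qed
    then have "((\<lambda>R. n R / ball_vol TYPE('a) R) \<longlongrightarrow> limit) at_top"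
      by (intro mono_ball_ratio_tendsto) (use n0 N_mono Nfin in \<open>auto simp: n_def intro!: enn2real_mono\<close>)
    then have lim: "((\<lambda>R. ereal (n R / ball_vol TYPE('a) R)) \<longlongrightarrow> ereal limit) at_top" by simp
    show ?case
    proof (rule Lim_transform_eventually[OF lim])
      show "\<forall>\<^sub>F R in at_top. ereal (n R / ball_vol TYPE('a) R) = enn2ereal (N R w / ball_vol TYPE('a) R)"
        using eventually_gt_at_top[of 0]
        by eventually_elim (use nV n0 in \<open>simp add: enn2ereal_ennreal\<close>)
    qed
  qed
qed

end

end

section \<open>Critical points of nodal domains\<close>

definition dderiv :: "(real ^ 'n \<Rightarrow> real) \<Rightarrow> real ^ 'n \<Rightarrow> real ^ 'n \<Rightarrow> real" where
  "dderiv f v x = frechet_derivative f (at x) v"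

definition hess :: "(real ^ 'n \<Rightarrow> real) \<Rightarrow> 'n \<Rightarrow> 'n \<Rightarrow> real ^ 'n \<Rightarrow> real" where
  "hess f i j x = dderiv (dderiv f (axis i 1)) (axis j 1) x"

definition grad_sq :: "(real ^ 'n \<Rightarrow> real) \<Rightarrow> real ^ 'n \<Rightarrow> real" where
  "grad_sq f x = (\<Sum>i\<in>UNIV. (dderiv f (axis i 1) x)\<^sup>2)"

text \<open>The summand 1 in each entry leaves slack, so that near a critical point this exceeds the
  Lipschitz bound \<open>L\<close> used in \<open>critical_point_mass\<close>.\<close>

definition hess_sum :: "(real ^ 'n \<Rightarrow> real) \<Rightarrow> real ^ 'n \<Rightarrow> real" where
  "hess_sum f x = (\<Sum>i\<in>UNIV. \<Sum>j\<in>UNIV. 1 + \<bar>hess f i j x\<bar>)"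

lemma C_k_Suc_dderiv:
  assumes "C_k (Suc k) f"
  shows "(f has_derivative (\<lambda>v. dderiv f v x)) (at x)" and "C_k k (dderiv f v)"
proof -
  obtain f' where f': "\<And>x. (f has_derivative f' x) (at x)" and k: "\<And>v. C_k k (\<lambda>x. f' x v)"
    using assms by auto
  have eq: "f' x = frechet_derivative f (at x)" for x by (rule frechet_derivative_at[OF f'])
  show "(f has_derivative (\<lambda>v. dderiv f v x)) (at x)" unfolding dderiv_def using f'[of x] by (simp add: eq)
  show "C_k k (dderiv f v)" using k[of v] unfolding dderiv_def[abs_def] eq .
qed

lemma C2_derivatives:
  assumes "C_k 2 f"
  shows "(f has_derivative (\<lambda>v. dderiv f v x)) (at x)"
    and "(dderiv f u has_derivative (\<lambda>v. dderiv (dderiv f u) v x)) (at x)"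
    and "continuous_on UNIV (dderiv (dderiv f u) v)"
proof -
  have 2: "C_k (Suc (Suc 0)) f" using assms by (simp add: numeral_2_eq_2)
  show "(f has_derivative (\<lambda>v. dderiv f v x)) (at x)" by (rule C_k_Suc_dderiv[OF 2])
  have 1: "C_k (Suc 0) (dderiv f u)" by (rule C_k_Suc_dderiv[OF 2])
  show "(dderiv f u has_derivative (\<lambda>v. dderiv (dderiv f u) v x)) (at x)" by (rule C_k_Suc_dderiv[OF 1])
  have "C_k 0 (dderiv (dderiv f u) v)" by (rule C_k_Suc_dderiv[OF 1])
  then show "continuous_on UNIV (dderiv (dderiv f u) v)" by (rule C_k_continuous)
qed

lemma dderiv_sum_axis:
  fixes f :: "real ^ 'n \<Rightarrow> real"
  assumes "(f has_derivative (\<lambda>v. dderiv f v x)) (at x)"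
  shows "dderiv f v x = (\<Sum>i\<in>UNIV. v $ i * dderiv f (axis i 1) x)"
proof -
  interpret L: bounded_linear "\<lambda>v. dderiv f v x" using assms by (rule has_derivative_bounded_linear)
  have "v = (\<Sum>i\<in>UNIV. (v $ i) *\<^sub>R axis i 1)"
    using basis_expansion[of v] by (simp add: scalar_mult_eq_scaleR)
  then have "dderiv f v x = dderiv f (\<Sum>i\<in>UNIV. (v $ i) *\<^sub>R axis i 1) x" by simp
  also have "\<dots> = (\<Sum>i\<in>UNIV. v $ i * dderiv f (axis i 1) x)" by (simp add: L.sum L.scaleR)
  finally show ?thesis .
qed

lemma mvt_line:
  fixes f :: "real ^ 'n \<Rightarrow> real"
  assumes der: "\<And>x. (f has_derivative D x) (at x)" and ab: "a < b"
  shows "\<exists>s. a < s \<and> s < b \<and> f (p + b *\<^sub>R v) - f (p + a *\<^sub>R v) = (b - a) * D (p + s *\<^sub>R v) v"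
proof -
  have d: "((\<lambda>s. f (p + s *\<^sub>R v)) has_real_derivative D (p + s *\<^sub>R v) v) (at s)" for s
  proof -
    have 1: "((\<lambda>s. p + s *\<^sub>R v) has_derivative (\<lambda>h. h *\<^sub>R v)) (at s)" by (auto intro!: derivative_eq_intros)
    interpret L: bounded_linear "D (p + s *\<^sub>R v)" using der by (rule has_derivative_bounded_linear)
    from has_derivative_compose[OF 1 der]
    have "((\<lambda>s. f (p + s *\<^sub>R v)) has_derivative (\<lambda>h. h * D (p + s *\<^sub>R v) v)) (at s)"
      by (simp add: L.scaleR)
    then show ?thesis unfolding has_field_derivative_def
      by (rule has_derivative_eq_rhs) (auto simp: mult.commute)
  qed
  from MVT2[OF ab, of "\<lambda>s. f (p + s *\<^sub>R v)" "\<lambda>s. D (p + s *\<^sub>R v) v"] d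
  show ?thesis by blast
qed

text \<open>At a nonzero point of the closure, the domain of that point is an open neighbourhood, so
  it meets the given domain and coincides with it.\<close>

lemma nodal_domain_closure:
  assumes f: "continuous_on UNIV f" and y: "y \<in> closure (nodal_domain f x)" "f y \<noteq> 0"
  shows "y \<in> nodal_domain f x"
proof -
  have "open (nodal_domain f y)" "y \<in> nodal_domain f y"
    using open_nodal_domain[OF f] nodal_domain_self[of f y] y by auto
  then obtain z where z: "z \<in> nodal_domain f y" "z \<in> nodal_domain f x"
    using y(1) closure_iff_nhds_not_empty[of y] by blast
  have "nodal_domain f z = nodal_domain f y" "nodal_domain f z = nodal_domain f x"
    by (rule nodal_domain_eq[OF z(1)], rule nodal_domain_eq[OF z(2)])
  then show ?thesis using nodal_domain_self[of f y] y by auto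
qed

text \<open>The maximum of \<bar>f\<bar> over the compact closure is not 0, so it is attained inside
  the open domain. There \<open>f\<close> has an extremum, a maximum or a minimum according to its
  sign.\<close>

lemma nodal_domain_critical_point:
  fixes f :: "real ^ 'n \<Rightarrow> real"
  assumes f: "C_k 2 f" and x: "f x \<noteq> 0" and b: "bounded (nodal_domain f x)"
  shows "\<exists>p\<in>nodal_domain f x. \<forall>v. dderiv f v p = 0"
proof -
  let ?\<omega> = "nodal_domain f x"
  have cont: "continuous_on UNIV f" using f by (rule C_k_continuous)
  have "compact (closure ?\<omega>)" using b by (simp add: compact_closure)
  moreover have x\<omega>: "x \<in> ?\<omega>" using nodal_domain_self[of f x] x by simp
  moreover have "continuous_on (closure ?\<omega>) (\<lambda>y. \<bar>f y\<bar>)"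
    by (intro continuous_intros continuous_on_subset[OF cont]) simp
  ultimately obtain p where p: "p \<in> closure ?\<omega>" "\<And>y. y \<in> closure ?\<omega> \<Longrightarrow> \<bar>f y\<bar> \<le> \<bar>f p\<bar>"
    using continuous_attains_sup[of "closure ?\<omega>" "\<lambda>y. \<bar>f y\<bar>"] closure_subset by (metis empty_iff subsetD)
  have "\<bar>f x\<bar> \<le> \<bar>f p\<bar>" using p(2) x\<omega> closure_subset by blast
  then have "f p \<noteq> 0" using x by auto
  then have p\<omega>: "p \<in> ?\<omega>" by (intro nodal_domain_closure[OF cont p(1)])
  have max: "\<bar>f y\<bar> \<le> \<bar>f p\<bar>" if "y \<in> ?\<omega>" for y using p(2) that closure_subset by blast
  have "(\<forall>y\<in>?\<omega>. f y \<le> f p) \<or> (\<forall>y\<in>?\<omega>. f p \<le> f y)"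
  proof (cases "f p > 0")
    case True
    then have "\<forall>y\<in>?\<omega>. f y \<le> f p" using max by fastforce
    then show ?thesis ..
  next
    case False
    then have "\<forall>y\<in>?\<omega>. f p \<le> f y" using max by fastforce
    then show ?thesis ..
  qed
  then have "(\<lambda>v. dderiv f v p) = (\<lambda>v. 0)"
    by (rule differential_zero_maxmin[OF p\<omega> open_nodal_domain[OF cont] C2_derivatives(1)[OF f]])
  then show ?thesis using p\<omega> by (metis (no_types))
qed

text \<open>Near a critical point \<open>p\<close> the gradient at \<open>x\<close> is at most \<open>L * norm (x - p)\<close>, where \<open>L\<close>
  is slightly larger than the sum of the absolute values of the second derivatives at \<open>p\<close>. So
  \<open>ball p (\<epsilon> / L)\<close> belongs to the set where the gradient is smaller than \<open>\<epsilon>\<close>.\<close>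

lemma critical_point_mass:
  fixes f :: "real ^ 'n \<Rightarrow> real"
  assumes f: "C_k 2 f" and crit: "\<And>v. dderiv f v p = 0" and op: "open \<omega>" and p: "p \<in> \<omega>"
  shows "\<forall>\<^sub>F \<epsilon> in at_right 0. ennreal (ball_vol TYPE(real ^ 'n) \<epsilon>) \<le>
    (\<integral>\<^sup>+x. (if grad_sq f x < \<epsilon>\<^sup>2 then ennreal (hess_sum f x ^ CARD('n)) else 0) * indicator \<omega> x \<partial>lborel)"
proof -
  define n where "n = real CARD('n)"
  have n: "n \<ge> 1" unfolding n_def by (simp add: Suc_leI)
  define A where "A = (\<Sum>i\<in>UNIV. \<Sum>j\<in>UNIV. \<bar>hess f i j p\<bar>)"
  define L where "L = A + 1 / 2"
  have A0: "A \<ge> 0" unfolding A_def by (intro sum_nonneg) auto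
  have L: "L > 0" unfolding L_def using A0 by simp
  \<comment> \<open>Summed over the n * n entries the tolerance amounts to 1 / 2, exactly the slack
    in \<open>L\<close>.\<close>
  define \<delta> where "\<delta> = 1 / (2 * n * n)"
  have \<delta>: "\<delta> > 0" unfolding \<delta>_def using n by simp
  have cont: "continuous_on UNIV (hess f i j)" for i j
    unfolding hess_def[abs_def] by (rule C2_derivatives(3)[OF f])
  have "\<forall>\<^sub>F x in at p. \<forall>i\<in>UNIV. \<forall>j\<in>UNIV. dist (hess f i j x) (hess f i j p) < \<delta>"
    using cont \<delta> by (intro eventually_ball_finite ballI finite tendstoD)
      (auto simp: continuous_on_def)
  then obtain \<eta>1 where \<eta>1: "\<eta>1 > 0" "\<And>x i j. x \<noteq> p \<Longrightarrow> dist x p < \<eta>1 \<Longrightarrow> dist (hess f i j x) (hess f i j p) < \<delta>"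
    unfolding eventually_at by auto
  obtain \<eta>2 where \<eta>2: "\<eta>2 > 0" "ball p \<eta>2 \<subseteq> \<omega>" using op p open_contains_ball by blast
  define \<eta> where "\<eta> = min \<eta>1 \<eta>2"
  have \<eta>: "\<eta> > 0" unfolding \<eta>_def using \<eta>1 \<eta>2 by simp
  have close: "\<bar>hess f i j x - hess f i j p\<bar> \<le> \<delta>" if "dist x p < \<eta>" for x i j
    using \<eta>1(2)[of x i j] that \<delta> unfolding \<eta>_def by (cases "x = p") (auto simp: dist_real_def intro: less_imp_le)
  have card: "(\<Sum>i\<in>(UNIV::'n set). \<Sum>j\<in>(UNIV::'n set). \<delta>) = 1 / 2"
    unfolding \<delta>_def n_def by simp
  have grad: "grad_sq f x < \<epsilon>\<^sup>2" if x: "dist x p < \<eta>" "dist x p < \<epsilon> / L" for x \<epsilon>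
  proof -
    let ?w = "x - p"
    have g: "\<bar>dderiv f (axis i 1) x\<bar> \<le> (\<Sum>j\<in>UNIV. \<bar>hess f i j p\<bar> + \<delta>) * norm ?w" for i
    proof -
      obtain s where s: "0 < s" "s < 1"
        "dderiv f (axis i 1) (p + 1 *\<^sub>R ?w) - dderiv f (axis i 1) (p + 0 *\<^sub>R ?w) =
          (1 - 0) * dderiv (dderiv f (axis i 1)) ?w (p + s *\<^sub>R ?w)"
        using mvt_line[OF C2_derivatives(2)[OF f, of "axis i 1"], of 0 1 p ?w] by auto
      let ?y = "p + s *\<^sub>R ?w"
      have "dist ?y p < \<eta>"
      proof -
        have "dist ?y p = s * norm ?w" using s by (simp add: dist_norm)
        also have "\<dots> \<le> 1 * norm ?w" using s by (intro mult_right_mono) auto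
        finally show ?thesis using x by (simp add: dist_norm)
      qed
      then have hb: "\<bar>hess f i j ?y\<bar> \<le> \<bar>hess f i j p\<bar> + \<delta>" for j
        using close[of ?y i j] by linarith
      have "dderiv f (axis i 1) x = dderiv (dderiv f (axis i 1)) ?w ?y"
        using s(3) crit by simp
      also have "\<dots> = (\<Sum>j\<in>UNIV. ?w $ j * hess f i j ?y)"
        unfolding hess_def by (rule dderiv_sum_axis[OF C2_derivatives(2)[OF f]])
      also have "\<bar>\<dots>\<bar> \<le> (\<Sum>j\<in>UNIV. \<bar>?w $ j * hess f i j ?y\<bar>)" by (rule sum_abs)
      also have "\<dots> \<le> (\<Sum>j\<in>UNIV. norm ?w * (\<bar>hess f i j p\<bar> + \<delta>))"
        unfolding abs_mult by (intro sum_mono mult_mono component_le_norm_cart hb) auto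
      finally show ?thesis by (simp add: sum_distrib_left mult.commute)
    qed
    have "(\<Sum>i\<in>UNIV. \<bar>dderiv f (axis i 1) x\<bar>) \<le> (\<Sum>i\<in>UNIV. (\<Sum>j\<in>UNIV. \<bar>hess f i j p\<bar> + \<delta>) * norm ?w)"
      by (intro sum_mono g)
    also have "\<dots> = L * norm ?w"
      unfolding L_def A_def sum.distrib sum_distrib_right[symmetric] card ..
    also have "\<dots> < \<epsilon>"
      using x(2) L by (simp add: dist_norm field_simps)
    finally have lt: "(\<Sum>i\<in>UNIV. \<bar>dderiv f (axis i 1) x\<bar>) < \<epsilon>" .
    \<comment> \<open>The Euclidean norm is at most the sum of the absolute values of the
      components.\<close>
    have "grad_sq f x \<le> (\<Sum>i\<in>UNIV. \<bar>dderiv f (axis i 1) x\<bar>)\<^sup>2"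
      unfolding grad_sq_def using L2_set_le_sum_abs[of "\<lambda>i. dderiv f (axis i 1) x" UNIV]
      unfolding L2_set_def by (metis real_sqrt_le_iff real_sqrt_unique sum_abs_ge_zero real_sqrt_abs abs_of_nonneg)
    also have "\<dots> < \<epsilon>\<^sup>2" using lt by (intro power_strict_mono) (auto intro: sum_nonneg)
    finally show ?thesis .
  qed
  have hs: "L \<le> hess_sum f x" if "dist x p < \<eta>" for x
  proof -
    have "A - 1 / 2 = (\<Sum>i\<in>UNIV. \<Sum>j\<in>UNIV. \<bar>hess f i j p\<bar> - \<delta>)"
      unfolding sum_subtractf card A_def ..
    also have "\<dots> \<le> (\<Sum>i\<in>UNIV. \<Sum>j\<in>UNIV. \<bar>hess f i j x\<bar>)"
    proof (intro sum_mono)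
      show "\<bar>hess f i j p\<bar> - \<delta> \<le> \<bar>hess f i j x\<bar>" for i j
        using close[OF that, of i j] by linarith
    qed
    finally have "A - 1 / 2 \<le> (\<Sum>i\<in>UNIV. \<Sum>j\<in>UNIV. \<bar>hess f i j x\<bar>)" .
    moreover have "hess_sum f x = n * n + (\<Sum>i\<in>UNIV. \<Sum>j\<in>UNIV. \<bar>hess f i j x\<bar>)"
      unfolding hess_sum_def sum.distrib n_def by simp
    moreover have "n * n \<ge> 1" using mult_mono[OF n n] n by simp
    ultimately show ?thesis unfolding L_def by linarith
  qed
  have "\<forall>\<^sub>F \<epsilon> in at_right 0. \<epsilon> > 0 \<and> \<epsilon> < \<eta> * L"
    using \<eta> L by (intro eventually_conj eventually_at_right_less) (simp_all add: eventually_at_right_real eventually_at_right_field exI[of _ "\<eta> * L"])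
  then show ?thesis
  proof eventually_elim
    case (elim \<epsilon>)
    have r: "\<epsilon> / L > 0" "\<epsilon> / L < \<eta>" using elim L by (simp_all add: field_simps)
    \<comment> \<open>The volume of radius \<epsilon> / L is smaller by L^n; the weight
      \<open>hess_sum f x ^ CARD('n)\<close> compensates this factor.\<close>
    have "ennreal (ball_vol TYPE(real ^ 'n) \<epsilon>) = ennreal (L ^ CARD('n) * ball_vol TYPE(real ^ 'n) (\<epsilon> / L))"
      using measure_ball_scale[of "\<epsilon> / L" L, where 'a = "real ^ 'n"] r L by simp
    also have "\<dots> = ennreal (L ^ CARD('n)) * emeasure lborel (ball p (\<epsilon> / L))"
      using L by (simp add: ennreal_mult emeasure_ball_eq[of p])
    also have "\<dots> = (\<integral>\<^sup>+x. ennreal (L ^ CARD('n)) * indicator (ball p (\<epsilon> / L)) x \<partial>lborel)"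
      by (rule nn_integral_cmult_indicator[symmetric]) simp
    also have "\<dots> \<le> (\<integral>\<^sup>+x. (if grad_sq f x < \<epsilon>\<^sup>2 then ennreal (hess_sum f x ^ CARD('n)) else 0) * indicator \<omega> x \<partial>lborel)"
    proof (rule nn_integral_mono)
      fix x
      show "ennreal (L ^ CARD('n)) * indicator (ball p (\<epsilon> / L)) x \<le>
        (if grad_sq f x < \<epsilon>\<^sup>2 then ennreal (hess_sum f x ^ CARD('n)) else 0) * indicator \<omega> x"
      proof (cases "x \<in> ball p (\<epsilon> / L)")
        case True
        then have x: "dist x p < \<epsilon> / L" "dist x p < \<eta>" using r by (simp_all add: dist_commute)
        then have "x \<in> \<omega>" using \<eta>2 unfolding \<eta>_def by (auto simp: dist_commute)
        moreover have "grad_sq f x < \<epsilon>\<^sup>2" by (rule grad[OF x(2,1)])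
        moreover have "L ^ CARD('n) \<le> hess_sum f x ^ CARD('n)"
          using L hs[OF x(2)] by (intro power_mono) auto
        ultimately show ?thesis using True by (simp add: ennreal_leI)
      qed simp
    qed
    finally show ?case .
  qed
qed

text \<open>A Kac-Rice integrand with a cutoff in place of a delta function. The power of
  \<open>hess_sum\<close> replaces the determinant of the Hessian as an upper bound for the
  Jacobian.\<close>

definition crit_density :: "real \<Rightarrow> (real ^ 'n \<Rightarrow> real) \<Rightarrow> ennreal" where
  "crit_density \<epsilon> f = (if grad_sq f 0 < \<epsilon>\<^sup>2 then ennreal (hess_sum f 0 ^ CARD('n)) else 0)"

lemma dderiv_path_shift:
  assumes "\<And>y. (f has_derivative (\<lambda>v. dderiv f v y)) (at y)"
  shows "dderiv (path_shift x f) v y = dderiv f v (x + y)"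
proof -
  have "((\<lambda>y. x + y) has_derivative (\<lambda>z. z)) (at y)" by (auto intro!: derivative_eq_intros)
  from has_derivative_compose[OF this assms]
  have "(path_shift x f has_derivative (\<lambda>v. dderiv f v (x + y))) (at y)" by (simp add: path_shift_def)
  then show ?thesis unfolding dderiv_def[of "path_shift x f"] by (metis frechet_derivative_at)
qed

lemma crit_density_path_shift:
  fixes f :: "real ^ 'n \<Rightarrow> real"
  assumes f: "C_k 2 f"
  shows "crit_density \<epsilon> (path_shift x f) = (if grad_sq f x < \<epsilon>\<^sup>2 then ennreal (hess_sum f x ^ CARD('n)) else 0)"
proof -
  have 1: "dderiv (path_shift x f) v = path_shift x (dderiv f v)" for v
    using dderiv_path_shift[OF C2_derivatives(1)[OF f]] by (auto simp: path_shift_def)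
  have "hess (path_shift x f) i j 0 = hess f i j x" for i j
    unfolding hess_def 1 by (simp add: dderiv_path_shift[OF C2_derivatives(2)[OF f]])
  moreover have "grad_sq (path_shift x f) 0 = grad_sq f x"
    unfolding grad_sq_def 1 by (simp add: path_shift_def)
  ultimately show ?thesis unfolding crit_density_def hess_sum_def by simp
qed

text \<open>For finitely many domains one \<epsilon> is small enough for all, and disjoint domains
  contribute separately. The threshold depends on \<open>f\<close> and on the domains, which is why
  a liminf appears; infinitely many domains force it to be \<infinity>.\<close>

lemma nodal_count_le_liminf:
  fixes f :: "real ^ 'n \<Rightarrow> real"
  assumes f: "C_k 2 f"
    and meas: "\<And>\<epsilon>. (\<lambda>x. crit_density \<epsilon> (path_shift x f)) \<in> borel_measurable borel"
  shows "nodal_count f t R \<le> liminf (\<lambda>m. (\<integral>\<^sup>+x. crit_density (1 / Suc m) (path_shift x f) * indicator (ball 0 R) x \<partial>lborel)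
      / ennreal (ball_vol TYPE(real ^ 'n) (1 / Suc m)))" (is "_ \<le> liminf ?J")
proof -
  define S where "S = {\<omega> \<in> nodal_domains f. \<omega> \<subseteq> ball 0 R \<and> emeasure lborel \<omega> \<le> t}"
  have cont: "continuous_on UNIV f" using f by (rule C_k_continuous)
  have fin: "of_nat (card A) \<le> liminf ?J" if A: "finite A" "A \<subseteq> S" for A
  proof -
    have S_open: "open \<omega>" if "\<omega> \<in> S" for \<omega>
      using that open_nodal_domain[OF cont] unfolding S_def nodal_domains_iff by auto
    have disj: "disjoint_family_on (\<lambda>\<omega>. \<omega>) A"
      unfolding disjoint_family_on_def
    proof (intro ballI impI, rule ccontr)
      fix \<omega> \<omega>' assume w: "\<omega> \<in> A" "\<omega>' \<in> A" "\<omega> \<noteq> \<omega>'" and "\<omega> \<inter> \<omega>' \<noteq> {}"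
      then obtain z where z: "z \<in> \<omega>" "z \<in> \<omega>'" by blast
      obtain x x' where "\<omega> = nodal_domain f x" "\<omega>' = nodal_domain f x'"
        using subsetD[OF A(2) w(1)] subsetD[OF A(2) w(2)] unfolding S_def nodal_domains_iff by auto
      then show False using z nodal_domain_eq[of z f x] nodal_domain_eq[of z f x'] w(3) by simp
    qed
    have "\<forall>\<^sub>F \<epsilon> in at_right 0. \<forall>\<omega>\<in>A. ennreal (ball_vol TYPE(real ^ 'n) \<epsilon>) \<le>
        (\<integral>\<^sup>+x. crit_density \<epsilon> (path_shift x f) * indicator \<omega> x \<partial>lborel)"
    proof (intro eventually_ball_finite A ballI)
      fix \<omega> assume \<omega>: "\<omega> \<in> A"
      then obtain x where x: "f x \<noteq> 0" "\<omega> = nodal_domain f x" using A unfolding S_def nodal_domains_iff by auto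
      have "bounded \<omega>" using \<omega> A unfolding S_def by (auto intro: bounded_subset[OF bounded_ball])
      then obtain p where p: "p \<in> \<omega>" "\<And>v. dderiv f v p = 0"
        using nodal_domain_critical_point[OF f x(1)] x(2) by blast
      show "\<forall>\<^sub>F \<epsilon> in at_right 0. ennreal (ball_vol TYPE(real ^ 'n) \<epsilon>) \<le>
          (\<integral>\<^sup>+x. crit_density \<epsilon> (path_shift x f) * indicator \<omega> x \<partial>lborel)"
        unfolding crit_density_path_shift[OF f]
        by (rule critical_point_mass[OF f p(2) _ p(1)]) (use \<omega> A S_open in auto)
    qed
    moreover have "filterlim (\<lambda>m. 1 / real (Suc m)) (at_right 0) sequentially"
      unfolding filterlim_at using LIMSEQ_inverse_real_of_nat by (auto simp: inverse_eq_divide)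
    ultimately have "\<forall>\<^sub>F m in sequentially. \<forall>\<omega>\<in>A. ennreal (ball_vol TYPE(real ^ 'n) (1 / Suc m)) \<le>
        (\<integral>\<^sup>+x. crit_density (1 / Suc m) (path_shift x f) * indicator \<omega> x \<partial>lborel)"
      by (rule eventually_compose_filterlim)
    then have "\<forall>\<^sub>F m in sequentially. of_nat (card A) \<le> ?J m"
    proof eventually_elim
      case (elim m)
      let ?V = "ball_vol TYPE(real ^ 'n) (1 / Suc m)"
      let ?c = "\<lambda>x. crit_density (1 / Suc m) (path_shift x f)"
      have V: "?V > 0" by simp
      note meas[measurable]
      have "of_nat (card A) * ennreal ?V = (\<Sum>\<omega>\<in>A. ennreal ?V)" by simp
      also have "\<dots> \<le> (\<Sum>\<omega>\<in>A. \<integral>\<^sup>+x. ?c x * indicator \<omega> x \<partial>lborel)"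
        using elim by (intro sum_mono) blast
      also have "\<dots> = (\<integral>\<^sup>+x. (\<Sum>\<omega>\<in>A. ?c x * indicator \<omega> x) \<partial>lborel)"
        by (rule nn_integral_sum[symmetric]) (use A S_open in auto)
      also have "\<dots> = (\<integral>\<^sup>+x. ?c x * indicator (\<Union>\<omega>\<in>A. \<omega>) x \<partial>lborel)"
      proof (rule nn_integral_cong)
        fix x
        have "(\<Sum>\<omega>\<in>A. indicator \<omega> x) = (indicator (\<Union>\<omega>\<in>A. \<omega>) x :: ennreal)"
          by (rule indicator_UN_disjoint[symmetric, OF A(1) disj])
        then show "(\<Sum>\<omega>\<in>A. ?c x * indicator \<omega> x) = ?c x * indicator (\<Union>\<omega>\<in>A. \<omega>) x"
          by (simp only: sum_distrib_left[symmetric])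
      qed
      also have "\<dots> \<le> (\<integral>\<^sup>+x. ?c x * indicator (ball 0 R) x \<partial>lborel)"
      proof (intro nn_integral_mono mult_left_mono)
        have "(\<Union>\<omega>\<in>A. \<omega>) \<subseteq> ball 0 R" using A unfolding S_def by blast
        then show "indicator (\<Union>\<omega>\<in>A. \<omega>) x \<le> (indicator (ball 0 R) x :: ennreal)" for x by (auto simp: indicator_def)
      qed simp
      finally have "of_nat (card A) * ennreal ?V / ennreal ?V \<le> ?J m" by (rule divide_right_mono_ennreal)
      then show ?case using V by (subst (asm) ennreal_mult_divide_eq) auto
    qed
    then show ?thesis by (rule Liminf_bounded)
  qed
  show ?thesis
  proof (cases "finite S")
    case True
    then have "nodal_count f t R = of_nat (card S)"
      unfolding nodal_count_def S_def[symmetric] by (simp add: emeasure_count_space_finite)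
    then show ?thesis using fin[OF True] by simp
  next
    case False
    have "of_nat k \<le> liminf ?J" for k
    proof -
      obtain A where "finite A" "card A = k" "A \<subseteq> S" using infinite_arbitrarily_large[OF False] by blast
      then show ?thesis using fin by blast
    qed
    then have "\<not> liminf ?J < \<top>"
      using ennreal_Ex_less_of_nat[of "liminf ?J"] leD by blast
    then have "liminf ?J = \<top>" using top.not_eq_extremum by blast
    then show ?thesis by simp
  qed
qed

section \<open>Difference quotients\<close>

text \<open>Central differences respect parity under reflection at the origin, on which the
  independence of gradient and Hessian rests.\<close>

definition diff1 :: "real \<Rightarrow> real ^ 'n \<Rightarrow> (real \<times> (real ^ 'n)) list" where
  "diff1 a v = [(1 / (2 * a), a *\<^sub>R v), (- (1 / (2 * a)), - (a *\<^sub>R v))]"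

definition diff2 :: "real \<Rightarrow> real ^ 'n \<Rightarrow> real ^ 'n \<Rightarrow> (real \<times> (real ^ 'n)) list" where
  "diff2 a u v = (let c = 1 / (4 * a\<^sup>2) in
     [(c, a *\<^sub>R u + a *\<^sub>R v), (- c, a *\<^sub>R u - a *\<^sub>R v), (- c, - (a *\<^sub>R u) + a *\<^sub>R v), (c, - (a *\<^sub>R u) - a *\<^sub>R v)])"

lemma lin_diff1: "lin (diff1 a v) f = (f (a *\<^sub>R v) - f (- (a *\<^sub>R v))) / (2 * a)"
  by (simp add: diff1_def diff_divide_distrib)

lemma lin_diff2: "lin (diff2 a u v) f =
  (f (a *\<^sub>R u + a *\<^sub>R v) - f (a *\<^sub>R u - a *\<^sub>R v) - f (- (a *\<^sub>R u) + a *\<^sub>R v) + f (- (a *\<^sub>R u) - a *\<^sub>R v)) / (4 * a\<^sup>2)"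
  by (simp add: diff2_def Let_def diff_divide_distrib add_divide_distrib)

text \<open>The first quotient is odd and the second is even under reflection.\<close>

lemma qform_diff1_diff2:
  fixes \<kappa> :: "real ^ 'n \<Rightarrow> real"
  assumes even: "\<And>x. \<kappa> (- x) = \<kappa> x"
  shows "qform \<kappa> (diff1 a v) (diff2 b u w) = 0"
proof -
  let ?q = "\<lambda>x. lin (diff2 b u w) (\<lambda>y. \<kappa> (x - y))"
  have "?q (- x) = ?q x" for x
  proof -
    have "\<kappa> (- x - y) = \<kappa> (x - (- y))" for y using even[of "x + y"] by simp
    then have "?q (- x) = lin (diff2 b u w) (\<lambda>y. \<kappa> (x - (- y)))" by simp
    also have "\<dots> = ?q x" unfolding lin_diff2 by (simp add: algebra_simps)
    finally show ?thesis .
  qed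
  then show ?thesis unfolding qform_def lin_diff1[of a v] by simp
qed

text \<open>The mean value theorem gives each difference quotient as a derivative at some point
  within C / (m + 1) of 0; continuity does the rest.\<close>

lemma tendsto_at_small_points:
  fixes g :: "real ^ 'n \<Rightarrow> real"
  assumes g: "continuous_on UNIV g" and z: "\<And>m::nat. \<exists>y. norm y \<le> C / Suc m \<and> z m = g y"
  shows "z \<longlonglongrightarrow> g 0"
proof -
  obtain y where y: "\<And>m. norm (y m) \<le> C / Suc m" "\<And>m. z m = g (y m)" using z by metis
  have "(\<lambda>m. C * inverse (real (Suc m))) \<longlonglongrightarrow> C * 0"
    by (intro tendsto_mult tendsto_const LIMSEQ_inverse_real_of_nat)
  then have "(\<lambda>m. C / real (Suc m)) \<longlonglongrightarrow> 0" by (simp add: divide_inverse)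
  then have "y \<longlonglongrightarrow> 0" by (rule Lim_null_comparison[rotated]) (use y in auto)
  then have "(\<lambda>m. g (y m)) \<longlonglongrightarrow> g 0" by (intro continuous_on_tendsto_compose[OF g]) auto
  then show ?thesis unfolding y(2)[symmetric] .
qed

lemma diff1_tendsto:
  assumes f: "C_k 2 f"
  shows "(\<lambda>m. lin (diff1 (1 / Suc m) v) f) \<longlonglongrightarrow> dderiv f v 0"
proof (rule tendsto_at_small_points[where C = "norm v"])
  have "C_k (Suc 0) (dderiv f v)" using f by (intro C_k_Suc_dderiv) (simp add: numeral_2_eq_2)
  then show "continuous_on UNIV (dderiv f v)" by (rule C_k_continuous)
  fix m :: nat
  define a where "a = 1 / real (Suc m)"
  have a: "a > 0" unfolding a_def by simp
  obtain s where s: "- a < s" "s < a" "f (0 + a *\<^sub>R v) - f (0 + (- a) *\<^sub>R v) = (a - (- a)) * dderiv f v (0 + s *\<^sub>R v)"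
    using mvt_line[OF C2_derivatives(1)[OF f], of "- a" a 0 v] a by auto
  have "lin (diff1 a v) f = dderiv f v (s *\<^sub>R v)" using s(3) a unfolding lin_diff1 by (simp add: field_simps)
  moreover have "norm (s *\<^sub>R v) \<le> a * norm v" using s by (auto intro!: mult_right_mono)
  ultimately show "\<exists>y. norm y \<le> norm v / real (Suc m) \<and> lin (diff1 (1 / Suc m) v) f = dderiv f v y"
    unfolding a_def by (intro exI[of _ "s *\<^sub>R v"]) simp
qed

text \<open>The mean value theorem is used twice, along \<open>v\<close> and then along
  \<open>u\<close>. This order is why \<open>hess f i j\<close> corresponds to the quotient with
  \<open>axis j 1\<close> before \<open>axis i 1\<close>.\<close>

lemma diff2_tendsto:
  assumes f: "C_k 2 f"
  shows "(\<lambda>m. lin (diff2 (1 / Suc m) u v) f) \<longlonglongrightarrow> dderiv (dderiv f v) u 0"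
proof (rule tendsto_at_small_points[where C = "norm u + norm v"])
  show "continuous_on UNIV (dderiv (dderiv f v) u)" by (rule C2_derivatives(3)[OF f])
  fix m :: nat
  define a where "a = 1 / real (Suc m)"
  have a: "a > 0" unfolding a_def by simp
  \<comment> \<open>The difference in direction \<open>u\<close> is taken inside, so that the first
    mean value step is one-dimensional in \<open>v\<close>.\<close>
  define F where "F x = f (a *\<^sub>R u + x) - f (- (a *\<^sub>R u) + x)" for x
  have shift: "((\<lambda>x. f (c + x)) has_derivative (\<lambda>w. dderiv f w (c + x))) (at x)" for c x
  proof -
    have "((\<lambda>x. c + x) has_derivative (\<lambda>z. z)) (at x)" by (auto intro!: derivative_eq_intros)
    from has_derivative_compose[OF this C2_derivatives(1)[OF f]] show ?thesis .
  qed
  have F: "(F has_derivative (\<lambda>w. dderiv f w (a *\<^sub>R u + x) - dderiv f w (- (a *\<^sub>R u) + x))) (at x)" for x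
    unfolding F_def by (intro has_derivative_diff shift)
  obtain s where s: "- a < s" "s < a" "F (0 + a *\<^sub>R v) - F (0 + (- a) *\<^sub>R v) =
      (a - (- a)) * (dderiv f v (a *\<^sub>R u + (0 + s *\<^sub>R v)) - dderiv f v (- (a *\<^sub>R u) + (0 + s *\<^sub>R v)))"
    using mvt_line[OF F, of "- a" a 0 v] a by auto
  obtain r where r: "- a < r" "r < a" "dderiv f v (s *\<^sub>R v + a *\<^sub>R u) - dderiv f v (s *\<^sub>R v + (- a) *\<^sub>R u) =
      (a - (- a)) * dderiv (dderiv f v) u (s *\<^sub>R v + r *\<^sub>R u)"
    using mvt_line[OF C2_derivatives(2)[OF f, of v], of "- a" a "s *\<^sub>R v" u] a by auto
  have "F (a *\<^sub>R v) - F (- (a *\<^sub>R v)) = 4 * a\<^sup>2 * dderiv (dderiv f v) u (s *\<^sub>R v + r *\<^sub>R u)"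
    using s(3) r(3) by (simp add: add.commute power2_eq_square)
  then have "lin (diff2 a u v) f = dderiv (dderiv f v) u (s *\<^sub>R v + r *\<^sub>R u)"
    using a unfolding lin_diff2 F_def by (simp add: field_simps)
  moreover have "norm (s *\<^sub>R v + r *\<^sub>R u) \<le> a * (norm u + norm v)"
  proof -
    have "norm (s *\<^sub>R v + r *\<^sub>R u) \<le> \<bar>s\<bar> * norm v + \<bar>r\<bar> * norm u"
      using norm_triangle_ineq[of "s *\<^sub>R v" "r *\<^sub>R u"] by simp
    also have "\<dots> \<le> a * norm v + a * norm u"
      using s r by (intro add_mono mult_right_mono) auto
    finally show ?thesis by (simp add: algebra_simps)
  qed
  ultimately show "\<exists>y. norm y \<le> (norm u + norm v) / real (Suc m) \<and> lin (diff2 (1 / Suc m) u v) f = dderiv (dderiv f v) u y"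
    unfolding a_def by (intro exI[of _ "s *\<^sub>R v + r *\<^sub>R u"]) simp
qed


section \<open>Gaussian integrals\<close>

abbreviation gauss_prod :: "('n::finite \<Rightarrow> real) measure" where
  "gauss_prod \<equiv> \<Pi>\<^sub>M i\<in>UNIV. std_normal_distribution"

lemma prob_std_normal: "prob_space std_normal_distribution"
  by (rule prob_space_normal_density) simp

lemma product_prob_std_normal: "product_prob_space (\<lambda>_. std_normal_distribution)"
proof -
  interpret prob_space std_normal_distribution by (rule prob_std_normal)
  show ?thesis by unfold_locales
qed

text \<open>Independence of the coordinates factors the complex exponential; the real part is taken
  afterwards, since the cosine of a sum does not factor.\<close>

lemma gauss_prod_cos:
  "(\<integral>z. cos (\<Sum>i\<in>UNIV. b i * z i) \<partial>(gauss_prod :: ('n::finite \<Rightarrow> real) measure)) = exp (- (\<Sum>i\<in>UNIV. (b i)\<^sup>2) / 2)"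
proof -
  interpret S: prob_space std_normal_distribution by (rule prob_std_normal)
  interpret P: product_prob_space "\<lambda>_::'n. std_normal_distribution" by (rule product_prob_std_normal)
  interpret G: prob_space "gauss_prod :: ('n \<Rightarrow> real) measure" by (rule prob_space_PiM) (rule prob_std_normal)
  have int1: "integrable std_normal_distribution (\<lambda>x. iexp (c * x))" for c :: real
    by (rule S.integrable_const_bound[where B = 1]) auto
  have prod: "(\<Prod>i\<in>UNIV. iexp (b i * z i)) = iexp (\<Sum>i\<in>UNIV. b i * z i)" for z :: "'n \<Rightarrow> real"
    by (simp add: exp_sum[symmetric] sum_distrib_left)
  have "(CLINT z|gauss_prod. iexp (\<Sum>i\<in>UNIV. b i * z i)) = (\<Prod>i\<in>UNIV. CLINT x|std_normal_distribution. iexp (b i * x))"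
    unfolding prod[symmetric] by (rule P.product_integral_prod) (use int1 in auto)
  also have "\<dots> = (\<Prod>i\<in>UNIV. complex_of_real (exp (- ((b i)\<^sup>2) / 2)))"
    using char_std_normal_distribution unfolding char_def[abs_def] by (simp add: fun_eq_iff)
  also have "\<dots> = complex_of_real (exp (- (\<Sum>i\<in>UNIV. (b i)\<^sup>2) / 2))"
    by (simp add: exp_sum[symmetric] sum_negf sum_divide_distrib flip: of_real_prod)
  finally have eq: "(CLINT z|gauss_prod. iexp (\<Sum>i\<in>UNIV. b i * z i)) = complex_of_real (exp (- (\<Sum>i\<in>UNIV. (b i)\<^sup>2) / 2))" .
  have "(\<integral>z. cos (\<Sum>i\<in>UNIV. b i * z i) \<partial>gauss_prod) = (\<integral>z. Re (iexp (\<Sum>i\<in>UNIV. b i * z i)) \<partial>gauss_prod)"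
    by (simp add: Re_exp)
  also have "\<dots> = Re (CLINT z|gauss_prod. iexp (\<Sum>i\<in>UNIV. b i * z i))"
    by (rule integral_Re) (auto intro!: G.integrable_const_bound[where B = 1])
  finally show ?thesis unfolding eq by simp
qed

text \<open>Bounding the standard density by its maximum leaves 1 / sqrt c times a normal density
  with standard deviation 1 / sqrt c.\<close>

lemma std_normal_exp_square_le:
  assumes c: "c > 0"
  shows "(\<integral>x. exp (- c * x\<^sup>2 / 2) \<partial>std_normal_distribution) \<le> 1 / sqrt c"
proof -
  let ?s = "1 / sqrt c"
  have s: "?s > 0" using c by simp
  have dens: "normal_density 0 ?s x = sqrt c / sqrt (2 * pi) * exp (- c * x\<^sup>2 / 2)" for x
    using c by (simp add: normal_density_def power_divide real_sqrt_divide field_simps)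
  have "(\<integral>x. exp (- c * x\<^sup>2 / 2) \<partial>std_normal_distribution) = (\<integral>x. std_normal_density x * exp (- c * x\<^sup>2 / 2) \<partial>lborel)"
    by (subst integral_density) auto
  also have "\<dots> \<le> (\<integral>x. ?s * normal_density 0 ?s x \<partial>lborel)"
  proof (rule integral_mono)
    show int: "integrable lborel (\<lambda>x. ?s * normal_density 0 ?s x)"
      using s by (intro integrable_mult_right integrable_normal_density)
    show le: "std_normal_density x * exp (- c * x\<^sup>2 / 2) \<le> ?s * normal_density 0 ?s x" for x
    proof -
      have "std_normal_density x \<le> 1 / sqrt (2 * pi)" unfolding std_normal_density_def
        by (simp, intro divide_right_mono) simp_all
      then have "std_normal_density x * exp (- c * x\<^sup>2 / 2) \<le> 1 / sqrt (2 * pi) * exp (- c * x\<^sup>2 / 2)"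
        by (rule mult_right_mono) simp
      also have "\<dots> = ?s * normal_density 0 ?s x" unfolding dens using c by simp
      finally show ?thesis .
    qed
    show "integrable lborel (\<lambda>x. std_normal_density x * exp (- c * x\<^sup>2 / 2))"
      by (rule Bochner_Integration.integrable_bound[OF int]) (use le s in \<open>auto simp: normal_density_nonneg\<close>)
  qed
  also have "\<dots> = ?s" using s by simp
  finally show ?thesis .
qed

lemma gauss_prod_exp_le:
  assumes c: "c > 0"
  shows "(\<integral>z. exp (- c * (\<Sum>i\<in>UNIV. (z i)\<^sup>2) / 2) \<partial>(gauss_prod :: ('n::finite \<Rightarrow> real) measure)) \<le> (1 / sqrt c) ^ CARD('n)"
proof -
  interpret S: prob_space std_normal_distribution by (rule prob_std_normal)
  interpret P: product_prob_space "\<lambda>_::'n. std_normal_distribution" by (rule product_prob_std_normal)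
  have int1: "integrable std_normal_distribution (\<lambda>x. exp (- c * x\<^sup>2 / 2))"
    using c by (intro S.integrable_const_bound[where B = 1]) auto
  have "(\<integral>z. exp (- c * (\<Sum>i\<in>UNIV. (z i)\<^sup>2) / 2) \<partial>(gauss_prod :: ('n \<Rightarrow> real) measure)) =
      (\<integral>z. (\<Prod>i\<in>UNIV. exp (- c * (z i)\<^sup>2 / 2)) \<partial>(gauss_prod :: ('n \<Rightarrow> real) measure))"
    by (simp add: exp_sum[symmetric] sum_distrib_left sum_divide_distrib sum_negf)
  also have "\<dots> = (\<Prod>i\<in>(UNIV :: 'n set). \<integral>x. exp (- c * x\<^sup>2 / 2) \<partial>std_normal_distribution)"
    by (rule P.product_integral_prod) (use int1 in auto)
  also have "\<dots> \<le> (1 / sqrt c) ^ CARD('n)"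
    using std_normal_exp_square_le[OF c] by (simp add: power_mono)
  finally show ?thesis .
qed

section \<open>One-dimensional marginals and independence of uncorrelated combinations\<close>

context gaussian_path
begin

lemma sin_lin: "(\<integral>f. sin (t * lin L f) \<partial>\<mu>) = 0"
proof -
  have "sin (t * lin L f) = cos (- (pi / 2) + lin (lscale t L) f)" for f
    using cos_diff[of "t * lin L f" "pi / 2"] by (simp add: lin_lscale)
  then show ?thesis using cos_lin[of "- (pi / 2)" "lscale t L"] by simp
qed

text \<open>Both sides have the characteristic function exp (- t^2 Q / 2). Writing the law as an
  image of the standard normal includes the degenerate case Q = 0.\<close>

lemma distr_lin:
  "distr \<mu> borel (lin L) = distr std_normal_distribution borel (\<lambda>z. sqrt (qform \<kappa> L L) * z)"
proof (rule Levy_uniqueness)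
  interpret S: prob_space std_normal_distribution by (rule prob_std_normal)
  let ?r = "sqrt (qform \<kappa> L L)"
  show "real_distribution (distr \<mu> borel (lin L))" by (rule real_distribution_distr) measurable
  show "real_distribution (distr std_normal_distribution borel (\<lambda>z. ?r * z))"
    by (rule S.real_distribution_distr) measurable
  show "char (distr \<mu> borel (lin L)) = char (distr std_normal_distribution borel (\<lambda>z. ?r * z))"
  proof
    fix t
    have int: "integrable \<mu> (\<lambda>f. iexp (t * lin L f))"
      by (rule integrable_const_bound[where B = 1]) auto
    have "char (distr \<mu> borel (lin L)) t = (CLINT f|\<mu>. iexp (t * lin L f))"
      unfolding char_def by (subst integral_distr) auto
    also have "\<dots> = complex_of_real (exp (- (t\<^sup>2 * qform \<kappa> L L) / 2))"
    proof (rule complex_eqI)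
      have "Re (CLINT f|\<mu>. iexp (t * lin L f)) = (\<integral>f. cos (0 + lin (lscale t L) f) \<partial>\<mu>)"
        using integral_Re[OF int] by (simp add: Re_exp lin_lscale)
      also have "\<dots> = exp (- (t\<^sup>2 * qform \<kappa> L L) / 2)"
        unfolding cos_lin by (simp add: qform_lscale power2_eq_square mult.assoc)
      finally show "Re (CLINT f|\<mu>. iexp (t * lin L f)) = Re (complex_of_real (exp (- (t\<^sup>2 * qform \<kappa> L L) / 2)))" by simp
      have "Im (CLINT f|\<mu>. iexp (t * lin L f)) = (\<integral>f. sin (t * lin L f) \<partial>\<mu>)"
        using integral_Im[OF int] by (simp add: Im_exp)
      then show "Im (CLINT f|\<mu>. iexp (t * lin L f)) = Im (complex_of_real (exp (- (t\<^sup>2 * qform \<kappa> L L) / 2)))"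
        by (simp add: sin_lin)
    qed
    also have "\<dots> = char std_normal_distribution (t * ?r)"
      using qform_nonneg[of L] by (simp add: char_std_normal_distribution power_mult_distrib)
    also have "\<dots> = char (distr std_normal_distribution borel (\<lambda>z. ?r * z)) t"
      unfolding char_def by (subst integral_distr) (auto simp: mult.assoc)
    finally show "char (distr \<mu> borel (lin L)) t = char (distr std_normal_distribution borel (\<lambda>z. ?r * z)) t" .
  qed
qed

text \<open>The cutoff \<open>K\<close> keeps the function bounded, as required when it is combined
  with cosines later. The right-hand side is free of \<open>K\<close>, so that the cutoff can be
  removed.\<close>

lemma min_moment_lin_le:
  assumes "qform \<kappa> L L \<le> B" and K: "0 \<le> K"
  shows "(\<integral>f. min (\<bar>lin L f\<bar> ^ k) K \<partial>\<mu>) \<le> sqrt B ^ k * (\<integral>z. \<bar>z\<bar> ^ k \<partial>std_normal_distribution)"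
proof -
  interpret S: prob_space std_normal_distribution by (rule prob_std_normal)
  let ?r = "sqrt (qform \<kappa> L L)"
  have r: "0 \<le> ?r" using qform_nonneg by simp
  have int: "integrable std_normal_distribution (\<lambda>z. \<bar>z\<bar> ^ k)"
    using integrable_abs[OF integrable_std_normal_distribution_moment[of k]] by (simp add: power_abs)
  have "(\<integral>f. min (\<bar>lin L f\<bar> ^ k) K \<partial>\<mu>) = (\<integral>x. min (\<bar>x\<bar> ^ k) K \<partial>distr \<mu> borel (lin L))"
    by (rule integral_distr[symmetric]) measurable
  also have "\<dots> = (\<integral>z. min (\<bar>?r * z\<bar> ^ k) K \<partial>std_normal_distribution)"
    unfolding distr_lin by (rule integral_distr) measurable
  also have "\<dots> \<le> (\<integral>z. ?r ^ k * \<bar>z\<bar> ^ k \<partial>std_normal_distribution)"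
  proof (rule integral_mono)
    show "integrable std_normal_distribution (\<lambda>z. min (\<bar>?r * z\<bar> ^ k) K)"
      using K by (intro S.integrable_const_bound[where B = K]) auto
    show "min (\<bar>?r * z\<bar> ^ k) K \<le> ?r ^ k * \<bar>z\<bar> ^ k" for z
      using r by (simp add: abs_mult power_mult_distrib min_le_iff_disj)
  qed (use int in simp)
  also have "\<dots> = ?r ^ k * (\<integral>z. \<bar>z\<bar> ^ k \<partial>std_normal_distribution)" by simp
  also have "\<dots> \<le> sqrt B ^ k * (\<integral>z. \<bar>z\<bar> ^ k \<partial>std_normal_distribution)"
    using r assms(1) by (intro mult_right_mono power_mono) auto
  finally show ?thesis .
qed

text \<open>Uncorrelated jointly Gaussian variables are independent. For a cosine in place of \<psi>
  the product is a sum of two cosines whose variances add up without a mixed term; the monotone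
  class theorem on the line does the rest.\<close>

lemma cos_lin_uncorrelated:
  assumes cross: "qform \<kappa> L M = 0" and \<psi>: "\<psi> \<in> borel_measurable borel" and B: "\<And>x. \<bar>\<psi> x\<bar> \<le> B"
  shows "(\<integral>f. cos (lin L f) * \<psi> (lin M f) \<partial>\<mu>) = (\<integral>f. cos (lin L f) \<partial>\<mu>) * (\<integral>f. \<psi> (lin M f) \<partial>\<mu>)"
proof -
  define H where "H u \<longleftrightarrow> u \<in> borel_measurable borel \<and> (\<exists>K. \<forall>x. \<bar>u x\<bar> \<le> K) \<and>
    (\<integral>f. cos (lin L f) * u (lin M f) \<partial>\<mu>) = (\<integral>f. cos (lin L f) \<partial>\<mu>) * (\<integral>f. u (lin M f) \<partial>\<mu>)" for u :: "real \<Rightarrow> real"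
  have HI: "H u" if "u \<in> borel_measurable borel" "\<And>x. \<bar>u x\<bar> \<le> K"
    "(\<integral>f. cos (lin L f) * u (lin M f) \<partial>\<mu>) = (\<integral>f. cos (lin L f) \<partial>\<mu>) * (\<integral>f. u (lin M f) \<partial>\<mu>)" for u K
    unfolding H_def using that by blast
  have HD: "u \<in> borel_measurable borel" "\<exists>K. \<forall>x. \<bar>u x\<bar> \<le> K"
    "(\<integral>f. cos (lin L f) * u (lin M f) \<partial>\<mu>) = (\<integral>f. cos (lin L f) \<partial>\<mu>) * (\<integral>f. u (lin M f) \<partial>\<mu>)" if "H u" for u
    using that unfolding H_def by blast+
  have int: "integrable \<mu> (\<lambda>f. u (lin M f))" "integrable \<mu> (\<lambda>f. cos (lin L f) * u (lin M f))"
    if um: "u \<in> borel_measurable borel" and uK: "\<And>x. \<bar>u x\<bar> \<le> K" for u K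
  proof -
    note um[measurable]
    show "integrable \<mu> (\<lambda>f. u (lin M f))" by (rule integrable_const_bound[where B = K]) (use uK in auto)
    have "\<bar>cos (lin L f) * u (lin M f)\<bar> \<le> K" for f
      using mult_mono[OF abs_cos_le_one[of "lin L f"] uK[of "lin M f"]] by (simp add: abs_mult)
    then show "integrable \<mu> (\<lambda>f. cos (lin L f) * u (lin M f))"
      by (intro integrable_const_bound[where B = K]) auto
  qed
  \<comment> \<open>A single coordinate, indexed by \<open>unit\<close>: the boxes are the whole
    line and the closed lower half-lines.\<close>
  interpret trig_class "borel :: real measure" "\<lambda>(_::unit) x. x" H
  proof
    show "sets (borel :: real measure) = sigma_sets (space borel) (cylinder_generator (space borel) (\<lambda>(_::unit) x. x))"
    proof -
      have "sets (borel :: real measure) = sigma_sets UNIV (range (\<lambda>a. {..a}))"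
        by (subst borel_eq_atMost) (simp add: sets_measure_of)
      also have "\<dots> = sigma_sets UNIV (cylinder_generator UNIV (\<lambda>(_::unit) x. x))"
      proof (rule sigma_sets_eqI)
        fix A :: "real set" assume "A \<in> range (\<lambda>a. {..a})"
        then obtain a where "A = {..a}" by blast
        then have "A = {x\<in>UNIV. \<forall>i\<in>(UNIV::unit set). x \<le> (\<lambda>_. a) i}" by auto
        then have "A \<in> cylinder_generator UNIV (\<lambda>(_::unit) x. x)" by (simp only: cylinder_generatorI finite)
        then show "A \<in> sigma_sets UNIV (cylinder_generator UNIV (\<lambda>(_::unit) x. x))" by blast
      next
        fix A :: "real set" assume "A \<in> cylinder_generator UNIV (\<lambda>(_::unit) x. x)"
        then obtain J :: "unit set" and c where A: "A = {x\<in>UNIV. \<forall>i\<in>J. x \<le> c i}" unfolding cylinder_generator_def by blast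
        show "A \<in> sigma_sets UNIV (range (\<lambda>a. {..a}))"
        proof (cases "J = {}")
          case True
          then have "A = UNIV" unfolding A by auto
          then show ?thesis using sigma_sets_top by auto
        next
          case False
          then have "J = {()}" by auto
          then have "A = {..c ()}" unfolding A by auto
          then show ?thesis by blast
        qed
      qed
      finally show ?thesis by simp
    qed
    show "H (\<lambda>w. cos (\<theta> + (\<Sum>i\<in>S. a i * w)))" if "finite S" for \<theta> and S :: "unit set" and a
    proof -
      define b where "b = (\<Sum>i\<in>S. a i)"
      have cross': "qform \<kappa> M L = 0" using cross qform_commute[of \<kappa> M L] even_\<kappa> by metis
      have c: "cos (lin L f) * cos (\<theta> + b * lin M f) =
          (cos (\<theta> + lin (L @ lscale b M) f) + cos (\<theta> + lin (lscale (-1) L @ lscale b M) f)) / 2" for f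
      proof -
        have "cos (lin L f) * cos (\<theta> + b * lin M f) =
            (cos (lin L f - (\<theta> + b * lin M f)) + cos (lin L f + (\<theta> + b * lin M f))) / 2" by (rule cos_times_cos)
        \<comment> \<open>Changing the sign of the argument gives both cosines the same phase
          +\<theta>.\<close>
        also have "cos (lin L f - (\<theta> + b * lin M f)) = cos (- (lin L f - (\<theta> + b * lin M f)))" by (rule cos_minus[symmetric])
        finally show ?thesis by (simp add: lin_lscale algebra_simps)
      qed
      have int_cos: "integrable \<mu> (\<lambda>f. cos (\<theta> + lin K f))" for K
        by (rule integrable_const_bound[where B = 1]) auto
      have Q: "qform \<kappa> (L @ lscale b M) (L @ lscale b M) = qform \<kappa> L L + b * b * qform \<kappa> M M"
        "qform \<kappa> (lscale (-1) L @ lscale b M) (lscale (-1) L @ lscale b M) = qform \<kappa> L L + b * b * qform \<kappa> M M"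
        by (simp_all add: qform_append qform_lscale cross cross')
      have "(\<integral>f. cos (lin L f) * cos (\<theta> + b * lin M f) \<partial>\<mu>) = cos \<theta> * exp (- (qform \<kappa> L L + b * b * qform \<kappa> M M) / 2)"
        unfolding c using int_cos by (simp only: integral_divide_zero Bochner_Integration.integral_add cos_lin Q) simp
      also have "\<dots> = exp (- qform \<kappa> L L / 2) * (cos \<theta> * exp (- (b * b * qform \<kappa> M M) / 2))"
        by (simp add: exp_add[symmetric] add_divide_distrib mult.left_commute)
      also have "\<dots> = (\<integral>f. cos (lin L f) \<partial>\<mu>) * (\<integral>f. cos (\<theta> + b * lin M f) \<partial>\<mu>)"
        using cos_lin[of 0 L] cos_lin[of \<theta> "lscale b M"] by (simp add: lin_lscale qform_lscale mult.assoc)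
      finally show ?thesis
        by (intro HI[of _ 1]) (simp_all add: sum_distrib_right[symmetric] b_def)
    qed
    show "H (\<lambda>w. a * u w)" if u: "H u" for u a
    proof -
      note [measurable] = HD(1)[OF u]
      obtain K where K: "\<And>x. \<bar>u x\<bar> \<le> K" using HD(2)[OF u] by blast
      show ?thesis
      proof (rule HI[of _ "\<bar>a\<bar> * K"])
        show "\<bar>a * u x\<bar> \<le> \<bar>a\<bar> * K" for x using K by (auto simp: abs_mult intro!: mult_left_mono)
      qed (use HD(3)[OF u] in \<open>simp_all add: mult.left_commute[of _ a]\<close>)
    qed
    show "H (\<lambda>w. u w + v w)" if u: "H u" and v: "H v" for u v
    proof -
      note [measurable] = HD(1)[OF u] HD(1)[OF v]
      obtain K where K: "\<And>x. \<bar>u x\<bar> \<le> K" using HD(2)[OF u] by blast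
      obtain K' where K': "\<And>x. \<bar>v x\<bar> \<le> K'" using HD(2)[OF v] by blast
      show ?thesis
      proof (rule HI[of _ "K + K'"])
        show "\<bar>u x + v x\<bar> \<le> K + K'" for x
          using K[of x] K'[of x] by linarith
        show "(\<integral>f. cos (lin L f) * (u (lin M f) + v (lin M f)) \<partial>\<mu>) =
            (\<integral>f. cos (lin L f) \<partial>\<mu>) * (\<integral>f. u (lin M f) + v (lin M f) \<partial>\<mu>)"
          using int[OF HD(1)[OF u] K] int[OF HD(1)[OF v] K'] HD(3)[OF u] HD(3)[OF v]
          by (simp add: distrib_left)
      qed simp
    qed
    fix u v K
    assume u: "\<And>k::nat. H (u k)" and um [measurable]: "\<And>k. u k \<in> borel_measurable borel"
      and "\<And>k w. w \<in> space borel \<Longrightarrow> \<bar>u k w\<bar> \<le> K"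
      and "\<And>w. w \<in> space borel \<Longrightarrow> (\<lambda>k. u k w) \<longlonglongrightarrow> v w"
    then have K: "\<And>k w. \<bar>u k w\<bar> \<le> K" and lim: "\<And>w. (\<lambda>k. u k w) \<longlonglongrightarrow> v w" by simp_all
    have vm [measurable]: "v \<in> borel_measurable borel" by (rule borel_measurable_LIMSEQ_real[OF lim um])
    have Kv: "\<bar>v w\<bar> \<le> K" for w
      by (rule LIMSEQ_le_const2[OF tendsto_rabs[OF lim]]) (use K in auto)
    have cK: "\<bar>cos (lin L f) * u k (lin M f)\<bar> \<le> K" for f k
      using mult_mono[OF abs_cos_le_one[of "lin L f"] K[of k "lin M f"]] by (simp add: abs_mult)
    have 1: "(\<lambda>k. \<integral>f. cos (lin L f) * u k (lin M f) \<partial>\<mu>) \<longlonglongrightarrow> (\<integral>f. cos (lin L f) * v (lin M f) \<partial>\<mu>)"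
      by (rule integral_dominated_convergence[where w = "\<lambda>_. K"]) (use cK in \<open>auto intro!: tendsto_intros lim\<close>)
    have "(\<lambda>k. \<integral>f. u k (lin M f) \<partial>\<mu>) \<longlonglongrightarrow> (\<integral>f. v (lin M f) \<partial>\<mu>)"
      by (rule integral_dominated_convergence[where w = "\<lambda>_. K"]) (use K lim in auto)
    then have 2: "(\<lambda>k. (\<integral>f. cos (lin L f) \<partial>\<mu>) * (\<integral>f. u k (lin M f) \<partial>\<mu>)) \<longlonglongrightarrow>
        (\<integral>f. cos (lin L f) \<partial>\<mu>) * (\<integral>f. v (lin M f) \<partial>\<mu>)"
      by (intro tendsto_intros)
    show "H v"
      by (rule HI[OF vm Kv LIMSEQ_unique[OF 1[unfolded HD(3)[OF u]] 2]])
  qed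
  have "H \<psi>" by (rule H_bounded_measurable[OF \<psi> B])
  then show ?thesis by (rule HD(3))
qed

end

section \<open>The expected number of nodal domains\<close>

text \<open>Radiality is isotropy, the fourth moment bounds the variances of second derivatives, and
  the last condition prevents a directional derivative from vanishing almost surely.\<close>

locale kac_rice_path = spectral_path \<mu> \<kappa> \<rho>
  for \<mu> :: "(real ^ 'n \<Rightarrow> real) measure" and \<kappa> and \<rho> :: "(real ^ 'n) measure" +
  assumes radial: "\<And>x y. norm x = norm y \<Longrightarrow> \<kappa> x = \<kappa> y"
    and moment4: "integrable \<rho> (\<lambda>\<xi>. norm \<xi> ^ 4)"
    and nondegenerate: "\<And>v. v \<noteq> 0 \<Longrightarrow> \<not> (AE \<xi> in \<rho>. v \<bullet> \<xi> = 0)"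
begin

text \<open>The quadratic form is the \<rho>-integral of the squared modulus of the trigonometric
  sum attached to the combination.\<close>

lemma qform_spectral:
  "qform \<kappa> L L = (\<integral>\<xi>. (lin L (\<lambda>x. cos (x \<bullet> \<xi>)))\<^sup>2 + (lin L (\<lambda>x. sin (x \<bullet> \<xi>)))\<^sup>2 \<partial>\<rho>)"
proof -
  have int: "integrable \<rho> (\<lambda>\<xi>. cos ((x - y) \<bullet> \<xi>))" for x y
    by (rule spec.integrable_const_bound[where B = 1]) auto
  have "qform \<kappa> L L = lin L (\<lambda>x. lin L (\<lambda>y. \<integral>\<xi>. cos ((x - y) \<bullet> \<xi>) \<partial>\<rho>))"
    unfolding qform_def \<kappa>_cos ..
  also have "\<dots> = (\<integral>\<xi>. lin L (\<lambda>x. lin L (\<lambda>y. cos ((x - y) \<bullet> \<xi>))) \<partial>\<rho>)"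
    by (simp add: integral_lin integrable_lin int)
  also have "\<dots> = (\<integral>\<xi>. (lin L (\<lambda>x. cos (x \<bullet> \<xi>)))\<^sup>2 + (lin L (\<lambda>x. sin (x \<bullet> \<xi>)))\<^sup>2 \<partial>\<rho>)"
  proof (rule Bochner_Integration.integral_cong[OF refl])
    show "lin L (\<lambda>x. lin L (\<lambda>y. cos ((x - y) \<bullet> \<xi>))) =
      (lin L (\<lambda>x. cos (x \<bullet> \<xi>)))\<^sup>2 + (lin L (\<lambda>x. sin (x \<bullet> \<xi>)))\<^sup>2" for \<xi>
  proof -
    let ?C = "lin L (\<lambda>x. cos (x \<bullet> \<xi>))" and ?S = "lin L (\<lambda>x. sin (x \<bullet> \<xi>))"
    have "lin L (\<lambda>y. cos ((x - y) \<bullet> \<xi>)) = ?C * cos (x \<bullet> \<xi>) + ?S * sin (x \<bullet> \<xi>)" for x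
      by (simp add: inner_diff_left cos_diff lin_add lin_mult)
    then show ?thesis by (simp add: lin_add lin_mult power2_eq_square)
  qed
  qed
  finally show ?thesis .
qed

section \<open>Variances of first and second derivatives\<close>

definition grad_var :: "real ^ 'n \<Rightarrow> real" where
  "grad_var v = (\<integral>\<xi>. (v \<bullet> \<xi>)\<^sup>2 \<partial>\<rho>)"

lemma integrable_inner_square: "integrable \<rho> (\<lambda>\<xi>. (v \<bullet> \<xi>)\<^sup>2)"
proof (rule Bochner_Integration.integrable_bound)
  show "integrable \<rho> (\<lambda>\<xi>. (norm v)\<^sup>2 * (1 + norm \<xi> ^ 4))"
    using moment4 by simp
  show "AE \<xi> in \<rho>. norm ((v \<bullet> \<xi>)\<^sup>2) \<le> norm ((norm v)\<^sup>2 * (1 + norm \<xi> ^ 4))"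
  proof (rule AE_I2)
    fix \<xi>
    have "(v \<bullet> \<xi>)\<^sup>2 \<le> (norm v)\<^sup>2 * (norm \<xi>)\<^sup>2"
      using power_mono[OF Cauchy_Schwarz_ineq2[of v \<xi>], of 2] by (simp add: power_mult_distrib)
    also have "(norm \<xi>)\<^sup>2 \<le> 1 + norm \<xi> ^ 4"
    proof -
      have "0 \<le> ((norm \<xi>)\<^sup>2 - 1)\<^sup>2" by simp
      then have "2 * (norm \<xi>)\<^sup>2 \<le> 1 + norm \<xi> ^ 4" by (simp add: power2_diff flip: power_mult)
      then show ?thesis using zero_le_power2[of "norm \<xi>"] by linarith
    qed
    finally show "norm ((v \<bullet> \<xi>)\<^sup>2) \<le> norm ((norm v)\<^sup>2 * (1 + norm \<xi> ^ 4))" by (simp add: mult_left_mono)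
  qed
qed measurable

text \<open>The quotient acts on the frequency \<xi> through sin (a t) / a with t = v \<bullet>
  \<xi>. This tends to t and is at most \<bar>t\<bar> in absolute value, so convergence is dominated
  by an integrable function.\<close>

lemma qform_diff1_tendsto: "(\<lambda>m. qform \<kappa> (diff1 (1 / Suc m) v) (diff1 (1 / Suc m) v)) \<longlonglongrightarrow> grad_var v"
proof -
  have eq: "qform \<kappa> (diff1 a v) (diff1 a v) = (\<integral>\<xi>. (sin (a * (v \<bullet> \<xi>)) / a)\<^sup>2 \<partial>\<rho>)" if "a > 0" for a
    unfolding qform_spectral lin_diff1 using that by simp
  have "(\<lambda>m. \<integral>\<xi>. (sin (1 / Suc m * (v \<bullet> \<xi>)) / (1 / Suc m))\<^sup>2 \<partial>\<rho>) \<longlonglongrightarrow> grad_var v"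
    unfolding grad_var_def
  proof (rule integral_dominated_convergence[where w = "\<lambda>\<xi>. (v \<bullet> \<xi>)\<^sup>2"])
    show "AE \<xi> in \<rho>. (\<lambda>m. (sin (1 / real (Suc m) * (v \<bullet> \<xi>)) / (1 / real (Suc m)))\<^sup>2) \<longlonglongrightarrow> (v \<bullet> \<xi>)\<^sup>2"
    proof (rule AE_I2, rule tendsto_power)
      fix \<xi>
      let ?t = "v \<bullet> \<xi>"
      have "((\<lambda>h. sin (?t * h)) has_field_derivative ?t * cos (?t * 0)) (at 0)"
        by (auto intro!: derivative_eq_intros)
      then have "((\<lambda>h. sin (?t * h) / h) \<longlongrightarrow> ?t) (at 0)" unfolding DERIV_def by simp
      moreover have "filterlim (\<lambda>m. 1 / real (Suc m)) (at 0) sequentially"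
        by (rule filterlim_atI) (use LIMSEQ_inverse_real_of_nat in \<open>auto simp: inverse_eq_divide\<close>)
      ultimately have "(\<lambda>m. sin (?t * (1 / real (Suc m))) / (1 / real (Suc m))) \<longlonglongrightarrow> ?t"
        by (rule filterlim_compose)
      then show "(\<lambda>m. sin (1 / real (Suc m) * ?t) / (1 / real (Suc m))) \<longlonglongrightarrow> ?t"
        by (simp add: mult.commute)
    qed
    show "AE \<xi> in \<rho>. norm ((sin (1 / real (Suc m) * (v \<bullet> \<xi>)) / (1 / real (Suc m)))\<^sup>2) \<le> (v \<bullet> \<xi>)\<^sup>2" for m
    proof (rule AE_I2)
      fix \<xi>
      have *: "\<bar>sin (a * t) / a\<bar> \<le> \<bar>t\<bar>" if "a > 0" for a t :: real
        using abs_sin_x_le_abs_x[of "a * t"] that by (simp add: abs_mult pos_divide_le_eq mult.commute)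
      have "\<bar>sin (1 / real (Suc m) * (v \<bullet> \<xi>)) / (1 / real (Suc m))\<bar> \<le> \<bar>v \<bullet> \<xi>\<bar>"
        by (rule *) simp
      then show "norm ((sin (1 / real (Suc m) * (v \<bullet> \<xi>)) / (1 / real (Suc m)))\<^sup>2) \<le> (v \<bullet> \<xi>)\<^sup>2"
        using abs_le_square_iff by force
    qed
  qed (use integrable_inner_square in measurable)
  then show ?thesis by (simp add: eq)
qed

text \<open>The choice of the coordinate direction is immaterial by isotropy, as
  \<open>grad_var_eq\<close> shows.\<close>

definition \<sigma>2 :: real where "\<sigma>2 = grad_var (axis undefined 1)"

lemma \<sigma>2_pos: "\<sigma>2 > 0"
proof -
  let ?e = "axis undefined 1 :: real ^ 'n"
  have "\<sigma>2 \<noteq> 0"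
  proof
    assume "\<sigma>2 = 0"
    then have "AE \<xi> in \<rho>. (?e \<bullet> \<xi>)\<^sup>2 = 0"
      unfolding \<sigma>2_def grad_var_def by (subst (asm) integral_nonneg_eq_0_iff_AE[OF integrable_inner_square]) auto
    then show False using nondegenerate[of ?e] by (simp add: axis_eq_0_iff)
  qed
  moreover have "\<sigma>2 \<ge> 0" unfolding \<sigma>2_def grad_var_def by simp
  ultimately show ?thesis by simp
qed

text \<open>The difference quotients along \<open>v\<close> and along the axis vector
  \<open>w\<close> of the same norm have equal variance because \<kappa> is radial. So the gradient
  has covariance \<sigma>2 times the identity.\<close>

lemma grad_var_eq: "grad_var v = (norm v)\<^sup>2 * \<sigma>2"
proof -
  let ?e = "axis undefined 1 :: real ^ 'n"
  define w where "w = norm v *\<^sub>R ?e"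
  have nw: "norm w = norm v" unfolding w_def by simp
  have "qform \<kappa> (diff1 a v) (diff1 a v) = qform \<kappa> (diff1 a w) (diff1 a w)" for a
  proof -
    have "\<kappa> (c *\<^sub>R v) = \<kappa> (c *\<^sub>R w)" for c by (rule radial) (simp add: nw)
    from this[of "2 * a"] this[of "- (2 * a)"]
    have "\<kappa> (a *\<^sub>R v + a *\<^sub>R v) = \<kappa> (a *\<^sub>R w + a *\<^sub>R w)" "\<kappa> (- (a *\<^sub>R v) - a *\<^sub>R v) = \<kappa> (- (a *\<^sub>R w) - a *\<^sub>R w)"
      by (simp_all add: scaleR_left_distrib[symmetric] flip: scaleR_minus_left scaleR_left_diff_distrib)
    then show ?thesis unfolding qform_def lin_diff1 by simp
  qed
  then have "grad_var v = grad_var w"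
    using LIMSEQ_unique[OF qform_diff1_tendsto[of v]] qform_diff1_tendsto[of w] by simp
  also have "\<dots> = (norm v)\<^sup>2 * \<sigma>2" unfolding \<sigma>2_def grad_var_def w_def by (simp add: power_mult_distrib)
  finally show ?thesis .
qed

text \<open>On the frequency side the mixed quotient is - sin (a u \<bullet> \<xi>) sin (a v
  \<bullet> \<xi>) / a^2, and each sine is at most \<open>a * norm \<xi>\<close> in absolute value.
  The bound is uniform in \<open>a\<close>.\<close>

lemma qform_diff2_le:
  assumes u: "norm u = 1" and v: "norm v = 1" and a: "a > 0"
  shows "qform \<kappa> (diff2 a u v) (diff2 a u v) \<le> (\<integral>\<xi>. norm \<xi> ^ 4 \<partial>\<rho>)"
proof -
  have C: "lin (diff2 a u v) (\<lambda>x. cos (x \<bullet> \<xi>)) = - (sin (a * (u \<bullet> \<xi>)) * sin (a * (v \<bullet> \<xi>))) / a\<^sup>2" for \<xi>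
    unfolding lin_diff2 using a
    by (simp add: inner_add_left inner_diff_left cos_add cos_diff field_simps)
  have S: "lin (diff2 a u v) (\<lambda>x. sin (x \<bullet> \<xi>)) = 0" for \<xi>
    unfolding lin_diff2 by (simp add: inner_add_left inner_diff_left sin_add sin_diff)
  have bound: "(- (sin (a * (u \<bullet> \<xi>)) * sin (a * (v \<bullet> \<xi>))) / a\<^sup>2)\<^sup>2 \<le> norm \<xi> ^ 4" for \<xi>
  proof -
    have s: "\<bar>sin (a * (w \<bullet> \<xi>))\<bar> \<le> a * norm \<xi>" if "norm w = 1" for w
    proof -
      have "\<bar>sin (a * (w \<bullet> \<xi>))\<bar> \<le> \<bar>a * (w \<bullet> \<xi>)\<bar>" by (rule abs_sin_x_le_abs_x)
      also have "\<dots> \<le> a * norm \<xi>"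
        using Cauchy_Schwarz_ineq2[of w \<xi>] that a by (simp add: abs_mult)
      finally show ?thesis .
    qed
    have "\<bar>sin (a * (u \<bullet> \<xi>)) * sin (a * (v \<bullet> \<xi>))\<bar> \<le> (a * norm \<xi>) * (a * norm \<xi>)"
      unfolding abs_mult by (intro mult_mono s u v) (use a in auto)
    then have "\<bar>- (sin (a * (u \<bullet> \<xi>)) * sin (a * (v \<bullet> \<xi>))) / a\<^sup>2\<bar> \<le> (norm \<xi>)\<^sup>2"
      using a by (simp add: field_simps power2_eq_square)
    then have "\<bar>- (sin (a * (u \<bullet> \<xi>)) * sin (a * (v \<bullet> \<xi>))) / a\<^sup>2\<bar>\<^sup>2 \<le> ((norm \<xi>)\<^sup>2)\<^sup>2"
      by (intro power_mono) auto
    then show ?thesis unfolding power2_abs by (simp flip: power_mult)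
  qed
  show ?thesis unfolding qform_spectral C S
    by (rule integral_mono) (use bound moment4 in \<open>auto intro!: Bochner_Integration.integrable_bound[OF moment4]\<close>)
qed

lemma dderiv_meas [measurable]: "(\<lambda>f. dderiv f v 0) \<in> borel_measurable \<mu>"
  by (rule borel_measurable_LIMSEQ_real[where u = "\<lambda>m. lin (diff1 (1 / Suc m) v)"])
     (use diff1_tendsto space_\<mu> in auto)

lemma hess_meas [measurable]: "(\<lambda>f. hess f i j 0) \<in> borel_measurable \<mu>"
  unfolding hess_def
  by (rule borel_measurable_LIMSEQ_real[where u = "\<lambda>m. lin (diff2 (1 / Suc m) (axis j 1) (axis i 1))"])
     (use diff2_tendsto space_\<mu> in auto)

text \<open>Independence holds at the level of difference quotients, where the covariance is exactly
  0. The factorised bound then passes to the limit, with \<open>C\<close> uniform in the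
  mesh.\<close>

lemma cos_dderiv_hess_le:
  assumes \<psi>: "continuous_on UNIV \<psi>" and \<psi>0: "\<And>x. 0 \<le> \<psi> x" and B: "\<And>x. \<psi> x \<le> B"
    and C: "\<And>m. (\<integral>f. \<psi> (lin (diff2 (1 / Suc m) (axis j 1) (axis i 1)) f) \<partial>\<mu>) \<le> C"
  shows "(\<integral>f. cos (dderiv f v 0) * \<psi> (hess f i j 0) \<partial>\<mu>) \<le> exp (- ((norm v)\<^sup>2 * \<sigma>2) / 2) * C"
proof -
  let ?Y = "\<lambda>m. diff1 (1 / Suc m) v" and ?H = "\<lambda>m. diff2 (1 / Suc m) (axis j 1) (axis i 1) :: (real \<times> (real ^ 'n)) list"
  have [measurable]: "\<psi> \<in> borel_measurable borel" using \<psi> by (rule borel_measurable_continuous_onI)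
  have \<psi>B: "\<bar>\<psi> x\<bar> \<le> B" for x using \<psi>0[of x] B[of x] by simp
  have cB: "\<bar>cos x * \<psi> y\<bar> \<le> B" for x y
    using mult_mono[OF abs_cos_le_one[of x] \<psi>B[of y]] by (simp add: abs_mult)
  have "(\<lambda>m. \<integral>f. cos (lin (?Y m) f) * \<psi> (lin (?H m) f) \<partial>\<mu>) \<longlonglongrightarrow> (\<integral>f. cos (dderiv f v 0) * \<psi> (hess f i j 0) \<partial>\<mu>)"
  proof (rule integral_dominated_convergence[where w = "\<lambda>_. B"])
    show "AE f in \<mu>. (\<lambda>m. cos (lin (?Y m) f) * \<psi> (lin (?H m) f)) \<longlonglongrightarrow> cos (dderiv f v 0) * \<psi> (hess f i j 0)"
    proof (rule AE_I2)
      fix f assume "f \<in> space \<mu>"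
      then have f: "C_k 2 f" by (simp add: space_\<mu>)
      have "(\<lambda>m. \<psi> (lin (?H m) f)) \<longlonglongrightarrow> \<psi> (hess f i j 0)"
        unfolding hess_def by (rule continuous_on_tendsto_compose[OF \<psi> diff2_tendsto[OF f]]) auto
      then show "(\<lambda>m. cos (lin (?Y m) f) * \<psi> (lin (?H m) f)) \<longlonglongrightarrow> cos (dderiv f v 0) * \<psi> (hess f i j 0)"
        by (intro tendsto_intros diff1_tendsto[OF f])
    qed
  qed (use cB in auto)
  moreover have "(\<lambda>m. exp (- qform \<kappa> (?Y m) (?Y m) / 2) * C) \<longlonglongrightarrow> exp (- grad_var v / 2) * C"
    by (intro tendsto_intros qform_diff1_tendsto) simp
  moreover have "(\<integral>f. cos (lin (?Y m) f) * \<psi> (lin (?H m) f) \<partial>\<mu>) \<le> exp (- qform \<kappa> (?Y m) (?Y m) / 2) * C" for m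
  proof -
    have "(\<integral>f. cos (lin (?Y m) f) * \<psi> (lin (?H m) f) \<partial>\<mu>) = (\<integral>f. cos (lin (?Y m) f) \<partial>\<mu>) * (\<integral>f. \<psi> (lin (?H m) f) \<partial>\<mu>)"
      by (rule cos_lin_uncorrelated[where B = B]) (use \<psi>B qform_diff1_diff2[of \<kappa>] even_\<kappa> in auto)
    also have "(\<integral>f. cos (lin (?Y m) f) \<partial>\<mu>) = exp (- qform \<kappa> (?Y m) (?Y m) / 2)"
      using cos_lin[of 0 "?Y m"] by simp
    finally show ?thesis using C[of m] by (simp add: mult_left_mono)
  qed
  ultimately have "(\<integral>f. cos (dderiv f v 0) * \<psi> (hess f i j 0) \<partial>\<mu>) \<le> exp (- grad_var v / 2) * C"
    by (intro LIMSEQ_le) auto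
  then show ?thesis by (simp add: grad_var_eq)
qed

text \<open>The Gaussian weight in the gradient is the average of \<open>cos (dderiv f v 0)\<close> over Gaussian
  vectors \<open>v\<close>.\<close>

lemma grad_hess_integral_le:
  assumes \<psi>: "continuous_on UNIV \<psi>" and \<psi>0: "\<And>x. 0 \<le> \<psi> x" and B: "\<And>x. \<psi> x \<le> B"
    and C: "\<And>m. (\<integral>f. \<psi> (lin (diff2 (1 / Suc m) (axis j 1) (axis i 1)) f) \<partial>\<mu>) \<le> C" and \<epsilon>: "\<epsilon> > 0"
  shows "(\<integral>f. exp (- grad_sq f 0 / (2 * \<epsilon>\<^sup>2)) * \<psi> (hess f i j 0) \<partial>\<mu>) \<le> (\<epsilon> / sqrt \<sigma>2) ^ CARD('n) * C"
proof -
  let ?G = "gauss_prod :: ('n \<Rightarrow> real) measure"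
  interpret G: prob_space ?G by (rule prob_space_PiM) (rule prob_std_normal)
  interpret P: pair_prob_space \<mu> ?G ..
  have [measurable]: "\<psi> \<in> borel_measurable borel" using \<psi> by (rule borel_measurable_continuous_onI)
  have \<psi>B: "\<bar>\<psi> x\<bar> \<le> B" for x using \<psi>0[of x] B[of x] by simp
  have cB: "\<bar>cos x * \<psi> y\<bar> \<le> B" for x y
    using mult_mono[OF abs_cos_le_one[of x] \<psi>B[of y]] by (simp add: abs_mult)
  have C0: "0 \<le> C"
    by (rule order_trans[OF Bochner_Integration.integral_nonneg C[of 0]]) (rule \<psi>0)
  \<comment> \<open>The argument of the cosine read in two ways: linear in the Gaussian vector
    \<open>z\<close>, so that averaging over \<open>z\<close> gives the weight, and a directional
    derivative along \<open>vec z\<close>, so that averaging over \<open>f\<close> is covered by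
    \<open>cos_dderiv_hess_le\<close>.\<close>
  define g where "g f z = (\<Sum>i\<in>UNIV. dderiv f (axis i 1) 0 / \<epsilon> * z i)" for f :: "real ^ 'n \<Rightarrow> real" and z
  define vec where "vec z = (\<chi> i. z i / \<epsilon>)" for z :: "'n \<Rightarrow> real"
  have g_meas [measurable]: "(\<lambda>p. g (fst p) (snd p)) \<in> borel_measurable (\<mu> \<Otimes>\<^sub>M ?G)"
    unfolding g_def by measurable
  have gv: "g f z = dderiv f (vec z) 0" if "f \<in> space \<mu>" for f z
  proof -
    have "C_k 2 f" using that by (simp add: space_\<mu>)
    then have "dderiv f (vec z) 0 = (\<Sum>i\<in>UNIV. vec z $ i * dderiv f (axis i 1) 0)"
      by (intro dderiv_sum_axis C2_derivatives(1))
    also have "\<dots> = g f z" unfolding g_def vec_def by (rule sum.cong) simp_all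
    finally show ?thesis ..
  qed
  have norm_vec: "(norm (vec z))\<^sup>2 = (\<Sum>i\<in>UNIV. (z i)\<^sup>2) / \<epsilon>\<^sup>2" for z
    unfolding norm_vec_def L2_set_def vec_def by (simp add: sum_nonneg power_divide sum_divide_distrib)
  have "(\<integral>z. cos (g f z) \<partial>?G) = exp (- grad_sq f 0 / (2 * \<epsilon>\<^sup>2))" for f
    unfolding g_def gauss_prod_cos grad_sq_def
    by (simp add: power_divide sum_divide_distrib[symmetric] mult.commute)
  then have "exp (- grad_sq f 0 / (2 * \<epsilon>\<^sup>2)) * \<psi> (hess f i j 0) = (\<integral>z. cos (g f z) * \<psi> (hess f i j 0) \<partial>?G)" for f
    by simp
  then have "(\<integral>f. exp (- grad_sq f 0 / (2 * \<epsilon>\<^sup>2)) * \<psi> (hess f i j 0) \<partial>\<mu>) =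
      (\<integral>f. (\<integral>z. cos (g f z) * \<psi> (hess f i j 0) \<partial>?G) \<partial>\<mu>)"
    by (intro Bochner_Integration.integral_cong[OF refl])
  also have "\<dots> = (\<integral>z. (\<integral>f. cos (g f z) * \<psi> (hess f i j 0) \<partial>\<mu>) \<partial>?G)"
    by (rule P.Fubini_integral[symmetric])
       (use cB in \<open>auto intro!: P.P.integrable_const_bound[where B = B] simp: case_prod_beta'\<close>)
  also have "\<dots> \<le> (\<integral>z. exp (- (\<sigma>2 / \<epsilon>\<^sup>2) * (\<Sum>i\<in>UNIV. (z i)\<^sup>2) / 2) * C \<partial>?G)"
  proof (rule integral_mono)
    show "integrable ?G (\<lambda>z. \<integral>f. cos (g f z) * \<psi> (hess f i j 0) \<partial>\<mu>)"
      by (rule P.integrable_snd[where f = "\<lambda>f z. cos (g f z) * \<psi> (hess f i j 0)"])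
         (use cB in \<open>auto intro!: P.P.integrable_const_bound[where B = B] simp: case_prod_beta'\<close>)
    have "integrable ?G (\<lambda>z. exp (- (\<sigma>2 / \<epsilon>\<^sup>2) * (\<Sum>i\<in>UNIV. (z i)\<^sup>2) / 2))"
      using \<sigma>2_pos by (intro G.integrable_const_bound[where B = 1]) (auto intro!: sum_nonneg mult_nonneg_nonneg divide_nonneg_nonneg)
    then show "integrable ?G (\<lambda>z. exp (- (\<sigma>2 / \<epsilon>\<^sup>2) * (\<Sum>i\<in>UNIV. (z i)\<^sup>2) / 2) * C)" by simp
    fix z
    have "(\<integral>f. cos (g f z) * \<psi> (hess f i j 0) \<partial>\<mu>) = (\<integral>f. cos (dderiv f (vec z) 0) * \<psi> (hess f i j 0) \<partial>\<mu>)"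
      by (rule Bochner_Integration.integral_cong[OF refl]) (simp add: gv)
    also have "\<dots> \<le> exp (- ((norm (vec z))\<^sup>2 * \<sigma>2) / 2) * C"
      by (rule cos_dderiv_hess_le[OF \<psi> \<psi>0 B C])
    finally show "(\<integral>f. cos (g f z) * \<psi> (hess f i j 0) \<partial>\<mu>) \<le> exp (- (\<sigma>2 / \<epsilon>\<^sup>2) * (\<Sum>i\<in>UNIV. (z i)\<^sup>2) / 2) * C"
      unfolding norm_vec by (simp add: mult.commute)
  qed
  also have "\<dots> = (\<integral>z. exp (- (\<sigma>2 / \<epsilon>\<^sup>2) * (\<Sum>i\<in>UNIV. (z i)\<^sup>2) / 2) \<partial>?G) * C" by simp
  \<comment> \<open>The remaining Gaussian integral has rate \<sigma>2 / \<epsilon>^2 in each of the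
    n coordinates; this is the origin of the factor \<epsilon>^n.\<close>
  also have "\<dots> \<le> (1 / sqrt (\<sigma>2 / \<epsilon>\<^sup>2)) ^ CARD('n) * C"
    using \<sigma>2_pos \<epsilon> by (intro mult_right_mono gauss_prod_exp_le C0) simp
  also have "1 / sqrt (\<sigma>2 / \<epsilon>\<^sup>2) = \<epsilon> / sqrt \<sigma>2" using \<epsilon> by (simp add: real_sqrt_divide)
  finally show ?thesis .
qed

text \<open>Apply \<open>grad_hess_integral_le\<close> to the cutoff power, with a bound free of the
  cutoff, and remove the cutoff by Fatou.\<close>

lemma grad_hess_power_integral_le:
  assumes \<epsilon>: "\<epsilon> > 0"
  shows "(\<integral>\<^sup>+f. ennreal (exp (- grad_sq f 0 / (2 * \<epsilon>\<^sup>2)) * \<bar>hess f i j 0\<bar> ^ k) \<partial>\<mu>) \<le>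
    ennreal ((\<epsilon> / sqrt \<sigma>2) ^ CARD('n) * (sqrt (\<integral>\<xi>. norm \<xi> ^ 4 \<partial>\<rho>) ^ k * (\<integral>z. \<bar>z\<bar> ^ k \<partial>std_normal_distribution)))"
    (is "_ \<le> ennreal ?K")
proof -
  let ?u = "\<lambda>K f. exp (- grad_sq f 0 / (2 * \<epsilon>\<^sup>2)) * min (\<bar>hess f i j 0\<bar> ^ k) (real K)"
  have [measurable]: "(\<lambda>f. grad_sq f 0) \<in> borel_measurable \<mu>" unfolding grad_sq_def by measurable
  have bound: "(\<integral>\<^sup>+f. ennreal (?u K f) \<partial>\<mu>) \<le> ennreal ?K" for K :: nat
  proof -
    have g0: "0 \<le> grad_sq f 0" for f unfolding grad_sq_def by (simp add: sum_nonneg)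
    have "\<bar>?u K f\<bar> \<le> real K" for f
    proof -
      have "\<bar>?u K f\<bar> = exp (- grad_sq f 0 / (2 * \<epsilon>\<^sup>2)) * min (\<bar>hess f i j 0\<bar> ^ k) (real K)" by (simp add: abs_mult)
      also have "\<dots> \<le> 1 * real K" using g0[of f] by (intro mult_mono) auto
      finally show ?thesis by simp
    qed
    then have int: "integrable \<mu> (?u K)" by (intro integrable_const_bound[where B = "real K"]) auto
    have "(\<integral>\<^sup>+f. ennreal (?u K f) \<partial>\<mu>) = ennreal (\<integral>f. ?u K f \<partial>\<mu>)"
      by (rule nn_integral_eq_integral[OF int]) simp
    also have "(\<integral>f. ?u K f \<partial>\<mu>) \<le> ?K"
    proof (rule grad_hess_integral_le[OF _ _ _ _ \<epsilon>, where B = "real K"])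
      show "continuous_on UNIV (\<lambda>x. min (\<bar>x\<bar> ^ k) (real K))" by (intro continuous_intros)
      show "(\<integral>f. min (\<bar>lin (diff2 (1 / Suc m) (axis j 1) (axis i 1)) f\<bar> ^ k) (real K) \<partial>\<mu>) \<le>
          sqrt (\<integral>\<xi>. norm \<xi> ^ 4 \<partial>\<rho>) ^ k * (\<integral>z. \<bar>z\<bar> ^ k \<partial>std_normal_distribution)" for m
        by (intro min_moment_lin_le qform_diff2_le) auto
    qed auto
    finally show ?thesis by (simp add: ennreal_leI)
  qed
  have "(\<integral>\<^sup>+f. ennreal (exp (- grad_sq f 0 / (2 * \<epsilon>\<^sup>2)) * \<bar>hess f i j 0\<bar> ^ k) \<partial>\<mu>) = (\<integral>\<^sup>+f. liminf (\<lambda>K. ennreal (?u K f)) \<partial>\<mu>)"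
  proof (rule nn_integral_cong)
    fix f
    have "\<forall>\<^sub>F K in sequentially. \<bar>hess f i j 0\<bar> ^ k \<le> real K"
      by (rule eventually_compose_filterlim[OF eventually_ge_at_top filterlim_real_sequentially])
    then have "\<forall>\<^sub>F K in sequentially. ennreal (?u K f) = ennreal (exp (- grad_sq f 0 / (2 * \<epsilon>\<^sup>2)) * \<bar>hess f i j 0\<bar> ^ k)"
      by eventually_elim simp
    then have "(\<lambda>K. ennreal (?u K f)) \<longlonglongrightarrow> ennreal (exp (- grad_sq f 0 / (2 * \<epsilon>\<^sup>2)) * \<bar>hess f i j 0\<bar> ^ k)"
      by (rule tendsto_eventually)
    then show "ennreal (exp (- grad_sq f 0 / (2 * \<epsilon>\<^sup>2)) * \<bar>hess f i j 0\<bar> ^ k) = liminf (\<lambda>K. ennreal (?u K f))"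
      by (intro lim_imp_Liminf[symmetric]) auto
  qed
  also have "\<dots> \<le> liminf (\<lambda>K. \<integral>\<^sup>+f. ennreal (?u K f) \<partial>\<mu>)" by (rule nn_integral_liminf) measurable
  also have "\<dots> \<le> ennreal ?K"
    by (rule Liminf_le) (simp, intro always_eventually allI bound)
  finally show ?thesis .
qed

lemma crit_density_meas [measurable]: "crit_density \<epsilon> \<in> borel_measurable \<mu>"
  unfolding crit_density_def[abs_def] grad_sq_def hess_sum_def by measurable

text \<open>Where \<open>grad_sq f 0 < \<epsilon>\<^sup>2\<close> the Gaussian weight is at least
  exp (- 1 / 2), so the indicator is at most exp (1 / 2) times the weight. The power of
  \<open>hess_sum\<close> reduces to zeroth and n-th powers of single entries, each covered by the
  previous lemma.\<close>

lemma crit_density_integral_le: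
  "\<exists>K\<ge>0. \<forall>\<epsilon>>0. (\<integral>\<^sup>+f. crit_density \<epsilon> f \<partial>\<mu>) \<le> ennreal (K * \<epsilon> ^ CARD('n))"
proof -
  define n where "n = CARD('n)"
  \<comment> \<open>Three losses: the sum of n * n entries against its largest term, (1 + h)^n \<le>
    2^n (1 + h^n), and the indicator against the Gaussian weight.\<close>
  define c where "c = real (n * n) ^ n * 2 ^ n * exp (1 / 2)"
  define K0 where "K0 k = (1 / sqrt \<sigma>2) ^ n * (sqrt (\<integral>\<xi>. norm \<xi> ^ 4 \<partial>\<rho>) ^ k * (\<integral>z. \<bar>z\<bar> ^ k \<partial>std_normal_distribution))" for k
  have c0: "c \<ge> 0" unfolding c_def by simp
  have K00: "K0 k \<ge> 0" for k unfolding K0_def using \<sigma>2_pos by simp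
  have [measurable]: "(\<lambda>f. grad_sq f 0) \<in> borel_measurable \<mu>" unfolding grad_sq_def by measurable
  have "(\<integral>\<^sup>+f. crit_density \<epsilon> f \<partial>\<mu>) \<le> ennreal (c * (real (n * n) * (K0 0 + K0 n)) * \<epsilon> ^ CARD('n))" if \<epsilon>: "\<epsilon> > 0" for \<epsilon>
  proof -
    define w where "w f = exp (- grad_sq f 0 / (2 * \<epsilon>\<^sup>2))" for f :: "real ^ 'n \<Rightarrow> real"
    have w0: "w f \<ge> 0" for f unfolding w_def by simp
    have [measurable]: "w \<in> borel_measurable \<mu>" unfolding w_def by measurable
    define q where "q i j k f = ennreal (w f * \<bar>hess f i j 0\<bar> ^ k)" for i j k and f :: "real ^ 'n \<Rightarrow> real"
    have [measurable]: "q i j k \<in> borel_measurable \<mu>" for i j k unfolding q_def by measurable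
    have q_le: "(\<integral>\<^sup>+f. q i j k f \<partial>\<mu>) \<le> ennreal (K0 k * \<epsilon> ^ n)" for i j k
      unfolding q_def w_def using grad_hess_power_integral_le[OF \<epsilon>, of i j k] unfolding K0_def n_def
      by (simp add: power_divide mult.commute mult.left_commute)
    have pw: "crit_density \<epsilon> f \<le> ennreal c * (\<Sum>i\<in>UNIV. \<Sum>j\<in>UNIV. q i j 0 f + q i j n f)" for f
    proof (cases "grad_sq f 0 < \<epsilon>\<^sup>2")
      case True
      define h where "h p = \<bar>hess f (fst p) (snd p) 0\<bar>" for p
      define D where "D = (UNIV :: ('n \<times> 'n) set)"
      have h0: "h p \<ge> 0" for p unfolding h_def by simp
      have hs: "hess_sum f 0 = (\<Sum>p\<in>D. 1 + h p)"
        unfolding hess_sum_def h_def D_def UNIV_Times_UNIV[symmetric] sum.cartesian_product by (simp add: case_prod_beta')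
      have cD: "card D = n * n" unfolding D_def n_def by (simp add: card_cartesian_product flip: UNIV_Times_UNIV)
      have Df: "finite D" "D \<noteq> {}" unfolding D_def by simp_all
      \<comment> \<open>The maximal entry depends on \<open>f\<close>; adding up over all entries
        afterwards removes this dependence.\<close>
      define M where "M = Max ((\<lambda>p. 1 + h p) ` D)"
      have "M \<in> (\<lambda>p. 1 + h p) ` D" unfolding M_def by (rule Max_in) (use Df in auto)
      then obtain p where p: "p \<in> D" "M = 1 + h p" by blast
      have "hess_sum f 0 \<le> (\<Sum>p\<in>D. M)" unfolding hs M_def
        by (intro sum_mono Max_ge) (use Df in auto)
      then have 1: "hess_sum f 0 \<le> real (n * n) * (1 + h p)" using cD p by simp
      have "1 + h p \<le> 2 * max 1 (h p)" by simp
      then have "(1 + h p) ^ n \<le> (2 * max 1 (h p)) ^ n" using h0[of p] by (intro power_mono) auto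
      also have "\<dots> = 2 ^ n * (max 1 (h p)) ^ n" by (simp add: power_mult_distrib)
      also have "(max 1 (h p)) ^ n \<le> h p ^ 0 + h p ^ n"
        using h0[of p] by (cases "1 \<le> h p") (simp_all add: max_def power_le_one)
      finally have 2: "(1 + h p) ^ n \<le> 2 ^ n * (h p ^ 0 + h p ^ n)" by simp
      have 3: "h p ^ 0 + h p ^ n \<le> (\<Sum>p\<in>D. h p ^ 0 + h p ^ n)"
        by (rule member_le_sum[OF p(1)]) (use h0 Df in auto)
      have "hess_sum f 0 \<ge> 0" unfolding hess_sum_def by (intro sum_nonneg) simp
      then have "hess_sum f 0 ^ n \<le> (real (n * n) * (1 + h p)) ^ n" by (intro power_mono 1)
      also have "\<dots> = real (n * n) ^ n * (1 + h p) ^ n" by (rule power_mult_distrib)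
      also have "\<dots> \<le> real (n * n) ^ n * (2 ^ n * (\<Sum>p\<in>D. h p ^ 0 + h p ^ n))"
        using 2 3 by (intro mult_left_mono) (auto intro: order_trans mult_left_mono)
      finally have 4: "hess_sum f 0 ^ n \<le> real (n * n) ^ n * 2 ^ n * (\<Sum>p\<in>D. h p ^ 0 + h p ^ n)" by simp
      have "- (1 / 2) \<le> - grad_sq f 0 / (2 * \<epsilon>\<^sup>2)" using True \<epsilon> by (simp add: field_simps)
      then have "exp (- (1 / 2)) \<le> w f" unfolding w_def by (simp only: exp_le_cancel_iff)
      then have "exp (1 / 2) * exp (- (1 / 2)) \<le> exp (1 / 2) * w f" by (intro mult_left_mono) auto
      then have 5: "1 \<le> exp (1 / 2) * w f" by (simp add: exp_add[symmetric])
      have "hess_sum f 0 ^ n \<le> (exp (1 / 2) * w f) * (real (n * n) ^ n * 2 ^ n * (\<Sum>p\<in>D. h p ^ 0 + h p ^ n))"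
        using mult_mono[OF 5 4] \<open>hess_sum f 0 \<ge> 0\<close> w0 by simp
      also have "\<dots> = c * (\<Sum>p\<in>D. w f * h p ^ 0 + w f * h p ^ n)"
        unfolding c_def by (simp add: sum_distrib_left algebra_simps)
      finally have "ennreal (hess_sum f 0 ^ n) \<le> ennreal c * ennreal (\<Sum>p\<in>D. w f * h p ^ 0 + w f * h p ^ n)"
        using c0 by (subst ennreal_mult'[symmetric]) (simp_all add: ennreal_leI)
      also have "ennreal (\<Sum>p\<in>D. w f * h p ^ 0 + w f * h p ^ n) = (\<Sum>p\<in>D. ennreal (w f * h p ^ 0) + ennreal (w f * h p ^ n))"
        using w0 h0 by (subst sum_ennreal[symmetric]) (auto intro!: add_nonneg_nonneg mult_nonneg_nonneg sum.cong ennreal_plus)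
      also have "\<dots> = (\<Sum>i\<in>UNIV. \<Sum>j\<in>UNIV. q i j 0 f + q i j n f)"
        unfolding D_def UNIV_Times_UNIV[symmetric] sum.cartesian_product q_def h_def by (simp add: case_prod_beta')
      finally show ?thesis using True unfolding crit_density_def n_def by simp
    next
      case False
      then show ?thesis by (simp add: crit_density_def)
    qed
    have "(\<integral>\<^sup>+f. crit_density \<epsilon> f \<partial>\<mu>) \<le> (\<integral>\<^sup>+f. ennreal c * (\<Sum>i\<in>UNIV. \<Sum>j\<in>UNIV. q i j 0 f + q i j n f) \<partial>\<mu>)"
      by (rule nn_integral_mono) (rule pw)
    also have "\<dots> = ennreal c * (\<Sum>i\<in>UNIV. \<Sum>j\<in>UNIV. (\<integral>\<^sup>+f. q i j 0 f \<partial>\<mu>) + (\<integral>\<^sup>+f. q i j n f \<partial>\<mu>))"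
      by (simp add: nn_integral_cmult nn_integral_sum nn_integral_add)
    also have "\<dots> \<le> ennreal c * (\<Sum>i\<in>(UNIV::'n set). \<Sum>j\<in>(UNIV::'n set). ennreal (K0 0 * \<epsilon> ^ n) + ennreal (K0 n * \<epsilon> ^ n))"
      by (intro mult_left_mono sum_mono add_mono q_le) simp
    also have "\<dots> = ennreal (c * (real (n * n) * (K0 0 + K0 n)) * \<epsilon> ^ CARD('n))"
    proof -
      have "(\<Sum>i\<in>(UNIV::'n set). \<Sum>j\<in>(UNIV::'n set). ennreal (K0 0 * \<epsilon> ^ n) + ennreal (K0 n * \<epsilon> ^ n)) =
          (\<Sum>i\<in>(UNIV::'n set). \<Sum>j\<in>(UNIV::'n set). ennreal (K0 0 * \<epsilon> ^ n + K0 n * \<epsilon> ^ n))"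
        using K00 \<epsilon> by (simp add: ennreal_plus)
      also have "\<dots> = ennreal (\<Sum>i\<in>(UNIV::'n set). \<Sum>j\<in>(UNIV::'n set). K0 0 * \<epsilon> ^ n + K0 n * \<epsilon> ^ n)"
        using K00 \<epsilon> by (subst sum_ennreal, simp, subst sum_ennreal) (auto intro!: mult_nonneg_nonneg add_nonneg_nonneg sum_nonneg)
      also have "(\<Sum>i\<in>(UNIV::'n set). \<Sum>j\<in>(UNIV::'n set). K0 0 * \<epsilon> ^ n + K0 n * \<epsilon> ^ n) = real (n * n) * (K0 0 + K0 n) * \<epsilon> ^ n"
        unfolding n_def by (simp add: algebra_simps)
      finally show ?thesis using c0 by (simp add: ennreal_mult'[symmetric] n_def mult.assoc)
    qed
    finally show ?thesis .
  qed
  moreover have "0 \<le> c * (real (n * n) * (K0 0 + K0 n))" using c0 K00 by simp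
  ultimately show ?thesis by blast
qed

text \<open>Fatou moves the liminf outside, and Fubini with stationarity makes the expected density
  constant in x. Its order \<epsilon>^n cancels against the volume b \<epsilon>^n of the small ball,
  where \<open>b\<close> belongs to the unit ball.\<close>

theorem nodal_count_integral_le:
  "\<exists>K\<ge>0. \<forall>t R. 0 < R \<longrightarrow> (\<integral>\<^sup>+f. nodal_count f t R \<partial>\<mu>) \<le> ennreal (K * ball_vol TYPE(real ^ 'n) R)"
proof -
  obtain K where K: "K \<ge> 0" "\<And>\<epsilon>. \<epsilon> > 0 \<Longrightarrow> (\<integral>\<^sup>+f. crit_density \<epsilon> f \<partial>\<mu>) \<le> ennreal (K * \<epsilon> ^ CARD('n))"
    using crit_density_integral_le by blast
  define b where "b = ball_vol TYPE(real ^ 'n) 1"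
  have b: "b > 0" unfolding b_def by simp
  have "(\<integral>\<^sup>+f. nodal_count f t R \<partial>\<mu>) \<le> ennreal (K / b * ball_vol TYPE(real ^ 'n) R)" if R: "R > 0" for t R
  proof -
    interpret B: prob_space "ball_avg R :: (real ^ 'n) measure" by (rule prob_space_ball_avg[OF R])
    interpret Q: pair_sigma_finite \<mu> "lborel :: (real ^ 'n) measure" ..
    define V where "V m = ball_vol TYPE(real ^ 'n) (1 / real (Suc m))" for m
    have V: "V m = b * (1 / real (Suc m)) ^ CARD('n)" for m
      using measure_ball_scale[of 1 "1 / real (Suc m)", where 'a = "real ^ 'n"] unfolding V_def b_def by simp
    have V0: "V m > 0" for m unfolding V using b by simp
    let ?J = "\<lambda>m f. (\<integral>\<^sup>+x. crit_density (1 / Suc m) (path_shift x f) * indicator (ball 0 R) x \<partial>lborel) / ennreal (V m)"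
    have ind [measurable]: "(\<lambda>p. indicator (ball (0 :: real ^ 'n) R) (snd p) :: ennreal) \<in> borel_measurable (\<mu> \<Otimes>\<^sub>M lborel)"
      by (rule measurable_compose[OF measurable_snd borel_measurable_indicator]) simp
    have cd [measurable]: "(\<lambda>p. crit_density (1 / Suc m) (path_shift (snd p) (fst p))) \<in> borel_measurable (\<mu> \<Otimes>\<^sub>M lborel)" for m
      by (rule measurable_compose[OF T_measurable crit_density_meas]) measurable
    have "(\<integral>\<^sup>+f. nodal_count f t R \<partial>\<mu>) \<le> (\<integral>\<^sup>+f. liminf (\<lambda>m. ?J m f) \<partial>\<mu>)"
    proof (rule nn_integral_mono)
      fix f assume f: "f \<in> space \<mu>"
      show "nodal_count f t R \<le> liminf (\<lambda>m. ?J m f)"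
        unfolding V_def
      proof (rule nodal_count_le_liminf)
        show "C_k 2 f" using f by (simp add: space_\<mu>)
        show "(\<lambda>x. crit_density \<epsilon> (path_shift x f)) \<in> borel_measurable borel" for \<epsilon>
          by (rule measurable_compose[OF T_measurable crit_density_meas]) (use f in simp_all)
      qed
    qed
    also have "\<dots> \<le> liminf (\<lambda>m. \<integral>\<^sup>+f. ?J m f \<partial>\<mu>)"
      by (rule nn_integral_liminf) measurable
    also have "\<dots> \<le> ennreal (K / b * ball_vol TYPE(real ^ 'n) R)"
    proof (rule Liminf_le, simp, rule always_eventually, rule allI)
      fix m
      have "(\<integral>\<^sup>+f. ?J m f \<partial>\<mu>) = (\<integral>\<^sup>+f. (\<integral>\<^sup>+x. crit_density (1 / Suc m) (path_shift x f) * indicator (ball 0 R) x \<partial>lborel) \<partial>\<mu>) / V m"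
        by (rule nn_integral_divide) measurable
      also have "(\<integral>\<^sup>+f. (\<integral>\<^sup>+x. crit_density (1 / Suc m) (path_shift x f) * indicator (ball 0 R) x \<partial>lborel) \<partial>\<mu>) =
          (\<integral>\<^sup>+x. (\<integral>\<^sup>+f. crit_density (1 / Suc m) (path_shift x f) * indicator (ball 0 R) x \<partial>\<mu>) \<partial>lborel)"
        by (rule Q.Fubini'[symmetric]) (simp add: case_prod_beta')
      also have "\<dots> = (\<integral>\<^sup>+x. (\<integral>\<^sup>+f. crit_density (1 / Suc m) f \<partial>\<mu>) * indicator (ball (0 :: real ^ 'n) R) x \<partial>lborel)"
        by (intro nn_integral_cong) (subst nn_integral_multc, auto simp: nn_integral_T)
      also have "\<dots> = (\<integral>\<^sup>+f. crit_density (1 / Suc m) f \<partial>\<mu>) * emeasure lborel (ball (0 :: real ^ 'n) R)"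
        by (rule nn_integral_cmult_indicator) simp
      also have "\<dots> \<le> ennreal (K * (1 / Suc m) ^ CARD('n)) * ennreal (ball_vol TYPE(real ^ 'n) R)"
        unfolding emeasure_ball_eq[of 0] by (intro mult_right_mono K) auto
      also have "\<dots> / ennreal (V m) = ennreal (K / b * ball_vol TYPE(real ^ 'n) R)"
        using K(1) b V0[of m] unfolding V by (simp add: ennreal_mult[symmetric] divide_ennreal field_simps)
      finally show "(\<integral>\<^sup>+f. ?J m f \<partial>\<mu>) \<le> ennreal (K / b * ball_vol TYPE(real ^ 'n) R)"
        by (simp add: divide_right_mono_ennreal)
    qed
    finally show ?thesis .
  qed
  moreover have "K / b \<ge> 0" using K b by simp
  ultimately show ?thesis by blast
qed

end

section \<open>Ergodic limits of the nodal counts\<close>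

context kac_rice_path
begin

lemma nodal_count_meas:
  assumes R: "R > 0"
  shows "(\<lambda>f. nodal_count f t R) \<in> borel_measurable \<mu>"
proof -
  have "(\<lambda>p. (snd p, fst p)) \<in> path_space \<Otimes>\<^sub>M (lborel :: (real ^ 'n) measure) \<rightarrow>\<^sub>M borel \<Otimes>\<^sub>M (path_space :: (real ^ 'n \<Rightarrow> real) measure)"
    by measurable
  from measurable_compose[OF this nodal_density_measurable[OF R]]
  have "(\<lambda>p. nodal_density t R (fst p) (snd p)) \<in> borel_measurable ((path_space :: (real ^ 'n \<Rightarrow> real) measure) \<Otimes>\<^sub>M (lborel :: (real ^ 'n) measure))"
    by simp
  then have "(\<lambda>f :: real ^ 'n \<Rightarrow> real. \<integral>\<^sup>+x. nodal_density t R f x \<partial>lborel) \<in> borel_measurable path_space"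
    by (intro lborel.borel_measurable_nn_integral) (simp add: case_prod_beta')
  then have "(\<lambda>f :: real ^ 'n \<Rightarrow> real. nodal_count f t R) \<in> borel_measurable path_space"
    by (rule measurable_cong[THEN iffD1, rotated]) (simp add: nodal_count_eq_integral R)
  then show ?thesis using measurable_cong_sets[OF sets_\<mu> refl] by blast
qed

theorem nodal_count_limit:
  "\<exists>c\<ge>0. ((\<lambda>R. \<integral>\<^sup>+f. e2ennreal \<bar>enn2ereal (nodal_count f t R / ennreal (ball_vol TYPE(real ^ 'n) R)) - ereal c\<bar> \<partial>\<mu>) \<longlongrightarrow> 0) at_top \<and>
     (AE f in \<mu>. ((\<lambda>R. enn2ereal (nodal_count f t R / ennreal (ball_vol TYPE(real ^ 'n) R))) \<longlongrightarrow> ereal c) at_top)"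
proof -
  \<comment> \<open>Evaluating the density at the origin of the shifted path makes it a stationary
    process in x. The radii \<open>Suc r\<close> are positive, as measurability of the density
    demands.\<close>
  interpret S: flow_sandwich \<mu> path_shift "\<lambda>R f. nodal_count f t R" "\<lambda>r f. nodal_density t (real (Suc r)) f 0"
  proof
    show "(\<lambda>f. nodal_count f t R) \<in> borel_measurable \<mu>" if "R > 0" for R by (rule nodal_count_meas[OF that])
    have "(\<lambda>f. (0, f)) \<in> path_space \<rightarrow>\<^sub>M borel \<Otimes>\<^sub>M (path_space :: (real ^ 'n \<Rightarrow> real) measure)" by measurable
    from measurable_compose[OF this nodal_density_measurable]
    have "(\<lambda>f :: real ^ 'n \<Rightarrow> real. nodal_density t R f 0) \<in> borel_measurable path_space" if "R > 0" for R
      using that by simp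
    from this[OF of_nat_0_less_iff[THEN iffD2, OF zero_less_Suc]]
    have "(\<lambda>f :: real ^ 'n \<Rightarrow> real. nodal_density t (real (Suc r)) f 0) \<in> borel_measurable path_space" for r .
    then show "(\<lambda>f. nodal_density t (real (Suc r)) f 0) \<in> borel_measurable \<mu>" for r
      using measurable_cong_sets[OF sets_\<mu> refl] by blast
    show "nodal_density t (real (Suc r)) f 0 \<le> nodal_density t (real (Suc (Suc r))) f 0" for r f
      by (rule nodal_density_mono) simp
    show "nodal_count f t r \<le> nodal_count f t R" if "r \<le> R" for r R f by (rule nodal_count_mono[OF that])
  next
    fix r :: nat and R :: real and f assume f: "f \<in> space \<mu>" and R: "real (Suc r) < R"
    have f2: "C_k 2 f" using f by (simp add: space_\<mu>)
    have "(\<integral>\<^sup>+x. nodal_density t (real (Suc r)) (path_shift x f) 0 * indicator (ball 0 (R - real (Suc r))) x \<partial>lborel) \<le>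
        (\<integral>\<^sup>+x. nodal_density t R f x \<partial>lborel)"
    proof (rule nn_integral_mono)
      show "nodal_density t (real (Suc r)) (path_shift x f) 0 * indicator (ball 0 (R - real (Suc r))) x \<le> nodal_density t R f x" for x
        using nodal_density_lower[OF f2, of x R "real (Suc r)" t] by (simp add: indicator_def)
    qed
    also have "\<dots> = nodal_count f t R" using R by (intro nodal_count_eq_integral[symmetric] f2) simp
    finally show "(\<integral>\<^sup>+x. nodal_density t (real (Suc r)) (path_shift x f) 0 * indicator (ball 0 (R - real (Suc r))) x \<partial>lborel) \<le> nodal_count f t R" .
  next
    fix R :: real and f assume f: "f \<in> space \<mu>" and R: "0 < R"
    have f2: "C_k 2 f" using f by (simp add: space_\<mu>)
    show "nodal_count f t R \<le> (\<integral>\<^sup>+x. (SUP r. nodal_density t (real (Suc r)) (path_shift x f) 0) * indicator (ball 0 R) x \<partial>lborel)"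
      unfolding nodal_count_eq_integral[OF f2 R] by (rule nn_integral_mono) (rule nodal_density_upper[OF f2])
  qed
  obtain K where K: "K \<ge> 0" "\<And>R. 0 < R \<Longrightarrow> (\<integral>\<^sup>+f. nodal_count f t R \<partial>\<mu>) \<le> ennreal (K * ball_vol TYPE(real ^ 'n) R)"
    using nodal_count_integral_le by blast
  have "(\<integral>\<^sup>+f. S.\<Phi> f \<partial>\<mu>) \<le> ennreal K" by (rule S.integral_\<Phi>_le) (use K in auto)
  then have fin: "(\<integral>\<^sup>+f. S.\<Phi> f \<partial>\<mu>) < \<infinity>" by (simp add: le_less_trans)
  show ?thesis
    by (intro exI[of _ S.limit] conjI S.limit_nonneg[OF fin ergodic] S.mean_limit[OF fin ergodic] S.almost_sure_limit[OF fin ergodic])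
qed

end


section \<open>From the field to its law\<close>

text \<open>A phase is split off by the addition formula; the sine expectation vanishes since the
  characteristic function is real. The degenerate variable fits the same formula with variance
  0.\<close>

lemma centred_gaussian_cos:
  assumes "prob_space M" and Y: "centred_gaussian M Y"
  shows "integrable M (\<lambda>w. (Y w)\<^sup>2)"
    and "(\<integral>w. cos (\<theta> + Y w) \<partial>M) = cos \<theta> * exp (- (\<integral>w. (Y w)\<^sup>2 \<partial>M) / 2)"
proof -
  interpret prob_space M by fact
  have [measurable]: "Y \<in> borel_measurable M" using Y unfolding centred_gaussian_def by blast
  have "integrable M (\<lambda>w. (Y w)\<^sup>2) \<and> (\<integral>w. cos (\<theta> + Y w) \<partial>M) = cos \<theta> * exp (- (\<integral>w. (Y w)\<^sup>2 \<partial>M) / 2)"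
  proof (cases "AE w in M. Y w = 0")
    case True
    have "integrable M (\<lambda>w. (Y w)\<^sup>2) \<longleftrightarrow> integrable M (\<lambda>w. 0 :: real)"
      by (rule integrable_cong_AE) (use True in auto)
    moreover have "(\<integral>w. (Y w)\<^sup>2 \<partial>M) = (\<integral>w. 0 \<partial>M)"
      by (rule integral_cong_AE) (use True in auto)
    moreover have "(\<integral>w. cos (\<theta> + Y w) \<partial>M) = (\<integral>w. cos \<theta> \<partial>M)"
      by (rule integral_cong_AE) (use True in auto)
    ultimately show ?thesis by (simp add: prob_space)
  next
    case False
    then obtain \<sigma> where \<sigma>: "\<sigma> > 0" and D: "distributed M lborel Y (normal_density 0 \<sigma>)"
      using Y unfolding centred_gaussian_def by blast
    have int: "integrable M (\<lambda>w. (Y w)\<^sup>2)"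
      using distributed_integrable[OF D, of "\<lambda>x. x\<^sup>2"] integrable_normal_moment[OF \<sigma>, of 0 2] by simp
    have var: "(\<integral>w. (Y w)\<^sup>2 \<partial>M) = \<sigma>\<^sup>2"
      using normal_distributed_variance[OF \<sigma> D] normal_distributed_expectation[OF \<sigma> D] by simp
    have D': "distributed M lborel (\<lambda>w. Y w / \<sigma>) std_normal_density"
      using D normal_standard_normal_convert[OF \<sigma>, of Y 0] by simp
    have "distr M lborel (\<lambda>w. Y w / \<sigma>) = std_normal_distribution"
      by (rule distributed_distr_eq_density[OF D'])
    then have "(CLINT w|M. iexp (Y w)) = char std_normal_distribution \<sigma>"
      unfolding char_def using \<sigma> by (subst \<open>distr M lborel _ = _\<close>[symmetric], subst integral_distr) auto
    also have "\<dots> = complex_of_real (exp (- \<sigma>\<^sup>2 / 2))" by (simp add: char_std_normal_distribution)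
    finally have ch: "(CLINT w|M. iexp (Y w)) = complex_of_real (exp (- \<sigma>\<^sup>2 / 2))" .
    have ie: "integrable M (\<lambda>w. iexp (Y w))" by (rule integrable_const_bound[where B = 1]) auto
    have c: "(\<integral>w. cos (Y w) \<partial>M) = exp (- \<sigma>\<^sup>2 / 2)"
      using integral_Re[OF ie] unfolding ch by (simp add: Re_exp)
    have s: "(\<integral>w. sin (Y w) \<partial>M) = 0"
      using integral_Im[OF ie] unfolding ch by (simp add: Im_exp)
    have "integrable M (\<lambda>w. cos (Y w))" "integrable M (\<lambda>w. sin (Y w))"
      by (auto intro!: integrable_const_bound[where B = 1])
    then have "(\<integral>w. cos (\<theta> + Y w) \<partial>M) = cos \<theta> * exp (- \<sigma>\<^sup>2 / 2)"
      by (simp add: cos_add c s)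
    then show ?thesis using int var by simp
  qed
  then show "integrable M (\<lambda>w. (Y w)\<^sup>2)"
    and "(\<integral>w. cos (\<theta> + Y w) \<partial>M) = cos \<theta> * exp (- (\<integral>w. (Y w)\<^sup>2 \<partial>M) / 2)" by blast+
qed

lemma C_k_zero: "C_k k (\<lambda>x. 0)"
  by (induction k) (auto intro!: exI[of _ "\<lambda>x v. 0"])

lemma lin_product: "lin L g * lin L g = lin L (\<lambda>x. lin L (\<lambda>y. g x * g y))"
proof -
  have "lin L (\<lambda>y. g x * g y) = lin L g * g x" for x
    using lin_mult[of L "g x" g] by (simp only: mult.commute)
  then show ?thesis using lin_mult[of L "lin L g" g] by (simp add: mult.commute)
qed

text \<open>The two functions differ only inside a null set, and every subset of it is measurable in
  the completion.\<close>

lemma measurable_completion_AE: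
  assumes f: "f \<in> borel_measurable M" and eq: "AE w in M. f w = g w"
  shows "g \<in> borel_measurable (completion M)"
proof (rule measurableI)
  obtain N where N: "N \<in> null_sets M" "{w \<in> space M. f w \<noteq> g w} \<subseteq> N"
    using AE_E[OF eq] by (metis null_setsI)
  fix A :: "'b set" assume "A \<in> sets borel"
  then have 1: "f -` A \<inter> space M - N \<in> sets (completion M)"
    using f N by (intro sets.Diff) (auto intro: measurable_sets null_setsD2)
  have 2: "g -` A \<inter> space M \<inter> N \<in> sets (completion M)"
    by (rule sets_completionI_sub[OF N(1)]) auto
  have "g -` A \<inter> space (completion M) = (f -` A \<inter> space M - N) \<union> (g -` A \<inter> space M \<inter> N)"
    using N(2) by auto
  then show "g -` A \<inter> space (completion M) \<in> sets (completion M)"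
    using sets.Un[OF 1 2] by simp
qed simp

text \<open>The constant distance of \<open>c\<close> and \<open>d\<close> is at most the sum of two
  mean distances that tend to 0.\<close>

lemma converges_in_mean_unique:
  assumes "prob_space M" and c: "converges_in_mean M X c" and d: "converges_in_mean M X d"
  shows "c = d"
proof -
  interpret prob_space M by fact
  define D where "D a R w = e2ennreal \<bar>enn2ereal (X R w) - ereal a\<bar>" for a R w
  have lim: "((\<lambda>R. (\<integral>\<^sup>+w. D c R w \<partial>M) + (\<integral>\<^sup>+w. D d R w \<partial>M)) \<longlongrightarrow> 0 + 0) at_top"
    using c d unfolding converges_in_mean_def D_def by (intro tendsto_add) auto
  have "ennreal \<bar>c - d\<bar> \<le> (\<integral>\<^sup>+w. D c R w \<partial>M) + (\<integral>\<^sup>+w. D d R w \<partial>M)" if R: "R > 0" for R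
  proof -
    have [measurable]: "X R \<in> borel_measurable (completion M)"
      using c R unfolding converges_in_mean_def by blast
    have le: "ennreal \<bar>c - d\<bar> \<le> D c R w + D d R w" for w
    proof (cases "X R w")
      case (real r)
      have "ennreal \<bar>c - d\<bar> \<le> ennreal (\<bar>r - c\<bar> + \<bar>r - d\<bar>)" by (intro ennreal_leI) arith
      also have "\<dots> = ennreal \<bar>r - c\<bar> + ennreal \<bar>r - d\<bar>" by (rule ennreal_plus) auto
      finally show ?thesis unfolding D_def using real by (simp add: enn2ereal_ennreal)
    next
      case top
      then show ?thesis unfolding D_def by simp
    qed
    have "ennreal \<bar>c - d\<bar> = (\<integral>\<^sup>+w. ennreal \<bar>c - d\<bar> \<partial>M)" by (simp add: emeasure_space_1)
    also have "\<dots> \<le> (\<integral>\<^sup>+w. D c R w + D d R w \<partial>M)" by (rule nn_integral_mono) (rule le)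
    \<comment> \<open>The distances are measurable for the completion, so additivity of the integral
      is applied there.\<close>
    also have "\<dots> = (\<integral>\<^sup>+w. D c R w + D d R w \<partial>completion M)" by (simp add: nn_integral_completion)
    also have "\<dots> = (\<integral>\<^sup>+w. D c R w \<partial>completion M) + (\<integral>\<^sup>+w. D d R w \<partial>completion M)"
      unfolding D_def by (rule nn_integral_add) measurable
    finally show ?thesis by (simp add: nn_integral_completion)
  qed
  then have "ennreal \<bar>c - d\<bar> \<le> 0"
    using lim by (intro tendsto_lowerbound[OF lim[simplified]]) (auto intro: eventually_mono[OF eventually_gt_at_top[of 0]])
  then show ?thesis by simp
qed

lemma converges_in_mean_divide:
  assumes X: "converges_in_mean M X c" and a: "a > 0"
    and Y: "\<And>R w. R > 0 \<Longrightarrow> Y R w = X R w / ennreal a"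
  shows "converges_in_mean M Y (c / a)"
proof -
  have meas: "X R \<in> borel_measurable (completion M)" if "R > 0" for R
    using X that unfolding converges_in_mean_def by blast
  have eq: "(\<integral>\<^sup>+w. e2ennreal \<bar>enn2ereal (Y R w) - ereal (c / a)\<bar> \<partial>M) = (\<integral>\<^sup>+w. e2ennreal \<bar>enn2ereal (X R w) - ereal c\<bar> \<partial>M) / ennreal a"
    if R: "R > 0" for R
  proof -
    note [measurable] = meas[OF R]
    have "e2ennreal \<bar>enn2ereal (Y R w) - ereal (c / a)\<bar> = e2ennreal \<bar>enn2ereal (X R w) - ereal c\<bar> / ennreal a" for w
    proof (cases "X R w")
      case (real r)
      then have "Y R w = ennreal (r / a)" using a Y[OF R] by (simp add: divide_ennreal)
      then have "e2ennreal \<bar>enn2ereal (Y R w) - ereal (c / a)\<bar> = ennreal \<bar>r / a - c / a\<bar>"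
        using real a by (simp add: enn2ereal_ennreal)
      also have "\<bar>r / a - c / a\<bar> = \<bar>r - c\<bar> / a" using a by (simp add: diff_divide_distrib[symmetric])
      also have "ennreal \<dots> = ennreal \<bar>r - c\<bar> / ennreal a" using a by (simp add: divide_ennreal)
      finally show ?thesis using real by (simp add: enn2ereal_ennreal)
    next
      case top
      then show ?thesis using Y[OF R] by (simp add: ennreal_top_divide)
    qed
    then have "(\<integral>\<^sup>+w. e2ennreal \<bar>enn2ereal (Y R w) - ereal (c / a)\<bar> \<partial>M) =
        (\<integral>\<^sup>+w. e2ennreal \<bar>enn2ereal (X R w) - ereal c\<bar> / ennreal a \<partial>completion M)"
      by (simp add: nn_integral_completion)
    also have "\<dots> = (\<integral>\<^sup>+w. e2ennreal \<bar>enn2ereal (X R w) - ereal c\<bar> \<partial>completion M) / ennreal a"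
      by (rule nn_integral_divide) measurable
    finally show ?thesis by (simp add: nn_integral_completion)
  qed
  have "Y R \<in> borel_measurable (completion M)" if "R > 0" for R
  proof -
    note [measurable] = meas[OF that]
    have "(\<lambda>w. X R w / ennreal a) \<in> borel_measurable (completion M)" by measurable
    then show ?thesis using Y[OF that] by (simp add: fun_eq_iff cong: measurable_cong)
  qed
  moreover have "((\<lambda>R. \<integral>\<^sup>+w. e2ennreal \<bar>enn2ereal (Y R w) - ereal (c / a)\<bar> \<partial>M) \<longlongrightarrow> 0) at_top"
  proof (rule tendsto_0_le_ennreal)
    fix \<epsilon> :: real assume \<epsilon>: "\<epsilon> > 0"
    have "\<forall>\<^sub>F R in at_top. (\<integral>\<^sup>+w. e2ennreal \<bar>enn2ereal (X R w) - ereal c\<bar> \<partial>M) < ennreal (\<epsilon> * a)"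
      using X \<epsilon> a unfolding converges_in_mean_def by (intro order_tendstoD(2)) auto
    then show "\<forall>\<^sub>F R in at_top. (\<integral>\<^sup>+w. e2ennreal \<bar>enn2ereal (Y R w) - ereal (c / a)\<bar> \<partial>M) \<le> ennreal \<epsilon>"
      using eventually_gt_at_top[of 0]
    proof eventually_elim
      case (elim R)
      have "(\<integral>\<^sup>+w. e2ennreal \<bar>enn2ereal (X R w) - ereal c\<bar> \<partial>M) / ennreal a \<le> ennreal (\<epsilon> * a) / ennreal a"
        using elim by (intro divide_right_mono_ennreal) simp
      also have "\<dots> = ennreal \<epsilon>" using a \<epsilon> by (simp add: divide_ennreal)
      finally show ?case unfolding eq[OF elim(2)] .
    qed
  qed
  ultimately show ?thesis unfolding converges_in_mean_def by blast
qed

text \<open>The volume bound \<open>t\<close> is extended-valued, so one statement serves both the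
  restricted counts and, with t = \<infinity>, the full count. Both modes of convergence share the
  limit \<open>c\<close>.\<close>

theorem nodal_count_converges:
  fixes M :: "'w measure"
    and F :: "real ^ 'n \<Rightarrow> 'w \<Rightarrow> real"
    and \<rho> :: "(real ^ 'n) measure"
  assumes M: "prob_space M"
    and gauss: "centred_gaussian_field M F"
    and smooth: "AE w in M. smooth (\<lambda>x. F x w)"
    and iso: "isotropic M F"
    and spectral: "spectral_measure M F \<rho>"
    and rho1: "\<And>\<xi>. measure \<rho> {\<xi>} = 0"
    and rho2: "\<exists>p>4. integrable \<rho> (\<lambda>\<xi>. norm \<xi> powr p)"
    and rho3: "\<not> (\<exists>a. a \<noteq> 0 \<and> measure_support \<rho> \<subseteq> {\<xi>. a \<bullet> \<xi> = 0})"
  shows "\<exists>c. converges_in_mean M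
           (\<lambda>R w. nodal_count (\<lambda>x. F x w) t R / emeasure lborel (ball (0 :: real ^ 'n) R)) c \<and>
         converges_almost_surely M
           (\<lambda>R w. nodal_count (\<lambda>x. F x w) t R / emeasure lborel (ball (0 :: real ^ 'n) R)) c"
proof -
  interpret M: prob_space M by (rule M)
  interpret rho: prob_space \<rho> using spectral unfolding spectral_measure_def by blast
  have sets_\<rho> [measurable_cong]: "sets \<rho> = sets borel" using spectral unfolding spectral_measure_def by blast
  obtain Z where Z: "Z \<in> null_sets M" "{w \<in> space M. \<not> smooth (\<lambda>x. F x w)} \<subseteq> Z"
    using AE_E[OF smooth] by (metis null_setsI)
  have G: "centred_gaussian M (\<lambda>w. \<Sum>x\<in>S. b x * F x w)" if "finite S" for S b
    using gauss that unfolding centred_gaussian_field_def by simp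
  have F_gauss: "centred_gaussian M (F x)" for x using G[of "{x}" "\<lambda>_. 1"] by simp
  \<comment> \<open>On the null set of irregular paths the zero path is substituted, so that every
    realisation belongs to \<open>path_space\<close>.\<close>
  define X where "X w x = (if w \<in> Z then 0 else F x w)" for w x
  have F_meas [measurable]: "F x \<in> borel_measurable M" for x
    using F_gauss unfolding centred_gaussian_def by simp
  have X_meas: "X \<in> M \<rightarrow>\<^sub>M path_space"
  proof -
    have "(\<lambda>w x. X w x) \<in> M \<rightarrow>\<^sub>M path_space"
    proof (rule measurable_path_spaceI)
      have [measurable]: "Z \<in> sets M" using Z(1) by blast
      show "(\<lambda>w. X w x) \<in> borel_measurable M" for x unfolding X_def by measurable
      show "C_k 2 (\<lambda>x. X w x)" if "w \<in> space M" for w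
        using that Z(2) C_k_zero[of 2] unfolding X_def smooth_def by (cases "w \<in> Z") auto
    qed
    then show ?thesis by simp
  qed
  have X_eq: "AE w in M. X w = (\<lambda>x. F x w)"
  proof -
    have "AE w in M. w \<notin> Z" by (rule AE_not_in[OF Z(1)])
    then show ?thesis by eventually_elim (simp add: X_def fun_eq_iff)
  qed
  define \<mu> where "\<mu> = distr M path_space X"
  define \<kappa> where "\<kappa> z = (\<integral>\<xi>. cos (z \<bullet> \<xi>) \<partial>\<rho>)" for z :: "real ^ 'n"
  have ie: "integrable \<rho> (\<lambda>\<xi>. iexp (z \<bullet> \<xi>))" for z :: "real ^ 'n"
    by (rule rho.integrable_const_bound[where B = 1]) auto
  have spec: "complex_of_real (covariance M F x y) = (CLINT \<xi>|\<rho>. iexp ((x - y) \<bullet> \<xi>))" for x y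
    using spectral unfolding spectral_measure_def by blast
  have cov: "covariance M F x y = \<kappa> (x - y)" for x y
    using integral_Re[OF ie, of "x - y"] unfolding spec[symmetric] \<kappa>_def by (simp add: Re_exp)
  \<comment> \<open>The covariance is real, so the imaginary part of its spectral representation
    vanishes.\<close>
  have sin0: "(\<integral>\<xi>. sin (z \<bullet> \<xi>) \<partial>\<rho>) = 0" for z
    using integral_Im[OF ie, of z] spec[of z 0] by (simp add: Im_exp) (metis Im_complex_of_real)
  have FF: "integrable M (\<lambda>w. F x w * F y w)" for x y
  proof (rule Bochner_Integration.integrable_bound)
    have "integrable M (\<lambda>w. (F x w)\<^sup>2)" for x by (rule centred_gaussian_cos(1)[OF M F_gauss])
    then show "integrable M (\<lambda>w. (F x w)\<^sup>2 + (F y w)\<^sup>2)" by simp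
    show "AE w in M. norm (F x w * F y w) \<le> norm ((F x w)\<^sup>2 + (F y w)\<^sup>2)"
    proof (rule AE_I2)
      fix w
      have "2 * \<bar>F x w * F y w\<bar> \<le> (F x w)\<^sup>2 + (F y w)\<^sup>2"
        using sum_squares_bound[of "\<bar>F x w\<bar>" "\<bar>F y w\<bar>"] by (simp add: abs_mult)
      then show "norm (F x w * F y w) \<le> norm ((F x w)\<^sup>2 + (F y w)\<^sup>2)" by simp
    qed
  qed measurable
  have cos_lin: "(\<integral>f. cos (\<theta> + lin L f) \<partial>\<mu>) = cos \<theta> * exp (- qform \<kappa> L L / 2)" for \<theta> L
  proof -
    obtain S a where S: "finite S" and L: "\<And>f. lin L f = (\<Sum>x\<in>S. a x * f x)" using lin_as_sum by blast
    have Y: "centred_gaussian M (\<lambda>w. lin L (\<lambda>x. F x w))"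
      unfolding L by (rule G[OF S])
    then have [measurable]: "(\<lambda>w. lin L (\<lambda>x. F x w)) \<in> borel_measurable M" unfolding centred_gaussian_def by blast
    note [measurable] = measurable_compose[OF X_meas lin_measurable]
    have "(\<integral>w. (lin L (\<lambda>x. F x w))\<^sup>2 \<partial>M) = qform \<kappa> L L"
      unfolding power2_eq_square lin_product qform_def
      by (simp add: integral_lin integrable_lin FF flip: cov) (simp add: covariance_def)
    moreover have "(\<integral>f. cos (\<theta> + lin L f) \<partial>\<mu>) = (\<integral>w. cos (\<theta> + lin L (X w)) \<partial>M)"
      unfolding \<mu>_def by (rule integral_distr[OF X_meas]) measurable
    moreover have "\<dots> = (\<integral>w. cos (\<theta> + lin L (\<lambda>x. F x w)) \<partial>M)"
    proof (rule integral_cong_AE)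
      show "AE w in M. cos (\<theta> + lin L (X w)) = cos (\<theta> + lin L (\<lambda>x. F x w))"
        using X_eq by eventually_elim simp
    qed measurable
    ultimately show ?thesis using centred_gaussian_cos(2)[OF M Y] by simp
  qed
  interpret kac_rice_path \<mu> \<kappa> \<rho>
  proof (unfold_locales)
    interpret distr: prob_space \<mu> unfolding \<mu>_def by (rule M.prob_space_distr[OF X_meas])
    show "emeasure \<mu> (space \<mu>) = 1" by (rule distr.emeasure_space_1)
    then show "emeasure \<mu> (space \<mu>) \<noteq> \<top>" by simp
    show "\<exists>A. countable A \<and> A \<subseteq> sets \<mu> \<and> \<Union> A = space \<mu> \<and> (\<forall>a\<in>A. emeasure \<mu> a \<noteq> \<infinity>)"
      by (rule distr.sigma_finite_countable)
    show "sets \<mu> = sets path_space" unfolding \<mu>_def by simp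
    show "\<kappa> (- x) = \<kappa> x" for x unfolding \<kappa>_def by simp
    show "(\<integral>f. cos (\<theta> + lin L f) \<partial>\<mu>) = cos \<theta> * exp (- qform \<kappa> L L / 2)" for \<theta> L by (rule cos_lin)
    show "sets \<rho> = sets borel" by (rule sets_\<rho>)
    show "\<kappa> x = (\<integral>\<xi>. cos (x \<bullet> \<xi>) \<partial>\<rho>)" for x unfolding \<kappa>_def ..
    show "(\<integral>\<xi>. sin (x \<bullet> \<xi>) \<partial>\<rho>) = 0" for x by (rule sin0)
    show "measure \<rho> {\<xi>} = 0" for \<xi> by (rule rho1)
    obtain k where k: "\<And>x y. covariance M F x y = k (dist x y)" using iso unfolding isotropic_def by blast
    show "\<kappa> x = \<kappa> y" if "norm x = norm y" for x y
      using cov[of x 0] cov[of y 0] k[of x 0] k[of y 0] that by simp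
    obtain p where p: "p > 4" "integrable \<rho> (\<lambda>\<xi>. norm \<xi> powr p)" using rho2 by blast
    show "integrable \<rho> (\<lambda>\<xi>. norm \<xi> ^ 4)"
    proof (rule Bochner_Integration.integrable_bound)
      show "integrable \<rho> (\<lambda>\<xi>. 1 + norm \<xi> powr p)" using p by simp
      \<comment> \<open>For \<open>norm \<xi> \<ge> 1\<close> the larger exponent p dominates,
        otherwise the constant 1 does.\<close>
      have "norm \<xi> ^ 4 \<le> 1 + norm \<xi> powr p" for \<xi> :: "real ^ 'n"
      proof (cases "norm \<xi> \<ge> 1")
        case True
        then have "norm \<xi> ^ 4 = norm \<xi> powr 4" by (simp add: powr_numeral)
        also have "\<dots> \<le> norm \<xi> powr p" using True p by (intro powr_mono) auto
        finally show ?thesis by simp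
      next
        case False
        then have "norm \<xi> ^ 4 \<le> 1" by (intro power_le_one) auto
        then show ?thesis using powr_ge_zero[of "norm \<xi>" p] by linarith
      qed
      then show "AE \<xi> in \<rho>. norm (norm \<xi> ^ 4) \<le> norm (1 + norm \<xi> powr p)" by (intro AE_I2) simp
    qed measurable
    show "\<not> (AE \<xi> in \<rho>. v \<bullet> \<xi> = 0)" if v: "v \<noteq> 0" for v
    proof
      assume ae: "AE \<xi> in \<rho>. v \<bullet> \<xi> = 0"
      \<comment> \<open>A support point off the hyperplane would give positive mass to its open
        complement, which is null by \<open>ae\<close>.\<close>
      have "measure_support \<rho> \<subseteq> {\<xi>. v \<bullet> \<xi> = 0}"
      proof (rule ccontr)
        assume "\<not> measure_support \<rho> \<subseteq> {\<xi>. v \<bullet> \<xi> = 0}"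
        then obtain \<xi> where \<xi>: "\<xi> \<in> measure_support \<rho>" "v \<bullet> \<xi> \<noteq> 0" by blast
        let ?U = "{\<xi>. v \<bullet> \<xi> \<noteq> 0}"
        have U: "open ?U" by (intro open_Collect_neq continuous_intros)
        then have "emeasure \<rho> ?U > 0" using \<xi> unfolding measure_support_def by blast
        moreover have "emeasure \<rho> ?U = 0"
          using AE_iff_measurable[of ?U \<rho> "\<lambda>\<xi>. v \<bullet> \<xi> = 0"] ae U sets_eq_imp_space_eq[OF sets_\<rho>]
          by (simp add: sets_\<rho>)
        ultimately show False by simp
      qed
      then show False using rho3 v by blast
    qed
  qed
  define V where "V R = ball_vol TYPE(real ^ 'n) R" for R
  obtain c where c: "((\<lambda>R. \<integral>\<^sup>+f. e2ennreal \<bar>enn2ereal (nodal_count f t R / ennreal (V R)) - ereal c\<bar> \<partial>\<mu>) \<longlongrightarrow> 0) at_top"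
    "AE f in \<mu>. ((\<lambda>R. enn2ereal (nodal_count f t R / ennreal (V R))) \<longlongrightarrow> ereal c) at_top"
    using nodal_count_limit[of t] unfolding V_def by blast
  have vol: "emeasure lborel (ball (0 :: real ^ 'n) R) = ennreal (V R)" for R
    unfolding V_def by (rule emeasure_ball_eq)
  have meas: "(\<lambda>w. nodal_count (X w) t R / ennreal (V R)) \<in> borel_measurable M" if "R > 0" for R
  proof -
    have "(\<lambda>f :: real ^ 'n \<Rightarrow> real. nodal_count f t R) \<in> borel_measurable path_space"
      using nodal_count_meas[OF that] measurable_cong_sets[OF sets_\<mu> refl] by blast
    from measurable_compose[OF X_meas this] show ?thesis by measurable
  qed
  have mean: "(\<integral>\<^sup>+f. e2ennreal \<bar>enn2ereal (nodal_count f t R / ennreal (V R)) - ereal c\<bar> \<partial>\<mu>) =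
      (\<integral>\<^sup>+w. e2ennreal \<bar>enn2ereal (nodal_count (\<lambda>x. F x w) t R / ennreal (V R)) - ereal c\<bar> \<partial>M)" if "R > 0" for R
  proof -
    have [measurable]: "(\<lambda>f :: real ^ 'n \<Rightarrow> real. nodal_count f t R) \<in> borel_measurable path_space"
      using nodal_count_meas[OF that] measurable_cong_sets[OF sets_\<mu> refl] by blast
    have "(\<integral>\<^sup>+f. e2ennreal \<bar>enn2ereal (nodal_count f t R / ennreal (V R)) - ereal c\<bar> \<partial>\<mu>) =
        (\<integral>\<^sup>+w. e2ennreal \<bar>enn2ereal (nodal_count (X w) t R / ennreal (V R)) - ereal c\<bar> \<partial>M)"
      unfolding \<mu>_def by (rule nn_integral_distr[OF X_meas]) measurable
    also have "\<dots> = (\<integral>\<^sup>+w. e2ennreal \<bar>enn2ereal (nodal_count (\<lambda>x. F x w) t R / ennreal (V R)) - ereal c\<bar> \<partial>M)"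
      by (rule nn_integral_cong_AE) (use X_eq in eventually_elim, simp)
    finally show ?thesis .
  qed
  have "converges_in_mean M (\<lambda>R w. nodal_count (\<lambda>x. F x w) t R / emeasure lborel (ball (0 :: real ^ 'n) R)) c"
    unfolding converges_in_mean_def vol
  proof (intro conjI allI impI)
    fix R :: real assume R: "R > 0"
    show "(\<lambda>w. nodal_count (\<lambda>x. F x w) t R / ennreal (V R)) \<in> borel_measurable (completion M)"
      by (rule measurable_completion_AE[OF meas[OF R]]) (use X_eq in eventually_elim, simp)
  next
    show "((\<lambda>R. \<integral>\<^sup>+w. e2ennreal \<bar>enn2ereal (nodal_count (\<lambda>x. F x w) t R / ennreal (V R)) - ereal c\<bar> \<partial>M) \<longlongrightarrow> 0) at_top"
      by (rule Lim_transform_eventually[OF c(1)])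
         (use eventually_gt_at_top[of 0] in eventually_elim, rule mean)
  qed
  moreover have "converges_almost_surely M (\<lambda>R w. nodal_count (\<lambda>x. F x w) t R / emeasure lborel (ball (0 :: real ^ 'n) R)) c"
    unfolding converges_almost_surely_def vol
    using AE_distrD[OF X_meas c(2)[unfolded \<mu>_def]] X_eq by eventually_elim simp
  ultimately show ?thesis by blast
qed

theorem theorem3p1:
  fixes M :: "'w measure"
    and F :: "real ^ 'n \<Rightarrow> 'w \<Rightarrow> real"
    and \<rho> :: "(real ^ 'n) measure"
  assumes "prob_space M"
    and "centred_gaussian_field M F"
    and "AE w in M. smooth (\<lambda>x. F x w)"
    and "isotropic M F"
    and "\<And>x. (\<integral>w. (F x w)\<^sup>2 \<partial>M) = 1"
    and "spectral_measure M F \<rho>"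
    and rho1: "\<And>\<xi>. measure \<rho> {\<xi>} = 0"
    and rho2: "\<exists>p>4. integrable \<rho> (\<lambda>\<xi>. norm \<xi> powr p)"
    and rho3: "\<not> (\<exists>a. a \<noteq> 0 \<and> measure_support \<rho> \<subseteq> {\<xi>. a \<bullet> \<xi> = 0})"
  shows "(\<forall>t::real. t > 0 \<longrightarrow>
            (\<exists>C. converges_in_mean M
               (\<lambda>R w. nodal_count (\<lambda>x. F x w) (ennreal t) R
                        / emeasure lborel (ball (0 :: real ^ 'n) R)) C)) \<and>
         (nazarov_sodin_constant M F > 0 \<longrightarrow>
            converges_in_mean M
              (\<lambda>R w. nodal_count (\<lambda>x. F x w) \<infinity> R
                       / emeasure lborel (ball (0 :: real ^ 'n) R))
              (nazarov_sodin_constant M F) \<and>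
            converges_almost_surely M
              (\<lambda>R w. nodal_count (\<lambda>x. F x w) \<infinity> R
                       / emeasure lborel (ball (0 :: real ^ 'n) R))
              (nazarov_sodin_constant M F) \<and>
            (\<forall>t::real. t > 0 \<longrightarrow>
               (\<exists>!\<psi>. converges_in_mean M
                  (\<lambda>R w. nodal_count (\<lambda>x. F x w) (ennreal t) R
                           / (ennreal (nazarov_sodin_constant M F)
                                * emeasure lborel (ball (0 :: real ^ 'n) R))) \<psi>)))"
proof -
  note conv = nodal_count_converges[OF assms(1-4) assms(6) rho1 rho2 rho3]
  let ?X = "\<lambda>t R w. nodal_count (\<lambda>x. F x w) t R / emeasure lborel (ball (0 :: real ^ 'n) R)"
  define a where "a = nazarov_sodin_constant M F"
  \<comment> \<open>The description defining the constant denotes something: existence is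
    \<open>nodal_count_converges\<close> for t = \<infinity>, and uniqueness follows from
    convergence in mean.\<close>
  have a: "converges_in_mean M (?X \<infinity>) a \<and> converges_almost_surely M (?X \<infinity>) a"
    unfolding a_def nazarov_sodin_constant_def
  proof (rule theI')
    show "\<exists>!c. converges_in_mean M (?X \<infinity>) c \<and> converges_almost_surely M (?X \<infinity>) c"
      using conv[of \<infinity>] converges_in_mean_unique[OF assms(1)] by blast
  qed
  \<comment> \<open>Dividing by the positive constant \<open>a\<close> scales both the variables and
    their mean distance to the limit, so the new limit is \<open>C / a\<close>.\<close>
  have ratio: "\<exists>!\<psi>. converges_in_mean M (\<lambda>R w. nodal_count (\<lambda>x. F x w) t R /
      (ennreal a * emeasure lborel (ball (0 :: real ^ 'n) R))) \<psi>" if a0: "a > 0" for t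
  proof -
    obtain C where C: "converges_in_mean M (?X t) C" using conv[of t] by blast
    have "converges_in_mean M (\<lambda>R w. nodal_count (\<lambda>x. F x w) t R / (ennreal a * emeasure lborel (ball (0 :: real ^ 'n) R))) (C / a)"
    proof (rule converges_in_mean_divide[OF C a0])
      fix R :: real and w assume "R > 0"
      let ?V = "ball_vol TYPE(real ^ 'n) R"
      have V: "?V > 0" using \<open>R > 0\<close> by simp
      show "nodal_count (\<lambda>x. F x w) t R / (ennreal a * emeasure lborel (ball (0 :: real ^ 'n) R)) = ?X t R w / ennreal a"
        unfolding emeasure_ball_eq[of 0] divide_ennreal_def using V a0
        by (simp add: inverse_ennreal ennreal_mult[symmetric] mult.assoc inverse_mult_distrib mult.commute[of "inverse a"])
    qed
    then show ?thesis using converges_in_mean_unique[OF assms(1)] by blast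
  qed
  show ?thesis
    using conv a ratio unfolding a_def by blast
qed

end
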